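(* Let $s\ge 3$ and $u_0\in H^s$. For $B,b>0$ let $u^{B,b}$ be the solution of $$\partial_t u+u\,\partial_x u+\int_{\mathbf R}B e^{-b|x-\xi|}u_\xi(t,\xi)\,d\xi=0,\qquad u(0,x)=u_0(x),$$ and let $$G(u_0)=\{(B,b)\in(0,\infty)^2:\ u^{B,b}\text{ exists globally}\},\qquad B(u_0)=\{(B,b)\in(0,\infty)^2:\ u^{B,b}\text{ blows up in finite time}\}.$$ Then $G(u_0)$ is a closed set of $\mathbf R^2$ and $B(u_0)$ is an open set of $\mathbf R^2$.
   Context: The equation is posed for real-valued $u(t,x)$, $t>0$, $x\in\mathbf R$. $H^s=H^s(\mathbf R)$ is the Sobolev space with norm $\|f\|_{H^s}=\|(1+|\xi|^2)^{s/2}\widehat f\,\|_{L^2}$. For $u_0\in H^s$, $s>3/2$, the solution is the unique $u\in C([0,T_{max});H^s)\cap C^1([0,T_{max});H^{s-1})$ defined up to its maximal existence time $T_{max}\in(0,\infty]$. It exists globally if $T_{max}=\infty$ and blows up in finite time if $T_{max}<\infty$.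
   Formalization: Closedness of G(u_0) in R^2 is stated for u_0 not almost everywhere zero, since for u_0 = 0 one has G(0) = (0,∞)^2, which is not closed in R^2; for every u_0, G(u_0) is shown closed relative to (0,∞)^2. *)

theory Defs
  imports "HOL-Analysis.Analysis"
begin

definition L2 :: "(real \<Rightarrow> 'a :: euclidean_space) set" where
  "L2 = {f. f \<in> borel_measurable lborel \<and> integrable lborel (\<lambda>x. (norm (f x))\<^sup>2)}"

definition L2_norm :: "(real \<Rightarrow> 'a :: euclidean_space) \<Rightarrow> real" where
  "L2_norm f = sqrt (\<integral>x. (norm (f x))\<^sup>2 \<partial>lborel)"

(* Plancherel's transform: a function in L2 need not be integrable, so its Fourier transform is
   the limit in L2 of the transforms of its truncations to {-n..n}. The limit is
   determined up to a null set only, and the norm below does not see the choice. *)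
definition has_fourier_transform :: "(real \<Rightarrow> real) \<Rightarrow> (real \<Rightarrow> complex) \<Rightarrow> bool" where
  "has_fourier_transform f g \<longleftrightarrow> g \<in> L2 \<and>
     (\<lambda>n::nat. \<integral>\<^sup>+\<xi>. ennreal ((cmod
        ((LINT x:{- real n..real n}|lborel. cis (- (x * \<xi>)) * complex_of_real (f x)) - g \<xi>))\<^sup>2) \<partial>lborel)
       \<longlonglongrightarrow> 0"

definition fourier_transform :: "(real \<Rightarrow> real) \<Rightarrow> real \<Rightarrow> complex" where
  "fourier_transform f = (SOME g. has_fourier_transform f g)"

definition sobolev_weighted :: "real \<Rightarrow> (real \<Rightarrow> real) \<Rightarrow> real \<Rightarrow> complex" where
  "sobolev_weighted s f = (\<lambda>\<xi>. complex_of_real ((1 + \<bar>\<xi>\<bar>\<^sup>2) powr (s / 2)) * fourier_transform f \<xi>)"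

(* Real-valued H^s for s \<ge> 0, where H^s is a subspace of L2 (no distributions are needed).
   Elements are functions, to be read up to equality almost everywhere. *)
definition sobolev :: "real \<Rightarrow> (real \<Rightarrow> real) set" where
  "sobolev s = {f. f \<in> L2 \<and> sobolev_weighted s f \<in> L2}"

definition sobolev_norm :: "real \<Rightarrow> (real \<Rightarrow> real) \<Rightarrow> real" where
  "sobolev_norm s f = L2_norm (sobolev_weighted s f)"

definition sobolev_continuous_on :: "real \<Rightarrow> real set \<Rightarrow> (real \<Rightarrow> real \<Rightarrow> real) \<Rightarrow> bool" where
  "sobolev_continuous_on s I u \<longleftrightarrow> (\<forall>t\<in>I. u t \<in> sobolev s) \<and>
     (\<forall>t\<in>I. ((\<lambda>r. sobolev_norm s (\<lambda>x. u r x - u t x)) \<longlongrightarrow> 0) (at t within I))"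

(* u belongs to C^1(I; H^s) with derivative v; one-sided at an end point of I. *)
definition sobolev_C1_on ::
    "real \<Rightarrow> real set \<Rightarrow> (real \<Rightarrow> real \<Rightarrow> real) \<Rightarrow> (real \<Rightarrow> real \<Rightarrow> real) \<Rightarrow> bool" where
  "sobolev_C1_on s I u v \<longleftrightarrow> (\<forall>t\<in>I. u t \<in> sobolev s) \<and> sobolev_continuous_on s I v \<and>
     (\<forall>t\<in>I. ((\<lambda>r. sobolev_norm s (\<lambda>x. (u r x - u t x) / (r - t) - v t x)) \<longlongrightarrow> 0) (at t within I))"

definition time_interval :: "ereal \<Rightarrow> real set" where
  "time_interval T = {t. 0 \<le> t \<and> ereal t < T}"

(* u is a solution in C([0,T); H^s) and C^1([0,T); H^(s-1)). Each u t is taken to be the continuous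
   representative of its class; for s > 3/2 it is continuously differentiable by Sobolev's embedding,
   so that deriv is the classical x-derivative. The time derivative v is the one in H^(s-1), and the
   equation is an identity between elements of H^(s-1), i.e. almost everywhere in x. *)
definition is_solution ::
    "real \<Rightarrow> (real \<Rightarrow> real) \<Rightarrow> real \<Rightarrow> real \<Rightarrow> ereal \<Rightarrow> (real \<Rightarrow> real \<Rightarrow> real) \<Rightarrow> bool" where
  "is_solution s u0 B b T u \<longleftrightarrow>
     (\<forall>t\<in>time_interval T. continuous_on UNIV (u t)) \<and>
     sobolev_continuous_on s (time_interval T) u \<and>
     (AE x in lborel. u 0 x = u0 x) \<and>
     (\<exists>v. sobolev_C1_on (s - 1) (time_interval T) u v \<and>
        (\<forall>t\<in>time_interval T. AE x in lborel.
           v t x + u t x * deriv (u t) x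
             + (\<integral>\<xi>. B * exp (- b * \<bar>x - \<xi>\<bar>) * deriv (u t) \<xi> \<partial>lborel) = 0))"

(* By well-posedness in H^s, s > 3/2, the set below contains a positive time, its members are
   restrictions of one and the same solution, and the supremum is attained: it is the maximal
   existence time, in (0,\<infinity>], of the unique solution. *)
definition T_max :: "real \<Rightarrow> (real \<Rightarrow> real) \<Rightarrow> real \<Rightarrow> real \<Rightarrow> ereal" where
  "T_max s u0 B b = Sup {T. 0 < T \<and> (\<exists>u. is_solution s u0 B b T u)}"

definition global_set :: "real \<Rightarrow> (real \<Rightarrow> real) \<Rightarrow> (real \<times> real) set" where
  "global_set s u0 = {(B, b). 0 < B \<and> 0 < b \<and> T_max s u0 B b = \<infinity>}"

definition blowup_set :: "real \<Rightarrow> (real \<Rightarrow> real) \<Rightarrow> (real \<times> real) set" where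
  "blowup_set s u0 = {(B, b). 0 < B \<and> 0 < b \<and> T_max s u0 B b < \<infinity>}"

end

(* Only a limit of global solutions has to be shown global. Suppose u solves the equation on [0,T+1].
   The L^2 norm is conserved, which bounds the nonlocal term, hence sup |u| and the forcing F in
   (u_x)_t + u (u_x)_x = - (u_x)^2 + F, in terms of T, B, b and the initial data. At the extrema of
   u_x this bounds u_x from above, and if u_x were very negative at a time in [0,T], it would reach
   minus infinity before T+1. So u_x is bounded on [0,T] uniformly for (B,b) in bounded sets, and by
   the energy estimate so is the H^s norm. For (B_n,b_n) tending to (B,b), the solutions are then Cauchy
   in L^2. Their limit is weakly continuous in H^s, and strongly because its norm is continuous.
   A limit point with B = 0 or b = 0 is excluded for nonzero data: F tends to 0 there, whereas a point
   of negative initial slope breaks in finite time unless F is bounded below in terms of that slope.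
   The analysis takes place on the Fourier side, with a t standing for the transform of u t. *)
theory Submission
  imports Defs
begin

section \<open>Square-integrable functions\<close>

text \<open>Since \<open>T_max\<close> is a supremum, it is enough to have a solution on
  \<open>[0,T]\<close> for every \<open>T\<close>. Passing from a slope bound to an
  \<open>H^s\<close> bound takes two energy estimates. For real \<open>s\<close> the multiplier of
  order \<open>s\<close> obeys no product rule, so its commutator with \<open>u\<close> is estimated
  frequency by frequency; this costs the \<open>L^1\<close> norm of the transform of
  \<open>u_x\<close>, which sup \<open>|u_x|\<close> does not control. The \<open>H^2\<close> norm
  does, and at order two the commutator is explicit and sup \<open>|u_x|\<close> suffices. Because
  the right-hand side loses a derivative, a norm of order \<open>s\<close> cannot be differentiated
  in time directly: the weights are regularized to order \<open>s - 2\<close>, with constants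
  independent of the regularization. Convergence in \<open>L^2\<close> is raised to
  \<open>H^(s-1)\<close> by interpolation; the time derivative of the limit is found in
  \<open>H^(s-2)\<close> first and promoted afterwards. The condition \<open>s \<ge> 3\<close> makes
  the equation for \<open>u_x\<close> hold pointwise with continuous \<open>u_xx\<close>, as the
  argument at extrema requires.\<close>

lemma L2_I: "f \<in> borel_measurable borel \<Longrightarrow> integrable lborel (\<lambda>x. (norm (f x))\<^sup>2) \<Longrightarrow> f \<in> L2"
  by (simp add: L2_def)

lemma L2_measurable [measurable_dest]: "f \<in> L2 \<Longrightarrow> f \<in> borel_measurable borel"
  by (simp add: L2_def)

lemma L2_integrable: "f \<in> L2 \<Longrightarrow> integrable lborel (\<lambda>x. (norm (f x))\<^sup>2)"
  by (simp add: L2_def)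

lemma L2_norm_nonneg [simp]: "0 \<le> L2_norm f"
  by (simp add: L2_norm_def)

lemma L2_norm_sq: "(L2_norm f)\<^sup>2 = (\<integral>x. (norm (f x))\<^sup>2 \<partial>lborel)"
  by (simp add: L2_norm_def)

lemma L2_norm_0 [simp]: "L2_norm (\<lambda>x. 0) = 0"
  by (simp add: L2_norm_def)

lemma L2_0 [simp]: "(\<lambda>x. 0) \<in> L2"
  by (simp add: L2_def)

lemma L2_dominated:
  assumes "g \<in> L2" "f \<in> borel_measurable borel" "AE x in lborel. norm (f x) \<le> norm (g x)"
  shows "f \<in> L2" "L2_norm f \<le> L2_norm g"
proof -
  have *: "AE x in lborel. (norm (f x))\<^sup>2 \<le> (norm (g x))\<^sup>2"
    using assms(3) by eventually_elim (simp add: power_mono)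
  have i: "integrable lborel (\<lambda>x. (norm (f x))\<^sup>2)"
    by (rule Bochner_Integration.integrable_bound[OF L2_integrable[OF assms(1)]])
       (use assms(2) * in auto)
  then show "f \<in> L2" using assms(2) by (intro L2_I)
  show "L2_norm f \<le> L2_norm g" unfolding L2_norm_def
    by (intro real_sqrt_le_mono integral_mono_AE i L2_integrable assms *)
qed

lemma L2_norm_cong_AE:
  assumes "AE x in lborel. norm (f x) = norm (g x)" "f \<in> borel_measurable borel" "g \<in> borel_measurable borel"
  shows "L2_norm f = L2_norm g"
  unfolding L2_norm_def
  by (intro arg_cong[where f = sqrt] integral_cong_AE) (use assms in auto)

lemma L2_cong_AE:
  assumes "AE x in lborel. f x = g x" "f \<in> L2" "g \<in> borel_measurable borel"
  shows "g \<in> L2"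
  by (rule L2_dominated(1)[OF assms(2)]) (use assms in auto)

lemma L2_scaleR: "f \<in> L2 \<Longrightarrow> (\<lambda>x. c *\<^sub>R f x) \<in> L2"
  by (rule L2_I) (auto simp: power_mult_distrib L2_integrable)

lemma L2_norm_scaleR: "L2_norm (\<lambda>x. c *\<^sub>R f x) = \<bar>c\<bar> * L2_norm f"
  by (simp add: L2_norm_def power_mult_distrib real_sqrt_mult)

lemma L2_cmult: "f \<in> L2 \<Longrightarrow> (\<lambda>x. c * f x :: complex) \<in> L2"
  by (rule L2_I) (auto simp: power_mult_distrib norm_mult L2_integrable)

lemma L2_norm_cmult: "L2_norm (\<lambda>x. c * f x :: complex) = norm c * L2_norm f"
  by (simp add: L2_norm_def power_mult_distrib norm_mult real_sqrt_mult)

lemma L2_norm_minus: "L2_norm (\<lambda>x. - f x) = L2_norm f"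
  by (simp add: L2_norm_def)

lemma L2_norm_minus_commute: "L2_norm (\<lambda>x. f x - g x) = L2_norm (\<lambda>x. g x - f x)"
  by (simp add: L2_norm_def norm_minus_commute)

lemma L2_Cauchy_Schwarz:
  assumes "f \<in> L2" "g \<in> L2"
  shows "integrable lborel (\<lambda>x. norm (f x) * norm (g x))"
    and "(\<integral>x. norm (f x) * norm (g x) \<partial>lborel) \<le> L2_norm f * L2_norm g"
proof -
  note [measurable] = L2_measurable[OF assms(1)] L2_measurable[OF assms(2)]
  show i: "integrable lborel (\<lambda>x. norm (f x) * norm (g x))"
  proof (rule Bochner_Integration.integrable_bound)
    show "integrable lborel (\<lambda>x. (norm (f x))\<^sup>2 + (norm (g x))\<^sup>2)"
      by (intro Bochner_Integration.integrable_add L2_integrable assms)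
    show "AE x in lborel. norm (norm (f x) * norm (g x)) \<le> norm ((norm (f x))\<^sup>2 + (norm (g x))\<^sup>2)"
    proof (intro AE_I2)
      fix x
      have "2 * (norm (f x) * norm (g x)) \<le> (norm (f x))\<^sup>2 + (norm (g x))\<^sup>2"
        using sum_squares_bound[of "norm (f x)" "norm (g x)"] by (simp add: mult.assoc)
      moreover have "0 \<le> norm (f x) * norm (g x)" by simp
      ultimately show "norm (norm (f x) * norm (g x)) \<le> norm ((norm (f x))\<^sup>2 + (norm (g x))\<^sup>2)"
        unfolding real_norm_def by linarith
    qed
  qed simp
  have "(\<integral>\<^sup>+x. ennreal (norm (f x)) * ennreal (norm (g x)) \<partial>lborel)\<^sup>2
     \<le> (\<integral>\<^sup>+x. ennreal (norm (f x)) ^ 2 \<partial>lborel) * (\<integral>\<^sup>+x. ennreal (norm (g x)) ^ 2 \<partial>lborel)"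
    by (rule Cauchy_Schwarz_nn_integral) auto
  also have "(\<integral>\<^sup>+x. ennreal (norm (f x)) ^ 2 \<partial>lborel) = ennreal ((L2_norm f)\<^sup>2)"
    unfolding L2_norm_sq by (subst nn_integral_eq_integral[symmetric]) (auto simp: L2_integrable assms ennreal_power)
  also have "(\<integral>\<^sup>+x. ennreal (norm (g x)) ^ 2 \<partial>lborel) = ennreal ((L2_norm g)\<^sup>2)"
    unfolding L2_norm_sq by (subst nn_integral_eq_integral[symmetric]) (auto simp: L2_integrable assms ennreal_power)
  also have "(\<integral>\<^sup>+x. ennreal (norm (f x)) * ennreal (norm (g x)) \<partial>lborel)
      = ennreal (\<integral>x. norm (f x) * norm (g x) \<partial>lborel)"
    by (subst nn_integral_eq_integral[symmetric, OF i]) (auto simp: ennreal_mult)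
  finally have "ennreal ((\<integral>x. norm (f x) * norm (g x) \<partial>lborel)\<^sup>2) \<le> ennreal ((L2_norm f * L2_norm g)\<^sup>2)"
    by (simp add: ennreal_power ennreal_mult[symmetric] power_mult_distrib)
  then have "(\<integral>x. norm (f x) * norm (g x) \<partial>lborel)\<^sup>2 \<le> (L2_norm f * L2_norm g)\<^sup>2"
    by (subst (asm) ennreal_le_iff) auto
  then show "(\<integral>x. norm (f x) * norm (g x) \<partial>lborel) \<le> L2_norm f * L2_norm g"
    by (rule power2_le_imp_le) simp
qed

lemma L2_add:
  assumes "f \<in> L2" "g \<in> L2"
  shows "(\<lambda>x. f x + g x) \<in> L2"
    and L2_norm_triangle: "L2_norm (\<lambda>x. f x + g x) \<le> L2_norm f + L2_norm g"
proof -
  note [measurable] = L2_measurable[OF assms(1)] L2_measurable[OF assms(2)]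
  note i = L2_integrable[OF assms(1)] L2_integrable[OF assms(2)] L2_Cauchy_Schwarz(1)[OF assms]
  have le: "(norm (f x + g x))\<^sup>2 \<le> (norm (f x))\<^sup>2 + 2 * (norm (f x) * norm (g x)) + (norm (g x))\<^sup>2" for x
    using power_mono[OF norm_triangle_ineq[of "f x" "g x"], of 2] by (simp add: power2_sum)
  have ib: "integrable lborel (\<lambda>x. (norm (f x))\<^sup>2 + 2 * (norm (f x) * norm (g x)) + (norm (g x))\<^sup>2)"
    by (intro Bochner_Integration.integrable_add integrable_mult_right i)
  have ii: "integrable lborel (\<lambda>x. (norm (f x + g x))\<^sup>2)"
    by (rule Bochner_Integration.integrable_bound[OF ib]) (auto intro!: AE_I2 order_trans[OF le])
  then show "(\<lambda>x. f x + g x) \<in> L2" by (intro L2_I) simp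
  have "(L2_norm (\<lambda>x. f x + g x))\<^sup>2 \<le> (\<integral>x. (norm (f x))\<^sup>2 + 2 * (norm (f x) * norm (g x)) + (norm (g x))\<^sup>2 \<partial>lborel)"
    unfolding L2_norm_sq by (intro integral_mono ii ib le)
  also have "\<dots> = (L2_norm f)\<^sup>2 + 2 * (\<integral>x. norm (f x) * norm (g x) \<partial>lborel) + (L2_norm g)\<^sup>2"
    unfolding L2_norm_sq using i by simp
  also have "\<dots> \<le> (L2_norm f + L2_norm g)\<^sup>2"
    using L2_Cauchy_Schwarz(2)[OF assms] by (simp add: power2_sum)
  finally show "L2_norm (\<lambda>x. f x + g x) \<le> L2_norm f + L2_norm g"
    by (rule power2_le_imp_le) (simp add: add_nonneg_nonneg)
qed

lemma L2_minus: "f \<in> L2 \<Longrightarrow> (\<lambda>x. - f x) \<in> L2"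
  using L2_scaleR[of f "-1"] by simp

lemma L2_diff:
  assumes "f \<in> L2" "g \<in> L2"
  shows "(\<lambda>x. f x - g x) \<in> L2"
  using L2_add(1)[OF assms(1) L2_minus[OF assms(2)]] by simp

lemma L2_norm_diff_le:
  assumes "f \<in> L2" "g \<in> L2"
  shows "L2_norm (\<lambda>x. f x - g x) \<le> L2_norm f + L2_norm g"
  using L2_norm_triangle[OF assms(1) L2_minus[OF assms(2)]] by (simp add: L2_norm_minus)

lemma L2_norm_triangle3:
  assumes "f \<in> L2" "g \<in> L2" "h \<in> L2"
  shows "L2_norm (\<lambda>x. f x - h x) \<le> L2_norm (\<lambda>x. f x - g x) + L2_norm (\<lambda>x. g x - h x)"
  using L2_norm_triangle[OF L2_diff[OF assms(1,2)] L2_diff[OF assms(2,3)]] by simp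

lemma L2_norm_reverse_triangle:
  assumes "f \<in> L2" "g \<in> L2"
  shows "\<bar>L2_norm f - L2_norm g\<bar> \<le> L2_norm (\<lambda>x. f x - g x)"
  using L2_norm_triangle[OF L2_diff[OF assms] assms(2)] L2_norm_triangle[OF L2_diff[OF assms(2,1)] assms(1)]
    L2_norm_minus_commute[of f g] by simp

lemma L2_norm_eq_0_iff:
  assumes "f \<in> L2"
  shows "L2_norm f = 0 \<longleftrightarrow> (AE x in lborel. f x = 0)"
  unfolding L2_norm_def using integral_nonneg_eq_0_iff_AE[OF L2_integrable[OF assms]] by simp

lemma nn_integral_sq_L2:
  assumes "f \<in> L2"
  shows "(\<integral>\<^sup>+x. ennreal ((norm (f x))\<^sup>2) \<partial>lborel) = ennreal ((L2_norm f)\<^sup>2)"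
  unfolding L2_norm_sq by (rule nn_integral_eq_integral) (auto simp: L2_integrable assms)

lemma L2_nn_integral_le:
  assumes "f \<in> borel_measurable borel" "0 \<le> C" "(\<integral>\<^sup>+x. ennreal ((norm (f x))\<^sup>2) \<partial>lborel) \<le> ennreal (C\<^sup>2)"
  shows "f \<in> L2" "L2_norm f \<le> C"
proof -
  have "(\<integral>\<^sup>+x. ennreal ((norm (f x))\<^sup>2) \<partial>lborel) < \<infinity>"
    using assms(3) by (simp add: le_less_trans)
  then show f: "f \<in> L2"
    using assms(1) by (intro L2_I integrableI_bounded) auto
  show "L2_norm f \<le> C"
    using assms(2,3) nn_integral_sq_L2[OF f] by (auto simp: power2_le_iff_abs_le)
qed

text \<open>The mass \<open>pi\<close> of this density is the source of the constants below:
  \<open>2 * pi\<close> in Plancherel's theorem, \<open>sqrt pi\<close> in the embedding of weighted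
  spaces into \<open>L^1\<close>, and \<open>pi / b\<close> for the symbol of the nonlocal
  term.\<close>

lemma has_integral_arctan:
  "integrable lborel (\<lambda>x::real. 1 / (1 + x\<^sup>2))" "(\<integral>x. 1 / (1 + (x::real)\<^sup>2) \<partial>lborel) = pi"
proof -
  have 1: "set_integrable lborel (einterval (-\<infinity>) \<infinity>) (\<lambda>x::real. 1 / (1 + x\<^sup>2)) \<and>
     (LBINT x=-\<infinity>..\<infinity>. 1 / (1 + x\<^sup>2)) = pi / 2 - (- (pi / 2))"
  proof (intro conjI)
    note * = interval_integral_FTC_nonneg[of "-\<infinity>" "\<infinity>" arctan "\<lambda>x. 1 / (1 + x\<^sup>2)" "- (pi/2)" "pi/2"]
    have nz: "1 + x\<^sup>2 \<noteq> 0" for x :: real by (smt (verit) zero_le_power2)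
    have d: "DERIV arctan x :> 1 / (1 + x\<^sup>2)" for x
      using DERIV_arctan[of x] by (simp add: inverse_eq_divide)
    have c: "isCont (\<lambda>x::real. 1 / (1 + x\<^sup>2)) x" for x
      using nz by (intro continuous_intros) auto
    have l1: "((arctan \<circ> real_of_ereal) \<longlongrightarrow> - (pi / 2)) (at_right (- \<infinity>))"
      unfolding ereal_tendsto_simps by (rule tendsto_arctan_at_bot)
    have l2: "((arctan \<circ> real_of_ereal) \<longlongrightarrow> pi / 2) (at_left \<infinity>)"
      unfolding ereal_tendsto_simps by (rule tendsto_arctan_at_top)
    show "set_integrable lborel (einterval (-\<infinity>) \<infinity>) (\<lambda>x::real. 1 / (1 + x\<^sup>2))"
      by (rule *(1)) (use d c l1 l2 in auto)
    show "(LBINT x=-\<infinity>..\<infinity>. 1 / (1 + x\<^sup>2)) = pi / 2 - (- (pi / 2))"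
      by (rule *(2)) (use d c l1 l2 in auto)
  qed
  then show "integrable lborel (\<lambda>x::real. 1 / (1 + x\<^sup>2))" "(\<integral>x. 1 / (1 + (x::real)\<^sup>2) \<partial>lborel) = pi"
    by (auto simp: set_integrable_def interval_lebesgue_integral_def set_lebesgue_integral_def)
qed

lemma L2_weight: "(\<lambda>x::real. 1 / (1 + x\<^sup>2)) \<in> L2"
proof (rule L2_I)
  show "integrable lborel (\<lambda>x::real. (norm (1 / (1 + x\<^sup>2)))\<^sup>2)"
  proof (rule Bochner_Integration.integrable_bound[OF has_integral_arctan(1)])
    have "1 / (1 + x\<^sup>2)^2 \<le> 1 / (1 + x\<^sup>2)" for x :: real
      by (intro divide_left_mono) (auto simp: power2_eq_square add_pos_nonneg)
    then show "AE x::real in lborel. norm ((norm (1 / (1 + x\<^sup>2)))\<^sup>2) \<le> norm (1 / (1 + x\<^sup>2))"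
      by (simp add: power_divide)
  qed simp
qed simp

text \<open>Multiplication by a fixed positive weight in \<open>L2\<close> turns an
  \<open>L2\<close>-Cauchy sequence into an \<open>L^1\<close>-Cauchy one by Cauchy-Schwarz, and
  such a sequence has a subsequence that is Cauchy almost everywhere. The weight has no zeros, so
  the corresponding subsequence of \<open>f\<close> converges too; Fatou's lemma returns the
  estimate in \<open>L2\<close>.\<close>

lemma L2_complete:
  fixes f :: "nat \<Rightarrow> real \<Rightarrow> 'a::euclidean_space"
  assumes f: "\<And>n. f n \<in> L2"
    and cau: "\<And>e. 0 < e \<Longrightarrow> \<exists>N. \<forall>m\<ge>N. \<forall>n\<ge>N. L2_norm (\<lambda>x. f m x - f n x) < e"
  shows "\<exists>g\<in>L2. (\<lambda>n. L2_norm (\<lambda>x. f n x - g x)) \<longlonglongrightarrow> 0"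
proof -
  define h where "h = (\<lambda>x::real. 1 / (1 + x\<^sup>2))"
  have h: "h \<in> L2" "h x > 0" for x unfolding h_def using L2_weight by (auto simp: add_pos_nonneg)
  note [measurable] = L2_measurable[OF f] L2_measurable[OF h(1)]
  define s where "s n x = h x *\<^sub>R f n x" for n x
  have si: "integrable lborel (s n)" for n
    unfolding s_def by (rule Bochner_Integration.integrable_bound[OF L2_Cauchy_Schwarz(1)[OF h(1) f[of n]]]) auto
  have sc: "\<exists>N. \<forall>i\<ge>N. \<forall>j\<ge>N. LINT x|lborel. norm (s i x - s j x) < e" if "e > 0" for e
  proof -
    obtain N where N: "\<And>m n. m \<ge> N \<Longrightarrow> n \<ge> N \<Longrightarrow> L2_norm (\<lambda>x. f m x - f n x) < e / (L2_norm h + 1)"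
      using cau[of "e / (L2_norm h + 1)"] \<open>e > 0\<close> by (auto simp: add_nonneg_pos)
    have "LINT x|lborel. norm (s i x - s j x) < e" if "i \<ge> N" "j \<ge> N" for i j
    proof -
      have "(LINT x|lborel. norm (s i x - s j x)) = (\<integral>x. norm (h x) * norm (f i x - f j x) \<partial>lborel)"
        unfolding s_def by (simp flip: scaleR_diff_right)
      also have "\<dots> \<le> L2_norm h * L2_norm (\<lambda>x. f i x - f j x)"
        by (rule L2_Cauchy_Schwarz(2)[OF h(1) L2_diff[OF f f]])
      also have "\<dots> \<le> L2_norm h * (e / (L2_norm h + 1))"
        by (intro mult_left_mono less_imp_le[OF N] that) simp
      also have "\<dots> < e" using \<open>e > 0\<close> L2_norm_nonneg[of h]
        by (auto simp: divide_simps add_nonneg_pos)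
      finally show ?thesis .
    qed
    then show ?thesis by blast
  qed
  obtain r where r: "strict_mono r" "AE x in lborel. Cauchy (\<lambda>i. s (r i) x)"
    using cauchy_L1_AE_cauchy_subseq[OF si sc] by blast
  define g where "g x = lim (\<lambda>i. f (r i) x)" for x
  have g[measurable]: "g \<in> borel_measurable borel"
    unfolding g_def by (rule borel_measurable_lim_metric) simp
  have lim: "AE x in lborel. (\<lambda>i. f (r i) x) \<longlonglongrightarrow> g x"
    using r(2)
  proof eventually_elim
    case (elim x)
    then obtain l where "(\<lambda>i. s (r i) x) \<longlonglongrightarrow> l" using Cauchy_convergent convergent_def by blast
    then have "(\<lambda>i. (1 / h x) *\<^sub>R s (r i) x) \<longlonglongrightarrow> (1 / h x) *\<^sub>R l" by (intro tendsto_intros)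
    moreover have "(\<lambda>i. (1 / h x) *\<^sub>R s (r i) x) = (\<lambda>i. f (r i) x)"
      using h(2)[of x] by (simp add: s_def)
    ultimately show ?case unfolding g_def using convergent_LIMSEQ_iff convergent_def by auto
  qed
  have est: "(\<lambda>x. f n x - g x) \<in> L2 \<and> L2_norm (\<lambda>x. f n x - g x) \<le> e"
    if e: "0 < e" and N: "\<forall>m\<ge>N. \<forall>n\<ge>N. L2_norm (\<lambda>x. f m x - f n x) < e" "n \<ge> N" for e n N
  proof -
    have "(\<integral>\<^sup>+x. ennreal ((norm (f n x - g x))\<^sup>2) \<partial>lborel)
        = (\<integral>\<^sup>+x. liminf (\<lambda>i. ennreal ((norm (f n x - f (r i) x))\<^sup>2)) \<partial>lborel)"
    proof (rule nn_integral_cong_AE, use lim in eventually_elim)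
      case (elim x)
      then have "(\<lambda>i. ennreal ((norm (f n x - f (r i) x))\<^sup>2)) \<longlonglongrightarrow> ennreal ((norm (f n x - g x))\<^sup>2)"
        by (intro tendsto_ennrealI tendsto_intros)
      then show ?case by (rule lim_imp_Liminf[OF sequentially_bot, symmetric])
    qed
    also have "\<dots> \<le> liminf (\<lambda>i. \<integral>\<^sup>+x. ennreal ((norm (f n x - f (r i) x))\<^sup>2) \<partial>lborel)"
      by (rule nn_integral_liminf) simp
    also have "\<dots> \<le> ennreal (e\<^sup>2)"
    proof (rule Liminf_le)
      show "\<forall>\<^sub>F i in sequentially. (\<integral>\<^sup>+x. ennreal ((norm (f n x - f (r i) x))\<^sup>2) \<partial>lborel) \<le> ennreal (e\<^sup>2)"
        using eventually_ge_at_top[of N]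
      proof eventually_elim
        case (elim i)
        then have "r i \<ge> N" using seq_suble[OF r(1), of i] by linarith
        then show ?case
          using N \<open>e > 0\<close> by (subst nn_integral_sq_L2[OF L2_diff[OF f f]])
            (auto intro!: ennreal_leI power_mono less_imp_le)
      qed
    qed simp
    finally show ?thesis using e L2_nn_integral_le[of "\<lambda>x. f n x - g x" e] by auto
  qed
  obtain N0 where "\<forall>m\<ge>N0. \<forall>n\<ge>N0. L2_norm (\<lambda>x. f m x - f n x) < 1" using cau[of 1] by auto
  from est[OF _ this order_refl] have "(\<lambda>x. f N0 x - g x) \<in> L2" by simp
  from L2_diff[OF f[of N0] this] have "g \<in> L2" by simp
  moreover have "(\<lambda>n. L2_norm (\<lambda>x. f n x - g x)) \<longlonglongrightarrow> 0"
  proof (rule LIMSEQ_I)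
    fix e :: real assume "0 < e"
    obtain N where "\<forall>m\<ge>N. \<forall>n\<ge>N. L2_norm (\<lambda>x. f m x - f n x) < e/2" using cau[of "e/2"] \<open>0 < e\<close> by auto
    from est[OF _ this] \<open>0 < e\<close> show "\<exists>N. \<forall>n\<ge>N. norm (L2_norm (\<lambda>x. f n x - g x) - 0) < e"
      by (intro exI[of _ N]) (force simp: abs_le_iff)
  qed
  ultimately show ?thesis by blast
qed

text \<open>Fatou's lemma along growing intervals. It later allows membership in a weighted space to
  be tested on bounded frequencies, provided that the bound does not depend on
  \<open>n\<close>.\<close>

lemma L2_of_truncations:
  fixes g :: "real \<Rightarrow> 'a::euclidean_space"
  assumes "g \<in> borel_measurable borel" "0 \<le> C"
    and "\<And>n::nat. (\<lambda>x. indicator {-real n..real n} x *\<^sub>R g x) \<in> L2"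
    and "\<And>n::nat. L2_norm (\<lambda>x. indicator {-real n..real n} x *\<^sub>R g x) \<le> C"
  shows "g \<in> L2" "L2_norm g \<le> C"
proof -
  note [measurable] = assms(1)
  have lim: "(\<lambda>n. ennreal ((norm (indicator {-real n..real n} x *\<^sub>R g x))\<^sup>2)) \<longlonglongrightarrow> ennreal ((norm (g x))\<^sup>2)" for x
  proof (rule tendsto_eventually)
    obtain N :: nat where "\<bar>x\<bar> \<le> real N" using real_arch_simple by blast
    then show "\<forall>\<^sub>F n in sequentially. ennreal ((norm (indicator {-real n..real n} x *\<^sub>R g x))\<^sup>2) = ennreal ((norm (g x))\<^sup>2)"
      by (intro eventually_sequentiallyI[of N]) (auto simp: indicator_def)
  qed
  have "(\<integral>\<^sup>+x. ennreal ((norm (g x))\<^sup>2) \<partial>lborel)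
     = (\<integral>\<^sup>+x. liminf (\<lambda>n. ennreal ((norm (indicator {-real n..real n} x *\<^sub>R g x))\<^sup>2)) \<partial>lborel)"
    by (intro nn_integral_cong) (metis lim lim_imp_Liminf sequentially_bot)
  also have "\<dots> \<le> liminf (\<lambda>n. \<integral>\<^sup>+x. ennreal ((norm (indicator {-real n..real n} x *\<^sub>R g x))\<^sup>2) \<partial>lborel)"
    by (rule nn_integral_liminf) simp
  also have "\<dots> \<le> ennreal (C\<^sup>2)"
    by (intro Liminf_le always_eventually allI)
       (auto simp: nn_integral_sq_L2[OF assms(3)] simp del: norm_scaleR intro!: ennreal_leI power_mono assms)
  finally show "g \<in> L2" "L2_norm g \<le> C"
    using L2_nn_integral_le[OF assms(1,2)] by auto
qed

section \<open>Convolution and the Fourier integral\<close>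

text \<open>Fubini's theorem asks for measurability over \<open>lborel\<close>, whereas the
  measurability prover works over \<open>borel\<close>; this converts between the two.\<close>

lemma measurable_lborel_pair_iff:
  "f \<in> borel_measurable (lborel \<Otimes>\<^sub>M lborel) \<longleftrightarrow> f \<in> borel_measurable (borel \<Otimes>\<^sub>M borel)"
  by (intro arg_cong2[where f = "(\<in>)"] refl measurable_cong_sets sets_pair_measure_cong) auto

lemma integrable_reflect_shift:
  fixes f :: "real \<Rightarrow> 'a::{banach,second_countable_topology}"
  shows "integrable lborel (\<lambda>y. f (t - y)) \<longleftrightarrow> integrable lborel f"
  using lborel_integrable_real_affine_iff[of "-1" f t] by simp

lemma integral_reflect_shift:
  fixes f :: "real \<Rightarrow> 'a::euclidean_space"
  shows "(\<integral>y. f (t - y) \<partial>lborel) = (\<integral>y. f y \<partial>lborel)"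
  using lborel_integral_real_affine[of "-1" f t] by simp

lemma integrable_shift:
  fixes f :: "real \<Rightarrow> 'a::{banach,second_countable_topology}"
  shows "integrable lborel (\<lambda>y. f (y - t)) \<longleftrightarrow> integrable lborel f"
  using lborel_integrable_real_affine_iff[of 1 f "-t"] by (simp add: algebra_simps)

lemma integral_shift:
  fixes f :: "real \<Rightarrow> 'a::euclidean_space"
  shows "(\<integral>y. f (y - t) \<partial>lborel) = (\<integral>y. f y \<partial>lborel)"
  using lborel_integral_real_affine[of 1 f "-t"] by (simp add: algebra_simps)

lemma integral_reflect:
  fixes f :: "real \<Rightarrow> 'a::euclidean_space"
  shows "(\<integral>y. f (- y) \<partial>lborel) = (\<integral>y. f y \<partial>lborel)"
  using integral_reflect_shift[of f 0] by simp

lemma integrable_reflect: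
  fixes f :: "real \<Rightarrow> 'a::{banach,second_countable_topology}"
  shows "integrable lborel (\<lambda>y. f (- y)) \<longleftrightarrow> integrable lborel f"
  using integrable_reflect_shift[of f 0] by simp

lemma L2_reflect_shift:
  assumes "f \<in> L2"
  shows "(\<lambda>y. f (t - y)) \<in> L2" "L2_norm (\<lambda>y. f (t - y)) = L2_norm f"
proof -
  note [measurable] = L2_measurable[OF assms]
  show "(\<lambda>y. f (t - y)) \<in> L2"
    by (rule L2_I) (use integrable_reflect_shift[of "\<lambda>x. (norm (f x))\<^sup>2"] L2_integrable[OF assms] in auto)
  show "L2_norm (\<lambda>y. f (t - y)) = L2_norm f"
    unfolding L2_norm_def using integral_reflect_shift[of "\<lambda>x. (norm (f x))\<^sup>2" t] by simp
qed

lemma L2_shift: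
  assumes "f \<in> L2"
  shows "(\<lambda>y. f (y - t)) \<in> L2" "L2_norm (\<lambda>y. f (y - t)) = L2_norm f"
proof -
  note [measurable] = L2_measurable[OF assms]
  show "(\<lambda>y. f (y - t)) \<in> L2"
    by (rule L2_I) (use integrable_shift[of "\<lambda>x. (norm (f x))\<^sup>2"] L2_integrable[OF assms] in auto)
  show "L2_norm (\<lambda>y. f (y - t)) = L2_norm f"
    unfolding L2_norm_def using integral_shift[of "\<lambda>x. (norm (f x))\<^sup>2" t] by simp
qed

definition conv :: "(real \<Rightarrow> complex) \<Rightarrow> (real \<Rightarrow> complex) \<Rightarrow> real \<Rightarrow> complex" where
  "conv a b \<xi> = (\<integral>\<eta>. a (\<xi> - \<eta>) * b \<eta> \<partial>lborel)"

definition ft :: "(real \<Rightarrow> complex) \<Rightarrow> real \<Rightarrow> complex" where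
  "ft f \<xi> = (\<integral>x. cis (- (x * \<xi>)) * f x \<partial>lborel)"

text \<open>The normalization of \<open>has_fourier_transform\<close> puts the whole factor
  \<open>2 * pi\<close> here; it reappears in \<open>ift_conv\<close> and in Parseval's
  identity.\<close>

definition ift :: "(real \<Rightarrow> complex) \<Rightarrow> real \<Rightarrow> complex" where
  "ift a x = (\<integral>\<xi>. cis (x * \<xi>) * a \<xi> \<partial>lborel) / (2 * pi)"

lemma ift_eq_ft: "ift a x = ft a (- x) / (2 * pi)"
  by (simp add: ift_def ft_def mult.commute)

lemma ft_eq_ift: "ft a x = 2 * pi * ift a (- x)"
  by (simp add: ift_def ft_def mult.commute)

lemma cis_measurable [measurable]: "cis \<in> borel_measurable borel"
  by (intro borel_measurable_continuous_onI continuous_intros)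

lemma integrable_cis_mult:
  fixes a :: "real \<Rightarrow> complex"
  assumes "integrable lborel a" and [measurable]: "g \<in> borel_measurable borel"
  shows "integrable lborel (\<lambda>\<xi>. cis (g \<xi>) * a \<xi>)"
  by (rule Bochner_Integration.integrable_bound[OF assms(1)])
     (use borel_measurable_integrable[OF assms(1)] in \<open>auto simp: norm_mult\<close>)

lemma integrable_bounded_mult:
  fixes a g :: "real \<Rightarrow> complex"
  assumes "integrable lborel a" and "g \<in> borel_measurable borel" and "\<And>x. norm (g x) \<le> C"
  shows "integrable lborel (\<lambda>\<xi>. g \<xi> * a \<xi>)"
proof (rule Bochner_Integration.integrable_bound[OF integrable_mult_right[OF integrable_norm[OF assms(1)], of C]])
  show "(\<lambda>\<xi>. g \<xi> * a \<xi>) \<in> borel_measurable lborel"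
    using assms(2) borel_measurable_integrable[OF assms(1)] by simp
  have "0 \<le> C" using assms(3)[of 0] norm_ge_zero order_trans by blast
  then show "AE x in lborel. norm (g x * a x) \<le> norm (C * norm (a x))"
    by (intro AE_I2) (auto simp: norm_mult abs_mult intro!: mult_right_mono assms)
qed

lemma ft_measurable [measurable]:
  assumes [measurable]: "f \<in> borel_measurable borel"
  shows "ft f \<in> borel_measurable borel"
proof -
  have "(\<lambda>\<xi>. \<integral>x. cis (- (x * \<xi>)) * f x \<partial>lborel) \<in> borel_measurable borel" by measurable
  then show ?thesis unfolding ft_def[abs_def] .
qed

lemma ift_measurable [measurable]:
  assumes [measurable]: "f \<in> borel_measurable borel"
  shows "ift f \<in> borel_measurable borel"
proof -
  have "(\<lambda>x. (\<integral>\<xi>. cis (x * \<xi>) * f \<xi> \<partial>lborel) / (2 * pi)) \<in> borel_measurable borel" by measurable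
  then show ?thesis unfolding ift_def[abs_def] .
qed

lemma conv_measurable [measurable]:
  assumes [measurable]: "a \<in> borel_measurable borel" "b \<in> borel_measurable borel"
  shows "conv a b \<in> borel_measurable borel"
proof -
  have "(\<lambda>\<xi>. \<integral>\<eta>. a (\<xi> - \<eta>) * b \<eta> \<partial>lborel) \<in> borel_measurable borel" by measurable
  then show ?thesis unfolding conv_def[abs_def] .
qed

lemma norm_ift_le: "norm (ift a x) \<le> (\<integral>\<xi>. norm (a \<xi>) \<partial>lborel) / (2 * pi)"
proof -
  have "norm (ift a x) = norm (\<integral>\<xi>. cis (x * \<xi>) * a \<xi> \<partial>lborel) / (2 * pi)"
    by (simp add: ift_def norm_divide norm_mult)
  also have "\<dots> \<le> (\<integral>\<xi>. norm (cis (x * \<xi>) * a \<xi>) \<partial>lborel) / (2 * pi)"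
    by (intro divide_right_mono integral_norm_bound) simp
  finally show ?thesis by (simp add: norm_mult)
qed

lemma ift_add: "integrable lborel a \<Longrightarrow> integrable lborel b \<Longrightarrow> ift (\<lambda>\<xi>. a \<xi> + b \<xi>) x = ift a x + ift b x"
  by (simp add: ift_def distrib_left integrable_cis_mult add_divide_distrib)

lemma ift_diff: "integrable lborel a \<Longrightarrow> integrable lborel b \<Longrightarrow> ift (\<lambda>\<xi>. a \<xi> - b \<xi>) x = ift a x - ift b x"
  by (simp add: ift_def right_diff_distrib integrable_cis_mult diff_divide_distrib)

lemma ift_cmult: "ift (\<lambda>\<xi>. c * a \<xi>) x = c * ift a x"
proof -
  have "(\<integral>\<xi>. cis (x * \<xi>) * (c * a \<xi>) \<partial>lborel) = (\<integral>\<xi>. c * (cis (x * \<xi>) * a \<xi>) \<partial>lborel)"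
    by (simp add: mult_ac)
  then show ?thesis by (simp add: ift_def)
qed

lemma ift_cong_AE:
  assumes "AE \<xi> in lborel. a \<xi> = b \<xi>" "a \<in> borel_measurable borel" "b \<in> borel_measurable borel"
  shows "ift a x = ift b x"
  unfolding ift_def
  by (intro arg_cong[where f = "\<lambda>z. z / _"] integral_cong_AE) (use assms in auto)

text \<open>A bounded kernel, here an oscillating factor, is dominated by its bound times the tensor
  product of the two integrable functions.\<close>

lemma Fubini_weighted:
  fixes f g :: "real \<Rightarrow> complex"
  assumes f: "integrable lborel f" and g: "integrable lborel g"
    and k: "(\<lambda>(x,y). k x y) \<in> borel_measurable (borel \<Otimes>\<^sub>M borel)" and kb: "\<And>x y. norm (k x y :: complex) \<le> C"
  shows "integrable (lborel \<Otimes>\<^sub>M lborel) (\<lambda>(x,y). k x y * (f x * g y))"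
    and "(\<integral>y. (\<integral>x. k x y * (f x * g y) \<partial>lborel) \<partial>lborel) = (\<integral>x. (\<integral>y. k x y * (f x * g y) \<partial>lborel) \<partial>lborel)"
proof -
  note [measurable] = borel_measurable_integrable[OF f] borel_measurable_integrable[OF g] k
  have C: "0 \<le> C" using kb[of 0 0] norm_ge_zero order_trans by blast
  have m: "(\<lambda>(x,y). k x y * (f x * g y)) \<in> borel_measurable (lborel \<Otimes>\<^sub>M lborel)"
    unfolding measurable_lborel_pair_iff by measurable
  have fg: "integrable (lborel \<Otimes>\<^sub>M lborel) (\<lambda>(x,y). C * (norm (f x) * norm (g y)))"
  proof (rule lborel_pair.Fubini_integrable)
    show "(\<lambda>(x, y). C * (norm (f x) * norm (g y))) \<in> borel_measurable (lborel \<Otimes>\<^sub>M lborel)"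
      unfolding measurable_lborel_pair_iff by measurable
    show "integrable lborel (\<lambda>x. \<integral>y. norm (case (x, y) of (x, y) \<Rightarrow> C * (norm (f x) * norm (g y))) \<partial>lborel)"
      using f C by (simp add: abs_mult)
    show "AE x in lborel. integrable lborel (\<lambda>y. case (x, y) of (x, y) \<Rightarrow> C * (norm (f x) * norm (g y)))"
      using g by simp
  qed
  show i: "integrable (lborel \<Otimes>\<^sub>M lborel) (\<lambda>(x,y). k x y * (f x * g y))"
    by (rule Bochner_Integration.integrable_bound[OF fg m])
       (use C kb in \<open>auto simp: norm_mult abs_mult split_beta intro!: AE_I2 mult_right_mono\<close>)
  show "(\<integral>y. (\<integral>x. k x y * (f x * g y) \<partial>lborel) \<partial>lborel) = (\<integral>x. (\<integral>y. k x y * (f x * g y) \<partial>lborel) \<partial>lborel)"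
    by (rule lborel_pair.Fubini_integral[OF i])
qed

text \<open>Applied with a second factor whose transform is explicit: an exponential weight, a
  shifted copy of the kernel, or the conjugate of a given transform.\<close>

lemma ft_duality:
  fixes f g :: "real \<Rightarrow> complex"
  assumes f: "integrable lborel f" and g: "integrable lborel g"
  shows "(\<integral>\<xi>. ft f \<xi> * g \<xi> \<partial>lborel) = (\<integral>x. f x * ft g x \<partial>lborel)"
proof -
  have "(\<integral>\<xi>. ft f \<xi> * g \<xi> \<partial>lborel) = (\<integral>\<xi>. (\<integral>x. cis (- (x * \<xi>)) * (f x * g \<xi>) \<partial>lborel) \<partial>lborel)"
    unfolding ft_def by (subst integral_mult_left_zero[symmetric]) (simp add: mult_ac)
  also have "\<dots> = (\<integral>x. (\<integral>\<xi>. cis (- (x * \<xi>)) * (f x * g \<xi>) \<partial>lborel) \<partial>lborel)"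
    by (rule Fubini_weighted(2)[OF f g, where C = 1]) auto
  also have "\<dots> = (\<integral>x. f x * ft g x \<partial>lborel)"
    unfolding ft_def by (subst integral_mult_right_zero[symmetric]) (simp add: mult_ac)
  finally show ?thesis .
qed

lemma conv_pair_integrable:
  fixes a b :: "real \<Rightarrow> complex"
  assumes a: "integrable lborel a" and b: "integrable lborel b"
  shows "integrable (lborel \<Otimes>\<^sub>M lborel) (\<lambda>(\<eta>,\<xi>). a (\<xi> - \<eta>) * b \<eta> :: complex)"
proof (rule lborel_pair.Fubini_integrable)
  note [measurable] = borel_measurable_integrable[OF a] borel_measurable_integrable[OF b]
  show "(\<lambda>(\<eta>,\<xi>). a (\<xi> - \<eta>) * b \<eta>) \<in> borel_measurable (lborel \<Otimes>\<^sub>M lborel)"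
    unfolding measurable_lborel_pair_iff by measurable
  show "integrable lborel (\<lambda>\<eta>. \<integral>\<xi>. norm (case (\<eta>, \<xi>) of (\<eta>, \<xi>) \<Rightarrow> a (\<xi> - \<eta>) * b \<eta>) \<partial>lborel)"
    using b by (simp add: norm_mult integral_shift[of "\<lambda>x. norm (a x)"])
  show "AE \<eta> in lborel. integrable lborel (\<lambda>\<xi>. case (\<eta>, \<xi>) of (\<eta>, \<xi>) \<Rightarrow> a (\<xi> - \<eta>) * b \<eta>)"
    using a by (simp add: integrable_shift[of a])
qed

lemma conv_integrable:
  assumes a: "integrable lborel a" and b: "integrable lborel b"
  shows "integrable lborel (conv a b)"
  using lborel_pair.integrable_snd[OF conv_pair_integrable[OF assms]] by (simp add: conv_def[abs_def])

lemma ft_conv: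
  assumes a: "integrable lborel a" and b: "integrable lborel b"
  shows "ft (conv a b) x = ft a x * ft b x"
proof -
  note [measurable] = borel_measurable_integrable[OF a] borel_measurable_integrable[OF b]
  have i: "integrable (lborel \<Otimes>\<^sub>M lborel) (\<lambda>(\<eta>,\<xi>). cis (- (\<xi> * x)) * (a (\<xi> - \<eta>) * b \<eta>))"
    by (rule Bochner_Integration.integrable_bound[OF conv_pair_integrable[OF assms]])
       (auto simp: norm_mult measurable_lborel_pair_iff)
  have "ft (conv a b) x = (\<integral>\<xi>. (\<integral>\<eta>. cis (- (\<xi> * x)) * (a (\<xi> - \<eta>) * b \<eta>) \<partial>lborel) \<partial>lborel)"
    unfolding ft_def conv_def by simp
  also have "\<dots> = (\<integral>\<eta>. (\<integral>\<xi>. cis (- (\<xi> * x)) * (a (\<xi> - \<eta>) * b \<eta>) \<partial>lborel) \<partial>lborel)"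
    by (rule lborel_pair.Fubini_integral[OF i])
  also have "\<dots> = (\<integral>\<eta>. (\<integral>\<xi>. cis (- ((\<xi> + \<eta>) * x)) * (a \<xi> * b \<eta>) \<partial>lborel) \<partial>lborel)"
    using integral_shift[of "\<lambda>\<xi>. cis (- ((\<xi> + \<eta>) * x)) * (a \<xi> * b \<eta>)" \<eta> for \<eta>] by simp
  also have "\<dots> = (\<integral>\<eta>. (\<integral>\<xi>. (cis (- (\<eta> * x)) * b \<eta>) * (cis (- (\<xi> * x)) * a \<xi>) \<partial>lborel) \<partial>lborel)"
  proof -
    have eq: "cis (- ((\<xi> + \<eta>) * x)) = cis (- (\<eta> * x)) * cis (- (\<xi> * x))" for \<xi> \<eta>
      by (simp add: cis_mult algebra_simps)
    show ?thesis unfolding eq by (simp add: mult_ac)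
  qed
  also have "\<dots> = ft a x * ft b x"
    unfolding ft_def by simp
  finally show ?thesis .
qed

lemma ift_conv:
  assumes a: "integrable lborel a" and b: "integrable lborel b"
  shows "ift (conv a b) x = 2 * pi * (ift a x * ift b x)"
  by (simp add: ift_eq_ft ft_conv[OF assms])

lemma conv_commute: "conv a b \<xi> = conv b a \<xi>"
  unfolding conv_def using integral_reflect_shift[of "\<lambda>\<eta>. b (\<xi> - \<eta>) * a \<eta>" \<xi>] by (simp add: mult.commute)

lemma conv_L2_integrable:
  fixes a b :: "real \<Rightarrow> complex"
  assumes "a \<in> L2" "b \<in> L2"
  shows "integrable lborel (\<lambda>\<eta>. a (\<xi> - \<eta>) * b \<eta>)"
    and "norm (conv a b \<xi>) \<le> L2_norm a * L2_norm b"
proof -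
  note [measurable] = L2_measurable[OF assms(1)] L2_measurable[OF assms(2)]
  note cs = L2_Cauchy_Schwarz[OF L2_reflect_shift(1)[OF assms(1), of \<xi>] assms(2)]
  show "integrable lborel (\<lambda>\<eta>. a (\<xi> - \<eta>) * b \<eta>)"
    by (rule Bochner_Integration.integrable_bound[OF cs(1)]) (auto simp: norm_mult)
  have "norm (conv a b \<xi>) \<le> (\<integral>\<eta>. norm (a (\<xi> - \<eta>)) * norm (b \<eta>) \<partial>lborel)"
    unfolding conv_def by (rule order_trans[OF integral_norm_bound]) (simp add: norm_mult)
  then show "norm (conv a b \<xi>) \<le> L2_norm a * L2_norm b"
    using cs(2) by (simp add: L2_reflect_shift(2)[OF assms(1)])
qed

lemma conv_add_left: "a \<in> L2 \<Longrightarrow> b \<in> L2 \<Longrightarrow> c \<in> L2 \<Longrightarrow> conv (\<lambda>x. a x + b x) c \<xi> = conv a c \<xi> + conv b c \<xi>"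
  unfolding conv_def by (simp add: distrib_right conv_L2_integrable)

lemma conv_diff_right: "a \<in> L2 \<Longrightarrow> b \<in> L2 \<Longrightarrow> c \<in> L2 \<Longrightarrow> conv a (\<lambda>x. b x - c x) \<xi> = conv a b \<xi> - conv a c \<xi>"
  unfolding conv_def by (simp add: right_diff_distrib conv_L2_integrable)

text \<open>Cauchy--Schwarz with respect to the finite measure of density \<^term>\<open>\<lambda>\<eta>. norm (a (\<xi> - \<eta>))\<close>.\<close>
lemma conv_Young:
  fixes a b :: "real \<Rightarrow> complex"
  assumes a: "integrable lborel a" and b: "b \<in> L2"
  shows "conv a b \<in> L2" and "L2_norm (conv a b) \<le> (\<integral>x. norm (a x) \<partial>lborel) * L2_norm b"
proof -
  note [measurable] = borel_measurable_integrable[OF a] L2_measurable[OF b]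
  define A where "A = (\<integral>x. norm (a x) \<partial>lborel)"
  have A: "0 \<le> A" unfolding A_def by simp
  have nA: "(\<integral>\<^sup>+\<eta>. ennreal (norm (a (\<xi> - \<eta>))) \<partial>lborel) = ennreal A" for \<xi>
  proof -
    have "(\<integral>\<^sup>+\<eta>. ennreal (norm (a (\<xi> - \<eta>))) \<partial>lborel) = ennreal (\<integral>\<eta>. norm (a (\<xi> - \<eta>)) \<partial>lborel)"
      using a by (intro nn_integral_eq_integral) (auto simp: integrable_reflect_shift)
    then show ?thesis by (simp add: A_def integral_reflect_shift[of "\<lambda>\<eta>. norm (a \<eta>)"])
  qed
  have nA': "(\<integral>\<^sup>+\<xi>. ennreal (norm (a (\<xi> - \<eta>))) \<partial>lborel) = ennreal A" for \<eta>
  proof -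
    have "(\<integral>\<^sup>+\<xi>. ennreal (norm (a (\<xi> - \<eta>))) \<partial>lborel) = ennreal (\<integral>\<xi>. norm (a (\<xi> - \<eta>)) \<partial>lborel)"
      using a by (intro nn_integral_eq_integral) (auto simp: integrable_shift)
    then show ?thesis by (simp add: A_def integral_shift[of "\<lambda>\<eta>. norm (a \<eta>)"])
  qed
  have sq: "ennreal (sqrt x) ^ 2 = ennreal x" if "0 \<le> x" for x
    using that by (simp add: ennreal_power)
  have pt: "ennreal ((norm (conv a b \<xi>))\<^sup>2) \<le> ennreal A * (\<integral>\<^sup>+\<eta>. ennreal (norm (a (\<xi> - \<eta>))) * ennreal ((norm (b \<eta>))\<^sup>2) \<partial>lborel)" for \<xi>
  proof -
    have "ennreal (norm (conv a b \<xi>)) \<le> (\<integral>\<^sup>+\<eta>. ennreal (norm (a (\<xi> - \<eta>) * b \<eta>)) \<partial>lborel)"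
    proof (cases "integrable lborel (\<lambda>\<eta>. a (\<xi> - \<eta>) * b \<eta>)")
      case True
      have "norm (conv a b \<xi>) \<le> (\<integral>\<eta>. norm (a (\<xi> - \<eta>) * b \<eta>) \<partial>lborel)"
        unfolding conv_def by (rule integral_norm_bound)
      then show ?thesis using True by (subst nn_integral_eq_integral) auto
    next
      \<comment> \<open>A divergent Bochner integral has value 0 by convention, so the bound is
        trivial here.\<close>
      case False
      then show ?thesis unfolding conv_def by (simp add: not_integrable_integral_eq)
    qed
    also have "\<dots> = (\<integral>\<^sup>+\<eta>. ennreal (sqrt (norm (a (\<xi> - \<eta>)))) * (ennreal (sqrt (norm (a (\<xi> - \<eta>)))) * ennreal (norm (b \<eta>))) \<partial>lborel)"
      by (intro nn_integral_cong) (simp add: norm_mult ennreal_mult[symmetric] mult.assoc[symmetric])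
    finally have "ennreal (norm (conv a b \<xi>)) ^ 2 \<le>
       (\<integral>\<^sup>+\<eta>. ennreal (sqrt (norm (a (\<xi> - \<eta>)))) * (ennreal (sqrt (norm (a (\<xi> - \<eta>)))) * ennreal (norm (b \<eta>))) \<partial>lborel) ^ 2"
      by (intro power_mono) auto
    also have "\<dots> \<le> (\<integral>\<^sup>+\<eta>. ennreal (sqrt (norm (a (\<xi> - \<eta>)))) ^ 2 \<partial>lborel) *
       (\<integral>\<^sup>+\<eta>. (ennreal (sqrt (norm (a (\<xi> - \<eta>)))) * ennreal (norm (b \<eta>))) ^ 2 \<partial>lborel)"
      by (rule Cauchy_Schwarz_nn_integral) auto
    also have "\<dots> = ennreal A * (\<integral>\<^sup>+\<eta>. ennreal (norm (a (\<xi> - \<eta>))) * ennreal ((norm (b \<eta>))\<^sup>2) \<partial>lborel)"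
      by (simp add: sq nA power_mult_distrib ennreal_power)
    finally show ?thesis by (simp add: ennreal_power)
  qed
  have "(\<integral>\<^sup>+\<xi>. ennreal ((norm (conv a b \<xi>))\<^sup>2) \<partial>lborel)
    \<le> (\<integral>\<^sup>+\<xi>. ennreal A * (\<integral>\<^sup>+\<eta>. ennreal (norm (a (\<xi> - \<eta>))) * ennreal ((norm (b \<eta>))\<^sup>2) \<partial>lborel) \<partial>lborel)"
    by (intro nn_integral_mono pt)
  also have "\<dots> = ennreal A * (\<integral>\<^sup>+\<xi>. (\<integral>\<^sup>+\<eta>. ennreal (norm (a (\<xi> - \<eta>))) * ennreal ((norm (b \<eta>))\<^sup>2) \<partial>lborel) \<partial>lborel)"
    by (rule nn_integral_cmult) measurable
  also have "(\<integral>\<^sup>+\<xi>. (\<integral>\<^sup>+\<eta>. ennreal (norm (a (\<xi> - \<eta>))) * ennreal ((norm (b \<eta>))\<^sup>2) \<partial>lborel) \<partial>lborel)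
     = (\<integral>\<^sup>+\<eta>. (\<integral>\<^sup>+\<xi>. ennreal (norm (a (\<xi> - \<eta>))) * ennreal ((norm (b \<eta>))\<^sup>2) \<partial>lborel) \<partial>lborel)"
    by (rule lborel_pair.Fubini') (unfold measurable_lborel_pair_iff, measurable)
  also have "\<dots> = (\<integral>\<^sup>+\<eta>. ennreal A * ennreal ((norm (b \<eta>))\<^sup>2) \<partial>lborel)"
    by (intro nn_integral_cong) (subst nn_integral_multc, auto simp: nA')
  also have "\<dots> = ennreal A * ennreal ((L2_norm b)\<^sup>2)"
    by (subst nn_integral_cmult) (auto simp: nn_integral_sq_L2[OF b])
  also have "ennreal A * \<dots> = ennreal ((A * L2_norm b)\<^sup>2)"
    using A by (simp add: ennreal_mult[symmetric] power2_eq_square mult_ac)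
  finally have "(\<integral>\<^sup>+\<xi>. ennreal ((norm (conv a b \<xi>))\<^sup>2) \<partial>lborel) \<le> ennreal ((A * L2_norm b)\<^sup>2)" .
  from L2_nn_integral_le[OF _ _ this] A show "conv a b \<in> L2" "L2_norm (conv a b) \<le> A * L2_norm b"
    by auto
qed

section \<open>Approximate identities and Plancherel's theorem\<close>

text \<open>The real exponential is the modulus of the complex one: the fundamental theorem for
  nonnegative integrands gives its integrability, which the complex version of that theorem then
  takes as input.\<close>

lemma halfline_exp:
  fixes e \<xi> :: real
  assumes e: "0 < e"
  shows "integrable lborel (\<lambda>x. indicator {0<..} x * exp (- (e * x)))"
    and "(\<integral>x. indicator {0<..} x *\<^sub>R exp (- (Complex e \<xi> * of_real x)) \<partial>lborel) = 1 / Complex e \<xi>"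
    and "integrable lborel (\<lambda>x. indicator {0<..} x *\<^sub>R exp (- (Complex e \<xi> * of_real x)))"
proof -
  have ei: "einterval (ereal 0) \<infinity> = {0<..}" by (auto simp: einterval_iff)
  have tend: "((\<lambda>x. exp (- (e * x))) \<longlongrightarrow> 0) at_top"
    using e by (auto intro!: exp_at_bot[THEN filterlim_compose] filterlim_tendsto_pos_mult_at_top filterlim_ident
             simp: filterlim_uminus_at_bot)
  have "set_integrable lborel (einterval (ereal 0) \<infinity>) (\<lambda>x. exp (- (e * x)))"
  proof (rule interval_integral_FTC_nonneg(1)[where F = "\<lambda>x. - exp (- (e * x)) / e" and A = "-1/e" and B = 0])
    show "(((\<lambda>x. - exp (- (e * x)) / e) \<circ> real_of_ereal) \<longlongrightarrow> -1/e) (at_right (ereal 0))"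
      unfolding ereal_tendsto_simps using e by (auto intro!: tendsto_eq_intros)
    show "(((\<lambda>x. - exp (- (e * x)) / e) \<circ> real_of_ereal) \<longlongrightarrow> 0) (at_left \<infinity>)"
      unfolding ereal_tendsto_simps using tendsto_divide[OF tendsto_minus[OF tend] tendsto_const, of e] e by simp
  qed (use e in \<open>auto intro!: derivative_eq_intros continuous_intros\<close>)
  then show i: "integrable lborel (\<lambda>x. indicator {0<..} x * exp (- (e * x)))"
    unfolding ei set_integrable_def by simp
  define z where "z = Complex e \<xi>"
  have z: "z \<noteq> 0" "Re z = e" using e by (auto simp: z_def complex_eq_iff)
  have nz: "norm (exp (- (z * of_real x))) = exp (- (e * x))" for x
    using z by (simp add: norm_exp_eq_Re)
  show i2: "integrable lborel (\<lambda>x. indicator {0<..} x *\<^sub>R exp (- (Complex e \<xi> * of_real x)))"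
    unfolding z_def[symmetric]
    by (rule Bochner_Integration.integrable_bound[OF i]) (auto simp: nz z indicator_def)
  have "(LBINT x=ereal 0..\<infinity>. exp (- (z * of_real x))) = 0 - (- 1 / z)"
  proof (rule interval_integral_FTC_integrable[where F = "\<lambda>x. - exp (- (z * of_real x)) / z"])
    fix x :: real
    have "((\<lambda>w. - exp (- (z * w)) / z) has_field_derivative exp (- (z * of_real x))) (at (of_real x))"
      using z by (auto intro!: derivative_eq_intros)
    from has_vector_derivative_real_field[OF this]
    show "((\<lambda>x. - exp (- (z * of_real x)) / z) has_vector_derivative exp (- (z * of_real x))) (at x)" .
    show "isCont (\<lambda>x. exp (- (z * of_real x))) x" by (intro continuous_intros)
  next
    show "set_integrable lborel (einterval (ereal 0) \<infinity>) (\<lambda>x. exp (- (z * of_real x)))"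
      unfolding ei set_integrable_def using i2 by (simp add: z_def)
    show "(((\<lambda>x. - exp (- (z * of_real x)) / z) \<circ> real_of_ereal) \<longlongrightarrow> -1/z) (at_right (ereal 0))"
      unfolding ereal_tendsto_simps using z by (auto intro!: tendsto_eq_intros)
    have "((\<lambda>x. exp (- (z * of_real x))) \<longlongrightarrow> 0) at_top"
      by (rule tendsto_norm_zero_cancel) (use tend in \<open>simp add: nz z\<close>)
    then show "(((\<lambda>x. - exp (- (z * of_real x)) / z) \<circ> real_of_ereal) \<longlongrightarrow> 0) (at_left \<infinity>)"
      unfolding ereal_tendsto_simps using tendsto_divide[OF tendsto_minus tendsto_const, of _ 0 at_top z] z by simp
  qed auto
  then show "(\<integral>x. indicator {0<..} x *\<^sub>R exp (- (Complex e \<xi> * of_real x)) \<partial>lborel) = 1 / Complex e \<xi>"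
    by (simp add: interval_lebesgue_integral_def set_lebesgue_integral_def ei z_def)
qed

lemma exp_abs_integrable:
  fixes e :: real
  assumes e: "0 < e"
  shows "integrable lborel (\<lambda>x. exp (- (e * \<bar>x\<bar>)))"
proof -
  note i = halfline_exp(1)[OF e]
  \<comment> \<open>Neither half line contains the origin, hence the exceptional point.\<close>
  have ae: "AE x in lborel. indicator {0<..} x * exp (- (e * x)) + indicator {0<..} (-x) * exp (- (e * (-x)))
      = exp (- (e * \<bar>x\<bar>))"
    using AE_lborel_singleton[of "0::real"] by eventually_elim (auto simp: indicator_def)
  show ?thesis
    by (rule integrable_cong_AE_imp[OF Bochner_Integration.integrable_add[OF i i[THEN integrable_reflect[THEN iffD2]]]])
       (use ae in auto)
qed

text \<open>Reflection of the negative half line changes the sign of the frequency, so the sum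
  \<open>1 / (e + i \<xi>) + 1 / (e - i \<xi>)\<close> appears: the Poisson kernel.\<close>

lemma ft_exp_abs:
  fixes e :: real
  assumes e: "0 < e"
  shows "ft (\<lambda>x. of_real (exp (- (e * \<bar>x\<bar>)))) \<xi> = of_real (2 * e / (e\<^sup>2 + \<xi>\<^sup>2))"
proof -
  define h where "h = (\<lambda>s x. indicator {0<..} x *\<^sub>R exp (- (Complex e s * of_real x)))"
  have h: "integrable lborel (h s)" "(\<integral>x. h s x \<partial>lborel) = 1 / Complex e s" for s
    unfolding h_def by (rule halfline_exp[OF e])+
  note hr = h(1)[THEN integrable_reflect[THEN iffD2]]
  have [measurable]: "h s \<in> borel_measurable borel" for s using borel_measurable_integrable[OF h(1)] by simp
  have eq: "exp (- (Complex e s * of_real x)) = cis (- (x * s)) * of_real (exp (- (e * x)))" for s x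
  proof -
    have "- (Complex e s * of_real x) = \<i> * of_real (- (x * s)) + of_real (- (e * x))"
      by (simp add: complex_eq_iff)
    then show ?thesis by (simp only: exp_add cis_conv_exp exp_of_real)
  qed
  have ae: "AE x in lborel. cis (- (x * \<xi>)) * of_real (exp (- (e * \<bar>x\<bar>))) = h \<xi> x + h (- \<xi>) (- x)"
    using AE_lborel_singleton[of "0::real"]
    by eventually_elim (auto simp: indicator_def h_def eq)
  have "ft (\<lambda>x. of_real (exp (- (e * \<bar>x\<bar>)))) \<xi> = (\<integral>x. h \<xi> x + h (- \<xi>) (- x) \<partial>lborel)"
    unfolding ft_def by (rule integral_cong_AE) (use ae in auto)
  also have "\<dots> = 1 / Complex e \<xi> + 1 / Complex e (- \<xi>)"
    using h hr by (simp add: integral_reflect[of "h (-\<xi>)"])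
  also have "\<dots> = of_real (2 * e / (e\<^sup>2 + \<xi>\<^sup>2))"
  proof -
    have "e\<^sup>2 + \<xi>\<^sup>2 > 0" using e by (simp add: add_pos_nonneg)
    then show ?thesis
      by (simp add: complex_eq_iff Re_divide Im_divide add_divide_distrib[symmetric] power2_eq_square)
  qed
  finally show ?thesis .
qed

lemma integral_exp_abs:
  fixes e :: real
  assumes e: "0 < e"
  shows "(\<integral>x. exp (- (e * \<bar>x\<bar>)) \<partial>lborel) = 2 / e"
proof -
  have "of_real (\<integral>x. exp (- (e * \<bar>x\<bar>)) \<partial>lborel) = (\<integral>x. complex_of_real (exp (- (e * \<bar>x\<bar>))) \<partial>lborel)"
    by simp
  also have "\<dots> = ft (\<lambda>x. of_real (exp (- (e * \<bar>x\<bar>)))) 0" by (simp add: ft_def)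
  also have "\<dots> = of_real (2 / e)" by (simp add: ft_exp_abs[OF e] power2_eq_square)
  finally show ?thesis using of_real_eq_iff by blast
qed

text \<open>The projection onto the disc of radius \<open>k\<close>. It keeps the phase and is
  continuous, so clamping a continuous function makes it bounded without destroying its
  continuity.\<close>

definition radial_clamp :: "real \<Rightarrow> complex \<Rightarrow> complex" where
  "radial_clamp k z = (k / max k (norm z)) *\<^sub>R z"

lemma radial_clamp_norm_le: "0 < k \<Longrightarrow> norm (radial_clamp k z) \<le> k"
  by (auto simp: radial_clamp_def max_def divide_simps mult_left_mono)

lemma radial_clamp_norm_le': "0 < k \<Longrightarrow> norm (radial_clamp k z) \<le> norm z"
  by (auto simp: radial_clamp_def max_def divide_simps mult_left_mono)

lemma radial_clamp_id: "0 < k \<Longrightarrow> norm z \<le> k \<Longrightarrow> radial_clamp k z = z"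
  by (auto simp: radial_clamp_def max_def)

lemma radial_clamp_continuous: "0 < k \<Longrightarrow> continuous_on UNIV (radial_clamp k)"
  unfolding radial_clamp_def[abs_def] by (intro continuous_intros) (auto simp: max_def)

text \<open>Measurability gives continuous functions converging to \<open>f\<close> almost
  everywhere, but no dominating function. Clamping the values and cutting off in space makes
  \<open>f\<close> and its approximants bounded with common compact support, and dominated
  convergence applies.\<close>

lemma L1_dense_continuous_compact_support:
  fixes f :: "real \<Rightarrow> complex"
  assumes f: "integrable lborel f" and e: "0 < e"
  shows "\<exists>g K. continuous_on UNIV g \<and> (\<forall>x. norm (g x) \<le> K) \<and> (\<forall>x. K < \<bar>x\<bar> \<longrightarrow> g x = 0) \<and>
     (\<integral>x. norm (f x - g x) \<partial>lborel) < e"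
proof -
  note [measurable] = borel_measurable_integrable[OF f]
  have "f \<in> borel_measurable lebesgue" by (simp add: measurable_completion)
  then have "f measurable_on UNIV" using lebesgue_measurable_imp_measurable_on[of f UNIV] by simp
  then obtain N G where N: "negligible N" and G: "\<And>n. continuous_on UNIV (G n)"
    and lim: "\<And>x. x \<notin> N \<Longrightarrow> (\<lambda>n. G n x) \<longlonglongrightarrow> (if x \<in> UNIV then f x else 0)"
    unfolding measurable_on_def by blast
  have ae: "AE x in lborel. (\<lambda>n. G n x) \<longlonglongrightarrow> f x"
  proof -
    have "AE x in lebesgue. x \<notin> N" using N negligible_iff_null_sets AE_not_in by blast
    then have "AE x in lebesgue. (\<lambda>n. G n x) \<longlonglongrightarrow> f x" by eventually_elim (use lim in auto)
    then show ?thesis by (simp add: AE_completion_iff)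
  qed
  \<comment> \<open>A trapezoid: 1 up to \<open>k\<close>, 0 beyond \<open>k + 1\<close>, linear in
    between.\<close>
  define cut where "cut k x = max 0 (min 1 (real k + 1 - \<bar>x\<bar>))" for k :: nat and x :: real
  have cut: "0 \<le> cut k x" "cut k x \<le> 1" "continuous_on UNIV (cut k)" for k x
    unfolding cut_def[abs_def] by (auto intro!: continuous_intros)
  have cut1: "cut k x = 1" if "\<bar>x\<bar> \<le> real k" for k x using that by (auto simp: cut_def)
  have cut0: "cut k x = 0" if "\<bar>x\<bar> \<ge> real k + 1" for k x using that by (auto simp: cut_def)
  define H where "H k x = cut k x *\<^sub>R radial_clamp (real k + 1) (f x)" for k x
  define GG where "GG k n x = cut k x *\<^sub>R radial_clamp (real k + 1) (G n x)" for k n x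
  have cl[measurable]: "radial_clamp (real k + 1) \<in> borel_measurable borel" "cut k \<in> borel_measurable borel"
     "G n \<in> borel_measurable borel" for k n
    by (auto intro!: borel_measurable_continuous_onI radial_clamp_continuous cut G)
  have Gc: "continuous_on UNIV (GG k n)" for k n
    unfolding GG_def[abs_def]
    by (intro continuous_intros cut continuous_on_compose2[OF radial_clamp_continuous[of "real k + 1"] G]) auto
  have [measurable]: "H k \<in> borel_measurable borel" "GG k n \<in> borel_measurable borel" for k n
    unfolding H_def[abs_def] GG_def[abs_def] by measurable
  have "(\<lambda>k. \<integral>x. norm (f x - H k x) \<partial>lborel) \<longlonglongrightarrow> (\<integral>x. 0 \<partial>(lborel::real measure))"
  proof (rule integral_dominated_convergence[where w = "\<lambda>x. 2 * norm (f x)"])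
    show "AE x in lborel. (\<lambda>k. norm (f x - H k x)) \<longlonglongrightarrow> 0"
    proof (intro AE_I2 tendsto_eventually)
      fix x
      obtain K :: nat where K: "max \<bar>x\<bar> (norm (f x)) \<le> real K" using real_arch_simple by blast
      show "\<forall>\<^sub>F k in sequentially. norm (f x - H k x) = 0"
      proof (rule eventually_sequentiallyI[of K])
        fix k assume "K \<le> k"
        then have "\<bar>x\<bar> \<le> real k" "norm (f x) \<le> real k + 1" using K by auto
        then show "norm (f x - H k x) = 0" by (simp add: H_def cut1 radial_clamp_id)
      qed
    qed
    show "AE x in lborel. norm (norm (f x - H k x)) \<le> 2 * norm (f x)" for k
    proof (intro AE_I2)
      fix x
      have "norm (H k x) \<le> 1 * norm (f x)"
        unfolding H_def norm_scaleR using cut(1,2)[of k x] radial_clamp_norm_le'[of "real k + 1" "f x"]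
        by (intro mult_mono) auto
      then show "norm (norm (f x - H k x)) \<le> 2 * norm (f x)"
        using norm_triangle_ineq4[of "f x" "H k x"] by simp
    qed
  qed (use f in auto)
  then have "(\<lambda>k. \<integral>x. norm (f x - H k x) \<partial>lborel) \<longlonglongrightarrow> 0" by simp
  from LIMSEQ_D[OF this, of "e/2"] e obtain k where k: "(\<integral>x. norm (f x - H k x) \<partial>lborel) < e / 2"
    by fastforce
  have bd: "norm (cut k x *\<^sub>R radial_clamp (real k + 1) z) \<le> (real k + 1) * indicator {-(real k+1)..real k + 1} x" for x z
  proof (cases "\<bar>x\<bar> \<ge> real k + 1")
    case False
    have "norm (cut k x *\<^sub>R radial_clamp (real k + 1) z) \<le> 1 * (real k + 1)"
      unfolding norm_scaleR using cut(1,2)[of k x] radial_clamp_norm_le[of "real k + 1" z] by (intro mult_mono) auto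
    with False show ?thesis by (auto simp: indicator_def)
  qed (simp add: cut0)
  have int_ind: "integrable lborel (\<lambda>x. (real k + 1) * indicator {-(real k+1)..real k + 1} x :: real)"
    by (intro integrable_mult_right integrable_real_indicator) (auto simp: emeasure_lborel_Icc_eq)
  have Hi: "integrable lborel (H k)" and GGi: "integrable lborel (GG k n)" for n
    by (rule Bochner_Integration.integrable_bound[OF int_ind]; use bd H_def GG_def in force)+
  have "(\<lambda>n. \<integral>x. norm (H k x - GG k n x) \<partial>lborel) \<longlonglongrightarrow> (\<integral>x. 0 \<partial>(lborel::real measure))"
  proof (rule integral_dominated_convergence[where w = "\<lambda>x. 2 * ((real k + 1) * indicator {-(real k+1)..real k + 1} x)"])
    show "AE x in lborel. (\<lambda>n. norm (H k x - GG k n x)) \<longlonglongrightarrow> 0"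
      using ae
    proof eventually_elim
      case (elim x)
      have "isCont (radial_clamp (real k + 1)) (f x)"
        using radial_clamp_continuous[of "real k + 1"] continuous_on_eq_continuous_at by auto
      from isCont_tendsto_compose[OF this elim]
      have "(\<lambda>n. GG k n x) \<longlonglongrightarrow> H k x" unfolding GG_def H_def by (intro tendsto_intros)
      from tendsto_norm[OF tendsto_diff[OF tendsto_const this, of "H k x"]] show ?case by simp
    qed
    show "AE x in lborel. norm (norm (H k x - GG k n x)) \<le> 2 * ((real k + 1) * indicator {-(real k+1)..real k + 1} x)" for n
    proof (intro AE_I2)
      fix x show "norm (norm (H k x - GG k n x)) \<le> 2 * ((real k + 1) * indicator {-(real k+1)..real k + 1} x)"
        using norm_triangle_ineq4[of "H k x" "GG k n x"] bd[of x "f x"] bd[of x "G n x"]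
        unfolding H_def GG_def by simp
    qed
  qed (use integrable_mult_right[OF int_ind, of 2] in auto)
  then have "(\<lambda>n. \<integral>x. norm (H k x - GG k n x) \<partial>lborel) \<longlonglongrightarrow> 0" by simp
  from LIMSEQ_D[OF this, of "e/2"] e obtain n where n: "(\<integral>x. norm (H k x - GG k n x) \<partial>lborel) < e / 2"
    by fastforce
  have "(\<integral>x. norm (f x - GG k n x) \<partial>lborel) \<le> (\<integral>x. norm (f x - H k x) + norm (H k x - GG k n x) \<partial>lborel)"
  proof (rule integral_mono)
    show "norm (f x - GG k n x) \<le> norm (f x - H k x) + norm (H k x - GG k n x)" for x
      using norm_triangle_ineq[of "f x - H k x" "H k x - GG k n x"] by simp
  qed (use f Hi GGi in auto)
  also have "\<dots> < e" using k n f Hi GGi by simp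
  finally have "(\<integral>x. norm (f x - GG k n x) \<partial>lborel) < e" .
  moreover have "norm (GG k n x) \<le> real k + 1" for x
  proof -
    have "(real k + 1) * indicator {-(real k+1)..real k + 1} x \<le> real k + 1" by (simp add: indicator_def)
    then show ?thesis using bd[of x "G n x"] unfolding GG_def by linarith
  qed
  moreover have "GG k n x = 0" if "real k + 1 < \<bar>x\<bar>" for x
    using that by (simp add: GG_def cut0)
  ultimately show ?thesis using Gc by blast
qed

lemma L1_translation:
  fixes f :: "real \<Rightarrow> complex"
  assumes f: "integrable lborel f" and h: "h \<longlonglongrightarrow> 0"
  shows "(\<lambda>n. \<integral>x. norm (f (x - h n) - f x) \<partial>lborel) \<longlonglongrightarrow> 0"
proof (rule LIMSEQ_I)
  fix e :: real assume e: "0 < e"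
  note [measurable] = borel_measurable_integrable[OF f]
  obtain g K where g: "continuous_on UNIV g" "\<And>x. norm (g x) \<le> K" "\<And>x. K < \<bar>x\<bar> \<Longrightarrow> g x = 0"
    and fg: "(\<integral>x. norm (f x - g x) \<partial>lborel) < e / 4"
    using L1_dense_continuous_compact_support[OF f, of "e/4"] e by auto
  have [measurable]: "g \<in> borel_measurable borel" using g(1) by (rule borel_measurable_continuous_onI)
  have K: "0 \<le> K" using g(2)[of 0] norm_ge_zero order_trans by blast
  have bd: "norm (g x) \<le> K * indicator {-K..K} x" for x
    using g(2)[of x] g(3)[of x] by (auto simp: indicator_def abs_le_iff not_le)
  have "integrable lborel (\<lambda>x. K * indicator {-K..K} x :: real)"
    by (intro integrable_mult_right integrable_real_indicator) (auto simp: emeasure_lborel_Icc_eq)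
  then have gi: "integrable lborel g"
    by (rule Bochner_Integration.integrable_bound) (use bd K in auto)
  \<comment> \<open>Shifts below 1 keep all supports in \<open>{-(K+1)..K+1}\<close>, which yields a
    common dominating function; the sequence is started at \<open>N1\<close> for this
    reason.\<close>
  obtain N1 where N1: "\<And>n. n \<ge> N1 \<Longrightarrow> \<bar>h n\<bar> < 1" using LIMSEQ_D[OF h, of 1] by auto
  have "(\<lambda>n. \<integral>x. norm (g (x - h (n + N1)) - g x) \<partial>lborel) \<longlonglongrightarrow> (\<integral>x. 0 \<partial>(lborel::real measure))"
  proof (rule integral_dominated_convergence[where w = "\<lambda>x. 2 * K * indicator {-(K+1)..K+1} x"])
    show "AE x in lborel. (\<lambda>n. norm (g (x - h (n + N1)) - g x)) \<longlonglongrightarrow> 0"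
    proof (intro AE_I2)
      fix x
      have "(\<lambda>n. x - h (n + N1)) \<longlonglongrightarrow> x - 0"
        by (intro tendsto_intros LIMSEQ_ignore_initial_segment h)
      then have "(\<lambda>n. g (x - h (n + N1))) \<longlonglongrightarrow> g x"
        using g(1) by (intro isCont_tendsto_compose[where g = g]) (auto simp: continuous_on_eq_continuous_at)
      then show "(\<lambda>n. norm (g (x - h (n + N1)) - g x)) \<longlonglongrightarrow> 0"
        using tendsto_norm_zero LIM_zero by blast
    qed
    show "AE x in lborel. norm (norm (g (x - h (n + N1)) - g x)) \<le> 2 * K * indicator {-(K+1)..K+1} x" for n
    proof (intro AE_I2)
      fix x
      show "norm (norm (g (x - h (n + N1)) - g x)) \<le> 2 * K * indicator {-(K+1)..K+1} x"
      proof (cases "\<bar>x\<bar> \<le> K + 1")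
        case True
        then show ?thesis using norm_triangle_ineq4[of "g (x - h (n + N1))" "g x"] g(2)[of x] g(2)[of "x - h (n + N1)"]
          by (auto simp: indicator_def abs_le_iff)
      next
        case False
        then have "K < \<bar>x\<bar>" "K < \<bar>x - h (n + N1)\<bar>" using N1[of "n + N1"] by auto
        then show ?thesis using g(3) K by simp
      qed
    qed
  qed (use K in \<open>auto simp: emeasure_lborel_Icc_eq\<close>)
  then have "(\<lambda>n. \<integral>x. norm (g (x - h (n + N1)) - g x) \<partial>lborel) \<longlonglongrightarrow> 0" by simp
  from LIMSEQ_D[OF this, of "e/2"] e obtain N2 where
    N2: "\<And>n. n \<ge> N2 \<Longrightarrow> (\<integral>x. norm (g (x - h (n + N1)) - g x) \<partial>lborel) < e / 2" by auto
  have "norm ((\<integral>x. norm (f (x - h n) - f x) \<partial>lborel) - 0) < e" if n: "n \<ge> N1 + N2" for n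
  proof -
    have n1: "N2 \<le> n - N1" using n by linarith
    have s: "integrable lborel (\<lambda>x. f (x - h n))" "integrable lborel (\<lambda>x. g (x - h n))"
      using f gi by (simp_all add: integrable_shift)
    have "(\<integral>x. norm (f (x - h n) - f x) \<partial>lborel) \<le>
      (\<integral>x. norm (f (x - h n) - g (x - h n)) + norm (g (x - h n) - g x) + norm (f x - g x) \<partial>lborel)"
    proof (rule integral_mono)
      show "norm (f (x - h n) - f x) \<le> norm (f (x - h n) - g (x - h n)) + norm (g (x - h n) - g x) + norm (f x - g x)" for x
        using norm_triangle_ineq[of "f (x - h n) - g (x - h n)" "g (x - h n) - g x"]
          norm_triangle_ineq4[of "f (x - h n) - g x" "f x - g x"] by simp
    qed (use f gi s in auto)
    also have "\<dots> = (\<integral>x. norm (f (x - h n) - g (x - h n)) \<partial>lborel) + (\<integral>x. norm (g (x - h n) - g x) \<partial>lborel)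
       + (\<integral>x. norm (f x - g x) \<partial>lborel)"
      using f gi s by simp
    also have "(\<integral>x. norm (f (x - h n) - g (x - h n)) \<partial>lborel) = (\<integral>x. norm (f x - g x) \<partial>lborel)"
      by (rule integral_shift[of "\<lambda>x. norm (f x - g x)"])
    also have "(\<integral>x. norm (f x - g x) \<partial>lborel) + (\<integral>x. norm (g (x - h n) - g x) \<partial>lborel) + (\<integral>x. norm (f x - g x) \<partial>lborel) < e"
      using fg N2[OF n1] n by simp
    finally show ?thesis by simp
  qed
  then show "\<exists>no. \<forall>n\<ge>no. norm ((\<integral>x. norm (f (x - h n) - f x) \<partial>lborel) - 0) < e" by blast
qed

lemma L2_inner_integrable:
  fixes f g :: "real \<Rightarrow> complex"
  assumes "f \<in> L2" "g \<in> L2"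
  shows "integrable lborel (\<lambda>x. f x * cnj (g x))"
    and "norm (\<integral>x. f x * cnj (g x) \<partial>lborel) \<le> L2_norm f * L2_norm g"
proof -
  note [measurable] = L2_measurable[OF assms(1)] L2_measurable[OF assms(2)]
  have [measurable]: "cnj \<in> borel_measurable borel"
    by (intro borel_measurable_continuous_onI continuous_intros)
  show "integrable lborel (\<lambda>x. f x * cnj (g x))"
    by (rule Bochner_Integration.integrable_bound[OF L2_Cauchy_Schwarz(1)[OF assms]]) (auto simp: norm_mult)
  have "norm (\<integral>x. f x * cnj (g x) \<partial>lborel) \<le> (\<integral>x. norm (f x) * norm (g x) \<partial>lborel)"
    by (rule order_trans[OF integral_norm_bound]) (simp add: norm_mult)
  then show "norm (\<integral>x. f x * cnj (g x) \<partial>lborel) \<le> L2_norm f * L2_norm g"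
    using L2_Cauchy_Schwarz(2)[OF assms] by simp
qed

lemma integral_mult_cnj_self:
  assumes "f \<in> L2"
  shows "(\<integral>x. f x * cnj (f x) \<partial>lborel) = of_real ((L2_norm f)\<^sup>2)"
  unfolding L2_norm_sq by (subst integral_complex_of_real[symmetric]) (simp flip: complex_norm_square)

lemma L2_norm_diff_sq:
  fixes f g :: "real \<Rightarrow> complex"
  assumes "f \<in> L2" "g \<in> L2"
  shows "(L2_norm (\<lambda>x. f x - g x))\<^sup>2 = (L2_norm f)\<^sup>2 - 2 * Re (\<integral>x. f x * cnj (g x) \<partial>lborel) + (L2_norm g)\<^sup>2"
proof -
  have "(norm (f x - g x))\<^sup>2 = (norm (f x))\<^sup>2 - 2 * Re (f x * cnj (g x)) + (norm (g x))\<^sup>2" for x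
    unfolding cmod_power2 by (simp add: power2_eq_square algebra_simps)
  then have "(L2_norm (\<lambda>x. f x - g x))\<^sup>2 = (\<integral>x. (norm (f x))\<^sup>2 - 2 * Re (f x * cnj (g x)) + (norm (g x))\<^sup>2 \<partial>lborel)"
    by (simp add: L2_norm_sq)
  also have "\<dots> = (L2_norm f)\<^sup>2 - 2 * Re (\<integral>x. f x * cnj (g x) \<partial>lborel) + (L2_norm g)\<^sup>2"
  proof -
    define r where "r x = Re (f x * cnj (g x))" for x
    have r: "integrable lborel r" "(\<integral>x. r x \<partial>lborel) = Re (\<integral>x. f x * cnj (g x) \<partial>lborel)"
      unfolding r_def[abs_def] using L2_inner_integrable(1)[OF assms]
      by (simp_all only: Bochner_Integration.integrable_Re Bochner_Integration.integral_Re)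
    show ?thesis unfolding r_def[symmetric] r(2)[symmetric]
      using L2_integrable[OF assms(1)] L2_integrable[OF assms(2)] r(1) by (simp add: L2_norm_sq)
  qed
  finally show ?thesis .
qed

lemma L2_norm_add_sq:
  fixes f g :: "real \<Rightarrow> complex"
  assumes "f \<in> L2" "g \<in> L2"
  shows "(L2_norm (\<lambda>x. f x + g x))\<^sup>2 = (L2_norm f)\<^sup>2 + 2 * Re (\<integral>x. f x * cnj (g x) \<partial>lborel) + (L2_norm g)\<^sup>2"
  using L2_norm_diff_sq[OF assms(1) L2_minus[OF assms(2)]] by (simp add: L2_norm_minus)

section \<open>Truncation to bounded intervals\<close>

definition trunc :: "nat \<Rightarrow> (real \<Rightarrow> 'a::real_vector) \<Rightarrow> real \<Rightarrow> 'a" where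
  "trunc n f x = indicator {-real n..real n} x *\<^sub>R f x"

lemma trunc_measurable [measurable]:
  "f \<in> borel_measurable borel \<Longrightarrow> (trunc n f :: real \<Rightarrow> 'a::euclidean_space) \<in> borel_measurable borel"
  unfolding trunc_def[abs_def] by measurable

lemma norm_trunc_le: "norm (trunc n f x :: 'a::real_normed_vector) \<le> norm (f x)"
  by (simp add: trunc_def indicator_def)

lemma trunc_L2:
  assumes "f \<in> L2"
  shows "trunc n f \<in> L2" "L2_norm (trunc n f) \<le> L2_norm f"
  by (rule L2_dominated[OF assms trunc_measurable[OF L2_measurable[OF assms]]]; simp add: norm_trunc_le)+

lemma integrable_trunc_L2:
  assumes "f \<in> L2"
  shows "integrable lborel (trunc n f)"
proof -
  have i: "(indicator {-real n..real n} :: real \<Rightarrow> real) \<in> L2"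
  proof (rule L2_I)
    have "(\<lambda>x. (norm (indicator {-real n..real n} x :: real))\<^sup>2) = (indicator {-real n..real n} :: real \<Rightarrow> real)"
      by (auto simp: indicator_def)
    then show "integrable lborel (\<lambda>x. (norm (indicator {-real n..real n} x :: real))\<^sup>2)"
      by (auto simp: emeasure_lborel_Icc_eq)
  qed simp
  show ?thesis
    by (rule Bochner_Integration.integrable_bound[OF L2_Cauchy_Schwarz(1)[OF i assms]])
       (use L2_measurable[OF assms] in \<open>auto simp: trunc_def\<close>)
qed

lemma trunc_tendsto: "(\<lambda>n. trunc n f x :: 'a::real_normed_vector) \<longlonglongrightarrow> f x"
proof (rule tendsto_eventually)
  obtain N :: nat where "\<bar>x\<bar> \<le> real N" using real_arch_simple by blast
  then show "\<forall>\<^sub>F n in sequentially. trunc n f x = f x"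
    by (intro eventually_sequentiallyI[of N]) (auto simp: indicator_def trunc_def)
qed

lemma L2_norm_tendsto_0_dominated:
  fixes f :: "nat \<Rightarrow> real \<Rightarrow> 'a::euclidean_space"
  assumes w: "w \<in> L2" and [measurable]: "\<And>n. f n \<in> borel_measurable borel"
    and le: "\<And>n x. norm (f n x) \<le> norm (w x)" and lim: "AE x in lborel. (\<lambda>n. f n x) \<longlonglongrightarrow> 0"
  shows "(\<lambda>n. L2_norm (f n)) \<longlonglongrightarrow> 0"
proof -
  have "(\<lambda>n. \<integral>x. (norm (f n x))\<^sup>2 \<partial>lborel) \<longlonglongrightarrow> (\<integral>x. 0 \<partial>(lborel::real measure))"
  proof (rule integral_dominated_convergence[where w = "\<lambda>x. (norm (w x))\<^sup>2"])
    show "AE x in lborel. (\<lambda>n. (norm (f n x))\<^sup>2) \<longlonglongrightarrow> 0"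
      using lim
    proof eventually_elim
      case (elim x)
      from tendsto_power[OF tendsto_norm[OF this], of 2] show ?case by simp
    qed
  qed (use le in \<open>auto simp: L2_integrable[OF w] intro!: power_mono\<close>)
  from tendsto_real_sqrt[OF this] show ?thesis by (simp add: L2_norm_def)
qed

lemma L2_norm_trunc_diff:
  fixes f :: "real \<Rightarrow> 'a::euclidean_space"
  assumes f: "f \<in> L2"
  shows "(\<lambda>n. L2_norm (\<lambda>x. trunc n f x - f x)) \<longlonglongrightarrow> 0"
proof (rule L2_norm_tendsto_0_dominated[OF f])
  note [measurable] = L2_measurable[OF f]
  show "(\<lambda>x. trunc n f x - f x) \<in> borel_measurable borel" for n by measurable
  show "norm (trunc n f x - f x) \<le> norm (f x)" for n x by (simp add: trunc_def indicator_def)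
  show "AE x in lborel. (\<lambda>n. trunc n f x - f x) \<longlonglongrightarrow> 0"
    using LIM_zero[OF trunc_tendsto] by (intro AE_I2)
qed

lemma L2_norm_trunc_tendsto:
  fixes f :: "real \<Rightarrow> 'a::euclidean_space"
  assumes f: "f \<in> L2"
  shows "(\<lambda>n. L2_norm (trunc n f)) \<longlonglongrightarrow> L2_norm f"
proof (rule LIM_zero_cancel, rule Lim_null_comparison[OF always_eventually[OF allI] L2_norm_trunc_diff[OF f]])
  show "norm (L2_norm (trunc n f) - L2_norm f) \<le> L2_norm (\<lambda>x. trunc n f x - f x)" for n
    using L2_norm_reverse_triangle[OF trunc_L2(1)[OF f] f] by simp
qed

text \<open>The fixed factor \<open>f\<close> is split at height \<open>k\<close>: against its
  bounded part the continuity of translations in \<open>L^1\<close> suffices, and the remainder is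
  small in \<open>L2\<close> uniformly in the shift.\<close>

lemma autocorrelation_continuous:
  fixes f :: "real \<Rightarrow> complex"
  assumes f1: "integrable lborel f" and f2: "f \<in> L2" and h: "h \<longlonglongrightarrow> 0"
  shows "(\<lambda>n. \<integral>x. f (x - h n) * cnj (f x) \<partial>lborel) \<longlonglongrightarrow> (\<integral>x. f x * cnj (f x) \<partial>lborel)"
proof (rule LIMSEQ_I)
  fix e :: real assume e: "0 < e"
  note [measurable] = L2_measurable[OF f2]
  define fk where "fk k x = (if norm (f x) \<le> real k then f x else 0)" for k :: nat and x
  have [measurable]: "fk k \<in> borel_measurable borel" for k unfolding fk_def[abs_def] by measurable
  have "(\<lambda>k. L2_norm (\<lambda>x. f x - fk k x)) \<longlonglongrightarrow> 0"
  proof (rule L2_norm_tendsto_0_dominated[OF f2])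
    show "AE x in lborel. (\<lambda>k. f x - fk k x) \<longlonglongrightarrow> 0"
    proof (intro AE_I2 tendsto_eventually)
      fix x
      obtain K :: nat where "norm (f x) \<le> real K" using real_arch_simple by blast
      then show "\<forall>\<^sub>F k in sequentially. f x - fk k x = 0"
        by (intro eventually_sequentiallyI[of K]) (auto simp: fk_def)
    qed
  qed (auto simp: fk_def)
  \<comment> \<open>A translated difference has norm at most \<open>2 * L2_norm f\<close>, so with
    this accuracy the unbounded part contributes at most \<open>e / 2\<close>; the summand 1 keeps
    the denominator positive.\<close>
  from LIMSEQ_D[OF this, of "e / (4 * L2_norm f + 1)"] e obtain k where
    k: "L2_norm (\<lambda>x. f x - fk k x) < e / (4 * L2_norm f + 1)"
    by (auto simp: add_nonneg_pos)
  have fk: "fk k \<in> L2" "norm (fk k x) \<le> real k" for x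
    by (rule L2_dominated(1)[OF f2]) (auto simp: fk_def)
  from LIMSEQ_D[OF L1_translation[OF f1 h], of "e / (2 * (real k + 1))"] e obtain N where
    N: "\<And>n. n \<ge> N \<Longrightarrow> (\<integral>x. norm (f (x - h n) - f x) \<partial>lborel) < e / (2 * (real k + 1))"
    by (auto simp: add_nonneg_pos)
  have "norm ((\<integral>x. f (x - h n) * cnj (f x) \<partial>lborel) - (\<integral>x. f x * cnj (f x) \<partial>lborel)) < e" if n: "n \<ge> N" for n
  proof -
    note s = L2_shift[OF f2, of "h n"]
    have d: "(\<lambda>x. f (x - h n) - f x) \<in> L2" by (rule L2_diff[OF s(1) f2])
    have d1: "integrable lborel (\<lambda>x. f (x - h n) - f x)" using f1 by (simp add: integrable_shift)
    have ek: "(\<lambda>x. f x - fk k x) \<in> L2" by (rule L2_diff[OF f2 fk(1)])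
    have "(\<integral>x. f (x - h n) * cnj (f x) \<partial>lborel) - (\<integral>x. f x * cnj (f x) \<partial>lborel)
      = (\<integral>x. (f (x - h n) - f x) * cnj (f x) \<partial>lborel)"
      using L2_inner_integrable(1)[OF s(1) f2] L2_inner_integrable(1)[OF f2 f2] by (simp add: left_diff_distrib)
    also have "norm \<dots> \<le> (\<integral>x. real k * norm (f (x - h n) - f x) + norm (f (x - h n) - f x) * norm (f x - fk k x) \<partial>lborel)"
    proof (rule order_trans[OF integral_norm_bound integral_mono])
      show "integrable lborel (\<lambda>x. norm ((f (x - h n) - f x) * cnj (f x)))"
        by (intro integrable_norm L2_inner_integrable d f2)
      show "integrable lborel (\<lambda>x. real k * norm (f (x - h n) - f x) + norm (f (x - h n) - f x) * norm (f x - fk k x))"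
        by (intro Bochner_Integration.integrable_add integrable_mult_right integrable_norm d1 L2_Cauchy_Schwarz(1) d ek)
      fix x
      have "norm (f x) \<le> real k + norm (f x - fk k x)"
        using norm_triangle_ineq[of "fk k x" "f x - fk k x"] fk(2)[of x] by simp
      from mult_left_mono[OF this norm_ge_zero[of "f (x - h n) - f x"]]
      show "norm ((f (x - h n) - f x) * cnj (f x)) \<le> real k * norm (f (x - h n) - f x) + norm (f (x - h n) - f x) * norm (f x - fk k x)"
        by (simp add: norm_mult distrib_left mult.commute)
    qed
    also have "\<dots> = real k * (\<integral>x. norm (f (x - h n) - f x) \<partial>lborel) + (\<integral>x. norm (f (x - h n) - f x) * norm (f x - fk k x) \<partial>lborel)"
      using d1 L2_Cauchy_Schwarz(1)[OF d ek] by simp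
    also have "real k * (\<integral>x. norm (f (x - h n) - f x) \<partial>lborel) \<le> real k * (e / (2 * (real k + 1)))"
      by (intro mult_left_mono less_imp_le[OF N] n) simp
    also have "(\<integral>x. norm (f (x - h n) - f x) * norm (f x - fk k x) \<partial>lborel)
        \<le> L2_norm (\<lambda>x. f (x - h n) - f x) * L2_norm (\<lambda>x. f x - fk k x)"
      by (rule L2_Cauchy_Schwarz(2)[OF d ek])
    also have "\<dots> \<le> (2 * L2_norm f) * (e / (4 * L2_norm f + 1))"
      using L2_norm_diff_le[OF s(1) f2] s(2) k by (intro mult_mono) auto
    also have "real k * (e / (2 * (real k + 1))) < e / 2"
      using e by (simp add: field_simps)
    also have "(2 * L2_norm f) * (e / (4 * L2_norm f + 1)) \<le> e / 2"
    proof -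
      have "0 < 4 * L2_norm f + 1" by (simp add: add_nonneg_pos)
      then show ?thesis using e by (simp add: field_simps)
    qed
    finally show ?thesis by simp
  qed
  then show "\<exists>no. \<forall>n\<ge>no. norm ((\<integral>x. f (x - h n) * cnj (f x) \<partial>lborel) - (\<integral>x. f x * cnj (f x) \<partial>lborel)) < e"
    by blast
qed

lemma norm_ft_le: "norm (ft f \<xi>) \<le> (\<integral>x. norm (f x) \<partial>lborel)"
  unfolding ft_def by (rule order_trans[OF integral_norm_bound]) (simp add: norm_mult)

lemma ft_cnj_reflect: "ft (\<lambda>\<eta>. cnj (f (- \<eta>))) \<xi> = cnj (ft f \<xi>)"
proof -
  have "cnj (ft f \<xi>) = (\<integral>x. cnj (cis (- (x * \<xi>)) * f x) \<partial>lborel)"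
    unfolding ft_def by (rule Bochner_Integration.integral_cnj[symmetric])
  also have "\<dots> = (\<integral>x. cnj (cis (- (- x * \<xi>)) * f (- x)) \<partial>lborel)"
    by (rule integral_reflect[symmetric])
  finally show ?thesis by (simp add: ft_def cis_cnj)
qed

text \<open>Abel summation: the Fourier transform of the autocorrelation of \<^term>\<open>f\<close> is
  \<^term>\<open>\<lambda>\<xi>. (norm (ft f \<xi>))\<^sup>2\<close>, and the transform of the weight
  \<^term>\<open>\<lambda>\<xi>. exp (- (e * \<bar>\<xi>\<bar>))\<close> is the Poisson kernel, an approximate identity.\<close>
theorem Plancherel:
  fixes f :: "real \<Rightarrow> complex"
  assumes f1: "integrable lborel f" and f2: "f \<in> L2"
  shows "ft f \<in> L2" and "L2_norm (ft f) = sqrt (2 * pi) * L2_norm f"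
proof -
  note [measurable] = L2_measurable[OF f2]
  have [measurable]: "cnj \<in> borel_measurable borel"
    by (intro borel_measurable_continuous_onI continuous_intros)
  define g where "g = (\<lambda>\<eta>. cnj (f (- \<eta>)))"
  have g1: "integrable lborel g"
    unfolding g_def using f1 integrable_reflect[of f] by simp
  have g2: "g \<in> L2" "L2_norm g = L2_norm f"
    using L2_reflect_shift[OF f2, of 0] by (auto simp: g_def L2_def L2_norm_def)
  define A where "A = conv f g"
  have A1: "integrable lborel A" unfolding A_def by (rule conv_integrable[OF f1 g1])
  note [measurable] = borel_measurable_integrable[OF A1]
  have Ab: "norm (A h) \<le> (L2_norm f)\<^sup>2" for h
    unfolding A_def using conv_L2_integrable(2)[OF f2 g2(1), of h] g2(2) by (simp add: power2_eq_square)
  have Aeq: "A h = (\<integral>x. f (x + h) * cnj (f x) \<partial>lborel)" for h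
    unfolding A_def conv_def g_def using integral_reflect[of "\<lambda>x. f (x + h) * cnj (f x)"] by simp
  have A0: "A 0 = of_real ((L2_norm f)\<^sup>2)"
    using Aeq[of 0] integral_mult_cnj_self[OF f2] by simp
  have Ac: "(\<lambda>n. A (h n)) \<longlonglongrightarrow> A 0" if h: "h \<longlonglongrightarrow> 0" for h
    using autocorrelation_continuous[OF f1 f2, of "\<lambda>n. - h n"] tendsto_minus[OF h] by (simp add: Aeq)
  have ftA: "ft A \<xi> = of_real ((norm (ft f \<xi>))\<^sup>2)" for \<xi>
    unfolding A_def ft_conv[OF f1 g1] by (simp add: g_def ft_cnj_reflect flip: complex_norm_square)
  define R where "R e = (\<integral>\<xi>. exp (- (e * \<bar>\<xi>\<bar>)) * (norm (ft f \<xi>))\<^sup>2 \<partial>lborel)" for e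
  have Rint: "integrable lborel (\<lambda>\<xi>. exp (- (e * \<bar>\<xi>\<bar>)) * (norm (ft f \<xi>))\<^sup>2)" if e: "0 < e" for e
  proof (rule Bochner_Integration.integrable_bound)
    show "integrable lborel (\<lambda>\<xi>. exp (- (e * \<bar>\<xi>\<bar>)) * (\<integral>x. norm (f x) \<partial>lborel)\<^sup>2)"
      by (rule integrable_mult_left[OF exp_abs_integrable[OF e]])
  qed (auto intro!: mult_left_mono power_mono norm_ft_le)
  \<comment> \<open>Rescaling by \<open>e\<close> freezes the Poisson kernel and moves the parameter
    into \<open>A\<close>, where continuity at 0 and the bound \<open>Ab\<close> permit dominated
    convergence.\<close>
  have Req: "of_real (R e) = (\<integral>k. of_real (2 / (1 + k\<^sup>2)) * A (e * k) \<partial>lborel)" if e: "0 < e" for e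
  proof -
    have ei: "integrable lborel (\<lambda>x. complex_of_real (exp (- (e * \<bar>x\<bar>))))"
      using exp_abs_integrable[OF e] by simp
    have "of_real (R e) = (\<integral>\<xi>. complex_of_real (exp (- (e * \<bar>\<xi>\<bar>)) * (norm (ft f \<xi>))\<^sup>2) \<partial>lborel)"
      unfolding R_def by (rule integral_complex_of_real[symmetric])
    also have "\<dots> = (\<integral>\<xi>. ft A \<xi> * of_real (exp (- (e * \<bar>\<xi>\<bar>))) \<partial>lborel)"
      by (simp add: ftA mult.commute)
    also have "\<dots> = (\<integral>h. A h * ft (\<lambda>x. of_real (exp (- (e * \<bar>x\<bar>)))) h \<partial>lborel)"
      by (rule ft_duality[OF A1 ei])
    also have "\<dots> = (\<integral>h. A h * of_real (2 * e / (e\<^sup>2 + h\<^sup>2)) \<partial>lborel)"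
      by (simp only: ft_exp_abs[OF e])
    also have "\<dots> = e *\<^sub>R (\<integral>k. A (e * k) * of_real (2 * e / (e\<^sup>2 + (e * k)\<^sup>2)) \<partial>lborel)"
      using lborel_integral_real_affine[of e "\<lambda>h. A h * of_real (2 * e / (e\<^sup>2 + h\<^sup>2))" 0] e by simp
    also have "\<dots> = (\<integral>k. e *\<^sub>R (A (e * k) * of_real (2 * e / (e\<^sup>2 + (e * k)\<^sup>2))) \<partial>lborel)"
      by simp
    also have "\<dots> = (\<integral>k. of_real (2 / (1 + k\<^sup>2)) * A (e * k) \<partial>lborel)"
    proof (rule Bochner_Integration.integral_cong[OF refl])
      fix k
      have "e * (2 * e / (e\<^sup>2 + (e * k)\<^sup>2)) = 2 / (1 + k\<^sup>2)"
      proof -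
        have "e\<^sup>2 + (e * k)\<^sup>2 = e\<^sup>2 * (1 + k\<^sup>2)" by (simp add: power_mult_distrib algebra_simps)
        moreover have "e * (2 * e / (e\<^sup>2 * c)) = 2 / c" for c
          using e by (simp add: power2_eq_square)
        ultimately show ?thesis by metis
      qed
      then show "e *\<^sub>R (A (e * k) * of_real (2 * e / (e\<^sup>2 + (e * k)\<^sup>2))) = of_real (2 / (1 + k\<^sup>2)) * A (e * k)"
        by (simp only: scaleR_conv_of_real) (metis mult.commute mult.left_commute of_real_mult)
    qed
    finally show ?thesis .
  qed
  define \<epsilon> where "\<epsilon> n = inverse (real (Suc n))" for n
  have \<epsilon>: "0 < \<epsilon> n" "\<epsilon> \<longlonglongrightarrow> 0" for n
    unfolding \<epsilon>_def using LIMSEQ_inverse_real_of_nat by auto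
  have "(\<lambda>n. \<integral>k. of_real (2 / (1 + k\<^sup>2)) * A (\<epsilon> n * k) \<partial>lborel) \<longlonglongrightarrow> (\<integral>k. of_real (2 / (1 + k\<^sup>2)) * A 0 \<partial>lborel)"
  proof (rule integral_dominated_convergence[where w = "\<lambda>k. 2 * (L2_norm f)\<^sup>2 * (1 / (1 + k\<^sup>2))"])
    show "integrable lborel (\<lambda>k. 2 * (L2_norm f)\<^sup>2 * (1 / (1 + k\<^sup>2)))"
      by (intro integrable_mult_right has_integral_arctan)
    show "AE x in lborel. (\<lambda>n. of_real (2 / (1 + x\<^sup>2)) * A (\<epsilon> n * x)) \<longlonglongrightarrow> of_real (2 / (1 + x\<^sup>2)) * A 0"
      using tendsto_mult_right[OF \<epsilon>(2)] by (intro AE_I2 tendsto_intros Ac) auto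
    show "AE x in lborel. norm (of_real (2 / (1 + x\<^sup>2)) * A (\<epsilon> n * x)) \<le> 2 * (L2_norm f)\<^sup>2 * (1 / (1 + x\<^sup>2))" for n
    proof (intro AE_I2)
      fix x
      have "norm (of_real (2 / (1 + x\<^sup>2)) * A (\<epsilon> n * x)) = 2 / (1 + x\<^sup>2) * norm (A (\<epsilon> n * x))"
        unfolding norm_mult norm_of_real by (simp add: add_nonneg_nonneg)
      also have "\<dots> \<le> 2 / (1 + x\<^sup>2) * (L2_norm f)\<^sup>2"
        by (intro mult_left_mono Ab) (simp add: add_nonneg_nonneg)
      finally show "norm (of_real (2 / (1 + x\<^sup>2)) * A (\<epsilon> n * x)) \<le> 2 * (L2_norm f)\<^sup>2 * (1 / (1 + x\<^sup>2))"
        by simp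
    qed
  qed measurable
  moreover have "(\<integral>k. of_real (2 / (1 + k\<^sup>2)) * A 0 \<partial>lborel) = of_real (2 * pi * (L2_norm f)\<^sup>2)"
  proof -
    have "(\<integral>k. of_real (2 / (1 + k\<^sup>2)) * A 0 \<partial>lborel) = (\<integral>k. of_real (2 * (L2_norm f)\<^sup>2 * (1 / (1 + k\<^sup>2))) \<partial>lborel)"
      by (simp add: A0)
    also have "\<dots> = of_real (\<integral>k. 2 * (L2_norm f)\<^sup>2 * (1 / (1 + k\<^sup>2)) \<partial>lborel)"
      by (rule integral_complex_of_real)
    also have "(\<integral>k. 2 * (L2_norm f)\<^sup>2 * (1 / (1 + k\<^sup>2)) \<partial>lborel) = 2 * (L2_norm f)\<^sup>2 * pi"
      by (subst integral_mult_right_zero) (simp only: has_integral_arctan(2))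
    finally show ?thesis by simp
  qed
  ultimately have "(\<lambda>n. complex_of_real (R (\<epsilon> n))) \<longlonglongrightarrow> of_real (2 * pi * (L2_norm f)\<^sup>2)"
    using \<epsilon>(1) by (simp only: Req)
  then have Rlim: "(\<lambda>n. R (\<epsilon> n)) \<longlonglongrightarrow> 2 * pi * (L2_norm f)\<^sup>2"
    unfolding tendsto_of_real_iff .
  have pt: "(\<lambda>n. exp (- (\<epsilon> n * \<bar>\<xi>\<bar>)) * (norm (ft f \<xi>))\<^sup>2) \<longlonglongrightarrow> (norm (ft f \<xi>))\<^sup>2" for \<xi>
  proof -
    have "(\<lambda>n. exp (- (\<epsilon> n * \<bar>\<xi>\<bar>)) * (norm (ft f \<xi>))\<^sup>2) \<longlonglongrightarrow> exp (- (0 * \<bar>\<xi>\<bar>)) * (norm (ft f \<xi>))\<^sup>2"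
      by (intro tendsto_intros \<epsilon>)
    then show ?thesis by simp
  qed
  have C: "2 * pi * (L2_norm f)\<^sup>2 = (sqrt (2 * pi) * L2_norm f)\<^sup>2"
    by (simp add: power_mult_distrib)
  have "(\<integral>\<^sup>+\<xi>. ennreal ((norm (ft f \<xi>))\<^sup>2) \<partial>lborel)
      = (\<integral>\<^sup>+\<xi>. liminf (\<lambda>n. ennreal (exp (- (\<epsilon> n * \<bar>\<xi>\<bar>)) * (norm (ft f \<xi>))\<^sup>2)) \<partial>lborel)"
    by (intro nn_integral_cong lim_imp_Liminf[symmetric] tendsto_ennrealI pt) simp
  also have "\<dots> \<le> liminf (\<lambda>n. \<integral>\<^sup>+\<xi>. ennreal (exp (- (\<epsilon> n * \<bar>\<xi>\<bar>)) * (norm (ft f \<xi>))\<^sup>2) \<partial>lborel)"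
    by (rule nn_integral_liminf) measurable
  also have "\<dots> = liminf (\<lambda>n. ennreal (R (\<epsilon> n)))"
    unfolding R_def by (subst nn_integral_eq_integral[OF Rint[OF \<epsilon>(1)]]) auto
  also have "\<dots> = ennreal ((sqrt (2 * pi) * L2_norm f)\<^sup>2)"
    unfolding C[symmetric] by (intro lim_imp_Liminf tendsto_ennrealI Rlim) simp
  finally have le: "(\<integral>\<^sup>+\<xi>. ennreal ((norm (ft f \<xi>))\<^sup>2) \<partial>lborel) \<le> ennreal ((sqrt (2 * pi) * L2_norm f)\<^sup>2)" .
  show L2: "ft f \<in> L2"
    using L2_nn_integral_le(1)[OF _ _ le] by simp
  \<comment> \<open>Fatou's lemma has just put \<open>ft f\<close> into \<open>L2\<close>; its
    square is now a dominating function, and a second passage to the limit identifies the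
    norm.\<close>
  have "(\<lambda>n. R (\<epsilon> n)) \<longlonglongrightarrow> (\<integral>\<xi>. (norm (ft f \<xi>))\<^sup>2 \<partial>lborel)"
    unfolding R_def
  proof (rule integral_dominated_convergence[where w = "\<lambda>\<xi>. (norm (ft f \<xi>))\<^sup>2"])
    show "AE x in lborel. norm (exp (- (\<epsilon> n * \<bar>x\<bar>)) * (norm (ft f x))\<^sup>2) \<le> (norm (ft f x))\<^sup>2" for n
      using \<epsilon>(1)[of n] by (intro AE_I2) (auto intro!: mult_left_le_one_le)
  qed (auto simp: pt L2_integrable[OF L2])
  with Rlim have "(L2_norm (ft f))\<^sup>2 = (sqrt (2 * pi) * L2_norm f)\<^sup>2"
    unfolding C L2_norm_sq[of "ft f"] by (rule LIMSEQ_unique[rotated])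
  then show "L2_norm (ft f) = sqrt (2 * pi) * L2_norm f"
    by (subst (asm) power2_eq_iff_nonneg) auto
qed

section \<open>The Fourier transform on square-integrable functions\<close>

lemma ift_L2:
  assumes "integrable lborel a" "a \<in> L2"
  shows "ift a \<in> L2" "(L2_norm (ift a))\<^sup>2 = (L2_norm a)\<^sup>2 / (2 * pi)"
proof -
  have eq: "ift a = (\<lambda>x. (1 / (2 * pi)) * ft a (0 - x))" by (auto simp: ift_eq_ft)
  note r = L2_reflect_shift[OF Plancherel(1)[OF assms], of 0]
  show "ift a \<in> L2" unfolding eq by (rule L2_cmult[OF r(1)])
  have "(L2_norm (ift a))\<^sup>2 = (1 / (2 * pi))\<^sup>2 * (2 * pi) * (L2_norm a)\<^sup>2"
    unfolding eq L2_norm_cmult r(2) Plancherel(2)[OF assms]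
    by (simp add: power_mult_distrib norm_divide norm_mult power_divide)
  then show "(L2_norm (ift a))\<^sup>2 = (L2_norm a)\<^sup>2 / (2 * pi)"
    by (simp add: power2_eq_square)
qed

text \<open>Polarization of the norm identity by differences yields real parts, and energies are
  real parts of pairings.\<close>

lemma Parseval_Re:
  assumes "integrable lborel a" "a \<in> L2" "integrable lborel b" "b \<in> L2"
  shows "Re (\<integral>\<xi>. a \<xi> * cnj (b \<xi>) \<partial>lborel) = 2 * pi * Re (\<integral>x. ift a x * cnj (ift b x) \<partial>lborel)"
proof -
  have "ift (\<lambda>\<xi>. a \<xi> - b \<xi>) = (\<lambda>x. ift a x - ift b x)"
    using ift_diff[OF assms(1,3)] by auto
  then have "(L2_norm (\<lambda>x. ift a x - ift b x))\<^sup>2 = (L2_norm (\<lambda>\<xi>. a \<xi> - b \<xi>))\<^sup>2 / (2 * pi)"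
    using ift_L2(2)[OF Bochner_Integration.integrable_diff[OF assms(1,3)] L2_diff[OF assms(2,4)]] by simp
  then show ?thesis
    unfolding L2_norm_diff_sq[OF assms(2,4)] L2_norm_diff_sq[OF ift_L2(1)[OF assms(1,2)] ift_L2(1)[OF assms(3,4)]]
      ift_L2(2)[OF assms(1,2)] ift_L2(2)[OF assms(3,4)]
    by (simp add: field_simps)
qed

lemma ft_diff: "integrable lborel a \<Longrightarrow> integrable lborel b \<Longrightarrow> ft (\<lambda>\<xi>. a \<xi> - b \<xi>) x = ft a x - ft b x"
  by (simp add: ft_def right_diff_distrib integrable_cis_mult)

lemma ft_add: "integrable lborel a \<Longrightarrow> integrable lborel b \<Longrightarrow> ft (\<lambda>\<xi>. a \<xi> + b \<xi>) x = ft a x + ft b x"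
  by (simp add: ft_def distrib_left integrable_cis_mult)

lemma ft_cmult: "ft (\<lambda>\<xi>. c * a \<xi>) x = c * ft a x"
  using ift_cmult[of c a "-x"] by (simp add: ft_eq_ift)

lemma ft_cong_AE:
  assumes "AE \<xi> in lborel. a \<xi> = b \<xi>" "a \<in> borel_measurable borel" "b \<in> borel_measurable borel"
  shows "ft a x = ft b x"
  using ift_cong_AE[OF assms, of "-x"] by (simp add: ft_eq_ift)

lemma ft_trunc_L2:
  assumes "f \<in> L2"
  shows "ft (trunc n f) \<in> L2" "L2_norm (ft (trunc n f)) = sqrt (2 * pi) * L2_norm (trunc n f)"
  using Plancherel[OF integrable_trunc_L2[OF assms] trunc_L2(1)[OF assms]] by auto

text \<open>The counterpart of \<open>has_fourier_transform\<close> for complex-valued functions,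
  with a real norm in place of an extended integral.\<close>

definition has_ft :: "(real \<Rightarrow> complex) \<Rightarrow> (real \<Rightarrow> complex) \<Rightarrow> bool" where
  "has_ft f g \<longleftrightarrow> g \<in> L2 \<and> (\<lambda>n. L2_norm (\<lambda>\<xi>. ft (trunc n f) \<xi> - g \<xi>)) \<longlonglongrightarrow> 0"

lemma has_fourier_transform_iff:
  assumes f: "(f :: real \<Rightarrow> real) \<in> L2"
  shows "has_fourier_transform f g \<longleftrightarrow> has_ft (\<lambda>x. of_real (f x)) g"
proof (cases "g \<in> L2")
  case g: True
  have f': "(\<lambda>x. complex_of_real (f x)) \<in> L2"
    using f by (auto simp: L2_def)
  have eq: "(LINT x:{- real n..real n}|lborel. cis (- (x * \<xi>)) * complex_of_real (f x))
      = ft (trunc n (\<lambda>x. of_real (f x))) \<xi>" for n \<xi>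
    unfolding ft_def set_lebesgue_integral_def trunc_def
    by (intro Bochner_Integration.integral_cong) (auto simp: indicator_def)
  have d: "(\<lambda>\<xi>. ft (trunc n (\<lambda>x. of_real (f x))) \<xi> - g \<xi>) \<in> L2" for n
    by (rule L2_diff[OF ft_trunc_L2(1)[OF f'] g])
  have "((\<lambda>n. ennreal ((L2_norm (\<lambda>\<xi>. ft (trunc n (\<lambda>x. of_real (f x))) \<xi> - g \<xi>))\<^sup>2)) \<longlonglongrightarrow> ennreal 0)
    \<longleftrightarrow> (\<lambda>n. (L2_norm (\<lambda>\<xi>. ft (trunc n (\<lambda>x. of_real (f x))) \<xi> - g \<xi>))\<^sup>2) \<longlonglongrightarrow> 0"
    by (rule tendsto_ennreal_iff) auto
  also have "\<dots> \<longleftrightarrow> (\<lambda>n. L2_norm (\<lambda>\<xi>. ft (trunc n (\<lambda>x. of_real (f x))) \<xi> - g \<xi>)) \<longlonglongrightarrow> 0"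
  proof
    assume "(\<lambda>n. (L2_norm (\<lambda>\<xi>. ft (trunc n (\<lambda>x. of_real (f x))) \<xi> - g \<xi>))\<^sup>2) \<longlonglongrightarrow> 0"
    from tendsto_real_sqrt[OF this]
    show "(\<lambda>n. L2_norm (\<lambda>\<xi>. ft (trunc n (\<lambda>x. of_real (f x))) \<xi> - g \<xi>)) \<longlonglongrightarrow> 0" by simp
  next
    assume "(\<lambda>n. L2_norm (\<lambda>\<xi>. ft (trunc n (\<lambda>x. of_real (f x))) \<xi> - g \<xi>)) \<longlonglongrightarrow> 0"
    from tendsto_power[OF this, of 2]
    show "(\<lambda>n. (L2_norm (\<lambda>\<xi>. ft (trunc n (\<lambda>x. of_real (f x))) \<xi> - g \<xi>))\<^sup>2) \<longlonglongrightarrow> 0" by simp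
  qed
  finally show ?thesis
    unfolding has_fourier_transform_def has_ft_def eq nn_integral_sq_L2[OF d] using g by simp
qed (auto simp: has_fourier_transform_def has_ft_def)

lemma has_ft_unique:
  assumes f: "f \<in> L2" and g: "has_ft f g" and h: "has_ft f h"
  shows "AE \<xi> in lborel. g \<xi> = h \<xi>"
proof -
  have L: "g \<in> L2" "h \<in> L2" using g h by (auto simp: has_ft_def)
  have "(\<lambda>n. L2_norm (\<lambda>\<xi>. ft (trunc n f) \<xi> - g \<xi>) + L2_norm (\<lambda>\<xi>. ft (trunc n f) \<xi> - h \<xi>)) \<longlonglongrightarrow> 0 + 0"
    using g h unfolding has_ft_def by (intro tendsto_add) auto
  moreover have "L2_norm (\<lambda>\<xi>. g \<xi> - h \<xi>) \<le> L2_norm (\<lambda>\<xi>. ft (trunc n f) \<xi> - g \<xi>) + L2_norm (\<lambda>\<xi>. ft (trunc n f) \<xi> - h \<xi>)" for n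
    using L2_norm_triangle3[OF L(1) ft_trunc_L2(1)[OF f, of n] L(2)] L2_norm_minus_commute[of g "ft (trunc n f)"] by simp
  ultimately have "L2_norm (\<lambda>\<xi>. g \<xi> - h \<xi>) \<le> 0 + 0"
    by (intro LIMSEQ_le_const[where x = "0 + 0"]) auto
  then have "L2_norm (\<lambda>\<xi>. g \<xi> - h \<xi>) = 0" using L2_norm_nonneg[of "\<lambda>\<xi>. g \<xi> - h \<xi>"] by linarith
  then show ?thesis using L2_norm_eq_0_iff[OF L2_diff[OF L]] by auto
qed

lemma has_ft_exists:
  assumes f: "f \<in> L2"
  shows "\<exists>g. has_ft f g"
proof -
  have "\<exists>g\<in>L2. (\<lambda>n. L2_norm (\<lambda>x. ft (trunc n f) x - g x)) \<longlonglongrightarrow> 0"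
  proof (rule L2_complete[OF ft_trunc_L2(1)[OF f]])
    fix e :: real assume e: "0 < e"
    from LIMSEQ_D[OF L2_norm_trunc_diff[OF f], of "e / (2 * sqrt (2 * pi))"] e obtain N where
      N: "\<And>n. n \<ge> N \<Longrightarrow> L2_norm (\<lambda>x. trunc n f x - f x) < e / (2 * sqrt (2 * pi))" by auto
    have "L2_norm (\<lambda>x. ft (trunc m f) x - ft (trunc n f) x) < e" if "m \<ge> N" "n \<ge> N" for m n
    proof -
      note i = integrable_trunc_L2[OF f, of m] integrable_trunc_L2[OF f, of n]
      note l = trunc_L2(1)[OF f, of m] trunc_L2(1)[OF f, of n]
      have "ft (\<lambda>x. trunc m f x - trunc n f x) = (\<lambda>x. ft (trunc m f) x - ft (trunc n f) x)"
        using ft_diff[OF i] by auto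
      then have "L2_norm (\<lambda>x. ft (trunc m f) x - ft (trunc n f) x) = sqrt (2 * pi) * L2_norm (\<lambda>x. trunc m f x - trunc n f x)"
        using Plancherel(2)[OF Bochner_Integration.integrable_diff[OF i] L2_diff[OF l]] by simp
      also have "\<dots> \<le> sqrt (2 * pi) * (L2_norm (\<lambda>x. trunc m f x - f x) + L2_norm (\<lambda>x. trunc n f x - f x))"
        using L2_norm_triangle3[OF l(1) f l(2)] L2_norm_minus_commute[of f "trunc n f"]
        by (intro mult_left_mono) auto
      also have "\<dots> < sqrt (2 * pi) * (e / (2 * sqrt (2 * pi)) + e / (2 * sqrt (2 * pi)))"
        using N that by (intro mult_strict_left_mono add_strict_mono) auto
      also have "\<dots> = e" by (simp add: field_simps)
      finally show ?thesis .
    qed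
    then show "\<exists>N. \<forall>m\<ge>N. \<forall>n\<ge>N. L2_norm (\<lambda>x. ft (trunc m f) x - ft (trunc n f) x) < e" by blast
  qed
  then show ?thesis unfolding has_ft_def by blast
qed

lemma has_ft_cong_AE:
  assumes g: "has_ft f g" and ae: "AE x in lborel. f x = f' x"
    and m: "f \<in> borel_measurable borel" "f' \<in> borel_measurable borel"
  shows "has_ft f' g"
proof -
  have "ft (trunc n f) = ft (trunc n f')" for n
    by (intro ext ft_cong_AE trunc_measurable m) (use ae in \<open>auto simp: trunc_def\<close>)
  then show ?thesis using g by (simp add: has_ft_def)
qed

lemma has_ft_linear:
  assumes f: "f \<in> L2" and f': "f' \<in> L2" and g: "has_ft f g" and g': "has_ft f' g'"
  shows "has_ft (\<lambda>x. c * f x + d * f' x) (\<lambda>x. c * g x + d * g' x)"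
  unfolding has_ft_def
proof
  have L: "g \<in> L2" "g' \<in> L2" using g g' by (auto simp: has_ft_def)
  show "(\<lambda>x. c * g x + d * g' x) \<in> L2" by (intro L2_add L2_cmult L)
  have eq: "ft (trunc n (\<lambda>x. c * f x + d * f' x)) \<xi> - (c * g \<xi> + d * g' \<xi>)
      = c * (ft (trunc n f) \<xi> - g \<xi>) + d * (ft (trunc n f') \<xi> - g' \<xi>)" for n \<xi>
  proof -
    have t: "trunc n (\<lambda>x. c * f x + d * f' x) = (\<lambda>x. c * trunc n f x + d * trunc n f' x)"
      by (auto simp: trunc_def indicator_def)
    have "ft (trunc n (\<lambda>x. c * f x + d * f' x)) \<xi> = c * ft (trunc n f) \<xi> + d * ft (trunc n f') \<xi>"
      unfolding t by (subst ft_add) (auto simp: ft_cmult integrable_trunc_L2[OF f] integrable_trunc_L2[OF f'])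
    then show ?thesis by (simp add: algebra_simps)
  qed
  have le: "norm (L2_norm (\<lambda>\<xi>. ft (trunc n (\<lambda>x. c * f x + d * f' x)) \<xi> - (c * g \<xi> + d * g' \<xi>)))
     \<le> norm c * L2_norm (\<lambda>\<xi>. ft (trunc n f) \<xi> - g \<xi>) + norm d * L2_norm (\<lambda>\<xi>. ft (trunc n f') \<xi> - g' \<xi>)" for n
    unfolding eq using L2_norm_triangle[OF L2_cmult L2_cmult, OF L2_diff[OF ft_trunc_L2(1)[OF f] L(1)] L2_diff[OF ft_trunc_L2(1)[OF f'] L(2)]]
    by (simp add: L2_norm_cmult)
  have "(\<lambda>n. norm c * L2_norm (\<lambda>\<xi>. ft (trunc n f) \<xi> - g \<xi>) + norm d * L2_norm (\<lambda>\<xi>. ft (trunc n f') \<xi> - g' \<xi>)) \<longlonglongrightarrow> norm c * 0 + norm d * 0"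
    using g g' unfolding has_ft_def by (intro tendsto_intros) auto
  then show "(\<lambda>n. L2_norm (\<lambda>\<xi>. ft (trunc n (\<lambda>x. c * f x + d * f' x)) \<xi> - (c * g \<xi> + d * g' \<xi>))) \<longlonglongrightarrow> 0"
    by (intro Lim_null_comparison[OF always_eventually[OF allI[OF le]]]) simp
qed

text \<open>The difference of the two functions has transform 0, and Plancherel's theorem for its
  truncations reads off its norm.\<close>

lemma has_ft_inj:
  assumes f: "f \<in> L2" and f': "f' \<in> L2" and g: "has_ft f g" and g': "has_ft f' g"
  shows "AE x in lborel. f x = f' x"
proof -
  have h: "has_ft (\<lambda>x. f x - f' x) (\<lambda>x. 0)"
    using has_ft_linear[OF assms, of 1 "-1"] by simp
  have d: "(\<lambda>x. f x - f' x) \<in> L2" by (rule L2_diff[OF f f'])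
  have "(\<lambda>n. L2_norm (ft (trunc n (\<lambda>x. f x - f' x)))) \<longlonglongrightarrow> 0"
    using h by (simp add: has_ft_def)
  moreover have "(\<lambda>n. L2_norm (ft (trunc n (\<lambda>x. f x - f' x)))) \<longlonglongrightarrow> sqrt (2 * pi) * L2_norm (\<lambda>x. f x - f' x)"
    unfolding ft_trunc_L2(2)[OF d] by (intro tendsto_intros L2_norm_trunc_tendsto d)
  ultimately have "L2_norm (\<lambda>x. f x - f' x) = 0" using LIMSEQ_unique by fastforce
  then show ?thesis using L2_norm_eq_0_iff[OF d] by auto
qed

text \<open>Fourier inversion by an exact computation. In the expansion of the squared distance the
  cross term is given by \<open>ft_duality\<close>, and what remains is \<open>2 * pi\<close> times
  the difference between the squared norm of \<open>f\<close> and that of its truncation.\<close>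

lemma has_ft_ift:
  assumes a1: "integrable lborel a" and a2: "a \<in> L2"
  shows "has_ft (ift a) a"
  unfolding has_ft_def
proof
  define f where "f = ift a"
  have f: "f \<in> L2" unfolding f_def by (rule ift_L2[OF a1 a2])
  have nf: "(L2_norm a)\<^sup>2 = 2 * pi * (L2_norm f)\<^sup>2" unfolding f_def ift_L2(2)[OF a1 a2] by simp
  have sq: "(L2_norm (\<lambda>\<xi>. ft (trunc n f) \<xi> - a \<xi>))\<^sup>2 = 2 * pi * ((L2_norm f)\<^sup>2 - (L2_norm (trunc n f))\<^sup>2)" for n
  proof -
    have ca: "integrable lborel (\<lambda>\<xi>. cnj (a \<xi>))" using a1 by simp
    have ftc: "ft (\<lambda>\<xi>. cnj (a \<xi>)) x = 2 * pi * cnj (f x)" for x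
    proof -
      have "cnj (\<integral>\<xi>. cis (x * \<xi>) * a \<xi> \<partial>lborel) = (\<integral>\<xi>. cnj (cis (x * \<xi>) * a \<xi>) \<partial>lborel)"
        by (rule Bochner_Integration.integral_cnj[symmetric])
      then have "cnj (f x) = (\<integral>\<xi>. cis (- (x * \<xi>)) * cnj (a \<xi>) \<partial>lborel) / (2 * pi)"
        unfolding f_def ift_def by (simp add: cis_cnj)
      then show ?thesis by (simp add: ft_def mult.commute)
    qed
    have "(\<integral>\<xi>. ft (trunc n f) \<xi> * cnj (a \<xi>) \<partial>lborel) = (\<integral>x. trunc n f x * (2 * pi * cnj (f x)) \<partial>lborel)"
      using ft_duality[OF integrable_trunc_L2[OF f] ca] by (simp add: ftc)
    also have "\<dots> = (\<integral>x. 2 * pi * (trunc n f x * cnj (trunc n f x)) \<partial>lborel)"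
      by (intro Bochner_Integration.integral_cong) (auto simp: trunc_def indicator_def)
    also have "\<dots> = 2 * pi * (\<integral>x. trunc n f x * cnj (trunc n f x) \<partial>lborel)" by simp
    also have "\<dots> = of_real (2 * pi * (L2_norm (trunc n f))\<^sup>2)"
      by (simp add: integral_mult_cnj_self[OF trunc_L2(1)[OF f]])
    finally have ip: "Re (\<integral>\<xi>. ft (trunc n f) \<xi> * cnj (a \<xi>) \<partial>lborel) = 2 * pi * (L2_norm (trunc n f))\<^sup>2" by simp
    show ?thesis
      unfolding L2_norm_diff_sq[OF ft_trunc_L2(1)[OF f] a2] ip nf ft_trunc_L2(2)[OF f]
      by (simp add: power_mult_distrib algebra_simps)
  qed
  have "(\<lambda>n. (L2_norm (\<lambda>\<xi>. ft (trunc n f) \<xi> - a \<xi>))\<^sup>2) \<longlonglongrightarrow> 2 * pi * ((L2_norm f)\<^sup>2 - (L2_norm f)\<^sup>2)"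
    unfolding sq by (intro tendsto_intros L2_norm_trunc_tendsto f)
  from tendsto_real_sqrt[OF this] show "(\<lambda>n. L2_norm (\<lambda>\<xi>. ft (trunc n (ift a)) \<xi> - a \<xi>)) \<longlonglongrightarrow> 0"
    by (simp add: f_def)
qed (rule a2)

lemma has_ft_imp_eq_ift:
  assumes "f \<in> L2" "has_ft f a" "integrable lborel a"
  shows "AE x in lborel. f x = ift a x"
proof -
  have a: "a \<in> L2" using assms(2) by (simp add: has_ft_def)
  show ?thesis
    by (rule has_ft_inj[OF assms(1) ift_L2(1)[OF assms(3) a] assms(2) has_ft_ift[OF assms(3) a]])
qed

lemma L2_of_real_iff [simp]: "(\<lambda>x. complex_of_real (f x)) \<in> L2 \<longleftrightarrow> f \<in> L2"
proof
  assume a: "(\<lambda>x. complex_of_real (f x)) \<in> L2"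
  have "Re \<in> borel_measurable borel" by (intro borel_measurable_continuous_onI continuous_intros)
  from measurable_compose[OF L2_measurable[OF a] this] have "f \<in> borel_measurable borel" by simp
  moreover have "integrable lborel (\<lambda>x. (norm (f x))\<^sup>2)" using L2_integrable[OF a] by simp
  ultimately show "f \<in> L2" by (rule L2_I)
qed (auto simp: L2_def)

lemma has_ft_fourier_transform:
  assumes "f \<in> L2"
  shows "has_ft (\<lambda>x. of_real (f x)) (fourier_transform f)"
proof -
  have "(\<lambda>x. complex_of_real (f x)) \<in> L2" using assms by simp
  then obtain g where "has_fourier_transform f g"
    using has_ft_exists has_fourier_transform_iff[OF assms] by blast
  then have "has_fourier_transform f (fourier_transform f)"
    unfolding fourier_transform_def by (rule someI[of "has_fourier_transform f"])
  then show ?thesis using has_fourier_transform_iff[OF assms] by blast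
qed

lemma fourier_transform_AE_eq:
  assumes "f \<in> L2" "has_ft (\<lambda>x. of_real (f x)) g"
  shows "AE \<xi> in lborel. fourier_transform f \<xi> = g \<xi>"
  by (rule has_ft_unique[OF _ has_ft_fourier_transform[OF assms(1)] assms(2)]) (use assms in simp)

lemma fourier_transform_L2: "f \<in> L2 \<Longrightarrow> fourier_transform f \<in> L2"
  using has_ft_fourier_transform by (auto simp: has_ft_def)

section \<open>Weighted spaces of transforms\<close>

definition wt :: "real \<Rightarrow> real \<Rightarrow> real" where
  "wt s \<xi> = (1 + \<xi>\<^sup>2) powr (s / 2)"

definition wa :: "real \<Rightarrow> (real \<Rightarrow> complex) \<Rightarrow> real \<Rightarrow> complex" where
  "wa s a \<xi> = of_real (wt s \<xi>) * a \<xi>"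

text \<open>The elements are transforms, not functions of the space variable;
  \<open>sobolev_iff\<close> gives the connection with \<open>sobolev\<close>.\<close>

definition Hs :: "real \<Rightarrow> (real \<Rightarrow> complex) set" where
  "Hs s = {a. wa s a \<in> L2}"

definition Hn :: "real \<Rightarrow> (real \<Rightarrow> complex) \<Rightarrow> real" where
  "Hn s a = L2_norm (wa s a)"

lemma one_plus_sq_pos [simp]: "0 < 1 + (\<xi>::real)\<^sup>2" "1 + \<xi>\<^sup>2 \<noteq> 0"
  by (simp_all add: add_pos_nonneg) (smt (verit) zero_le_power2)

lemma wt_pos [simp]: "0 < wt s \<xi>" "0 \<le> wt s \<xi>" "wt s \<xi> \<noteq> 0" "\<bar>wt s \<xi>\<bar> = wt s \<xi>"
  using one_plus_sq_pos(2)[of \<xi>] by (simp_all add: wt_def)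

lemma wt_0 [simp]: "wt 0 \<xi> = 1" by (simp add: wt_def)

lemma wt_2: "wt 2 \<xi> = 1 + \<xi>\<^sup>2" by (simp add: wt_def)

lemma wt_minus_2: "wt (-2) \<xi> = 1 / (1 + \<xi>\<^sup>2)" by (simp add: wt_def powr_minus_divide)

lemma wt_add: "wt (s + r) \<xi> = wt s \<xi> * wt r \<xi>"
  by (simp add: wt_def powr_add add_divide_distrib)

lemma wt_mono: "s \<le> r \<Longrightarrow> wt s \<xi> \<le> wt r \<xi>"
  by (simp add: wt_def powr_mono)

lemma wt_ge_1: "0 \<le> s \<Longrightarrow> 1 \<le> wt s \<xi>"
  using wt_mono[of 0 s \<xi>] by simp

lemma wt_1: "wt 1 \<xi> = sqrt (1 + \<xi>\<^sup>2)"
  by (simp add: wt_def powr_half_sqrt)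

lemma wt_powr: "wt s \<xi> = wt 1 \<xi> powr s"
  by (simp add: wt_def powr_powr)

lemma abs_le_wt_1: "\<bar>\<xi>\<bar> \<le> wt 1 \<xi>"
  unfolding wt_1 by (rule real_le_rsqrt) simp

lemma wt_measurable [measurable]: "wt s \<in> borel_measurable borel"
  unfolding wt_def[abs_def] by measurable

text \<open>The triangle inequality in the plane for the decomposition of \<open>(1, \<xi>)\<close>
  into \<open>(1, \<xi> - \<eta>)\<close> and \<open>(0, \<eta>)\<close>.\<close>

lemma wt_1_triangle: "wt 1 \<xi> \<le> wt 1 (\<xi> - \<eta>) + wt 1 \<eta>"
proof -
  have "wt 1 \<xi> \<le> sqrt (1\<^sup>2 + (\<xi> - \<eta>)\<^sup>2) + sqrt (0\<^sup>2 + \<eta>\<^sup>2)"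
    using real_sqrt_sum_squares_triangle_ineq[of 1 0 "\<xi> - \<eta>" \<eta>] by (simp add: wt_1)
  then show ?thesis using abs_le_wt_1[of \<eta>] by (simp add: wt_1)
qed

text \<open>One of the two weights of order 1 is at least half of \<open>wt 1 \<xi>\<close>; raising
  this to the power \<open>s\<close> gives the factor \<open>2 powr s\<close>.\<close>

lemma wt_subadditive:
  assumes "0 \<le> s"
  shows "wt s \<xi> \<le> 2 powr s * (wt s (\<xi> - \<eta>) + wt s \<eta>)"
proof -
  have "wt 1 \<xi> \<le> 2 * max (wt 1 (\<xi> - \<eta>)) (wt 1 \<eta>)" using wt_1_triangle[of \<xi> \<eta>] by linarith
  then have "wt s \<xi> \<le> (2 * max (wt 1 (\<xi> - \<eta>)) (wt 1 \<eta>)) powr s"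
    unfolding wt_powr[of s \<xi>] by (intro powr_mono2 assms) auto
  also have "\<dots> = 2 powr s * max (wt 1 (\<xi> - \<eta>)) (wt 1 \<eta>) powr s"
    by (simp add: powr_mult le_max_iff_disj)
  also have "max (wt 1 (\<xi> - \<eta>)) (wt 1 \<eta>) powr s \<le> wt s (\<xi> - \<eta>) + wt s \<eta>"
    using wt_pos(2)[of s "\<xi> - \<eta>"] wt_pos(2)[of s \<eta>]
    by (cases "wt 1 (\<xi> - \<eta>) \<le> wt 1 \<eta>") (auto simp: max_def simp flip: wt_powr)
  finally show ?thesis by simp
qed

lemma norm_wa: "norm (wa s a \<xi>) = wt s \<xi> * norm (a \<xi>)"
  by (simp add: wa_def norm_mult)

lemma wa_0 [simp]: "wa 0 a = a" by (simp add: wa_def fun_eq_iff)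

lemma Hn_nonneg [simp]: "0 \<le> Hn s a" by (simp add: Hn_def)

lemma Hs_measurable:
  assumes "a \<in> Hs s" shows "a \<in> borel_measurable borel"
proof -
  have [measurable]: "wa s a \<in> borel_measurable borel" using assms by (auto simp: Hs_def intro: L2_measurable)
  have "(\<lambda>\<xi>. of_real (1 / wt s \<xi>) * wa s a \<xi>) \<in> borel_measurable borel" by measurable
  then show ?thesis by (simp add: wa_def)
qed

lemma wa_measurable [measurable]: "a \<in> borel_measurable borel \<Longrightarrow> wa s a \<in> borel_measurable borel"
  unfolding wa_def[abs_def] by measurable

lemma Hs_0: "Hs 0 = L2" and Hn_0: "Hn 0 = L2_norm"
  by (auto simp: Hs_def Hn_def)

lemma Hs_dominated:
  assumes a: "a \<in> Hs r" and b: "b \<in> borel_measurable borel"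
    and le: "\<And>\<xi>. wt s \<xi> * norm (b \<xi>) \<le> C * (wt r \<xi> * norm (a \<xi>))"
  shows "b \<in> Hs s" "Hn s b \<le> \<bar>C\<bar> * Hn r a"
proof -
  have L: "(\<lambda>\<xi>. C *\<^sub>R wa r a \<xi>) \<in> L2" using a by (intro L2_scaleR) (simp add: Hs_def)
  have le': "norm (wa s b \<xi>) \<le> norm (C *\<^sub>R wa r a \<xi>)" for \<xi>
    using order_trans[OF le abs_ge_self, of \<xi>] by (simp add: norm_wa abs_mult)
  show "b \<in> Hs s" "Hn s b \<le> \<bar>C\<bar> * Hn r a"
    using L2_dominated[OF L wa_measurable[OF b]] le' L2_norm_scaleR[of C "wa r a"] by (auto simp: Hs_def Hn_def)
qed

lemma Hs_mono:
  assumes "r \<le> s" "a \<in> Hs s"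
  shows "a \<in> Hs r" "Hn r a \<le> Hn s a"
  using Hs_dominated[OF assms(2) Hs_measurable[OF assms(2)], of r 1] wt_mono[OF assms(1)]
  by (simp_all add: mult_right_mono)

lemma Hs_L2:
  assumes "0 \<le> s" "a \<in> Hs s"
  shows "a \<in> L2" "L2_norm a \<le> Hn s a"
  using Hs_mono[OF assms] by (simp_all add: Hs_0 Hn_0)

lemma L2_wt_minus_1: "(\<lambda>\<xi>. wt (-1) \<xi>) \<in> L2" and L2_norm_wt_minus_1: "L2_norm (\<lambda>\<xi>. wt (-1) \<xi>) = sqrt pi"
proof -
  have eq: "(norm (wt (-1) \<xi>))\<^sup>2 = 1 / (1 + \<xi>\<^sup>2)" for \<xi>
    using wt_add[of "-1" "-1" \<xi>] by (simp add: wt_minus_2 power2_eq_square)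
  show "(\<lambda>\<xi>. wt (-1) \<xi>) \<in> L2" by (rule L2_I) (simp_all add: eq has_integral_arctan del: real_norm_def)
  show "L2_norm (\<lambda>\<xi>. wt (-1) \<xi>) = sqrt pi"
    by (simp add: L2_norm_def eq has_integral_arctan del: real_norm_def)
qed

text \<open>Cauchy-Schwarz against the weight of order \<open>-1\<close>, which is
  square-integrable. A whole order is traded for integrability, and this keeps the thresholds on the
  order integers.\<close>

lemma Hs_L1_weighted:
  assumes "a \<in> Hs (k + 1)"
  shows "integrable lborel (\<lambda>\<xi>. wt k \<xi> * norm (a \<xi>))"
    and "(\<integral>\<xi>. wt k \<xi> * norm (a \<xi>) \<partial>lborel) \<le> sqrt pi * Hn (k + 1) a"
proof -
  have eq: "norm (wt (-1) \<xi>) * norm (wa (k + 1) a \<xi>) = wt k \<xi> * norm (a \<xi>)" for \<xi>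
    using wt_add[of "-1" "k + 1" \<xi>] by (simp add: norm_wa mult.assoc[symmetric])
  show "integrable lborel (\<lambda>\<xi>. wt k \<xi> * norm (a \<xi>))"
    and "(\<integral>\<xi>. wt k \<xi> * norm (a \<xi>) \<partial>lborel) \<le> sqrt pi * Hn (k + 1) a"
    using L2_Cauchy_Schwarz[OF L2_wt_minus_1, of "wa (k+1) a"] assms
    unfolding eq L2_norm_wt_minus_1 by (simp_all add: Hs_def Hn_def)
qed

lemma Hs_L1:
  assumes "1 \<le> s" "a \<in> Hs s"
  shows "integrable lborel a" "(\<integral>\<xi>. norm (a \<xi>) \<partial>lborel) \<le> sqrt pi * Hn s a"
proof -
  have a: "a \<in> Hs (0 + 1)" "Hn 1 a \<le> Hn s a" using Hs_mono[OF assms] by simp_all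
  note * = Hs_L1_weighted[OF a(1)]
  show "integrable lborel a"
    using *(1) by (simp add: integrable_norm_iff Hs_measurable[OF a(1)])
  have "sqrt pi * Hn 1 a \<le> sqrt pi * Hn s a" using a(2) by (intro mult_left_mono) auto
  then show "(\<integral>\<xi>. norm (a \<xi>) \<partial>lborel) \<le> sqrt pi * Hn s a" using order_trans[OF *(2)] by simp
qed

lemma Hs_add: "a \<in> Hs s \<Longrightarrow> b \<in> Hs s \<Longrightarrow> (\<lambda>\<xi>. a \<xi> + b \<xi>) \<in> Hs s"
  using L2_add(1)[of "wa s a" "wa s b"] by (simp add: Hs_def wa_def[abs_def] distrib_left)

lemma Hn_add: "a \<in> Hs s \<Longrightarrow> b \<in> Hs s \<Longrightarrow> Hn s (\<lambda>\<xi>. a \<xi> + b \<xi>) \<le> Hn s a + Hn s b"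
  using L2_norm_triangle[of "wa s a" "wa s b"] by (simp add: Hs_def Hn_def wa_def[abs_def] distrib_left)

lemma Hs_diff: "a \<in> Hs s \<Longrightarrow> b \<in> Hs s \<Longrightarrow> (\<lambda>\<xi>. a \<xi> - b \<xi>) \<in> Hs s"
  using L2_diff[of "wa s a" "wa s b"] by (simp add: Hs_def wa_def[abs_def] right_diff_distrib)

lemma wa_cmult: "wa s (\<lambda>\<xi>. c * a \<xi>) = (\<lambda>\<xi>. c * wa s a \<xi>)"
  by (simp add: wa_def fun_eq_iff)

lemma wa_diff: "wa s (\<lambda>\<xi>. a \<xi> - b \<xi>) = (\<lambda>\<xi>. wa s a \<xi> - wa s b \<xi>)"
  by (simp add: wa_def fun_eq_iff right_diff_distrib)

lemma Hs_cmult: "a \<in> Hs s \<Longrightarrow> (\<lambda>\<xi>. c * a \<xi>) \<in> Hs s"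
  by (simp add: Hs_def wa_cmult L2_cmult)

lemma Hn_cmult: "Hn s (\<lambda>\<xi>. c * a \<xi>) = norm c * Hn s a"
  by (simp add: Hn_def wa_cmult L2_norm_cmult)

lemma Hs_divide: "a \<in> Hs s \<Longrightarrow> (\<lambda>\<xi>. a \<xi> / c) \<in> Hs s"
  using Hs_cmult[of a s "1 / c"] by simp

lemma Hn_divide: "Hn s (\<lambda>\<xi>. a \<xi> / c) = Hn s a / norm c"
  using Hn_cmult[of s "1 / c" a] by (simp add: norm_divide)

lemma Hn_diff_le: "a \<in> Hs s \<Longrightarrow> b \<in> Hs s \<Longrightarrow> Hn s (\<lambda>\<xi>. a \<xi> - b \<xi>) \<le> Hn s a + Hn s b"
  using L2_norm_diff_le[of "wa s a" "wa s b"] by (simp add: Hs_def Hn_def wa_diff)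

lemma Hn_triangle3: "a \<in> Hs s \<Longrightarrow> b \<in> Hs s \<Longrightarrow> c \<in> Hs s \<Longrightarrow>
   Hn s (\<lambda>\<xi>. a \<xi> - c \<xi>) \<le> Hn s (\<lambda>\<xi>. a \<xi> - b \<xi>) + Hn s (\<lambda>\<xi>. b \<xi> - c \<xi>)"
  using L2_norm_triangle3[of "wa s a" "wa s b" "wa s c"] by (simp add: Hs_def Hn_def wa_diff)

lemma Hn_reverse_triangle: "a \<in> Hs s \<Longrightarrow> b \<in> Hs s \<Longrightarrow> \<bar>Hn s a - Hn s b\<bar> \<le> Hn s (\<lambda>\<xi>. a \<xi> - b \<xi>)"
  using L2_norm_reverse_triangle[of "wa s a" "wa s b"] by (simp add: Hs_def Hn_def wa_diff)

lemma Hn_minus_commute: "Hn s (\<lambda>\<xi>. a \<xi> - b \<xi>) = Hn s (\<lambda>\<xi>. b \<xi> - a \<xi>)"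
  unfolding Hn_def wa_diff by (rule L2_norm_minus_commute)

lemma Hs_multiplier:
  assumes a: "a \<in> Hs (s + r)" and [measurable]: "m \<in> borel_measurable borel"
    and le: "\<And>\<xi>. norm (m \<xi>) \<le> C * wt r \<xi>"
  shows "(\<lambda>\<xi>. m \<xi> * a \<xi>) \<in> Hs s" "Hn s (\<lambda>\<xi>. m \<xi> * a \<xi>) \<le> C * Hn (s + r) a"
proof -
  note [measurable] = Hs_measurable[OF a]
  have C: "0 \<le> C" using order_trans[OF norm_ge_zero le[of 0]] by (simp add: wt_def)
  have *: "wt s \<xi> * norm (m \<xi> * a \<xi>) \<le> C * (wt (s + r) \<xi> * norm (a \<xi>))" for \<xi>
    using mult_left_mono[OF mult_right_mono[OF le[of \<xi>], of "norm (a \<xi>)"], of "wt s \<xi>"]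
    by (simp add: norm_mult wt_add mult_ac)
  show "(\<lambda>\<xi>. m \<xi> * a \<xi>) \<in> Hs s" "Hn s (\<lambda>\<xi>. m \<xi> * a \<xi>) \<le> C * Hn (s + r) a"
    using Hs_dominated[OF a _ *] C by auto
qed

definition dx :: "(real \<Rightarrow> complex) \<Rightarrow> real \<Rightarrow> complex" where
  "dx a \<xi> = \<i> * of_real \<xi> * a \<xi>"

lemma dx_measurable [measurable]: "a \<in> borel_measurable borel \<Longrightarrow> dx a \<in> borel_measurable borel"
  unfolding dx_def[abs_def] by measurable

lemma dx_Hs:
  assumes "a \<in> Hs (s + 1)"
  shows "dx a \<in> Hs s" "Hn s (dx a) \<le> Hn (s + 1) a"
  using Hs_multiplier[OF assms, of "\<lambda>\<xi>. \<i> * of_real \<xi>" 1] abs_le_wt_1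
  by (simp_all add: dx_def[abs_def] norm_mult)

lemma dx_Hs':
  assumes "a \<in> Hs s"
  shows "dx a \<in> Hs (s - 1)" "Hn (s - 1) (dx a) \<le> Hn s a"
  using dx_Hs[of a "s - 1"] assms by simp_all

lemma norm_dx: "norm (dx a \<xi>) = \<bar>\<xi>\<bar> * norm (a \<xi>)"
  by (simp add: dx_def norm_mult)

lemma norm_complex_L2: "a \<in> L2 \<Longrightarrow> (\<lambda>\<xi>. norm (a \<xi>)) \<in> L2"
  and L2_norm_norm_complex: "L2_norm (\<lambda>\<xi>. complex_of_real (norm (a \<xi>))) = L2_norm a"
  by (auto simp: L2_def L2_norm_def)

lemma norm_conv_le: "norm (conv a b \<xi>) \<le> (\<integral>\<eta>. norm (a (\<xi> - \<eta>)) * norm (b \<eta>) \<partial>lborel)"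
  unfolding conv_def by (rule order_trans[OF integral_norm_bound]) (simp add: norm_mult)

lemma conv_of_real:
  "conv (\<lambda>\<xi>. of_real (f \<xi>)) (\<lambda>\<xi>. of_real (g \<xi>)) \<xi> = of_real (\<integral>\<eta>. f (\<xi> - \<eta>) * g \<eta> \<partial>lborel)"
  unfolding conv_def by (subst integral_complex_of_real[symmetric]) simp

text \<open>The factor \<open>2 powr s\<close> comes from \<open>wt_subadditive\<close>,
  \<open>sqrt pi\<close> from the embedding into \<open>L^1\<close>, and 2 from the two factors that
  may carry the weight.\<close>

definition Calg :: "real \<Rightarrow> real" where "Calg s = 2 * 2 powr s * sqrt pi"

lemma Calg_nonneg [simp]: "0 \<le> Calg s" by (simp add: Calg_def)

text \<open>A norm on the left of the weighted convolution is transferred to one of the two factors,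
  which Young's inequality then keeps in $L^2$ while the other one stays in $L^1$.\<close>
lemma conv_Hs:
  assumes s: "1 \<le> s" and a: "a \<in> Hs s" and b: "b \<in> Hs s"
  shows "conv a b \<in> Hs s" "Hn s (conv a b) \<le> Calg s * Hn s a * Hn s b"
proof -
  note [measurable] = Hs_measurable[OF a] Hs_measurable[OF b]
  define A where "A = (\<lambda>\<xi>. complex_of_real (norm (a \<xi>)))"
  define B where "B = (\<lambda>\<xi>. complex_of_real (norm (b \<xi>)))"
  define A' where "A' = (\<lambda>\<xi>. complex_of_real (norm (wa s a \<xi>)))"
  define B' where "B' = (\<lambda>\<xi>. complex_of_real (norm (wa s b \<xi>)))"
  have L: "a \<in> L2" "b \<in> L2" "wa s a \<in> L2" "wa s b \<in> L2"
    using Hs_L2(1)[OF _ a] Hs_L2(1)[OF _ b] s a b by (simp_all add: Hs_def)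
  have 1: "integrable lborel A" "(\<integral>\<xi>. norm (A \<xi>) \<partial>lborel) \<le> sqrt pi * Hn s a"
      "integrable lborel B" "(\<integral>\<xi>. norm (B \<xi>) \<partial>lborel) \<le> sqrt pi * Hn s b"
    using Hs_L1[OF s a] Hs_L1[OF s b] by (auto simp: A_def B_def)
  have 2: "A' \<in> L2" "L2_norm A' = Hn s a" "B' \<in> L2" "L2_norm B' = Hn s b" "A \<in> L2" "B \<in> L2"
    using L by (auto simp: A'_def B'_def A_def B_def norm_complex_L2 L2_norm_norm_complex Hn_def)
  have Y1: "conv A B' \<in> L2" "L2_norm (conv A B') \<le> sqrt pi * Hn s a * Hn s b"
    using conv_Young[OF 1(1) 2(3)] mult_right_mono[OF 1(2), of "Hn s b"] 2(4) by auto
  have Y2: "conv B A' \<in> L2" "L2_norm (conv B A') \<le> sqrt pi * Hn s a * Hn s b"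
    using conv_Young[OF 1(3) 2(1)] mult_right_mono[OF 1(4), of "Hn s a"] 2(2) by (auto simp: mult_ac)
  define D where "D \<xi> = 2 powr s *\<^sub>R (conv A B' \<xi> + conv B A' \<xi>)" for \<xi>
  have D: "D \<in> L2" unfolding D_def[abs_def] by (intro L2_scaleR L2_add Y1 Y2)
  have le: "norm (wa s (conv a b) \<xi>) \<le> norm (D \<xi>)" for \<xi>
  proof -
    have i1: "integrable lborel (\<lambda>\<eta>. norm (a (\<xi> - \<eta>)) * norm (wa s b \<eta>))"
      using L2_Cauchy_Schwarz(1)[OF L2_reflect_shift(1)[OF L(1), of \<xi>] L(4)] .
    have i2: "integrable lborel (\<lambda>\<eta>. norm (wa s a (\<xi> - \<eta>)) * norm (b \<eta>))"
      using L2_Cauchy_Schwarz(1)[OF L2_reflect_shift(1)[OF L(3), of \<xi>] L(2)] .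
    have i3: "integrable lborel (\<lambda>\<eta>. norm (a (\<xi> - \<eta>)) * norm (b \<eta>))"
      using L2_Cauchy_Schwarz(1)[OF L2_reflect_shift(1)[OF L(1), of \<xi>] L(2)] .
    have "norm (wa s (conv a b) \<xi>) \<le> wt s \<xi> * (\<integral>\<eta>. norm (a (\<xi> - \<eta>)) * norm (b \<eta>) \<partial>lborel)"
      unfolding norm_wa by (intro mult_left_mono norm_conv_le) simp
    also have "\<dots> = (\<integral>\<eta>. wt s \<xi> * (norm (a (\<xi> - \<eta>)) * norm (b \<eta>)) \<partial>lborel)" by simp
    also have "\<dots> \<le> (\<integral>\<eta>. 2 powr s * (norm (wa s a (\<xi> - \<eta>)) * norm (b \<eta>) + norm (a (\<xi> - \<eta>)) * norm (wa s b \<eta>)) \<partial>lborel)"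
    proof (rule integral_mono)
      show "wt s \<xi> * (norm (a (\<xi> - \<eta>)) * norm (b \<eta>))
          \<le> 2 powr s * (norm (wa s a (\<xi> - \<eta>)) * norm (b \<eta>) + norm (a (\<xi> - \<eta>)) * norm (wa s b \<eta>))" for \<eta>
        using mult_right_mono[OF wt_subadditive[of s \<xi> \<eta>], of "norm (a (\<xi> - \<eta>)) * norm (b \<eta>)"] s
        by (simp add: norm_wa algebra_simps)
    qed (use i1 i2 i3 in auto)
    also have "\<dots> = 2 powr s * ((\<integral>\<eta>. norm (wa s a (\<xi> - \<eta>)) * norm (b \<eta>) \<partial>lborel) + (\<integral>\<eta>. norm (a (\<xi> - \<eta>)) * norm (wa s b \<eta>) \<partial>lborel))"
      using i1 i2 by simp
    also have "\<dots> = norm (D \<xi>)"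
    proof -
      have "conv B A' \<xi> = conv A' B \<xi>" by (rule conv_commute)
      then have "D \<xi> = of_real (2 powr s * ((\<integral>\<eta>. norm (wa s a (\<xi> - \<eta>)) * norm (b \<eta>) \<partial>lborel) + (\<integral>\<eta>. norm (a (\<xi> - \<eta>)) * norm (wa s b \<eta>) \<partial>lborel)))"
        unfolding D_def A_def B_def A'_def B'_def by (simp only: conv_of_real scaleR_conv_of_real of_real_mult of_real_add add.commute)
      then show ?thesis by (simp only: norm_of_real) (auto intro!: abs_of_nonneg[symmetric] mult_nonneg_nonneg add_nonneg_nonneg)
    qed
    finally show ?thesis .
  qed
  have dom: "wa s (conv a b) \<in> L2" "L2_norm (wa s (conv a b)) \<le> L2_norm D"
    by (rule L2_dominated[OF D]; use le in simp)+
  show "conv a b \<in> Hs s" using dom by (simp add: Hs_def)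
  have "L2_norm D \<le> 2 powr s * (sqrt pi * Hn s a * Hn s b + sqrt pi * Hn s a * Hn s b)"
    unfolding D_def[abs_def] L2_norm_scaleR using L2_norm_triangle[OF Y1(1) Y2(1)] Y1(2) Y2(2)
    by (simp add: mult_left_mono)
  then show "Hn s (conv a b) \<le> Calg s * Hn s a * Hn s b"
    using dom(2) by (simp add: Hn_def Calg_def mult_ac)
qed

definition fw_kernel :: "real \<Rightarrow> real \<Rightarrow> real \<Rightarrow> real" where
  "fw_kernel B b \<xi> = 2 * B * b / (b\<^sup>2 + \<xi>\<^sup>2)"

text \<open>As \<^term>\<open>ift (conv a a)\<close> is $2\pi$ times the square of \<^term>\<open>ift a\<close>, the first summand is the transform
  of $- (u^2/2)_x$. The function \<^term>\<open>fw_kernel B b\<close> is the transform of $B e^{-b|x|}$.\<close>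
definition rhs :: "real \<Rightarrow> real \<Rightarrow> (real \<Rightarrow> complex) \<Rightarrow> real \<Rightarrow> complex" where
  "rhs B b a \<xi> = - dx (\<lambda>\<xi>. conv a a \<xi> / (4 * pi) + of_real (fw_kernel B b \<xi>) * a \<xi>) \<xi>"

lemma fw_kernel_measurable [measurable]: "fw_kernel B b \<in> borel_measurable borel"
  unfolding fw_kernel_def[abs_def] by measurable

lemma fw_kernel_bounds:
  assumes "0 < b" "0 \<le> B"
  shows "0 \<le> fw_kernel B b \<xi>" "fw_kernel B b \<xi> \<le> 2 * B / b"
proof -
  show "0 \<le> fw_kernel B b \<xi>" using assms by (simp add: fw_kernel_def)
  have "fw_kernel B b \<xi> \<le> 2 * B * b / b\<^sup>2"
    unfolding fw_kernel_def using assms by (intro divide_left_mono) (auto simp: add_pos_nonneg)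
  then show "fw_kernel B b \<xi> \<le> 2 * B / b" using assms by (simp add: power2_eq_square)
qed

lemma kernel_Hs:
  assumes "0 < b" "0 \<le> B" "a \<in> Hs s"
  shows "(\<lambda>\<xi>. of_real (fw_kernel B b \<xi>) * a \<xi>) \<in> Hs s"
    "Hn s (\<lambda>\<xi>. of_real (fw_kernel B b \<xi>) * a \<xi>) \<le> 2 * B / b * Hn s a"
  using Hs_multiplier[of a s 0 "\<lambda>\<xi>. of_real (fw_kernel B b \<xi>)" "2 * B / b"] assms(3) fw_kernel_bounds[OF assms(1,2)]
  by simp_all

lemma rhs_Hs:
  assumes "0 < b" "0 \<le> B" "1 \<le> s" "a \<in> Hs s"
  shows "rhs B b a \<in> Hs (s - 1)"
proof -
  have "dx (\<lambda>\<xi>. conv a a \<xi> / (4 * pi) + of_real (fw_kernel B b \<xi>) * a \<xi>) \<in> Hs (s - 1)"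
    by (intro dx_Hs' Hs_add Hs_divide conv_Hs kernel_Hs assms)
  from Hs_cmult[OF this, of "-1"] show ?thesis by (simp add: rhs_def[abs_def])
qed

lemma conv_square_diff:
  assumes "a \<in> L2" "c \<in> L2"
  shows "conv a a \<xi> - conv c c \<xi> = conv (\<lambda>\<xi>. a \<xi> + c \<xi>) (\<lambda>\<xi>. a \<xi> - c \<xi>) \<xi>"
proof -
  have "conv (\<lambda>\<xi>. a \<xi> + c \<xi>) (\<lambda>\<xi>. a \<xi> - c \<xi>) \<xi> = conv a a \<xi> - conv a c \<xi> + (conv c a \<xi> - conv c c \<xi>)"
    by (subst conv_diff_right) (simp_all add: assms L2_add conv_add_left)
  then show ?thesis using conv_commute[of a c \<xi>] by simp
qed

text \<open>The flux is quadratic, so its difference factors into a sum times a difference: a local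
  Lipschitz bound at the price of one order.\<close>

lemma rhs_diff_Hs:
  assumes b: "0 < b" "0 \<le> B" and s: "1 \<le> s" and a: "a \<in> Hs s" and c: "c \<in> Hs s"
  shows "Hn (s - 1) (\<lambda>\<xi>. rhs B b a \<xi> - rhs B b c \<xi>)
    \<le> (Calg s * (Hn s a + Hn s c) + 2 * B / b) * Hn s (\<lambda>\<xi>. a \<xi> - c \<xi>)"
proof -
  have L: "a \<in> L2" "c \<in> L2" using Hs_L2(1)[OF _ a] Hs_L2(1)[OF _ c] s by simp_all
  define d where "d = (\<lambda>\<xi>. a \<xi> - c \<xi>)"
  have d: "d \<in> Hs s" unfolding d_def by (rule Hs_diff[OF a c])
  have sm: "(\<lambda>\<xi>. a \<xi> + c \<xi>) \<in> Hs s" by (rule Hs_add[OF a c])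
  have cd: "conv a a \<xi> - conv c c \<xi> = conv (\<lambda>\<xi>. a \<xi> + c \<xi>) d \<xi>" for \<xi>
    unfolding d_def by (rule conv_square_diff[OF L])
  have "rhs B b a \<xi> - rhs B b c \<xi>
      = (-1) * dx (\<lambda>\<xi>. conv (\<lambda>\<xi>. a \<xi> + c \<xi>) d \<xi> / (4 * pi) + of_real (fw_kernel B b \<xi>) * d \<xi>) \<xi>" for \<xi>
  proof -
    have "conv a a \<xi> = conv c c \<xi> + conv (\<lambda>\<xi>. a \<xi> + c \<xi>) d \<xi>" for \<xi> using cd[of \<xi>] by (simp add: algebra_simps)
    moreover have "a \<xi> = c \<xi> + d \<xi>" by (simp add: d_def)
    ultimately show ?thesis by (simp add: rhs_def dx_def add_divide_distrib distrib_left)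
  qed
  then have "Hn (s - 1) (\<lambda>\<xi>. rhs B b a \<xi> - rhs B b c \<xi>)
      = Hn (s - 1) (dx (\<lambda>\<xi>. conv (\<lambda>\<xi>. a \<xi> + c \<xi>) d \<xi> / (4 * pi) + of_real (fw_kernel B b \<xi>) * d \<xi>))"
    using Hn_cmult[of "s - 1" "-1"] by simp
  also have "\<dots> \<le> Hn s (\<lambda>\<xi>. conv (\<lambda>\<xi>. a \<xi> + c \<xi>) d \<xi> / (4 * pi) + of_real (fw_kernel B b \<xi>) * d \<xi>)"
    by (intro dx_Hs' Hs_add Hs_divide conv_Hs kernel_Hs b s d sm)
  also have "\<dots> \<le> Hn s (\<lambda>\<xi>. conv (\<lambda>\<xi>. a \<xi> + c \<xi>) d \<xi> / (4 * pi)) + Hn s (\<lambda>\<xi>. of_real (fw_kernel B b \<xi>) * d \<xi>)"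
    by (intro Hn_add Hs_divide conv_Hs kernel_Hs b s d sm)
  also have "Hn s (\<lambda>\<xi>. conv (\<lambda>\<xi>. a \<xi> + c \<xi>) d \<xi> / (4 * pi)) \<le> Hn s (conv (\<lambda>\<xi>. a \<xi> + c \<xi>) d)"
  proof -
    have "1 \<le> 4 * pi" using pi_gt3 by simp
    then have "Hn s (conv (\<lambda>\<xi>. a \<xi> + c \<xi>) d) / (4 * pi) \<le> Hn s (conv (\<lambda>\<xi>. a \<xi> + c \<xi>) d) / 1"
      by (intro divide_left_mono) auto
    then show ?thesis by (simp add: Hn_divide norm_mult)
  qed
  also have "\<dots> \<le> Calg s * Hn s (\<lambda>\<xi>. a \<xi> + c \<xi>) * Hn s d"
    by (rule conv_Hs(2)[OF s sm d])
  also have "\<dots> \<le> Calg s * (Hn s a + Hn s c) * Hn s d"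
    by (intro mult_right_mono mult_left_mono Hn_add a c) auto
  also have "Hn s (\<lambda>\<xi>. of_real (fw_kernel B b \<xi>) * d \<xi>) \<le> 2 * B / b * Hn s d"
    by (rule kernel_Hs(2)[OF b d])
  finally show ?thesis unfolding d_def[symmetric] by (simp add: distrib_right)
qed

section \<open>Functions with a given transform\<close>

definition rift :: "(real \<Rightarrow> complex) \<Rightarrow> real \<Rightarrow> real" where
  "rift a x = Re (ift a x)"

text \<open>Reality is demanded of the inverse transform at every point. The equivalent Hermitian
  symmetry of \<open>a\<close> could be asked only almost everywhere, since transforms are
  determined up to null sets.\<close>

definition realv :: "(real \<Rightarrow> complex) \<Rightarrow> bool" where
  "realv a \<longleftrightarrow> (\<forall>x. Im (ift a x) = 0)"

lemma realv_ift: "realv a \<Longrightarrow> ift a x = of_real (rift a x)"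
  by (simp add: realv_def rift_def complex_eq_iff)

lemma abs_rift_le: "\<bar>rift a x\<bar> \<le> (\<integral>\<xi>. norm (a \<xi>) \<partial>lborel) / (2 * pi)"
  unfolding rift_def by (rule order_trans[OF abs_Re_le_cmod norm_ift_le])

lemma norm_cis_minus_1_le: "norm (cis t - 1) \<le> \<bar>t\<bar>"
proof -
  have "norm (cis t - 1) = 2 * \<bar>sin (t / 2)\<bar>"
    using dist_exp_i_1[of t] by (simp add: cis_conv_exp)
  then show ?thesis using abs_sin_x_le_abs_x[of "t / 2"] by simp
qed

lemma cis_difference_quotient:
  assumes h: "h \<longlonglongrightarrow> 0" "\<And>n. h n \<noteq> 0"
  shows "(\<lambda>n. (cis (h n * \<xi>) - 1) / of_real (h n)) \<longlonglongrightarrow> \<i> * of_real \<xi>"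
proof -
  have "((\<lambda>z. exp (\<i> * of_real \<xi> * z)) has_field_derivative \<i> * of_real \<xi>) (at 0)"
    by (auto intro!: derivative_eq_intros)
  then have "((\<lambda>z. (exp (\<i> * of_real \<xi> * z) - 1) / z) \<longlongrightarrow> \<i> * of_real \<xi>) (at 0)"
    by (simp add: DERIV_def)
  moreover have "filterlim (\<lambda>n. complex_of_real (h n)) (at 0) sequentially"
    unfolding filterlim_at using h tendsto_of_real[OF h(1), where 'a = complex] by auto
  ultimately have "(\<lambda>n. (exp (\<i> * of_real \<xi> * of_real (h n)) - 1) / of_real (h n)) \<longlonglongrightarrow> \<i> * of_real \<xi>"
    by (rule filterlim_compose)
  then show ?thesis by (simp add: cis_conv_exp mult_ac)
qed

lemma ift_translate_diff:
  assumes "integrable lborel a"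
  shows "ift a (x + h) - ift a x = ift (\<lambda>\<xi>. (cis (h * \<xi>) - 1) * a \<xi>) x"
proof -
  have "ift a (x + h) = ift (\<lambda>\<xi>. cis (h * \<xi>) * a \<xi>) x"
    by (simp add: ift_def distrib_right cis_mult[symmetric] mult.assoc)
  moreover have "ift (\<lambda>\<xi>. cis (h * \<xi>) * a \<xi> - a \<xi>) x = ift (\<lambda>\<xi>. cis (h * \<xi>) * a \<xi>) x - ift a x"
    by (intro ift_diff integrable_cis_mult assms) simp
  ultimately show ?thesis by (simp add: left_diff_distrib)
qed

lemma DERIV_rift:
  assumes a: "integrable lborel a" and xa: "integrable lborel (dx a)"
  shows "DERIV (rift a) x :> rift (dx a) x"
  unfolding DERIV_def tendsto_at_iff_sequentially
proof (intro allI impI)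
  note [measurable] = borel_measurable_integrable[OF a]
  fix h :: "nat \<Rightarrow> real" assume h0: "\<forall>i. h i \<in> UNIV - {0}" and h: "h \<longlonglongrightarrow> 0"
  have "(\<lambda>n. \<integral>\<xi>. cis (x * \<xi>) * ((cis (h n * \<xi>) - 1) / of_real (h n) * a \<xi>) \<partial>lborel)
     \<longlonglongrightarrow> (\<integral>\<xi>. cis (x * \<xi>) * dx a \<xi> \<partial>lborel)"
  proof (rule integral_dominated_convergence[where w = "\<lambda>\<xi>. norm (dx a \<xi>)"])
    show "AE \<xi> in lborel. (\<lambda>n. cis (x * \<xi>) * ((cis (h n * \<xi>) - 1) / of_real (h n) * a \<xi>)) \<longlonglongrightarrow> cis (x * \<xi>) * dx a \<xi>"
      unfolding dx_def using h0 by (intro AE_I2 tendsto_intros cis_difference_quotient h) auto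
    show "AE \<xi> in lborel. norm (cis (x * \<xi>) * ((cis (h n * \<xi>) - 1) / of_real (h n) * a \<xi>)) \<le> norm (dx a \<xi>)" for n
    proof (intro AE_I2)
      fix \<xi>
      have "norm (cis (h n * \<xi>) - 1) / \<bar>h n\<bar> \<le> \<bar>\<xi>\<bar>"
        using norm_cis_minus_1_le[of "h n * \<xi>"] h0 by (simp add: abs_mult field_simps)
      from mult_right_mono[OF this norm_ge_zero[of "a \<xi>"]]
      show "norm (cis (x * \<xi>) * ((cis (h n * \<xi>) - 1) / of_real (h n) * a \<xi>)) \<le> norm (dx a \<xi>)"
        by (simp add: norm_mult norm_divide norm_dx)
    qed
  qed (use xa in auto)
  then have "(\<lambda>n. Re (ift (\<lambda>\<xi>. (cis (h n * \<xi>) - 1) / of_real (h n) * a \<xi>) x)) \<longlonglongrightarrow> rift (dx a) x"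
    unfolding rift_def ift_def by (intro tendsto_intros) auto
  moreover have "Re (ift (\<lambda>\<xi>. (cis (h n * \<xi>) - 1) / of_real (h n) * a \<xi>) x) = (rift a (x + h n) - rift a x) / h n" for n
  proof -
    have "(rift a (x + h n) - rift a x) / h n = Re (1 / of_real (h n) * (ift a (x + h n) - ift a x))"
      by (simp add: rift_def)
    also have "1 / of_real (h n) * (ift a (x + h n) - ift a x) = ift (\<lambda>\<xi>. 1 / of_real (h n) * ((cis (h n * \<xi>) - 1) * a \<xi>)) x"
      unfolding ift_translate_diff[OF a] by (rule ift_cmult[symmetric])
    finally show ?thesis by simp
  qed
  ultimately show "((\<lambda>ha. (rift a (x + ha) - rift a x) / ha) \<circ> h) \<longlonglongrightarrow> rift (dx a) x"
    by (simp add: o_def)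
qed

lemma rift_add: "integrable lborel a \<Longrightarrow> integrable lborel b \<Longrightarrow> rift (\<lambda>\<xi>. a \<xi> + b \<xi>) x = rift a x + rift b x"
  by (simp add: rift_def ift_add)

lemma rift_diff: "integrable lborel a \<Longrightarrow> integrable lborel b \<Longrightarrow> rift (\<lambda>\<xi>. a \<xi> - b \<xi>) x = rift a x - rift b x"
  by (simp add: rift_def ift_diff)

lemma rift_cmult: "rift (\<lambda>\<xi>. of_real c * a \<xi>) x = c * rift a x"
  by (simp add: rift_def ift_cmult)

lemma rift_uminus: "rift (\<lambda>\<xi>. - a \<xi>) x = - rift a x"
  using rift_cmult[of "-1" a x] by simp

lemma realv_dx:
  assumes "integrable lborel a" "integrable lborel (dx a)" "realv a"
  shows "realv (dx a)"
  unfolding realv_def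
proof
  fix x
  \<comment> \<open>Multiplication by \<open>- \<i>\<close> turns imaginary parts into real parts,
    so \<open>DERIV_rift\<close> can also differentiate the imaginary part of \<open>ift a\<close>,
    which is constantly 0.\<close>
  define b where "b = (\<lambda>\<xi>. (- \<i>) * a \<xi>)"
  have dxb: "dx b = (\<lambda>\<xi>. (- \<i>) * dx a \<xi>)" by (auto simp: dx_def b_def)
  have "integrable lborel b" unfolding b_def by (rule integrable_mult_right[OF assms(1)])
  moreover have "integrable lborel (dx b)" unfolding dxb by (rule integrable_mult_right[OF assms(2)])
  ultimately have b: "integrable lborel b" "integrable lborel (dx b)" by simp_all
  have b3: "rift b = (\<lambda>x. 0)"
    unfolding b_def rift_def[abs_def] ift_cmult using assms(3) by (simp add: realv_def)
  have "DERIV (rift b) x :> rift (dx b) x" by (rule DERIV_rift[OF b])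
  then have "rift (dx b) x = 0" unfolding b3 using DERIV_unique DERIV_const by blast
  then show "Im (ift (dx a) x) = 0" unfolding dxb rift_def ift_cmult by simp
qed

lemma Hs_integrable: "a \<in> Hs s \<Longrightarrow> 1 \<le> s \<Longrightarrow> integrable lborel a"
  using Hs_L1(1) by blast

lemma dx_integrable: "a \<in> Hs s \<Longrightarrow> 2 \<le> s \<Longrightarrow> integrable lborel (dx a)"
  using Hs_integrable[OF dx_Hs'(1)] by simp

lemma DERIV_rift_Hs: "a \<in> Hs s \<Longrightarrow> 2 \<le> s \<Longrightarrow> DERIV (rift a) x :> rift (dx a) x"
  by (intro DERIV_rift dx_integrable Hs_integrable) auto

lemma realv_dx_Hs: "a \<in> Hs s \<Longrightarrow> 2 \<le> s \<Longrightarrow> realv a \<Longrightarrow> realv (dx a)"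
  by (intro realv_dx dx_integrable Hs_integrable) auto

lemma Lipschitz_DERIV_bound:
  fixes f f' :: "real \<Rightarrow> real"
  assumes "\<And>x. DERIV f x :> f' x" "\<And>x. \<bar>f' x\<bar> \<le> L"
  shows "\<bar>f x - f y\<bar> \<le> L * \<bar>x - y\<bar>"
  using field_differentiable_bound[of UNIV f f' L x y] assms by (auto simp: has_field_derivative_at_within)

text \<open>A value of size \<open>e\<close> far out forces values of size \<open>e / 2\<close> on
  an interval of radius \<open>d\<close> around it. The norm \<open>p\<close> of such a plateau is
  fixed, whereas the tails of \<open>f\<close> have arbitrarily small norm.\<close>

lemma Lipschitz_L2_vanishes:
  fixes f :: "real \<Rightarrow> real"
  assumes f: "f \<in> L2" and L: "\<And>x y. \<bar>f x - f y\<bar> \<le> L * \<bar>x - y\<bar>" and e: "0 < e"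
  shows "\<exists>R. \<forall>x. R < \<bar>x\<bar> \<longrightarrow> \<bar>f x\<bar> < e"
proof -
  note [measurable] = L2_measurable[OF f]
  have L0: "0 \<le> L" using order_trans[OF abs_ge_zero L[of 1 0]] by simp
  define d where "d = e / (2 * (L + 1))"
  have d: "0 < d" "L * d \<le> e / 2"
    using e L0 by (auto simp: d_def field_simps)
  define p where "p = e / 2 * sqrt (2 * d)"
  have p: "0 < p" using e d by (simp add: p_def)
  from LIMSEQ_D[OF L2_norm_trunc_diff[OF f] p] obtain n where
    n: "L2_norm (\<lambda>x. trunc n f x - f x) < p" by auto
  have "\<bar>f x\<bar> < e" if x: "real n + d < \<bar>x\<bar>" for x
  proof (rule ccontr)
    assume "\<not> \<bar>f x\<bar> < e"
    define g where "g = (\<lambda>y. (e / 2) *\<^sub>R indicator {x-d..x+d} y :: real)"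
    have le: "norm (g y) \<le> norm (trunc n f y - f y)" for y
    proof (cases "y \<in> {x-d..x+d}")
      case True
      then have y: "\<bar>x - y\<bar> \<le> d" by auto
      then have "real n < \<bar>y\<bar>" using x by auto
      then have t: "trunc n f y = 0" by (auto simp: trunc_def indicator_def)
      have "\<bar>f x - f y\<bar> \<le> L * d" using L[of x y] mult_left_mono[OF y L0] by linarith
      then have "e / 2 \<le> \<bar>f y\<bar>" using d(2) \<open>\<not> \<bar>f x\<bar> < e\<close> by linarith
      then show ?thesis using True e by (simp add: g_def t)
    qed (simp add: g_def)
    have [measurable]: "g \<in> borel_measurable borel" unfolding g_def by measurable
    have "L2_norm g \<le> L2_norm (\<lambda>x. trunc n f x - f x)"
      by (rule L2_dominated(2)[OF L2_diff[OF trunc_L2(1)[OF f] f]]) (use le in auto)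
    moreover have "L2_norm g = p"
    proof -
      have "(\<lambda>y. (norm (indicator {x-d..x+d} y :: real))\<^sup>2) = (indicator {x-d..x+d} :: real \<Rightarrow> real)"
        by (auto simp: indicator_def)
      then have "L2_norm (indicator {x-d..x+d} :: real \<Rightarrow> real) = sqrt (2 * d)"
        using d by (simp add: L2_norm_def)
      then show ?thesis using e unfolding g_def L2_norm_scaleR p_def by simp
    qed
    ultimately show False using n by simp
  qed
  then show ?thesis by blast
qed

lemma rift_L2:
  assumes "integrable lborel a" "a \<in> L2"
  shows "rift a \<in> L2"
proof (rule L2_dominated(1)[OF ift_L2(1)[OF assms]])
  have [measurable]: "ift a \<in> borel_measurable borel" "Re \<in> borel_measurable borel"
    using assms by (auto intro!: L2_measurable borel_measurable_continuous_onI continuous_intros)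
  show "rift a \<in> borel_measurable borel" unfolding rift_def[abs_def] by measurable
qed (auto simp: rift_def abs_Re_le_cmod)

lemma rift_Hs_bounds:
  assumes "a \<in> Hs s" "1 \<le> s"
  shows "\<bar>rift a x\<bar> \<le> Hn s a"
proof -
  have "\<bar>rift a x\<bar> \<le> (sqrt pi * Hn s a) / (2 * pi)"
    by (rule order_trans[OF abs_rift_le divide_right_mono[OF Hs_L1(2)]]) (use assms in auto)
  also have "\<dots> \<le> Hn s a"
  proof -
    have "sqrt pi \<le> 2 * pi" using pi_gt3 real_sqrt_le_mono[of pi "pi * pi"] by (simp add: real_sqrt_mult)
    from mult_right_mono[OF this Hn_nonneg[of s a]] show ?thesis by (simp add: field_simps)
  qed
  finally show ?thesis .
qed

lemma rift_dx_Hs_bounds: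
  assumes "a \<in> Hs s" "2 \<le> s"
  shows "\<bar>rift (dx a) x\<bar> \<le> Hn s a"
  using rift_Hs_bounds[OF dx_Hs'(1)[OF assms(1)], of x] dx_Hs'(2)[OF assms(1)] assms(2) by simp

lemma rift_Lipschitz:
  assumes "a \<in> Hs s" "2 \<le> s"
  shows "\<bar>rift a x - rift a y\<bar> \<le> Hn s a * \<bar>x - y\<bar>"
  by (rule Lipschitz_DERIV_bound[OF DERIV_rift_Hs[OF assms] rift_dx_Hs_bounds[OF assms]])

lemma rift_vanishes:
  assumes "a \<in> Hs s" "2 \<le> s" "0 < e"
  shows "\<exists>R. \<forall>x. R < \<bar>x\<bar> \<longrightarrow> \<bar>rift a x\<bar> < e"
proof (rule Lipschitz_L2_vanishes[OF rift_L2 rift_Lipschitz[OF assms(1,2)] assms(3)])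
  show "integrable lborel a" "a \<in> L2" using assms Hs_integrable[OF assms(1)] Hs_L2(1)[OF _ assms(1)] by auto
qed

section \<open>The nonlocal term on the physical side\<close>

abbreviation kmult :: "real \<Rightarrow> real \<Rightarrow> (real \<Rightarrow> complex) \<Rightarrow> real \<Rightarrow> complex" where
  "kmult B b a \<equiv> (\<lambda>\<xi>. of_real (fw_kernel B b \<xi>) * a \<xi>)"

text \<open>The function \<open>ift a\<close> need not be integrable, so \<open>ft_conv\<close> does
  not apply to it. The shifted kernel is integrable, its transform is \<open>fw_kernel\<close> up to
  a phase, and \<open>ft_duality\<close> moves the transform onto it.\<close>

lemma ift_kernel_conv:
  assumes a: "integrable lborel a" and b: "0 < b"
  shows "(\<integral>y. of_real (B * exp (- b * \<bar>x - y\<bar>)) * ift a y \<partial>lborel) = ift (kmult B b a) x"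
proof -
  define E where "E = (\<lambda>y. complex_of_real (exp (- (b * \<bar>y\<bar>))))"
  define g where "g = (\<lambda>y. complex_of_real (B * exp (- b * \<bar>x + y\<bar>)))"
  have Ei: "integrable lborel E" using exp_abs_integrable[OF b] by (simp add: E_def)
  have gE: "g = (\<lambda>y. of_real B * E (y - (- x)))" by (auto simp: g_def E_def add.commute)
  have gi: "integrable lborel g"
    unfolding gE using integrable_shift[of E "-x"] Ei by simp
  have ftg: "ft g \<xi> = cis (x * \<xi>) * of_real (fw_kernel B b \<xi>)" for \<xi>
  proof -
    have "ft g \<xi> = (\<integral>y. cis (- ((y - (- x)) * \<xi>) + x * \<xi>) * (of_real B * E (y - (- x))) \<partial>lborel)"
      unfolding ft_def gE by (simp add: algebra_simps)
    also have "\<dots> = (\<integral>y. cis (- (y * \<xi>) + x * \<xi>) * (of_real B * E y) \<partial>lborel)"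
      by (rule integral_shift[of "\<lambda>y. cis (- (y * \<xi>) + x * \<xi>) * (of_real B * E y)"])
    also have "\<dots> = (\<integral>y. (cis (x * \<xi>) * of_real B) * (cis (- (y * \<xi>)) * E y) \<partial>lborel)"
      by (simp only: cis_mult[symmetric] mult_ac)
    also have "\<dots> = (cis (x * \<xi>) * of_real B) * ft E \<xi>" by (simp add: ft_def)
    also have "\<dots> = cis (x * \<xi>) * of_real (fw_kernel B b \<xi>)"
      unfolding E_def ft_exp_abs[OF b] fw_kernel_def by simp
    finally show ?thesis .
  qed
  have "(\<integral>y. of_real (B * exp (- b * \<bar>x - y\<bar>)) * ift a y \<partial>lborel)
      = (\<integral>y. g (- y) * (ft a (- y) / (2 * pi)) \<partial>lborel)"
    by (simp add: g_def ift_eq_ft)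
  also have "\<dots> = (\<integral>y. g y * (ft a y / (2 * pi)) \<partial>lborel)"
    by (rule integral_reflect[of "\<lambda>y. g y * (ft a y / (2 * pi))"])
  also have "\<dots> = (\<integral>y. ft a y * g y \<partial>lborel) / (2 * pi)"
    by (simp add: mult.commute)
  also have "(\<integral>y. ft a y * g y \<partial>lborel) = (\<integral>\<xi>. a \<xi> * ft g \<xi> \<partial>lborel)"
    by (rule ft_duality[OF a gi])
  finally show ?thesis unfolding ftg ift_def by (simp add: mult_ac)
qed

lemma rift_kernel_conv:
  assumes a: "integrable lborel a" and b: "0 < b"
  shows "integrable lborel (\<lambda>y. B * exp (- b * \<bar>x - y\<bar>) * rift a y)"
    and "(\<integral>y. B * exp (- b * \<bar>x - y\<bar>) * rift a y \<partial>lborel) = rift (kmult B b a) x"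
proof -
  have i: "integrable lborel (\<lambda>y. ift a y * of_real (B * exp (- b * \<bar>x - y\<bar>)))"
  proof (rule integrable_bounded_mult)
    have "integrable lborel (\<lambda>y. exp (- (b * \<bar>x - y\<bar>)))"
      using integrable_reflect_shift[of "\<lambda>y. exp (- (b * \<bar>y\<bar>))" x] exp_abs_integrable[OF b] by simp
    then show "integrable lborel (\<lambda>y. complex_of_real (B * exp (- b * \<bar>x - y\<bar>)))" by simp
    show "ift a \<in> borel_measurable borel" using borel_measurable_integrable[OF a] by (intro ift_measurable) simp
  qed (rule norm_ift_le)
  have eq: "Re (of_real (B * exp (- b * \<bar>x - y\<bar>)) * ift a y) = B * exp (- b * \<bar>x - y\<bar>) * rift a y" for y
    by (simp add: rift_def)
  have i': "integrable lborel (\<lambda>y. of_real (B * exp (- b * \<bar>x - y\<bar>)) * ift a y)"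
    using i by (simp add: mult.commute)
  show "integrable lborel (\<lambda>y. B * exp (- b * \<bar>x - y\<bar>) * rift a y)"
    using Bochner_Integration.integrable_Re[OF i'] by (simp only: eq)
  have "rift (kmult B b a) x = Re (\<integral>y. of_real (B * exp (- b * \<bar>x - y\<bar>)) * ift a y \<partial>lborel)"
    using ift_kernel_conv[OF a b] by (simp add: rift_def)
  also have "\<dots> = (\<integral>y. Re (of_real (B * exp (- b * \<bar>x - y\<bar>)) * ift a y) \<partial>lborel)"
    by (rule Bochner_Integration.integral_Re[OF i', symmetric])
  finally show "(\<integral>y. B * exp (- b * \<bar>x - y\<bar>) * rift a y \<partial>lborel) = rift (kmult B b a) x" by (simp only: eq)
qed

text \<open>Here \<open>2 * B / b\<close> is the mass of the kernel.\<close>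

lemma rift_kmult_sup:
  assumes a: "integrable lborel a" and b: "0 < b" "0 \<le> B" and U: "\<And>y. \<bar>rift a y\<bar> \<le> U"
  shows "\<bar>rift (kmult B b a) x\<bar> \<le> 2 * B / b * U"
proof -
  have ei: "integrable lborel (\<lambda>y. exp (- (b * \<bar>x - y\<bar>)))"
    using integrable_reflect_shift[of "\<lambda>y. exp (- (b * \<bar>y\<bar>))" x] exp_abs_integrable[OF b(1)] by simp
  have "\<bar>rift (kmult B b a) x\<bar> \<le> (\<integral>y. \<bar>B * exp (- b * \<bar>x - y\<bar>) * rift a y\<bar> \<partial>lborel)"
    unfolding rift_kernel_conv(2)[OF a b(1), symmetric] by (rule integral_abs_bound)
  also have "\<dots> \<le> (\<integral>y. B * U * exp (- (b * \<bar>x - y\<bar>)) \<partial>lborel)"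
  proof (rule integral_mono)
    show "\<bar>B * exp (- b * \<bar>x - y\<bar>) * rift a y\<bar> \<le> B * U * exp (- (b * \<bar>x - y\<bar>))" for y
      using mult_left_mono[OF U[of y], of "B * exp (- (b * \<bar>x - y\<bar>))"] b by (simp add: abs_mult mult_ac)
  qed (use ei rift_kernel_conv(1)[OF a b(1), of B x] in auto)
  also have "\<dots> = B * U * (\<integral>y. exp (- (b * \<bar>x - y\<bar>)) \<partial>lborel)" by simp
  also have "(\<integral>y. exp (- (b * \<bar>x - y\<bar>)) \<partial>lborel) = 2 / b"
    using integral_reflect_shift[of "\<lambda>y. exp (- (b * \<bar>y\<bar>))" x] integral_exp_abs[OF b(1)] by simp
  finally show ?thesis by (simp add: mult_ac)
qed

lemma integral_Poisson:
  assumes b: "0 < b"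
  shows "integrable lborel (\<lambda>\<xi>::real. 1 / (b\<^sup>2 + \<xi>\<^sup>2))" "(\<integral>\<xi>. 1 / (b\<^sup>2 + (\<xi>::real)\<^sup>2) \<partial>lborel) = pi / b"
proof -
  have eq: "1 / (b\<^sup>2 + (b * k)\<^sup>2) = (1 / b\<^sup>2) * (1 / (1 + k\<^sup>2))" for k
  proof -
    have "b\<^sup>2 + (b * k)\<^sup>2 = b\<^sup>2 * (1 + k\<^sup>2)" by (simp add: power_mult_distrib distrib_left)
    then show ?thesis by simp
  qed
  show "integrable lborel (\<lambda>\<xi>::real. 1 / (b\<^sup>2 + \<xi>\<^sup>2))"
    using lborel_integrable_real_affine_iff[of b "\<lambda>\<xi>. 1 / (b\<^sup>2 + \<xi>\<^sup>2)" 0] b integrable_mult_right[OF has_integral_arctan(1), of "1 / b\<^sup>2"]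
    by (simp only: eq add_0)
  have "(\<integral>\<xi>. 1 / (b\<^sup>2 + (\<xi>::real)\<^sup>2) \<partial>lborel) = b * (\<integral>k. (1 / b\<^sup>2) * (1 / (1 + k\<^sup>2)) \<partial>lborel)"
    using lborel_integral_real_affine[of b "\<lambda>\<xi>. 1 / (b\<^sup>2 + \<xi>\<^sup>2)" 0] b
    by (simp only: eq add_0 real_scaleR_def abs_of_pos)
  also have "(\<integral>k. (1 / b\<^sup>2) * (1 / (1 + k\<^sup>2)) \<partial>lborel) = (1 / b\<^sup>2) * pi"
    by (subst integral_mult_right_zero) (simp only: has_integral_arctan(2))
  finally show "(\<integral>\<xi>. 1 / (b\<^sup>2 + (\<xi>::real)\<^sup>2) \<partial>lborel) = pi / b" using b by (simp add: power2_eq_square)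
qed

text \<open>The symbol \<open>g\<close> of the differentiated kernel is square-integrable, as
  \<open>g\<close> squared is at most \<open>(2 * B * b)^2 / (b^2 + \<xi>^2)\<close>, of mass
  \<open>4 * pi * B^2 * b\<close>. The bound involves only the \<open>L2\<close> norm, which will be
  conserved, and it tends to 0 with \<open>B\<close> or \<open>b\<close>.\<close>

lemma rift_dx_kmult_sup:
  assumes a: "a \<in> L2" and b: "0 < b" "0 \<le> B"
  shows "\<bar>rift (dx (kmult B b a)) x\<bar> \<le> B * sqrt b * L2_norm a"
proof -
  define g where "g = (\<lambda>\<xi>. 2 * B * b * (\<xi> / (b\<^sup>2 + \<xi>\<^sup>2)))"
  have pos: "0 < b\<^sup>2 + \<xi>\<^sup>2" for \<xi> using b by (simp add: add_pos_nonneg)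
  have gle: "(norm (g \<xi>))\<^sup>2 \<le> (2 * B * b)\<^sup>2 * (1 / (b\<^sup>2 + \<xi>\<^sup>2))" for \<xi>
  proof -
    have "\<xi>\<^sup>2 / (b\<^sup>2 + \<xi>\<^sup>2)\<^sup>2 \<le> (b\<^sup>2 + \<xi>\<^sup>2) / (b\<^sup>2 + \<xi>\<^sup>2)\<^sup>2" by (intro divide_right_mono) auto
    also have "\<dots> = 1 / (b\<^sup>2 + \<xi>\<^sup>2)" using pos[of \<xi>] by (simp add: power2_eq_square)
    finally show ?thesis unfolding g_def real_norm_def power2_abs power_mult_distrib[of "2 * B * b"] power_divide
      by (intro mult_left_mono) auto
  qed
  note pi' = integral_Poisson[OF b(1)]
  have [measurable]: "g \<in> borel_measurable borel" unfolding g_def by measurable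
  have gi: "integrable lborel (\<lambda>\<xi>. (norm (g \<xi>))\<^sup>2)"
    by (rule Bochner_Integration.integrable_bound[OF integrable_mult_right[OF pi'(1), of "(2 * B * b)\<^sup>2"]])
       (use gle in \<open>auto intro!: AE_I2 order_trans[OF _ abs_ge_self]\<close>)
  have g: "g \<in> L2" by (rule L2_I[OF _ gi]) measurable
  have "(L2_norm g)\<^sup>2 \<le> (\<integral>\<xi>. (2 * B * b)\<^sup>2 * (1 / (b\<^sup>2 + \<xi>\<^sup>2)) \<partial>lborel)"
    unfolding L2_norm_sq by (intro integral_mono gi integrable_mult_right pi' gle)
  also have "\<dots> = (2 * B * b)\<^sup>2 * (pi / b)" by (subst integral_mult_right_zero) (simp only: pi'(2))
  also have "\<dots> = (2 * B * sqrt (pi * b))\<^sup>2" using b by (simp add: power_mult_distrib power2_eq_square)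
  finally have gn: "L2_norm g \<le> 2 * B * sqrt (pi * b)" by (rule power2_le_imp_le) (use b in simp)
  have "\<bar>rift (dx (kmult B b a)) x\<bar> \<le> (\<integral>\<xi>. norm (dx (kmult B b a) \<xi>) \<partial>lborel) / (2 * pi)"
    by (rule abs_rift_le)
  also have "(\<integral>\<xi>. norm (dx (kmult B b a) \<xi>) \<partial>lborel) = (\<integral>\<xi>. norm (g \<xi>) * norm (a \<xi>) \<partial>lborel)"
    by (intro Bochner_Integration.integral_cong refl, simp only: norm_dx norm_mult norm_of_real)
       (simp add: g_def fw_kernel_def abs_mult)
  also have "\<dots> \<le> L2_norm g * L2_norm a" by (rule L2_Cauchy_Schwarz(2)[OF g a])
  also have "\<dots> \<le> (2 * B * sqrt (pi * b)) * L2_norm a" by (intro mult_right_mono gn) simp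
  finally have "\<bar>rift (dx (kmult B b a)) x\<bar> \<le> (2 * B * sqrt (pi * b)) * L2_norm a / (2 * pi)"
    by (simp add: divide_right_mono)
  also have "\<dots> = (B * sqrt b * L2_norm a) / sqrt pi"
    by (simp add: real_sqrt_mult field_simps)
  also have "\<dots> \<le> (B * sqrt b * L2_norm a) / 1"
    using pi_gt3 b by (intro divide_left_mono) auto
  finally show ?thesis by simp
qed

text \<open>The kernel is a fundamental solution: applying \<open>b^2\<close> minus the second
  derivative to it gives \<open>2 * B * b\<close> times the Dirac mass. So two derivatives of the
  nonlocal term are bounded by the function itself.\<close>

lemma rift_dx_dx_kmult:
  assumes a: "integrable lborel a" and b: "0 < b" "0 \<le> B"
  shows "rift (dx (dx (kmult B b a))) x = b\<^sup>2 * rift (kmult B b a) x - 2 * B * b * rift a x"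
proof -
  have ki: "integrable lborel (kmult B b a)"
    by (rule integrable_bounded_mult[OF a, where C = "2 * B / b"]) (use fw_kernel_bounds[OF b] in auto)
  have "dx (dx (kmult B b a)) \<xi> = of_real (b\<^sup>2) * kmult B b a \<xi> - of_real (2 * B * b) * a \<xi>" for \<xi>
  proof -
    have "0 < b\<^sup>2 + \<xi>\<^sup>2" using b by (simp add: add_pos_nonneg)
    then have "(b\<^sup>2 + \<xi>\<^sup>2) * fw_kernel B b \<xi> = 2 * B * b" by (simp add: fw_kernel_def)
    then have "- (\<xi>\<^sup>2) * fw_kernel B b \<xi> = b\<^sup>2 * fw_kernel B b \<xi> - 2 * B * b"
      by (simp add: algebra_simps)
    then have "of_real (- (\<xi>\<^sup>2) * fw_kernel B b \<xi>) * a \<xi> = of_real (b\<^sup>2 * fw_kernel B b \<xi> - 2 * B * b) * a \<xi>" by simp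
    moreover have "dx (dx (kmult B b a)) \<xi> = of_real (- (\<xi>\<^sup>2) * fw_kernel B b \<xi>) * a \<xi>"
      by (simp add: dx_def power2_eq_square mult_ac)
    ultimately show ?thesis by (simp add: left_diff_distrib)
  qed
  then have "rift (dx (dx (kmult B b a))) x = rift (\<lambda>\<xi>. of_real (b\<^sup>2) * kmult B b a \<xi> - of_real (2 * B * b) * a \<xi>) x"
    by presburger
  also have "\<dots> = b\<^sup>2 * rift (kmult B b a) x - 2 * B * b * rift a x"
    using ki a by (subst rift_diff) (simp_all only: integrable_mult_right rift_cmult)
  finally show ?thesis .
qed

lemma rift_conv_self:
  assumes "integrable lborel a" "realv a"
  shows "rift (\<lambda>\<xi>. conv a a \<xi> / (4 * pi)) x = (rift a x)\<^sup>2 / 2"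
proof -
  have "ift (\<lambda>\<xi>. (1 / (4 * pi)) * conv a a \<xi>) x = (1 / (4 * pi)) * (2 * pi * (ift a x * ift a x))"
    by (simp only: ift_cmult ift_conv[OF assms(1,1)])
  also have "\<dots> = of_real ((rift a x)\<^sup>2 / 2)"
    by (simp add: realv_ift[OF assms(2)] power2_eq_square)
  finally have "ift (\<lambda>\<xi>. conv a a \<xi> / (4 * pi)) x = of_real ((rift a x)\<^sup>2 / 2)" by simp
  then show ?thesis unfolding rift_def[of "\<lambda>\<xi>. conv a a \<xi> / (4 * pi)"] by (simp only: Re_complex_of_real)
qed

lemma conv_self_Hs: "1 \<le> s \<Longrightarrow> a \<in> Hs s \<Longrightarrow> (\<lambda>\<xi>. conv a a \<xi> / (4 * pi)) \<in> Hs s"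
  using Hs_divide[OF conv_Hs(1), of s a a "4 * pi"] by simp

text \<open>The product rule is read off on the physical side: half the square of
  \<open>rift a\<close> is differentiated both through its transform and directly, and derivatives
  are unique.\<close>

lemma rift_rhs:
  assumes a: "a \<in> Hs s" "2 \<le> s" "realv a" and b: "0 < b" "0 \<le> B"
  shows "rift (rhs B b a) x = - (rift a x * rift (dx a) x + rift (dx (kmult B b a)) x)"
proof -
  define q where "q = (\<lambda>\<xi>. conv a a \<xi> / (4 * pi))"
  have q: "q \<in> Hs s" unfolding q_def using a by (intro conv_self_Hs) auto
  have k: "kmult B b a \<in> Hs s" by (rule kernel_Hs[OF b a(1)])
  have rq: "rift q = (\<lambda>x. (rift a x)\<^sup>2 / 2)"
    unfolding q_def using rift_conv_self[OF Hs_integrable[OF a(1)] a(3)] a(2) by auto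
  have "DERIV (rift q) x :> rift (dx q) x" by (rule DERIV_rift_Hs[OF q a(2)])
  moreover have "DERIV (rift q) x :> rift a x * rift (dx a) x"
    unfolding rq by (auto intro!: derivative_eq_intros DERIV_rift_Hs[OF a(1,2)])
  ultimately have dq: "rift (dx q) x = rift a x * rift (dx a) x" by (rule DERIV_unique)
  have "rhs B b a = (\<lambda>\<xi>. - (dx q \<xi> + dx (kmult B b a) \<xi>))"
    by (auto simp: rhs_def dx_def q_def distrib_left)
  then have "rift (rhs B b a) x = - (rift (dx q) x + rift (dx (kmult B b a)) x)"
    using dx_integrable[OF q a(2)] dx_integrable[OF k a(2)] by (simp only: rift_uminus rift_add)
  then show ?thesis by (simp add: dq)
qed

text \<open>The threshold 3 enters here: the right-hand side has order \<open>s - 1\<close> and must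
  still be differentiable pointwise, which takes order 2.\<close>

lemma rift_dx_rhs:
  assumes a: "a \<in> Hs s" "3 \<le> s" "realv a" and b: "0 < b" "0 \<le> B"
  shows "rift (dx (rhs B b a)) x
    = - ((rift (dx a) x)\<^sup>2 + rift a x * rift (dx (dx a)) x + rift (dx (dx (kmult B b a))) x)"
proof -
  have s: "2 \<le> s" "2 \<le> s - 1" using a by auto
  have r: "rhs B b a \<in> Hs (s - 1)" using a by (intro rhs_Hs b) auto
  have k: "dx (kmult B b a) \<in> Hs (s - 1)" by (intro dx_Hs' kernel_Hs b a)
  note d = dx_Hs'(1)[OF a(1)]
  have "DERIV (rift (rhs B b a)) x :> rift (dx (rhs B b a)) x"
    by (rule DERIV_rift_Hs[OF r s(2)])
  moreover have "rift (rhs B b a) = (\<lambda>x. - (rift a x * rift (dx a) x + rift (dx (kmult B b a)) x))"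
    using rift_rhs[OF a(1) s(1) a(3) b] by auto
  moreover have "DERIV (\<lambda>x. - (rift a x * rift (dx a) x + rift (dx (kmult B b a)) x)) x :>
     - ((rift (dx a) x)\<^sup>2 + rift a x * rift (dx (dx a)) x + rift (dx (dx (kmult B b a))) x)"
    by (auto intro!: derivative_eq_intros DERIV_rift_Hs[OF a(1) s(1)] DERIV_rift_Hs[OF d s(2)] DERIV_rift_Hs[OF k s(2)]
        simp: power2_eq_square)
  ultimately show ?thesis using DERIV_unique by metis
qed

section \<open>The equation on the Fourier side\<close>

lemma realv_add: "integrable lborel a \<Longrightarrow> integrable lborel b \<Longrightarrow> realv a \<Longrightarrow> realv b \<Longrightarrow> realv (\<lambda>\<xi>. a \<xi> + b \<xi>)"
  by (simp add: realv_def ift_add)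

lemma realv_diff: "integrable lborel a \<Longrightarrow> integrable lborel b \<Longrightarrow> realv a \<Longrightarrow> realv b \<Longrightarrow> realv (\<lambda>\<xi>. a \<xi> - b \<xi>)"
  by (simp add: realv_def ift_diff)

lemma realv_cmult: "realv a \<Longrightarrow> realv (\<lambda>\<xi>. of_real c * a \<xi>)"
  by (simp add: realv_def ift_cmult)

lemma realv_kmult:
  assumes "integrable lborel a" "0 < b" "realv a"
  shows "realv (kmult B b a)"
  unfolding realv_def
proof
  fix x
  have "ift (kmult B b a) x = (\<integral>y. of_real (B * exp (- b * \<bar>x - y\<bar>) * rift a y) \<partial>lborel)"
    unfolding ift_kernel_conv[OF assms(1,2), symmetric] by (simp add: realv_ift[OF assms(3)])
  also have "\<dots> = of_real (\<integral>y. B * exp (- b * \<bar>x - y\<bar>) * rift a y \<partial>lborel)"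
    by (rule integral_complex_of_real)
  finally show "Im (ift (kmult B b a) x) = 0" by simp
qed

lemma realv_conv:
  assumes "integrable lborel a" "integrable lborel b" "realv a" "realv b"
  shows "realv (conv a b)"
  using assms by (simp add: realv_def ift_conv)

lemma realv_rhs:
  assumes a: "a \<in> Hs s" "2 \<le> s" "realv a" and b: "0 < b" "0 \<le> B"
  shows "realv (rhs B b a)"
proof -
  have ai: "integrable lborel a" using a by (intro Hs_integrable) auto
  define q where "q = (\<lambda>\<xi>. conv a a \<xi> / (4 * pi) + kmult B b a \<xi>)"
  have q: "q \<in> Hs s" unfolding q_def using a by (intro Hs_add conv_self_Hs kernel_Hs b) auto
  have "realv (\<lambda>\<xi>. of_real (1 / (4 * pi)) * conv a a \<xi>)"
    by (intro realv_cmult realv_conv ai a)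
  then have "realv (\<lambda>\<xi>. conv a a \<xi> / (4 * pi))" by simp
  moreover have "integrable lborel (\<lambda>\<xi>. conv a a \<xi> / (4 * pi))" "integrable lborel (kmult B b a)"
    using a Hs_integrable[OF conv_self_Hs[OF _ a(1)]] Hs_integrable[OF kernel_Hs(1)[OF b a(1)]] by simp_all
  ultimately have "realv q"
    unfolding q_def by (intro realv_add realv_kmult ai b a) auto
  then have "realv (dx q)" by (rule realv_dx_Hs[OF q a(2)])
  from realv_cmult[OF this, of "-1"] show ?thesis by (simp add: rhs_def[abs_def] q_def)
qed

section \<open>Transfer between Sobolev functions and their transforms\<close>

lemma Hs_cong_AE:
  assumes "AE \<xi> in lborel. a \<xi> = b \<xi>" "a \<in> Hs s" "b \<in> borel_measurable borel"
  shows "b \<in> Hs s"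
proof -
  have "AE \<xi> in lborel. wa s a \<xi> = wa s b \<xi>" using assms(1) by eventually_elim (simp add: wa_def)
  from L2_cong_AE[OF this _ wa_measurable[OF assms(3)]] show ?thesis using assms(2) by (simp add: Hs_def)
qed

lemma Hn_cong_AE:
  assumes "AE \<xi> in lborel. a \<xi> = b \<xi>" "a \<in> borel_measurable borel" "b \<in> borel_measurable borel"
  shows "Hn s a = Hn s b"
  unfolding Hn_def by (rule L2_norm_cong_AE) (use assms in \<open>auto simp: wa_def\<close>)

lemma sobolev_weighted_eq: "sobolev_weighted s f = wa s (fourier_transform f)"
  by (simp add: sobolev_weighted_def wa_def wt_def fun_eq_iff)

lemma sobolev_iff: "f \<in> sobolev s \<longleftrightarrow> f \<in> L2 \<and> fourier_transform f \<in> Hs s"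
  by (simp add: sobolev_def sobolev_weighted_eq Hs_def)

lemma sobolev_norm_eq: "sobolev_norm s f = Hn s (fourier_transform f)"
  by (simp add: sobolev_norm_def sobolev_weighted_eq Hn_def)

lemma has_ft_rift:
  assumes "a \<in> Hs s" "1 \<le> s" "realv a"
  shows "rift a \<in> L2" "has_ft (\<lambda>x. of_real (rift a x)) a"
proof -
  have a: "integrable lborel a" "a \<in> L2" using Hs_integrable[OF assms(1,2)] Hs_L2(1)[OF _ assms(1)] assms(2) by auto
  show "rift a \<in> L2" by (rule rift_L2[OF a])
  show "has_ft (\<lambda>x. of_real (rift a x)) a"
    using has_ft_ift[OF a] by (simp add: realv_ift[OF assms(3), symmetric])
qed

lemma fourier_transform_rift:
  assumes "a \<in> Hs s" "1 \<le> s" "realv a"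
  shows "AE \<xi> in lborel. fourier_transform (rift a) \<xi> = a \<xi>"
  by (rule fourier_transform_AE_eq[OF has_ft_rift[OF assms]])

lemma rift_sobolev:
  assumes "a \<in> Hs s" "1 \<le> s" "realv a"
  shows "rift a \<in> sobolev s" "sobolev_norm s (rift a) = Hn s a"
proof -
  note ae = fourier_transform_rift[OF assms]
  have m: "fourier_transform (rift a) \<in> borel_measurable borel" "a \<in> borel_measurable borel"
    using fourier_transform_L2[OF has_ft_rift(1)[OF assms]] L2_measurable Hs_measurable[OF assms(1)] by auto
  show "rift a \<in> sobolev s"
    unfolding sobolev_iff using has_ft_rift(1)[OF assms] ae Hs_cong_AE[OF _ assms(1) m(1)] by (auto simp: eq_commute)
  show "sobolev_norm s (rift a) = Hn s a"
    unfolding sobolev_norm_eq by (rule Hn_cong_AE[OF ae m])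
qed

lemma sobolev_eq_rift_AE:
  assumes "f \<in> sobolev s" "1 \<le> s"
  shows "AE x in lborel. of_real (f x) = ift (fourier_transform f) x"
  using assms has_ft_imp_eq_ift[OF _ has_ft_fourier_transform Hs_integrable[OF _ assms(2)]]
  by (simp add: sobolev_iff)

lemma ift_continuous:
  assumes "integrable lborel a"
  shows "continuous_on UNIV (ift a)"
  unfolding continuous_on_eq_continuous_at[OF open_UNIV] isCont_def tendsto_at_iff_sequentially o_def
proof (intro ballI allI impI)
  fix x :: real and X :: "nat \<Rightarrow> real" assume "\<forall>i. X i \<in> UNIV - {x}" and X: "X \<longlonglongrightarrow> x"
  note [measurable] = borel_measurable_integrable[OF assms]
  have "(\<lambda>n. \<integral>\<xi>. cis (X n * \<xi>) * a \<xi> \<partial>lborel) \<longlonglongrightarrow> (\<integral>\<xi>. cis (x * \<xi>) * a \<xi> \<partial>lborel)"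
    by (rule integral_dominated_convergence[where w = "\<lambda>\<xi>. norm (a \<xi>)"])
       (use assms X in \<open>auto simp: norm_mult intro!: AE_I2 tendsto_intros isCont_tendsto_compose[where g = cis] continuous_intros\<close>)
  then show "(\<lambda>n. ift a (X n)) \<longlonglongrightarrow> ift a x" unfolding ift_def by (intro tendsto_intros) auto
qed

lemma continuous_AE_eq:
  fixes f g :: "real \<Rightarrow> complex"
  assumes f: "continuous_on UNIV f" and g: "continuous_on UNIV g" and ae: "AE x in lborel. f x = g x"
  shows "f x = g x"
proof (rule ccontr)
  assume "f x \<noteq> g x"
  have o: "open {x. f x \<noteq> g x}" by (rule open_Collect_neq[OF f g])
  then obtain e where e: "0 < e" "ball x e \<subseteq> {x. f x \<noteq> g x}"
    using \<open>f x \<noteq> g x\<close> open_contains_ball by blast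
  have "AE y in lborel. y \<notin> ball x e" using ae by eventually_elim (use e in auto)
  then have "emeasure lborel (ball x e) = 0"
    by (subst (asm) AE_iff_measurable[of "ball x e"]) auto
  moreover have "emeasure lborel (ball x e) = ennreal (2 * e)"
    using e by (simp add: ball_eq_greaterThanLessThan)
  ultimately show False using e by simp
qed

text \<open>Both \<open>f\<close> and its inverse transform are continuous representatives of one
  class, hence equal everywhere.\<close>

lemma sobolev_continuous_eq_rift:
  assumes f: "f \<in> sobolev s" "1 \<le> s" and c: "continuous_on UNIV f"
  shows "realv (fourier_transform f)" "f = rift (fourier_transform f)"
proof -
  have i: "integrable lborel (fourier_transform f)"
    using f Hs_integrable by (auto simp: sobolev_iff)
  have eq: "ift (fourier_transform f) x = of_real (f x)" for x
    by (rule continuous_AE_eq[OF _ ift_continuous[OF i] sobolev_eq_rift_AE[OF f], symmetric]) (intro continuous_intros c)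
  show "realv (fourier_transform f)" by (simp add: realv_def eq)
  show "f = rift (fourier_transform f)" by (simp add: rift_def eq fun_eq_iff)
qed

text \<open>The equation as an ordinary differential equation for transforms, with values in
  \<open>Hs (s - 1)\<close>. Continuity of the time derivative follows from that of \<open>a\<close>
  by \<open>rhs_diff_Hs\<close>. An arbitrary set of times serves both half-open and closed
  intervals.\<close>

definition spec_solution :: "real \<Rightarrow> real \<Rightarrow> real \<Rightarrow> real set \<Rightarrow> (real \<Rightarrow> real \<Rightarrow> complex) \<Rightarrow> bool" where
  "spec_solution s B b I a \<longleftrightarrow> (\<forall>t\<in>I. a t \<in> Hs s \<and> realv (a t)) \<and>
    (\<forall>t\<in>I. ((\<lambda>r. Hn s (\<lambda>\<xi>. a r \<xi> - a t \<xi>)) \<longlongrightarrow> 0) (at t within I)) \<and>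
    (\<forall>t\<in>I. ((\<lambda>r. Hn (s - 1) (\<lambda>\<xi>. (a r \<xi> - a t \<xi>) / of_real (r - t) - rhs B b (a t) \<xi>)) \<longlongrightarrow> 0) (at t within I))"

text \<open>Transforms are chosen by \<open>SOME\<close>, so the identity can hold only up to a null
  set.\<close>

lemma fourier_transform_linear:
  assumes "f \<in> L2" "g \<in> L2"
  shows "AE \<xi> in lborel. fourier_transform (\<lambda>x. c * f x + d * g x) \<xi> = of_real c * fourier_transform f \<xi> + of_real d * fourier_transform g \<xi>"
proof (rule fourier_transform_AE_eq)
  show "(\<lambda>x. c * f x + d * g x) \<in> L2"
    using L2_add(1)[OF L2_scaleR[OF assms(1), of c] L2_scaleR[OF assms(2), of d]] by simp
  show "has_ft (\<lambda>x. of_real (c * f x + d * g x)) (\<lambda>\<xi>. of_real c * fourier_transform f \<xi> + of_real d * fourier_transform g \<xi>)"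
    using has_ft_linear[OF _ _ has_ft_fourier_transform[OF assms(1)] has_ft_fourier_transform[OF assms(2)], of "of_real c" "of_real d"] assms
    by simp
qed

lemma rhs_measurable:
  assumes [measurable]: "a \<in> borel_measurable borel"
  shows "rhs B b a \<in> borel_measurable borel"
  unfolding rhs_def[abs_def] by measurable

theorem solution_imp_spec_solution:
  assumes s: "3 \<le> s" and b: "0 < b" "0 \<le> B" and sol: "is_solution s u0 B b T u"
  defines "a \<equiv> \<lambda>t. fourier_transform (u t)"
  shows "spec_solution s B b (time_interval T) a"
    and "\<And>t. t \<in> time_interval T \<Longrightarrow> u t = rift (a t)"
    and "AE x in lborel. u 0 x = u0 x"
proof -
  define I where "I = time_interval T"
  from sol obtain v where
    cont: "\<And>t. t \<in> I \<Longrightarrow> continuous_on UNIV (u t)" and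
    sc: "sobolev_continuous_on s I u" and
    ic: "AE x in lborel. u 0 x = u0 x" and
    C1: "sobolev_C1_on (s - 1) I u v" and
    eq: "\<And>t. t \<in> I \<Longrightarrow> AE x in lborel. v t x + u t x * deriv (u t) x
             + (\<integral>\<xi>. B * exp (- b * \<bar>x - \<xi>\<bar>) * deriv (u t) \<xi> \<partial>lborel) = 0"
    unfolding is_solution_def I_def by blast
  have us: "u t \<in> sobolev s" if "t \<in> I" for t using sc that by (auto simp: sobolev_continuous_on_def)
  have uL: "u t \<in> L2" and aH: "a t \<in> Hs s" if "t \<in> I" for t
    using us[OF that] by (auto simp: sobolev_iff a_def)
  have ar: "realv (a t)" "u t = rift (a t)" if "t \<in> I" for t
    using sobolev_continuous_eq_rift[OF us[OF that] _ cont[OF that]] s unfolding a_def by auto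
  have am: "a t \<in> borel_measurable borel" if "t \<in> I" for t using Hs_measurable[OF aH[OF that]] .
  have vs: "v t \<in> sobolev (s - 1)" if "t \<in> I" for t
    using C1 that by (auto simp: sobolev_C1_on_def sobolev_continuous_on_def)
  \<comment> \<open>The equation determines \<open>v t\<close> almost everywhere as the function
    with transform \<open>rhs B b (a t)\<close>; uniqueness of transforms then replaces the unknown
    time derivative by \<open>rhs\<close> throughout.\<close>
  have ft_v: "AE \<xi> in lborel. fourier_transform (v t) \<xi> = rhs B b (a t) \<xi>" if t: "t \<in> I" for t
  proof (rule fourier_transform_AE_eq)
    show vL: "v t \<in> L2" using vs[OF t] by (simp add: sobolev_iff)
    have du: "deriv (u t) = rift (dx (a t))"
      unfolding ar(2)[OF t] using DERIV_rift_Hs[OF aH[OF t]] s by (auto intro!: DERIV_imp_deriv)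
    have km: "kmult B b (dx (a t)) = dx (kmult B b (a t))" by (auto simp: dx_def mult_ac)
    have di: "integrable lborel (dx (a t))" using dx_integrable[OF aH[OF t]] s by simp
    have "AE x in lborel. v t x = rift (rhs B b (a t)) x"
      using eq[OF t] unfolding du rift_kernel_conv(2)[OF di b(1)] km
    proof eventually_elim
      case (elim x)
      then show ?case using rift_rhs[OF aH[OF t] _ ar(1)[OF t] b, of x] s ar(2)[OF t] by simp
    qed
    then have ae: "AE x in lborel. complex_of_real (rift (rhs B b (a t)) x) = of_real (v t x)"
      by eventually_elim simp
    have rH: "rhs B b (a t) \<in> Hs (s - 1)" using s by (intro rhs_Hs b aH t) auto
    have rr: "realv (rhs B b (a t))" using s by (intro realv_rhs[OF aH[OF t]] b ar t) auto
    note h = has_ft_rift[OF rH _ rr]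
    show "has_ft (\<lambda>x. of_real (v t x)) (rhs B b (a t))"
      by (rule has_ft_cong_AE[OF h(2) ae]) (use s h(1) vL in \<open>auto intro!: L2_measurable\<close>)
  qed
  have "((\<lambda>r. Hn s (\<lambda>\<xi>. a r \<xi> - a t \<xi>)) \<longlongrightarrow> 0) (at t within I)" if t: "t \<in> I" for t
  proof (rule Lim_transform_within[OF _ zero_less_one])
    show "((\<lambda>r. sobolev_norm s (\<lambda>x. u r x - u t x)) \<longlongrightarrow> 0) (at t within I)"
      using sc t by (auto simp: sobolev_continuous_on_def)
    fix r assume r: "r \<in> I"
    have m: "(\<lambda>x. u r x - u t x) \<in> L2" by (rule L2_diff[OF uL[OF r] uL[OF t]])
    show "sobolev_norm s (\<lambda>x. u r x - u t x) = Hn s (\<lambda>\<xi>. a r \<xi> - a t \<xi>)"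
      unfolding sobolev_norm_eq
      by (rule Hn_cong_AE) (use fourier_transform_linear[OF uL[OF r] uL[OF t], of 1 "-1"] am r t
          L2_measurable[OF fourier_transform_L2[OF m]] in \<open>auto simp: a_def\<close>)
  qed
  moreover have "((\<lambda>r. Hn (s - 1) (\<lambda>\<xi>. (a r \<xi> - a t \<xi>) / of_real (r - t) - rhs B b (a t) \<xi>)) \<longlongrightarrow> 0) (at t within I)"
    if t: "t \<in> I" for t
  proof (rule Lim_transform_within[OF _ zero_less_one])
    show "((\<lambda>r. sobolev_norm (s - 1) (\<lambda>x. (u r x - u t x) / (r - t) - v t x)) \<longlongrightarrow> 0) (at t within I)"
      using C1 t by (auto simp: sobolev_C1_on_def)
    fix r assume r: "r \<in> I"
    have vL: "v t \<in> L2" using vs[OF t] by (simp add: sobolev_iff)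
    have d: "(\<lambda>x. u r x - u t x) \<in> L2" by (rule L2_diff[OF uL[OF r] uL[OF t]])
    have m: "(\<lambda>x. (u r x - u t x) / (r - t) - v t x) \<in> L2"
      using L2_diff[OF L2_scaleR[OF d, of "1 / (r - t)"] vL] by simp
    have "AE \<xi> in lborel. fourier_transform (\<lambda>x. (u r x - u t x) / (r - t) - v t x) \<xi>
       = (a r \<xi> - a t \<xi>) / of_real (r - t) - rhs B b (a t) \<xi>"
      using fourier_transform_linear[OF d vL, of "1 / (r - t)" "-1"]
        fourier_transform_linear[OF uL[OF r] uL[OF t], of 1 "-1"] ft_v[OF t]
      by eventually_elim (simp add: a_def)
    then show "sobolev_norm (s - 1) (\<lambda>x. (u r x - u t x) / (r - t) - v t x)
       = Hn (s - 1) (\<lambda>\<xi>. (a r \<xi> - a t \<xi>) / of_real (r - t) - rhs B b (a t) \<xi>)"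
      unfolding sobolev_norm_eq
      by (rule Hn_cong_AE) (use am[OF r] am[OF t] rhs_measurable[OF am[OF t]]
          L2_measurable[OF fourier_transform_L2[OF m]] in auto)
  qed
  ultimately show "spec_solution s B b (time_interval T) a"
    unfolding spec_solution_def I_def[symmetric] using aH ar by auto
  show "\<And>t. t \<in> time_interval T \<Longrightarrow> u t = rift (a t)" using ar(2) by (simp add: I_def)
  show "AE x in lborel. u 0 x = u0 x" by (rule ic)
qed

theorem spec_solution_imp_solution:
  assumes s: "3 \<le> s" and b: "0 < b" "0 \<le> B" and u0: "u0 \<in> sobolev s"
    and sol: "spec_solution s B b (time_interval T) a" and T: "0 < T"
    and a0: "AE \<xi> in lborel. a 0 \<xi> = fourier_transform u0 \<xi>"
  shows "is_solution s u0 B b T (\<lambda>t. rift (a t))"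
proof -
  define I where "I = time_interval T"
  have aH: "a t \<in> Hs s" and ar: "realv (a t)" if "t \<in> I" for t
    using sol that by (auto simp: spec_solution_def I_def)
  have ai: "integrable lborel (a t)" if "t \<in> I" for t using Hs_integrable[OF aH[OF that]] s by simp
  have dH: "(\<lambda>\<xi>. a r \<xi> - a t \<xi>) \<in> Hs s" and dr: "realv (\<lambda>\<xi>. a r \<xi> - a t \<xi>)"
    and de: "(\<lambda>x. rift (a r) x - rift (a t) x) = rift (\<lambda>\<xi>. a r \<xi> - a t \<xi>)"
    if "r \<in> I" "t \<in> I" for r t
    using that by (auto intro!: Hs_diff realv_diff aH ar ai simp: rift_diff ai)
  have rH: "rhs B b (a t) \<in> Hs (s - 1)" and rr: "realv (rhs B b (a t))" if t: "t \<in> I" for t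
    using s by (auto intro!: rhs_Hs b aH t realv_rhs[OF aH[OF t]] ar)
  have ri: "integrable lborel (rhs B b (a t))" if t: "t \<in> I" for t
    using Hs_integrable[OF rH[OF t]] s by simp
  have lim: "((\<lambda>r. Hn s (\<lambda>\<xi>. a r \<xi> - a t \<xi>)) \<longlongrightarrow> 0) (at t within I)" if "t \<in> I" for t
    using sol that by (auto simp: spec_solution_def I_def)
  have "continuous_on UNIV (rift (a t))" if "t \<in> I" for t
    using DERIV_rift_Hs[OF aH[OF that]] s by (intro continuous_at_imp_continuous_on ballI DERIV_isCont) auto
  moreover have "sobolev_continuous_on s I (\<lambda>t. rift (a t))"
    unfolding sobolev_continuous_on_def
  proof (intro conjI ballI)
    fix t assume t: "t \<in> I"
    show "rift (a t) \<in> sobolev s" using s by (intro rift_sobolev aH ar t) auto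
    show "((\<lambda>r. sobolev_norm s (\<lambda>x. rift (a r) x - rift (a t) x)) \<longlongrightarrow> 0) (at t within I)"
      by (rule Lim_transform_within[OF lim[OF t] zero_less_one])
         (use s in \<open>simp add: de t rift_sobolev(2)[OF dH _ dr]\<close>)
  qed
  moreover have "AE x in lborel. rift (a 0) x = u0 x"
  proof -
    have 0: "0 \<in> I" using T by (simp add: I_def time_interval_def zero_ereal_def)
    have m: "fourier_transform u0 \<in> borel_measurable borel"
      using u0 Hs_measurable[of "fourier_transform u0" s] by (simp add: sobolev_iff)
    have eq: "ift (a 0) x = ift (fourier_transform u0) x" for x
      by (rule ift_cong_AE[OF a0 Hs_measurable[OF aH[OF 0]] m])
    have "AE x in lborel. complex_of_real (u0 x) = ift (fourier_transform u0) x"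
      using sobolev_eq_rift_AE[OF u0] s by simp
    then show ?thesis by eventually_elim (simp add: rift_def eq, metis Re_complex_of_real)
  qed
  moreover have "sobolev_C1_on (s - 1) I (\<lambda>t. rift (a t)) (\<lambda>t. rift (rhs B b (a t)))"
    unfolding sobolev_C1_on_def sobolev_continuous_on_def
  proof (intro conjI ballI)
    fix t assume t: "t \<in> I"
    show "rift (a t) \<in> sobolev (s - 1)"
      using s by (intro rift_sobolev Hs_mono[OF _ aH] ar t) auto
    show "rift (rhs B b (a t)) \<in> sobolev (s - 1)" using s by (intro rift_sobolev rH rr t) auto
    show "((\<lambda>r. sobolev_norm (s - 1) (\<lambda>x. rift (rhs B b (a r)) x - rift (rhs B b (a t)) x)) \<longlongrightarrow> 0) (at t within I)"
    proof (rule Lim_null_comparison)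
      \<comment> \<open>The norm of \<open>a r\<close> in the Lipschitz constant is estimated
        through that of \<open>a t\<close> and of the difference, so that the bound visibly has a
        limit.\<close>
      have "((\<lambda>r. (Calg s * ((Hn s (\<lambda>\<xi>. a r \<xi> - a t \<xi>) + Hn s (a t)) + Hn s (a t)) + 2 * B / b) * Hn s (\<lambda>\<xi>. a r \<xi> - a t \<xi>))
         \<longlongrightarrow> (Calg s * ((0 + Hn s (a t)) + Hn s (a t)) + 2 * B / b) * 0) (at t within I)"
        by (intro tendsto_intros lim t)
      then show "((\<lambda>r. (Calg s * ((Hn s (\<lambda>\<xi>. a r \<xi> - a t \<xi>) + Hn s (a t)) + Hn s (a t)) + 2 * B / b) * Hn s (\<lambda>\<xi>. a r \<xi> - a t \<xi>))
         \<longlongrightarrow> 0) (at t within I)" by simp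
      have "norm (sobolev_norm (s - 1) (\<lambda>x. rift (rhs B b (a r)) x - rift (rhs B b (a t)) x))
        \<le> (Calg s * ((Hn s (\<lambda>\<xi>. a r \<xi> - a t \<xi>) + Hn s (a t)) + Hn s (a t)) + 2 * B / b) * Hn s (\<lambda>\<xi>. a r \<xi> - a t \<xi>)"
        if r: "r \<in> I" for r
      proof -
        have "(\<lambda>x. rift (rhs B b (a r)) x - rift (rhs B b (a t)) x) = rift (\<lambda>\<xi>. rhs B b (a r) \<xi> - rhs B b (a t) \<xi>)"
          using ri[OF r] ri[OF t] by (auto simp: rift_diff)
        moreover have "sobolev_norm (s - 1) (rift (\<lambda>\<xi>. rhs B b (a r) \<xi> - rhs B b (a t) \<xi>))
            = Hn (s - 1) (\<lambda>\<xi>. rhs B b (a r) \<xi> - rhs B b (a t) \<xi>)"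
          using s by (intro rift_sobolev Hs_diff rH r t realv_diff ri rr) auto
        ultimately have "norm (sobolev_norm (s - 1) (\<lambda>x. rift (rhs B b (a r)) x - rift (rhs B b (a t)) x))
            \<le> (Calg s * (Hn s (a r) + Hn s (a t)) + 2 * B / b) * Hn s (\<lambda>\<xi>. a r \<xi> - a t \<xi>)"
          using rhs_diff_Hs[OF b _ aH[OF r] aH[OF t]] s by simp
        also have "\<dots> \<le> (Calg s * ((Hn s (\<lambda>\<xi>. a r \<xi> - a t \<xi>) + Hn s (a t)) + Hn s (a t)) + 2 * B / b) * Hn s (\<lambda>\<xi>. a r \<xi> - a t \<xi>)"
          using Hn_add[OF dH[OF r t] aH[OF t]] by (intro mult_right_mono add_right_mono mult_left_mono) auto
        finally show ?thesis .
      qed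
      then show "\<forall>\<^sub>F r in at t within I. norm (sobolev_norm (s - 1) (\<lambda>x. rift (rhs B b (a r)) x - rift (rhs B b (a t)) x))
        \<le> (Calg s * ((Hn s (\<lambda>\<xi>. a r \<xi> - a t \<xi>) + Hn s (a t)) + Hn s (a t)) + 2 * B / b) * Hn s (\<lambda>\<xi>. a r \<xi> - a t \<xi>)"
        unfolding eventually_at_filter by (auto intro!: always_eventually)
    qed
    show "((\<lambda>r. sobolev_norm (s - 1) (\<lambda>x. (rift (a r) x - rift (a t) x) / (r - t) - rift (rhs B b (a t)) x)) \<longlongrightarrow> 0) (at t within I)"
    proof (rule Lim_transform_within[OF _ zero_less_one])
      show "((\<lambda>r. Hn (s - 1) (\<lambda>\<xi>. (a r \<xi> - a t \<xi>) / of_real (r - t) - rhs B b (a t) \<xi>)) \<longlongrightarrow> 0) (at t within I)"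
        using sol t by (auto simp: spec_solution_def I_def)
      fix r assume r: "r \<in> I"
      define q where "q = (\<lambda>\<xi>. of_real (1 / (r - t)) * (a r \<xi> - a t \<xi>))"
      have q: "q \<in> Hs s" "realv q" unfolding q_def by (intro Hs_cmult realv_cmult dH dr r t)+
      have q1: "q \<in> Hs (s - 1)" by (rule Hs_mono[OF _ q(1)]) simp
      have qi: "integrable lborel q" using Hs_integrable[OF q(1)] s by simp
      have "(\<lambda>x. (rift (a r) x - rift (a t) x) / (r - t) - rift (rhs B b (a t)) x) = rift (\<lambda>\<xi>. q \<xi> - rhs B b (a t) \<xi>)"
      proof
        fix x
        have "rift q x = (rift (a r) x - rift (a t) x) / (r - t)"
          unfolding q_def rift_cmult using fun_cong[OF de[OF r t], of x] by simp
        then show "(rift (a r) x - rift (a t) x) / (r - t) - rift (rhs B b (a t)) x = rift (\<lambda>\<xi>. q \<xi> - rhs B b (a t) \<xi>) x"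
          using qi ri[OF t] by (simp add: rift_diff)
      qed
      moreover have "sobolev_norm (s - 1) (rift (\<lambda>\<xi>. q \<xi> - rhs B b (a t) \<xi>)) = Hn (s - 1) (\<lambda>\<xi>. q \<xi> - rhs B b (a t) \<xi>)"
        using s by (intro rift_sobolev Hs_diff q1 rH t realv_diff qi ri q rr) auto
      ultimately show "Hn (s - 1) (\<lambda>\<xi>. (a r \<xi> - a t \<xi>) / of_real (r - t) - rhs B b (a t) \<xi>)
        = sobolev_norm (s - 1) (\<lambda>x. (rift (a r) x - rift (a t) x) / (r - t) - rift (rhs B b (a t)) x)"
        by (simp add: q_def)
    qed
  qed
  moreover have "AE x in lborel. rift (rhs B b (a t)) x + rift (a t) x * deriv (rift (a t)) x
             + (\<integral>\<xi>. B * exp (- b * \<bar>x - \<xi>\<bar>) * deriv (rift (a t)) \<xi> \<partial>lborel) = 0" if t: "t \<in> I" for t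
  proof (intro AE_I2)
    fix x
    have du: "deriv (rift (a t)) = rift (dx (a t))"
      using DERIV_rift_Hs[OF aH[OF t]] s by (auto intro!: DERIV_imp_deriv)
    have km: "kmult B b (dx (a t)) = dx (kmult B b (a t))" by (auto simp: dx_def mult_ac)
    have di: "integrable lborel (dx (a t))" using dx_integrable[OF aH[OF t]] s by simp
    show "rift (rhs B b (a t)) x + rift (a t) x * deriv (rift (a t)) x
             + (\<integral>\<xi>. B * exp (- b * \<bar>x - \<xi>\<bar>) * deriv (rift (a t)) \<xi> \<partial>lborel) = 0"
      unfolding du rift_kernel_conv(2)[OF di b(1)] km
      using rift_rhs[OF aH[OF t] _ ar[OF t] b, of x] s by simp
  qed
  ultimately show ?thesis unfolding is_solution_def I_def[symmetric] by blast
qed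

section \<open>Comparison with a barrier\<close>

text \<open>Decay at infinity stands in for compactness of the line when a positive maximum is
  sought.\<close>

definition vanishes :: "(real \<Rightarrow> real) \<Rightarrow> bool" where
  "vanishes f \<longleftrightarrow> (\<forall>e>0. \<exists>R. \<forall>x. R < \<bar>x\<bar> \<longrightarrow> \<bar>f x\<bar> < e)"

lemma vanishes_attains_max:
  assumes f: "continuous_on UNIV f" "vanishes f" and x0: "0 < f x0"
  obtains x1 where "\<And>z. f z \<le> f x1" "0 < f x1"
proof -
  obtain R where R: "\<And>x. R < \<bar>x\<bar> \<Longrightarrow> \<bar>f x\<bar> < f x0" using f(2) x0 by (auto simp: vanishes_def)
  define K where "K = \<bar>R\<bar> + \<bar>x0\<bar>"
  have "\<exists>x\<in>{-K..K}. \<forall>y\<in>{-K..K}. f y \<le> f x"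
    by (rule continuous_attains_sup) (auto simp: K_def intro: continuous_on_subset[OF f(1)])
  then obtain x1 where x1: "\<And>y. y \<in> {-K..K} \<Longrightarrow> f y \<le> f x1" by blast
  have x01: "f x0 \<le> f x1" by (intro x1) (auto simp: K_def)
  have "f z \<le> f x1" for z
  proof (cases "z \<in> {-K..K}")
    case False
    then have "R < \<bar>z\<bar>" by (auto simp: K_def)
    then show ?thesis using R[of z] x01 by linarith
  qed (rule x1)
  then show ?thesis using that[of x1] x01 x0 by auto
qed

text \<open>Either no value is positive, or the maximum is attained and inherits the strict
  inequality. A strict bound is thereby uniform, hence stable for a short time.\<close>

lemma vanishes_uniform_gap:
  assumes f: "continuous_on UNIV f" "vanishes f" and c: "0 < c" "\<And>x. f x < c"
  obtains d where "0 < d" "\<And>x. f x \<le> c - d"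
proof (cases "\<exists>x0. 0 < f x0")
  case True
  then obtain x1 where "\<And>z. f z \<le> f x1" using vanishes_attains_max[OF f] by metis
  then show ?thesis using that[of "c - f x1"] c by auto
next
  case False
  then show ?thesis using that[of c] c by (auto simp: not_less)
qed

text \<open>A comparison principle: the maximum of \<^term>\<open>f t\<close> cannot catch up with the barrier
  \<^term>\<open>y\<close>, because at the first contact the time derivative of \<^term>\<open>f\<close> at the maximum
  would have to be at least that of \<^term>\<open>y\<close>.\<close>
lemma barrier:
  fixes f g :: "real \<Rightarrow> real \<Rightarrow> real" and y y' :: "real \<Rightarrow> real" and t0 t1 :: real
  defines "J \<equiv> {t0..t1}"
  assumes van: "\<And>t. t \<in> J \<Longrightarrow> vanishes (f t)"
    and cont: "\<And>t. t \<in> J \<Longrightarrow> continuous_on UNIV (f t)"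
    and ucont: "\<And>t e. t \<in> J \<Longrightarrow> 0 < e \<Longrightarrow> \<exists>d>0. \<forall>r\<in>J. \<bar>r - t\<bar> < d \<longrightarrow> (\<forall>x. \<bar>f r x - f t x\<bar> \<le> e)"
    and fder: "\<And>t x. t \<in> J \<Longrightarrow> ((\<lambda>r. f r x) has_real_derivative g t x) (at t within J)"
    and yder: "\<And>t. t \<in> J \<Longrightarrow> (y has_real_derivative y' t) (at t within J)"
    and ypos: "\<And>t. t \<in> J \<Longrightarrow> 0 < y t"
    and init: "\<And>x. f t0 x < y t0"
    and crit: "\<And>t x. t \<in> J \<Longrightarrow> (\<And>z. f t z \<le> f t x) \<Longrightarrow> f t x = y t \<Longrightarrow> g t x < y' t"
    and t: "t \<in> J"
  shows "f t x < y t"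
proof (rule ccontr)
  define S where "S = {t\<in>J. \<exists>x. y t \<le> f t x}"
  assume "\<not> f t x < y t"
  then have tS: "t \<in> S" using t by (auto simp: S_def not_less)
  define \<tau> where "\<tau> = Inf S"
  have bdd: "bdd_below S" by (rule bdd_belowI[of _ t0]) (auto simp: S_def J_def)
  have \<tau>J: "\<tau> \<in> J"
  proof -
    have "t0 \<le> \<tau>" unfolding \<tau>_def using tS by (intro cInf_greatest) (auto simp: S_def J_def)
    moreover have "\<tau> \<le> t" unfolding \<tau>_def by (rule cInf_lower[OF tS bdd])
    ultimately show ?thesis using t by (auto simp: J_def)
  qed
  have before: "f r x < y r" if "r \<in> J" "r < \<tau>" for r x
    using that cInf_lower[OF _ bdd, of r] by (force simp: S_def \<tau>_def not_less)
  \<comment> \<open>The first contact is attained: otherwise the uniform gap at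
    \<open>\<tau>\<close> would persist on a neighbourhood by \<open>ucont\<close> and by continuity
    of \<open>y\<close>, and \<open>S\<close> would have no points close to its infimum.\<close>
  have \<tau>S: "\<tau> \<in> S"
  proof (rule ccontr)
    assume "\<tau> \<notin> S"
    then have "\<And>x. f \<tau> x < y \<tau>" using \<tau>J by (auto simp: S_def not_le)
    from vanishes_uniform_gap[OF cont[OF \<tau>J] van[OF \<tau>J] ypos[OF \<tau>J] this]
    obtain d where d: "0 < d" "\<And>x. f \<tau> x \<le> y \<tau> - d" by metis
    obtain d1 where d1: "0 < d1" "\<And>r x. r \<in> J \<Longrightarrow> \<bar>r - \<tau>\<bar> < d1 \<Longrightarrow> \<bar>f r x - f \<tau> x\<bar> \<le> d / 3"
      using ucont[OF \<tau>J, of "d / 3"] d by auto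
    have "continuous (at \<tau> within J) y" using yder[OF \<tau>J] by (rule DERIV_continuous)
    then obtain d2 where d2: "0 < d2" "\<And>r. r \<in> J \<Longrightarrow> \<bar>r - \<tau>\<bar> < d2 \<Longrightarrow> \<bar>y r - y \<tau>\<bar> < d / 3"
      unfolding continuous_within_eps_delta dist_real_def using d by (metis divide_pos_pos zero_less_numeral)
    obtain r where r: "r \<in> S" "r < \<tau> + min d1 d2"
      using cInf_lessD[of S "\<tau> + min d1 d2"] tS d1(1) d2(1) by (auto simp: \<tau>_def)
    then have "\<tau> \<le> r" "r \<in> J" using cInf_lower[OF _ bdd] by (auto simp: \<tau>_def S_def)
    obtain x where x: "y r \<le> f r x" using r by (auto simp: S_def)
    have "\<bar>r - \<tau>\<bar> < d1" "\<bar>r - \<tau>\<bar> < d2" using r(2) \<open>\<tau> \<le> r\<close> by auto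
    with d1(2)[OF \<open>r \<in> J\<close>, of x] d2(2)[OF \<open>r \<in> J\<close>] d(2)[of x] x d(1) show False by linarith
  qed
  then obtain x0 where x0: "y \<tau> \<le> f \<tau> x0" by (auto simp: S_def)
  then obtain x1 where x1: "\<And>z. f \<tau> z \<le> f \<tau> x1"
    using vanishes_attains_max[OF cont[OF \<tau>J] van[OF \<tau>J], of x0] ypos[OF \<tau>J] by auto
  have "\<tau> \<noteq> t0" using init[of x0] x0 by auto
  then have lt: "t0 < \<tau>" using \<tau>J by (auto simp: J_def)
  define h where "h r = f r x1 - y r" for r
  have hder: "(h has_real_derivative g \<tau> x1 - y' \<tau>) (at \<tau> within J)"
    unfolding h_def[abs_def] by (intro derivative_intros fder yder \<tau>J)
  have h\<tau>: "0 \<le> h \<tau>" using x0 x1[of x0] by (simp add: h_def)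
  have hneg: "h r < 0" if "r \<in> J" "r < \<tau>" for r using before[OF that, of x1] by (simp add: h_def)
  have "h \<tau> = 0"
  proof (rule ccontr)
    assume "h \<tau> \<noteq> 0"
    then have "0 < h \<tau>" using h\<tau> by simp
    have "continuous (at \<tau> within J) h" using hder by (rule DERIV_continuous)
    then obtain d where d: "0 < d" "\<And>r. r \<in> J \<Longrightarrow> \<bar>r - \<tau>\<bar> < d \<Longrightarrow> \<bar>h r - h \<tau>\<bar> < h \<tau>"
      unfolding continuous_within_eps_delta dist_real_def using \<open>0 < h \<tau>\<close> by metis
    define r where "r = max t0 (\<tau> - d / 2)"
    have "r \<in> J" "r < \<tau>" "\<bar>r - \<tau>\<bar> < d" using \<tau>J lt d(1) by (auto simp: r_def J_def)
    with d(2)[of r] hneg[of r] show False by linarith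
  qed
  then have "g \<tau> x1 - y' \<tau> < 0" using crit[OF \<tau>J x1] by (simp add: h_def)
  from has_real_derivative_neg_dec_left[OF hder this]
  obtain d where d: "0 < d" "\<And>k. 0 < k \<Longrightarrow> \<tau> - k \<in> J \<Longrightarrow> k < d \<Longrightarrow> h \<tau> < h (\<tau> - k)" by blast
  define k where "k = min (d / 2) (\<tau> - t0)"
  have "0 < k" "k < d" "\<tau> - k \<in> J" using lt d(1) \<tau>J by (auto simp: k_def J_def min_def)
  with d(2)[of k] hneg[of "\<tau> - k"] \<open>h \<tau> = 0\<close> show False by auto
qed

lemma spec_solution_subset:
  assumes "spec_solution s B b I a" "J \<subseteq> I"
  shows "spec_solution s B b J a"
  using assms unfolding spec_solution_def by (auto intro: tendsto_within_subset)

lemma rift_vanishes': "a \<in> Hs s \<Longrightarrow> 2 \<le> s \<Longrightarrow> vanishes (rift a)"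
  using rift_vanishes[of a s] by (simp add: vanishes_def)

lemma rift_continuous: "a \<in> Hs s \<Longrightarrow> 2 \<le> s \<Longrightarrow> continuous_on UNIV (rift a)"
  using DERIV_rift_Hs by (intro continuous_at_imp_continuous_on ballI DERIV_isCont) auto

lemma dx_diff: "dx (\<lambda>\<xi>. a \<xi> - b \<xi>) = (\<lambda>\<xi>. dx a \<xi> - dx b \<xi>)"
  by (simp add: dx_def fun_eq_iff right_diff_distrib)

lemma dx_cmult: "dx (\<lambda>\<xi>. c * a \<xi>) = (\<lambda>\<xi>. c * dx a \<xi>)"
  by (simp add: dx_def fun_eq_iff)

lemma Parseval_real:
  assumes "integrable lborel a" "a \<in> L2" "realv a" "integrable lborel b" "b \<in> L2" "realv b"
  shows "Re (\<integral>\<xi>. a \<xi> * cnj (b \<xi>) \<partial>lborel) = 2 * pi * (\<integral>x. rift a x * rift b x \<partial>lborel)"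
proof -
  have "Re (\<integral>\<xi>. a \<xi> * cnj (b \<xi>) \<partial>lborel) = 2 * pi * Re (\<integral>x. of_real (rift a x * rift b x) \<partial>lborel)"
    using Parseval_Re[OF assms(1,2,4,5)] by (simp add: realv_ift assms)
  then show ?thesis by (simp only: integral_complex_of_real Re_complex_of_real)
qed

text \<open>The quotient of squared norms equals twice the pairing with the difference quotient
  \<open>Q\<close> plus \<open>(r - t)\<close> times the squared norm of \<open>Q\<close>.
  Convergence of difference quotients is required exactly in the order of the multiplier, and this
  dictates which multipliers an energy may use.\<close>

lemma quadratic_deriv:
  fixes p :: "real \<Rightarrow> real" and a :: "real \<Rightarrow> real \<Rightarrow> complex"
  assumes [measurable]: "p \<in> borel_measurable borel" and p: "\<And>\<xi>. \<bar>p \<xi>\<bar> \<le> C * wt \<sigma> \<xi>"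
    and a: "\<And>r. r \<in> I \<Longrightarrow> a r \<in> Hs \<sigma>" and c: "c \<in> Hs \<sigma>" and t: "t \<in> I"
    and lim: "((\<lambda>r. Hn \<sigma> (\<lambda>\<xi>. (a r \<xi> - a t \<xi>) / of_real (r - t) - c \<xi>)) \<longlongrightarrow> 0) (at t within I)"
  shows "((\<lambda>r. (L2_norm (\<lambda>\<xi>. of_real (p \<xi>) * a r \<xi>))\<^sup>2) has_real_derivative
     2 * Re (\<integral>\<xi>. (of_real (p \<xi>) * c \<xi>) * cnj (of_real (p \<xi>) * a t \<xi>) \<partial>lborel)) (at t within I)"
proof -
  have mult: "(\<lambda>\<xi>. of_real (p \<xi>) * d \<xi>) \<in> L2" "L2_norm (\<lambda>\<xi>. of_real (p \<xi>) * d \<xi>) \<le> C * Hn \<sigma> d" if "d \<in> Hs \<sigma>" for d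
    using Hs_multiplier[of d 0 \<sigma> "\<lambda>\<xi>. of_real (p \<xi>)" C] that p by (auto simp: Hs_0 Hn_0)
  define X where "X r = (\<lambda>\<xi>. of_real (p \<xi>) * a r \<xi>)" for r
  define Y where "Y = (\<lambda>\<xi>. of_real (p \<xi>) * c \<xi>)"
  define Q where "Q r = (\<lambda>\<xi>. of_real (p \<xi>) * ((a r \<xi> - a t \<xi>) / of_real (r - t)))" for r
  have X: "X r \<in> L2" if "r \<in> I" for r unfolding X_def by (intro mult a that)
  have Y: "Y \<in> L2" unfolding Y_def by (intro mult c)
  have Q: "Q r \<in> L2" if "r \<in> I" for r unfolding Q_def by (intro mult Hs_divide Hs_diff a that t)
  have QY: "L2_norm (\<lambda>\<xi>. Q r \<xi> - Y \<xi>) \<le> C * Hn \<sigma> (\<lambda>\<xi>. (a r \<xi> - a t \<xi>) / of_real (r - t) - c \<xi>)" if "r \<in> I" for r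
    using mult(2)[OF Hs_diff[OF Hs_divide[OF Hs_diff[OF a[OF that] a[OF t]]] c]]
    by (simp add: Q_def Y_def right_diff_distrib)
  have limQ: "((\<lambda>r. L2_norm (\<lambda>\<xi>. Q r \<xi> - Y \<xi>)) \<longlongrightarrow> 0) (at t within I)"
  proof (rule Lim_null_comparison)
    show "((\<lambda>r. C * Hn \<sigma> (\<lambda>\<xi>. (a r \<xi> - a t \<xi>) / of_real (r - t) - c \<xi>)) \<longlongrightarrow> 0) (at t within I)"
      using tendsto_mult_left[OF lim, of C] by simp
    show "\<forall>\<^sub>F r in at t within I. norm (L2_norm (\<lambda>\<xi>. Q r \<xi> - Y \<xi>)) \<le> C * Hn \<sigma> (\<lambda>\<xi>. (a r \<xi> - a t \<xi>) / of_real (r - t) - c \<xi>)"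
      unfolding eventually_at_filter using QY by (auto intro!: always_eventually)
  qed
  have lim1: "((\<lambda>r. Re (\<integral>\<xi>. Q r \<xi> * cnj (X t \<xi>) \<partial>lborel)) \<longlongrightarrow> Re (\<integral>\<xi>. Y \<xi> * cnj (X t \<xi>) \<partial>lborel)) (at t within I)"
  proof (rule LIM_zero_cancel, rule Lim_null_comparison)
    show "((\<lambda>r. L2_norm (\<lambda>\<xi>. Q r \<xi> - Y \<xi>) * L2_norm (X t)) \<longlongrightarrow> 0) (at t within I)"
      using tendsto_mult_right[OF limQ, of "L2_norm (X t)"] by simp
    have "norm (Re (\<integral>\<xi>. Q r \<xi> * cnj (X t \<xi>) \<partial>lborel) - Re (\<integral>\<xi>. Y \<xi> * cnj (X t \<xi>) \<partial>lborel))
       \<le> L2_norm (\<lambda>\<xi>. Q r \<xi> - Y \<xi>) * L2_norm (X t)" if r: "r \<in> I" for r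
    proof -
      have "(\<integral>\<xi>. Q r \<xi> * cnj (X t \<xi>) \<partial>lborel) - (\<integral>\<xi>. Y \<xi> * cnj (X t \<xi>) \<partial>lborel) = (\<integral>\<xi>. (Q r \<xi> - Y \<xi>) * cnj (X t \<xi>) \<partial>lborel)"
        using L2_inner_integrable(1)[OF Q[OF r] X[OF t]] L2_inner_integrable(1)[OF Y X[OF t]]
        by (simp add: left_diff_distrib)
      then have "norm (Re (\<integral>\<xi>. Q r \<xi> * cnj (X t \<xi>) \<partial>lborel) - Re (\<integral>\<xi>. Y \<xi> * cnj (X t \<xi>) \<partial>lborel))
         \<le> norm (\<integral>\<xi>. (Q r \<xi> - Y \<xi>) * cnj (X t \<xi>) \<partial>lborel)"
        using abs_Re_le_cmod by (metis minus_complex.sel(1) real_norm_def)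
      then show ?thesis using L2_inner_integrable(2)[OF L2_diff[OF Q[OF r] Y] X[OF t]] by linarith
    qed
    then show "\<forall>\<^sub>F r in at t within I. norm (Re (\<integral>\<xi>. Q r \<xi> * cnj (X t \<xi>) \<partial>lborel) - Re (\<integral>\<xi>. Y \<xi> * cnj (X t \<xi>) \<partial>lborel))
       \<le> L2_norm (\<lambda>\<xi>. Q r \<xi> - Y \<xi>) * L2_norm (X t)"
      unfolding eventually_at_filter by (auto intro!: always_eventually)
  qed
  have lim2: "((\<lambda>r. (r - t) * (L2_norm (Q r))\<^sup>2) \<longlongrightarrow> 0) (at t within I)"
  proof (rule Lim_null_comparison)
    have "((\<lambda>r. \<bar>r - t\<bar> * (L2_norm (\<lambda>\<xi>. Q r \<xi> - Y \<xi>) + L2_norm Y)\<^sup>2) \<longlongrightarrow> \<bar>t - t\<bar> * (0 + L2_norm Y)\<^sup>2) (at t within I)"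
      by (intro tendsto_intros limQ)
    then show "((\<lambda>r. \<bar>r - t\<bar> * (L2_norm (\<lambda>\<xi>. Q r \<xi> - Y \<xi>) + L2_norm Y)\<^sup>2) \<longlongrightarrow> 0) (at t within I)" by simp
    have "norm ((r - t) * (L2_norm (Q r))\<^sup>2) \<le> \<bar>r - t\<bar> * (L2_norm (\<lambda>\<xi>. Q r \<xi> - Y \<xi>) + L2_norm Y)\<^sup>2" if r: "r \<in> I" for r
      using L2_norm_triangle[OF L2_diff[OF Q[OF r] Y] Y]
      by (auto simp: abs_mult intro!: mult_left_mono power_mono)
    then show "\<forall>\<^sub>F r in at t within I. norm ((r - t) * (L2_norm (Q r))\<^sup>2) \<le> \<bar>r - t\<bar> * (L2_norm (\<lambda>\<xi>. Q r \<xi> - Y \<xi>) + L2_norm Y)\<^sup>2"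
      unfolding eventually_at_filter by (auto intro!: always_eventually)
  qed
  have lim3: "((\<lambda>r. 2 * Re (\<integral>\<xi>. Q r \<xi> * cnj (X t \<xi>) \<partial>lborel) + (r - t) * (L2_norm (Q r))\<^sup>2)
      \<longlongrightarrow> 2 * Re (\<integral>\<xi>. Y \<xi> * cnj (X t \<xi>) \<partial>lborel) + 0) (at t within I)"
    by (intro tendsto_intros lim1 lim2)
  have quot: "((L2_norm (X r))\<^sup>2 - (L2_norm (X t))\<^sup>2) / (r - t)
      = 2 * Re (\<integral>\<xi>. Q r \<xi> * cnj (X t \<xi>) \<partial>lborel) + (r - t) * (L2_norm (Q r))\<^sup>2" if r: "r \<in> I" "r \<noteq> t" for r
  proof -
    have re: "Re (of_real k * z) = k * Re z" for k z by simp
    have "X r = (\<lambda>\<xi>. of_real (r - t) * Q r \<xi> + X t \<xi>)"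
    proof
      fix \<xi>
      have "of_real (r - t) * ((a r \<xi> - a t \<xi>) / of_real (r - t)) = a r \<xi> - a t \<xi>"
        using r(2) by (metis eq_iff_diff_eq_0 nonzero_mult_div_cancel_left of_real_eq_0_iff times_divide_eq_right)
      then have "of_real (p \<xi>) * (of_real (r - t) * ((a r \<xi> - a t \<xi>) / of_real (r - t))) = of_real (p \<xi>) * (a r \<xi> - a t \<xi>)" by simp
      then show "X r \<xi> = of_real (r - t) * Q r \<xi> + X t \<xi>"
        by (simp add: X_def Q_def right_diff_distrib mult.left_commute)
    qed
    then have "(L2_norm (X r))\<^sup>2 = (L2_norm (\<lambda>\<xi>. of_real (r - t) * Q r \<xi>))\<^sup>2
       + 2 * Re (\<integral>\<xi>. of_real (r - t) * Q r \<xi> * cnj (X t \<xi>) \<partial>lborel) + (L2_norm (X t))\<^sup>2"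
      using L2_norm_add_sq[OF L2_cmult[OF Q[OF r(1)]] X[OF t], of "of_real (r - t)"] by simp
    also have "(\<integral>\<xi>. of_real (r - t) * Q r \<xi> * cnj (X t \<xi>) \<partial>lborel) = of_real (r - t) * (\<integral>\<xi>. Q r \<xi> * cnj (X t \<xi>) \<partial>lborel)"
      by (simp only: mult.assoc integral_mult_right_zero)
    also have "L2_norm (\<lambda>\<xi>. of_real (r - t) * Q r \<xi>) = \<bar>r - t\<bar> * L2_norm (Q r)"
      by (simp only: L2_norm_cmult norm_of_real)
    finally have "(L2_norm (X r))\<^sup>2 - (L2_norm (X t))\<^sup>2
      = (r - t) * ((r - t) * (L2_norm (Q r))\<^sup>2 + 2 * Re (\<integral>\<xi>. Q r \<xi> * cnj (X t \<xi>) \<partial>lborel))"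
      by (simp only: power_mult_distrib power2_abs re) (simp add: algebra_simps power2_eq_square)
    then show ?thesis using r(2) by simp
  qed
  have "((\<lambda>r. ((L2_norm (X r))\<^sup>2 - (L2_norm (X t))\<^sup>2) / (r - t)) \<longlongrightarrow> 2 * Re (\<integral>\<xi>. Y \<xi> * cnj (X t \<xi>) \<partial>lborel) + 0) (at t within I)"
    by (rule Lim_transform_within[OF lim3 zero_less_one]) (use quot in simp)
  then show ?thesis
    unfolding has_field_derivative_iff X_def Y_def add_0_right .
qed

section \<open>Bounds on the solution and wave breaking\<close>

text \<open>The nonlocal term multiplies the transform by a purely imaginary number, so it drops out
  of every energy built from a real multiplier.\<close>

lemma Re_rhs_pairing:
  "Re ((of_real p * rhs B b c \<xi>) * cnj (of_real p * c \<xi>))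
    = - Re ((of_real p * dx (\<lambda>\<xi>. conv c c \<xi> / (4 * pi)) \<xi>) * cnj (of_real p * c \<xi>))"
proof -
  define D where "D = dx (\<lambda>\<xi>. conv c c \<xi> / (4 * pi)) \<xi>"
  have eq: "rhs B b c \<xi> = - D - \<i> * of_real (\<xi> * fw_kernel B b \<xi>) * c \<xi>"
    by (simp add: rhs_def D_def dx_def distrib_left mult_ac)
  have "(of_real p * rhs B b c \<xi>) * cnj (of_real p * c \<xi>)
     = - ((of_real p * D) * cnj (of_real p * c \<xi>))
       - \<i> * of_real (p * p * (\<xi> * fw_kernel B b \<xi>)) * (c \<xi> * cnj (c \<xi>))"
    unfolding eq by (simp add: algebra_simps)
  moreover have "\<i> * of_real (p * p * (\<xi> * fw_kernel B b \<xi>)) * (c \<xi> * cnj (c \<xi>))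
     = \<i> * of_real (p * p * (\<xi> * fw_kernel B b \<xi>) * (norm (c \<xi>))\<^sup>2)"
    by (simp only: complex_norm_square[symmetric] of_real_mult mult.assoc)
  ultimately show ?thesis unfolding D_def by simp
qed

locale fw_spec =
  fixes s B b T :: real and a :: "real \<Rightarrow> real \<Rightarrow> complex"
  assumes s: "3 \<le> s" and b: "0 < b" and B: "0 \<le> B" and T: "0 \<le> T"
    and sol: "spec_solution s B b {0..T} a"
begin

lemma aH: "t \<in> {0..T} \<Longrightarrow> a t \<in> Hs s" and ar: "t \<in> {0..T} \<Longrightarrow> realv (a t)"
  using sol by (auto simp: spec_solution_def)

lemma a_cont: "t \<in> {0..T} \<Longrightarrow> ((\<lambda>r. Hn s (\<lambda>\<xi>. a r \<xi> - a t \<xi>)) \<longlongrightarrow> 0) (at t within {0..T})"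
  using sol by (auto simp: spec_solution_def)

lemma a_deriv: "t \<in> {0..T} \<Longrightarrow>
    ((\<lambda>r. Hn (s - 1) (\<lambda>\<xi>. (a r \<xi> - a t \<xi>) / of_real (r - t) - rhs B b (a t) \<xi>)) \<longlongrightarrow> 0) (at t within {0..T})"
  using sol by (auto simp: spec_solution_def)

lemma rhsH: "t \<in> {0..T} \<Longrightarrow> rhs B b (a t) \<in> Hs (s - 1)"
  using s by (intro rhs_Hs b B aH) auto

lemma aL: "t \<in> {0..T} \<Longrightarrow> integrable lborel (a t)" "t \<in> {0..T} \<Longrightarrow> a t \<in> L2"
  using Hs_integrable[OF aH] Hs_L2(1)[OF _ aH] s by auto

lemma restrict: "0 \<le> T' \<Longrightarrow> T' \<le> T \<Longrightarrow> fw_spec s B b T' a"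
  by unfold_locales (use s b B spec_solution_subset[OF sol] in auto)

lemma near:
  assumes t: "t \<in> {0..T}" and e: "0 < e"
  shows "\<exists>d>0. \<forall>r\<in>{0..T}. \<bar>r - t\<bar> < d \<longrightarrow> Hn s (\<lambda>\<xi>. a r \<xi> - a t \<xi>) < e"
proof -
  obtain d where d: "0 < d" "\<And>r. r \<in> {0..T} \<Longrightarrow> 0 < dist r t \<Longrightarrow> dist r t < d \<Longrightarrow> dist (Hn s (\<lambda>\<xi>. a r \<xi> - a t \<xi>)) 0 < e"
    using a_cont[OF t] e unfolding Lim_within by blast
  have "Hn s (\<lambda>\<xi>. a r \<xi> - a t \<xi>) < e" if "r \<in> {0..T}" "\<bar>r - t\<bar> < d" for r
  proof (cases "r = t")
    case True
    then show ?thesis using e by (simp add: Hn_def wa_def[abs_def])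
  qed (use d(2)[of r] that in \<open>auto simp: dist_real_def\<close>)
  then show ?thesis using d(1) by blast
qed

lemma Hn_bounded: "\<exists>M. \<forall>t\<in>{0..T}. Hn s (a t) \<le> M"
proof -
  have "continuous_on {0..T} (\<lambda>t. Hn s (a t))"
    unfolding continuous_on_iff dist_real_def
  proof (intro ballI allI impI)
    fix t e :: real assume t: "t \<in> {0..T}" and e: "0 < e"
    obtain d where d: "0 < d" "\<And>r. r \<in> {0..T} \<Longrightarrow> \<bar>r - t\<bar> < d \<Longrightarrow> Hn s (\<lambda>\<xi>. a r \<xi> - a t \<xi>) < e"
      using near[OF t e] by blast
    have "\<bar>Hn s (a r) - Hn s (a t)\<bar> < e" if "r \<in> {0..T}" "\<bar>r - t\<bar> < d" for r
      using Hn_reverse_triangle[OF aH[OF that(1)] aH[OF t]] d(2)[OF that] by linarith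
    then show "\<exists>d>0. \<forall>r\<in>{0..T}. \<bar>r - t\<bar> < d \<longrightarrow> \<bar>Hn s (a r) - Hn s (a t)\<bar> < e" using d(1) by blast
  qed
  then have "compact ((\<lambda>t. Hn s (a t)) ` {0..T})" by (intro compact_continuous_image) auto
  from compact_imp_bounded[OF this] show ?thesis
    unfolding bounded_iff by (auto simp: abs_le_iff)
qed

lemma rift_diff_le:
  assumes "r \<in> {0..T}" "t \<in> {0..T}"
  shows "\<bar>rift (a r) x - rift (a t) x\<bar> \<le> Hn s (\<lambda>\<xi>. a r \<xi> - a t \<xi>)"
    "\<bar>rift (dx (a r)) x - rift (dx (a t)) x\<bar> \<le> Hn s (\<lambda>\<xi>. a r \<xi> - a t \<xi>)"
proof -
  have d: "(\<lambda>\<xi>. a r \<xi> - a t \<xi>) \<in> Hs s" by (intro Hs_diff aH assms)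
  show "\<bar>rift (a r) x - rift (a t) x\<bar> \<le> Hn s (\<lambda>\<xi>. a r \<xi> - a t \<xi>)"
    using rift_Hs_bounds[OF d, of x] s by (simp add: rift_diff[OF aL(1)[OF assms(1)] aL(1)[OF assms(2)]])
  show "\<bar>rift (dx (a r)) x - rift (dx (a t)) x\<bar> \<le> Hn s (\<lambda>\<xi>. a r \<xi> - a t \<xi>)"
    using rift_dx_Hs_bounds[OF d, of x] s dx_integrable[OF aH[OF assms(1)]] dx_integrable[OF aH[OF assms(2)]]
    by (simp add: rift_diff dx_diff)
qed

text \<open>The order \<open>s - 1\<close> is at least 2, so convergence of the difference quotients
  in \<open>Hs (s - 1)\<close> is uniform convergence of functions and of their slopes.\<close>

lemma rift_time_deriv:
  assumes t: "t \<in> {0..T}"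
  shows "((\<lambda>r. rift (a r) x) has_real_derivative rift (rhs B b (a t)) x) (at t within {0..T})"
    and "((\<lambda>r. rift (dx (a r)) x) has_real_derivative rift (dx (rhs B b (a t))) x) (at t within {0..T})"
proof -
  define q where "q r = (\<lambda>\<xi>. of_real (1 / (r - t)) * (a r \<xi> - a t \<xi>))" for r
  have q: "q r \<in> Hs (s - 1)" if "r \<in> {0..T}" for r
    unfolding q_def using s by (intro Hs_cmult Hs_diff Hs_mono(1)[OF _ aH] that t) auto
  have qd: "(\<lambda>\<xi>. q r \<xi> - rhs B b (a t) \<xi>) \<in> Hs (s - 1)" if "r \<in> {0..T}" for r
    by (intro Hs_diff q that rhsH t)
  have lim: "((\<lambda>r. Hn (s - 1) (\<lambda>\<xi>. q r \<xi> - rhs B b (a t) \<xi>)) \<longlongrightarrow> 0) (at t within {0..T})"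
    using a_deriv[OF t] by (simp add: q_def)
  have i: "integrable lborel (q r)" "integrable lborel (dx (q r))" if "r \<in> {0..T}" for r
    using Hs_integrable[OF q[OF that]] dx_integrable[OF q[OF that]] s by auto
  have ri: "integrable lborel (rhs B b (a t))" "integrable lborel (dx (rhs B b (a t)))"
    using Hs_integrable[OF rhsH[OF t]] dx_integrable[OF rhsH[OF t]] s by auto
  have qe: "rift (q r) x = (rift (a r) x - rift (a t) x) / (r - t)"
    "rift (dx (q r)) x = (rift (dx (a r)) x - rift (dx (a t)) x) / (r - t)" if "r \<in> {0..T}" for r
    using aL(1)[OF that] aL(1)[OF t] dx_integrable[OF aH[OF that]] dx_integrable[OF aH[OF t]] s
    unfolding q_def dx_cmult rift_cmult dx_diff by (simp_all add: rift_diff)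
  have n: "norm ((rift (a r) x - rift (a t) x) / (r - t) - rift (rhs B b (a t)) x) \<le> Hn (s - 1) (\<lambda>\<xi>. q r \<xi> - rhs B b (a t) \<xi>)"
    "norm ((rift (dx (a r)) x - rift (dx (a t)) x) / (r - t) - rift (dx (rhs B b (a t))) x) \<le> Hn (s - 1) (\<lambda>\<xi>. q r \<xi> - rhs B b (a t) \<xi>)"
    if r: "r \<in> {0..T}" for r
    using rift_Hs_bounds[OF qd[OF r], of x] rift_dx_Hs_bounds[OF qd[OF r], of x] s
    by (simp_all add: rift_diff i[OF r] ri qe[OF r] dx_diff)
  show "((\<lambda>r. rift (a r) x) has_real_derivative rift (rhs B b (a t)) x) (at t within {0..T})"
    unfolding has_field_derivative_iff
    by (rule LIM_zero_cancel, rule Lim_null_comparison[OF _ lim], unfold eventually_at_filter)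
       (use n in \<open>auto intro!: always_eventually\<close>)
  show "((\<lambda>r. rift (dx (a r)) x) has_real_derivative rift (dx (rhs B b (a t))) x) (at t within {0..T})"
    unfolding has_field_derivative_iff
    by (rule LIM_zero_cancel, rule Lim_null_comparison[OF _ lim], unfold eventually_at_filter)
       (use n in \<open>auto intro!: always_eventually\<close>)
qed

text \<open>With \<open>q = u^2 / 2\<close> the integral of \<open>q_x u\<close> is minus the
  integral of \<open>q u_x\<close> because \<open>dx\<close> is skew, and twice that integral
  because \<open>q_x u = u^2 u_x = 2 q u_x\<close> pointwise. Hence both vanish.\<close>

lemma L2_conserved:
  assumes t: "t \<in> {0..T}"
  shows "L2_norm (a t) = L2_norm (a 0)"
proof -
  have d0: "((\<lambda>r. (L2_norm (a r))\<^sup>2) has_real_derivative 0) (at t within {0..T})" if t: "t \<in> {0..T}" for t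
  proof -
    define q where "q = (\<lambda>\<xi>. conv (a t) (a t) \<xi> / (4 * pi))"
    have qH: "q \<in> Hs s" unfolding q_def using s by (intro conv_self_Hs aH t) auto
    have qr: "realv q"
      using realv_cmult[OF realv_conv[OF aL(1)[OF t] aL(1)[OF t] ar[OF t] ar[OF t]], of "1 / (4 * pi)"] by (simp add: q_def)
    have q: "integrable lborel q" "q \<in> L2" "integrable lborel (dx q)" "dx q \<in> L2" "realv (dx q)"
      using Hs_integrable[OF qH] Hs_L2(1)[OF _ qH] dx_integrable[OF qH] Hs_L2(1)[OF _ dx_Hs'(1)[OF qH]] realv_dx_Hs[OF qH _ qr] s by auto
    have da: "integrable lborel (dx (a t))" "dx (a t) \<in> L2" "realv (dx (a t))"
      using dx_integrable[OF aH[OF t]] Hs_L2(1)[OF _ dx_Hs'(1)[OF aH[OF t]]] realv_dx_Hs[OF aH[OF t] _ ar[OF t]] s by auto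
    have rq: "rift q = (\<lambda>x. (rift (a t) x)\<^sup>2 / 2)"
      unfolding q_def using rift_conv_self[OF aL(1)[OF t] ar[OF t]] by auto
    have rdq: "rift (dx q) x = rift (a t) x * rift (dx (a t)) x" for x
    proof (rule DERIV_unique)
      show "DERIV (rift q) x :> rift (dx q) x" using DERIV_rift_Hs[OF qH] s by auto
      show "DERIV (rift q) x :> rift (a t) x * rift (dx (a t)) x"
        unfolding rq using DERIV_rift_Hs[OF aH[OF t]] s by (auto intro!: derivative_eq_intros)
    qed
    have "Re (\<integral>\<xi>. dx q \<xi> * cnj (a t \<xi>) \<partial>lborel) = 2 * pi * (\<integral>x. rift (dx q) x * rift (a t) x \<partial>lborel)"
      by (rule Parseval_real[OF q(3-5) aL[OF t] ar[OF t]])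
    moreover have "Re (\<integral>\<xi>. q \<xi> * cnj (dx (a t) \<xi>) \<partial>lborel) = 2 * pi * (\<integral>x. rift q x * rift (dx (a t)) x \<partial>lborel)"
      by (rule Parseval_real[OF q(1,2) qr da])
    moreover have "(\<integral>\<xi>. dx q \<xi> * cnj (a t \<xi>) \<partial>lborel) = - (\<integral>\<xi>. q \<xi> * cnj (dx (a t) \<xi>) \<partial>lborel)"
      unfolding dx_def by (subst Bochner_Integration.integral_minus[symmetric]) (simp add: mult_ac)
    moreover have "(\<integral>x. rift (dx q) x * rift (a t) x \<partial>lborel) = 2 * (\<integral>x. rift q x * rift (dx (a t)) x \<partial>lborel)"
      unfolding rdq rq by (subst integral_mult_right_zero[symmetric]) (simp add: power2_eq_square mult_ac)
    ultimately have z: "Re (\<integral>\<xi>. dx q \<xi> * cnj (a t \<xi>) \<partial>lborel) = 0" by simp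
    have rL: "rhs B b (a t) \<in> L2" using Hs_L2(1)[OF _ rhsH[OF t]] s by simp
    have "Re (\<integral>\<xi>. rhs B b (a t) \<xi> * cnj (a t \<xi>) \<partial>lborel) = (\<integral>\<xi>. Re (rhs B b (a t) \<xi> * cnj (a t \<xi>)) \<partial>lborel)"
      by (rule Bochner_Integration.integral_Re[OF L2_inner_integrable(1)[OF rL aL(2)[OF t]], symmetric])
    also have "\<dots> = (\<integral>\<xi>. - Re (dx q \<xi> * cnj (a t \<xi>)) \<partial>lborel)"
      using Re_rhs_pairing[where p = 1 and c = "a t"] by (simp add: q_def)
    also have "\<dots> = - (\<integral>\<xi>. Re (dx q \<xi> * cnj (a t \<xi>)) \<partial>lborel)"
      by (rule Bochner_Integration.integral_minus)
    also have "\<dots> = - Re (\<integral>\<xi>. dx q \<xi> * cnj (a t \<xi>) \<partial>lborel)"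
      by (simp only: Bochner_Integration.integral_Re[OF L2_inner_integrable(1)[OF q(4) aL(2)[OF t]]])
    finally have z': "Re (\<integral>\<xi>. rhs B b (a t) \<xi> * cnj (a t \<xi>) \<partial>lborel) = 0" using z by simp
    have "((\<lambda>r. (L2_norm (\<lambda>\<xi>. of_real 1 * a r \<xi>))\<^sup>2) has_real_derivative
       2 * Re (\<integral>\<xi>. (of_real 1 * rhs B b (a t) \<xi>) * cnj (of_real 1 * a t \<xi>) \<partial>lborel)) (at t within {0..T})"
    proof (rule quadratic_deriv[where C = 1 and \<sigma> = "s - 1"])
      show "\<bar>1\<bar> \<le> 1 * wt (s - 1) \<xi>" for \<xi> using wt_ge_1[of "s - 1" \<xi>] s by simp
      show "a r \<in> Hs (s - 1)" if "r \<in> {0..T}" for r by (rule Hs_mono(1)[OF _ aH[OF that]]) simp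
    qed (use t a_deriv rhsH in auto)
    then show ?thesis using z' by simp
  qed
  obtain k where "\<And>t. t \<in> {0..T} \<Longrightarrow> (L2_norm (a t))\<^sup>2 = k"
    using has_field_derivative_zero_constant[OF convex_real_interval(5) d0] by auto
  then have "(L2_norm (a t))\<^sup>2 = (L2_norm (a 0))\<^sup>2" using t T by auto
  then show ?thesis by (subst (asm) power2_eq_iff_nonneg) auto
qed

text \<open>At an extremum of \<open>u\<close> only the nonlocal term drives \<open>u\<close>, and
  by conservation of the \<open>L2\<close> norm its bound is constant in time: hence the linear
  growth.\<close>

definition U :: "real \<Rightarrow> real \<Rightarrow> real" where
  "U U0 t = U0 + B * sqrt b * L2_norm (a 0) * t"

text \<open>By \<open>rift_dx_dx_kmult\<close> the forcing is \<open>b^2\<close> times the nonlocal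
  average minus \<open>2 * B * b * u\<close>. Each of the two terms is at most
  \<open>2 * B * b\<close> times the sup bound for \<open>u\<close>.\<close>

definition Fb :: "real \<Rightarrow> real" where
  "Fb U0 = 4 * B * b * U U0 T"

lemma rift_critical:
  assumes t: "t \<in> {0..T}" and ext: "(\<forall>z. rift (a t) z \<le> rift (a t) x) \<or> (\<forall>z. rift (a t) x \<le> rift (a t) z)"
  shows "\<bar>rift (rhs B b (a t)) x\<bar> \<le> B * sqrt b * L2_norm (a 0)"
proof -
  have d: "DERIV (rift (a t)) x :> rift (dx (a t)) x" using DERIV_rift_Hs[OF aH[OF t]] s by auto
  have "rift (dx (a t)) x = 0"
    using ext DERIV_local_max[OF d, of 1] DERIV_local_min[OF d, of 1] by auto
  then have "rift (rhs B b (a t)) x = - rift (dx (kmult B b (a t))) x"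
    using rift_rhs[OF aH[OF t] _ ar[OF t] b B] s by simp
  then show ?thesis
    using rift_dx_kmult_sup[OF aL(2)[OF t] b B, of x] by (simp add: L2_conserved[OF t])
qed

lemma sup_bound:
  assumes U0: "\<And>x. \<bar>rift (a 0) x\<bar> \<le> U0" and t: "t \<in> {0..T}"
  shows "\<bar>rift (a t) x\<bar> \<le> U U0 t"
proof -
  define D where "D = B * sqrt b * L2_norm (a 0)"
  have D: "0 \<le> D" using B b by (simp add: D_def)
  have U00: "0 \<le> U0" using order_trans[OF abs_ge_zero U0] .
  \<comment> \<open>The sign \<open>\<sigma>\<close> treats maxima and minima together;
    \<open>e\<close> supplies the strict inequalities of the comparison principle and is removed at
    the end.\<close>
  have "\<sigma> * rift (a t) x < (U0 + e) + (D + e) * t" if e: "0 < e" and \<sigma>: "\<sigma> = 1 \<or> \<sigma> = -1" for e \<sigma>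
  proof (rule barrier[where f = "\<lambda>t x. \<sigma> * rift (a t) x" and g = "\<lambda>t x. \<sigma> * rift (rhs B b (a t)) x"
        and y = "\<lambda>t. (U0 + e) + (D + e) * t" and y' = "\<lambda>t. D + e" and ?t0.0 = 0 and ?t1.0 = T])
    show "t \<in> {0..T}" by (rule t)
    fix t assume t: "t \<in> {0..T}"
    have "vanishes (rift (a t))" using rift_vanishes'[OF aH[OF t]] s by simp
    then show "vanishes (\<lambda>x. \<sigma> * rift (a t) x)" using \<sigma> by (auto simp: vanishes_def)
    show "continuous_on UNIV (\<lambda>x. \<sigma> * rift (a t) x)"
      using rift_continuous[OF aH[OF t]] s by (intro continuous_intros) auto
    show "((\<lambda>r. \<sigma> * rift (a r) x) has_real_derivative \<sigma> * rift (rhs B b (a t)) x) (at t within {0..T})" for x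
      by (intro DERIV_cmult rift_time_deriv t)
    show "((\<lambda>t. (U0 + e) + (D + e) * t) has_real_derivative D + e) (at t within {0..T})"
      by (auto intro!: derivative_eq_intros)
    show "0 < (U0 + e) + (D + e) * t"
    proof -
      have "0 \<le> (D + e) * t" using D e t by (intro mult_nonneg_nonneg) auto
      then show ?thesis using U00 e by linarith
    qed
    show "\<exists>d>0. \<forall>r\<in>{0..T}. \<bar>r - t\<bar> < d \<longrightarrow> (\<forall>x. \<bar>\<sigma> * rift (a r) x - \<sigma> * rift (a t) x\<bar> \<le> k)" if k: "0 < k" for k
    proof -
      have "\<bar>\<sigma> * rift (a r) x - \<sigma> * rift (a t) x\<bar> = \<bar>rift (a r) x - rift (a t) x\<bar>" for r x using \<sigma> by auto
      note abs_eq = this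
      obtain d where d: "0 < d" "\<And>r. r \<in> {0..T} \<Longrightarrow> \<bar>r - t\<bar> < d \<Longrightarrow> Hn s (\<lambda>\<xi>. a r \<xi> - a t \<xi>) < k"
        using near[OF t k] by blast
      have "\<bar>\<sigma> * rift (a r) x - \<sigma> * rift (a t) x\<bar> \<le> k" if "r \<in> {0..T}" "\<bar>r - t\<bar> < d" for r x
        unfolding abs_eq using rift_diff_le(1)[OF that(1) t, of x] d(2)[OF that] by linarith
      then show ?thesis using d(1) by blast
    qed
    show "\<sigma> * rift (rhs B b (a t)) x < D + e" if "\<And>z. \<sigma> * rift (a t) z \<le> \<sigma> * rift (a t) x" for x
    proof -
      have "\<bar>rift (rhs B b (a t)) x\<bar> \<le> D" unfolding D_def by (rule rift_critical[OF t]) (use that \<sigma> in auto)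
      then show ?thesis using \<sigma> e by auto
    qed
  next
    show "\<sigma> * rift (a 0) x < U0 + e + (D + e) * 0" for x using U0[of x] \<sigma> e by auto
  qed
  from this[of _ 1] this[of _ "-1"]
  have *: "\<bar>rift (a t) x\<bar> < U0 + D * t + e * (1 + t)" if "0 < e" for e
    using that by (force simp: algebra_simps abs_less_iff)
  have "\<bar>rift (a t) x\<bar> \<le> U0 + D * t"
  proof (rule field_le_epsilon)
    fix e :: real assume "0 < e"
    then show "\<bar>rift (a t) x\<bar> \<le> U0 + D * t + e" using *[of "e / (1 + t)"] t by auto
  qed
  then show ?thesis by (simp add: U_def D_def)
qed

lemma U_mono: "t \<le> T \<Longrightarrow> U U0 t \<le> U U0 T"
  unfolding U_def using b B by (intro add_left_mono mult_left_mono) auto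

lemma forcing_bound:
  assumes U0: "\<And>x. \<bar>rift (a 0) x\<bar> \<le> U0" and t: "t \<in> {0..T}"
  shows "\<bar>rift (dx (dx (kmult B b (a t)))) x\<bar> \<le> Fb U0"
proof -
  have u: "\<bar>rift (a t) y\<bar> \<le> U U0 T" for y
    using sup_bound[OF U0 t, of y] U_mono[of t U0] t by auto
  have "\<bar>rift (dx (dx (kmult B b (a t)))) x\<bar> \<le> b\<^sup>2 * \<bar>rift (kmult B b (a t)) x\<bar> + 2 * B * b * \<bar>rift (a t) x\<bar>"
    unfolding rift_dx_dx_kmult[OF aL(1)[OF t] b B] using b B
    by (intro order_trans[OF abs_triangle_ineq4]) (simp add: abs_mult)
  also have "\<dots> \<le> b\<^sup>2 * (2 * B / b * U U0 T) + 2 * B * b * U U0 T"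
    using b B by (intro add_mono mult_left_mono rift_kmult_sup[OF aL(1)[OF t] b B] u) auto
  also have "\<dots> = Fb U0" using b by (simp add: Fb_def power2_eq_square)
  finally show ?thesis .
qed

lemma slope_critical:
  assumes U0: "\<And>x. \<bar>rift (a 0) x\<bar> \<le> U0" and t: "t \<in> {0..T}"
    and ext: "(\<forall>z. rift (dx (a t)) z \<le> rift (dx (a t)) x) \<or> (\<forall>z. rift (dx (a t)) x \<le> rift (dx (a t)) z)"
  shows "\<bar>rift (dx (rhs B b (a t))) x + (rift (dx (a t)) x)\<^sup>2\<bar> \<le> Fb U0"
proof -
  have d: "DERIV (rift (dx (a t))) x :> rift (dx (dx (a t))) x"
    using DERIV_rift_Hs[OF dx_Hs'(1)[OF aH[OF t]]] s by auto
  have "rift (dx (dx (a t))) x = 0"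
    using ext DERIV_local_max[OF d, of 1] DERIV_local_min[OF d, of 1] by auto
  then have "rift (dx (rhs B b (a t))) x + (rift (dx (a t)) x)\<^sup>2 = - rift (dx (dx (kmult B b (a t)))) x"
    using rift_dx_rhs[OF aH[OF t] s ar[OF t] b B, of x] by simp
  then show ?thesis using forcing_bound[OF U0 t, of x] by simp
qed

lemma Fb_nonneg:
  assumes U0: "\<And>x. \<bar>rift (a 0) x\<bar> \<le> U0"
  shows "0 \<le> Fb U0"
  using order_trans[OF abs_ge_zero forcing_bound[OF U0, of 0]] T by auto

text \<open>At a maximum of the slope the Riccati term \<open>- (u_x)^2\<close> has the favourable
  sign, so the forcing alone can raise the maximum.\<close>

lemma slope_upper:
  assumes U0: "\<And>x. \<bar>rift (a 0) x\<bar> \<le> U0" and M0: "\<And>x. \<bar>rift (dx (a 0)) x\<bar> \<le> M0" and t: "t \<in> {0..T}"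
  shows "rift (dx (a t)) x \<le> M0 + Fb U0 * t"
proof -
  have M00: "0 \<le> M0" using order_trans[OF abs_ge_zero M0] .
  have F: "0 \<le> Fb U0" by (rule Fb_nonneg[OF U0])
  have "rift (dx (a t)) x < (M0 + e) + (Fb U0 + e) * t" if e: "0 < e" for e
  proof (rule barrier[where f = "\<lambda>t x. rift (dx (a t)) x" and g = "\<lambda>t x. rift (dx (rhs B b (a t))) x"
        and y = "\<lambda>t. (M0 + e) + (Fb U0 + e) * t" and y' = "\<lambda>t. Fb U0 + e" and ?t0.0 = 0 and ?t1.0 = T])
    show "t \<in> {0..T}" by (rule t)
    fix t assume t: "t \<in> {0..T}"
    note dH = dx_Hs'(1)[OF aH[OF t]]
    show "vanishes (rift (dx (a t)))" using rift_vanishes'[OF dH] s by simp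
    show "continuous_on UNIV (rift (dx (a t)))"
      using rift_continuous[OF dH] s by simp
    show "((\<lambda>r. rift (dx (a r)) x) has_real_derivative rift (dx (rhs B b (a t))) x) (at t within {0..T})" for x
      by (intro rift_time_deriv t)
    show "((\<lambda>t. (M0 + e) + (Fb U0 + e) * t) has_real_derivative Fb U0 + e) (at t within {0..T})"
      by (auto intro!: derivative_eq_intros)
    show "0 < (M0 + e) + (Fb U0 + e) * t"
    proof -
      have "0 \<le> (Fb U0 + e) * t" using F e t by (intro mult_nonneg_nonneg) auto
      then show ?thesis using M00 e by linarith
    qed
    show "\<exists>d>0. \<forall>r\<in>{0..T}. \<bar>r - t\<bar> < d \<longrightarrow> (\<forall>x. \<bar>rift (dx (a r)) x - rift (dx (a t)) x\<bar> \<le> k)" if k: "0 < k" for k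
    proof -
      obtain d where d: "0 < d" "\<And>r. r \<in> {0..T} \<Longrightarrow> \<bar>r - t\<bar> < d \<Longrightarrow> Hn s (\<lambda>\<xi>. a r \<xi> - a t \<xi>) < k"
        using near[OF t k] by blast
      have "\<bar>rift (dx (a r)) x - rift (dx (a t)) x\<bar> \<le> k" if "r \<in> {0..T}" "\<bar>r - t\<bar> < d" for r x
        using rift_diff_le(2)[OF that(1) t, of x] d(2)[OF that] by linarith
      then show ?thesis using d(1) by blast
    qed
    show "rift (dx (rhs B b (a t))) x < Fb U0 + e" if "\<And>z. rift (dx (a t)) z \<le> rift (dx (a t)) x" for x
    proof -
      have "\<bar>rift (dx (rhs B b (a t))) x + (rift (dx (a t)) x)\<^sup>2\<bar> \<le> Fb U0"
        by (rule slope_critical[OF U0 t]) (use that in auto)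
      then show ?thesis using e zero_le_power2[of "rift (dx (a t)) x"] by linarith
    qed
  next
    show "rift (dx (a 0)) x < M0 + e + (Fb U0 + e) * 0" for x using M0[of x] e by auto
  qed
  then have *: "rift (dx (a t)) x < M0 + Fb U0 * t + e * (1 + t)" if "0 < e" for e
    using that by (force simp: algebra_simps)
  show ?thesis
  proof (rule field_le_epsilon)
    fix e :: real assume "0 < e"
    then show "rift (dx (a t)) x \<le> M0 + Fb U0 * t + e" using *[of "e / (1 + t)"] t by auto
  qed
qed

text \<open>Wave breaking: the minimum $m$ of the slope satisfies $m' \le - m^2 + F$. The barrier
  \<^term>\<open>- 1 / z\<close> with \<^term>\<open>z\<close> decreasing at rate \<^term>\<open>1/2\<close> solves $y' = - y^2 / 2$ and reaches
  $-\infty$ at time \<^term>\<open>t0 + 2 * c\<close>. The comparison principle is applied backwards in time.\<close>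
lemma wave_breaking:
  assumes U0: "\<And>x. \<bar>rift (a 0) x\<bar> \<le> U0" and t0: "0 \<le> t0" and c: "0 < c" "t0 + 2 * c \<le> T"
    and F: "Fb U0 < 1 / (2 * c\<^sup>2)"
  shows "- 1 / c < rift (dx (a t0)) x"
proof -
  obtain M where M: "\<And>t. t \<in> {0..T} \<Longrightarrow> Hn s (a t) \<le> M" using Hn_bounded by blast
  have M0: "0 \<le> M" using order_trans[OF Hn_nonneg M[of 0]] T by simp
  \<comment> \<open>The reversed comparison has to start strictly below the barrier:
    \<open>1 / z1\<close> exceeds the bound \<open>M\<close> for the slope, and the term
    \<open>1 / c\<close> ensures \<open>z1 \<le> c\<close>.\<close>
  define z1 where "z1 = 1 / (M + 1 + 1 / c)"
  have den: "0 < M + 1 + 1 / c" using M0 c by (simp add: add_nonneg_pos)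
  have z1: "0 < z1" "z1 \<le> c"
  proof -
    show "0 < z1" using den by (simp add: z1_def)
    have "z1 \<le> 1 / (1 / c)" unfolding z1_def using M0 c den by (intro divide_left_mono) auto
    then show "z1 \<le> c" by simp
  qed
  \<comment> \<open>The time at which the barrier, started at \<open>- 1 / c\<close>, has come down
    to \<open>- 1 / z1\<close>; it precedes the breaking time \<open>t0 + 2 * c\<close>.\<close>
  define t1 where "t1 = t0 + 2 * (c - z1)"
  have t1: "t0 \<le> t1" "t1 \<le> T" using z1 c by (auto simp: t1_def)
  \<comment> \<open>Reversal of \<open>{t0..t1}\<close>. Minus the slope then has to stay below a
    decreasing positive barrier.\<close>
  define \<rho> where "\<rho> \<tau> = t0 + t1 - \<tau>" for \<tau>
  have \<rho>: "\<rho> \<tau> \<in> {0..T}" if "\<tau> \<in> {t0..t1}" for \<tau> using that t0 t1 by (auto simp: \<rho>_def)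
  define z where "z \<tau> = c - (\<rho> \<tau> - t0) / 2" for \<tau>
  have z: "0 < z \<tau>" "z \<tau> \<le> c" if "\<tau> \<in> {t0..t1}" for \<tau>
    using that z1 by (auto simp: z_def \<rho>_def t1_def)
  have \<rho>d: "(\<rho> has_real_derivative -1) (at \<tau> within J)" for \<tau> J
    unfolding \<rho>_def by (auto intro!: derivative_eq_intros)
  have zd: "(z has_real_derivative 1/2) (at \<tau> within J)" for \<tau> J
    unfolding z_def[abs_def] by (auto intro!: derivative_eq_intros \<rho>d)
  have "- rift (dx (a (\<rho> t1))) x < 1 / z t1"
  proof (rule barrier[where f = "\<lambda>\<tau> x. - rift (dx (a (\<rho> \<tau>))) x" and g = "\<lambda>\<tau> x. rift (dx (rhs B b (a (\<rho> \<tau>)))) x"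
        and y = "\<lambda>\<tau>. 1 / z \<tau>" and y' = "\<lambda>\<tau>. - (1/2) / (z \<tau>)\<^sup>2" and ?t0.0 = t0 and ?t1.0 = t1])
    show "t1 \<in> {t0..t1}" using t1 by simp
    have h: "Hn s (a t1) \<le> M" using t0 t1 by (intro M) auto
    have "\<rho> t0 = t1" "z t0 = z1" by (auto simp: \<rho>_def z_def t1_def diff_divide_distrib)
    moreover have "\<bar>rift (dx (a t1)) x\<bar> \<le> M" for x
      using order_trans[OF rift_dx_Hs_bounds[OF aH] h] t0 t1 s by auto
    moreover have "M < 1 / z1" using c by (simp add: z1_def add_pos_pos)
    ultimately show "- rift (dx (a (\<rho> t0))) x < 1 / z t0" for x
      by (smt (verit, best))
    fix \<tau> assume \<tau>: "\<tau> \<in> {t0..t1}"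
    note t = \<rho>[OF \<tau>]
    note dH = dx_Hs'(1)[OF aH[OF t]]
    have "vanishes (rift (dx (a (\<rho> \<tau>))))" using rift_vanishes'[OF dH] s by simp
    then show "vanishes (\<lambda>x. - rift (dx (a (\<rho> \<tau>))) x)" by (simp add: vanishes_def)
    show "continuous_on UNIV (\<lambda>x. - rift (dx (a (\<rho> \<tau>))) x)"
      using rift_continuous[OF dH] s by (intro continuous_intros) auto
    show "((\<lambda>r. - rift (dx (a (\<rho> r))) x) has_real_derivative rift (dx (rhs B b (a (\<rho> \<tau>)))) x) (at \<tau> within {t0..t1})" for x
    proof -
      have "((\<lambda>t. rift (dx (a t)) x) has_real_derivative rift (dx (rhs B b (a (\<rho> \<tau>)))) x) (at (\<rho> \<tau>) within \<rho> ` {t0..t1})"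
        by (rule DERIV_subset[OF rift_time_deriv(2)[OF t]]) (use \<rho> in auto)
      from DERIV_minus[OF DERIV_image_chain[OF this \<rho>d]] show ?thesis by (simp add: o_def)
    qed
    show "((\<lambda>\<tau>. 1 / z \<tau>) has_real_derivative - (1/2) / (z \<tau>)\<^sup>2) (at \<tau> within {t0..t1})"
      using z[OF \<tau>] by (auto intro!: derivative_eq_intros zd simp: power2_eq_square)
    show "0 < 1 / z \<tau>" using z[OF \<tau>] by simp
    show "\<exists>d>0. \<forall>r\<in>{t0..t1}. \<bar>r - \<tau>\<bar> < d \<longrightarrow> (\<forall>x. \<bar>- rift (dx (a (\<rho> r))) x - - rift (dx (a (\<rho> \<tau>))) x\<bar> \<le> k)" if k: "0 < k" for k
    proof -
      obtain d where d: "0 < d" "\<And>r. r \<in> {0..T} \<Longrightarrow> \<bar>r - \<rho> \<tau>\<bar> < d \<Longrightarrow> Hn s (\<lambda>\<xi>. a r \<xi> - a (\<rho> \<tau>) \<xi>) < k"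
        using near[OF t k] by blast
      have "\<bar>- rift (dx (a (\<rho> r))) x - - rift (dx (a (\<rho> \<tau>))) x\<bar> \<le> k" if r: "r \<in> {t0..t1}" "\<bar>r - \<tau>\<bar> < d" for r x
      proof -
        have "\<bar>\<rho> r - \<rho> \<tau>\<bar> < d" using r by (simp add: \<rho>_def)
        then show ?thesis using rift_diff_le(2)[OF \<rho>[OF r(1)] t, of x] d(2)[OF \<rho>[OF r(1)]] by linarith
      qed
      then show ?thesis using d(1) by blast
    qed
    \<comment> \<open>At contact \<open>(u_x)^2 = 1 / z^2\<close>. One half of it is the speed of
      the barrier, and the other half, at least \<open>1 / (2 * c^2)\<close> because
      \<open>z \<le> c\<close>, outweighs the forcing.\<close>
    show "rift (dx (rhs B b (a (\<rho> \<tau>)))) x < - (1/2) / (z \<tau>)\<^sup>2"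
      if mx: "\<And>w. - rift (dx (a (\<rho> \<tau>))) w \<le> - rift (dx (a (\<rho> \<tau>))) x" and eq: "- rift (dx (a (\<rho> \<tau>))) x = 1 / z \<tau>" for x
    proof -
      have "\<bar>rift (dx (rhs B b (a (\<rho> \<tau>)))) x + (rift (dx (a (\<rho> \<tau>))) x)\<^sup>2\<bar> \<le> Fb U0"
        by (rule slope_critical[OF U0 t]) (use mx in auto)
      moreover have "(rift (dx (a (\<rho> \<tau>))) x)\<^sup>2 = 1 / (z \<tau>)\<^sup>2"
        using eq by (metis power2_minus power_one_over)
      moreover have "1 / (2 * c\<^sup>2) \<le> 1 / (2 * (z \<tau>)\<^sup>2)"
        using z[OF \<tau>] by (intro divide_left_mono) (auto intro: power_mono)
      moreover have "1 / (z \<tau>)\<^sup>2 = 2 * (1 / (2 * (z \<tau>)\<^sup>2))" "- (1/2) / (z \<tau>)\<^sup>2 = - (1 / (2 * (z \<tau>)\<^sup>2))" by simp_all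
      ultimately show ?thesis using F by linarith
    qed
  qed
  then show ?thesis by (simp add: \<rho>_def z_def)
qed

end

section \<open>Energy estimates\<close>

lemma gronwall:
  fixes f f' :: "real \<Rightarrow> real"
  assumes d: "\<And>t. t \<in> {0..T} \<Longrightarrow> (f has_real_derivative f' t) (at t within {0..T})"
    and le: "\<And>t. t \<in> {0..T} \<Longrightarrow> f' t \<le> C * f t + D" and C: "0 \<le> C" and D: "0 \<le> D" and t: "t \<in> {0..T}"
  shows "f t \<le> (f 0 + D * t) * exp (C * t)"
proof -
  \<comment> \<open>The integrating factor leaves a source of at most
    \<open>D * exp (- (C * r)) \<le> D\<close>, so that \<open>g\<close> does not increase.\<close>
  define g where "g t = f t * exp (- (C * t)) - D * t" for t
  have gd: "(g has_derivative (*) ((f' r - C * f r) * exp (- (C * r)) - D)) (at r within {0..t})" if "r \<in> {0..t}" for r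
  proof -
    have r: "r \<in> {0..T}" using that t by auto
    have "(g has_real_derivative (f' r - C * f r) * exp (- (C * r)) - D) (at r within {0..T})"
      unfolding g_def by (auto intro!: derivative_eq_intros d[OF r] simp: algebra_simps)
    then have "(g has_real_derivative (f' r - C * f r) * exp (- (C * r)) - D) (at r within {0..t})"
      by (rule DERIV_subset) (use t in auto)
    then show ?thesis by (simp only: has_field_derivative_def)
  qed
  obtain r where r: "r \<in> {0..t}" "g t - g 0 = ((f' r - C * f r) * exp (- (C * r)) - D) * (t - 0)"
    using mvt_very_simple[OF _ gd] t by auto
  have "(f' r - C * f r) * exp (- (C * r)) \<le> D * exp (- (C * r))"
    using le[of r] r(1) t by (intro mult_right_mono) auto
  also have "\<dots> \<le> D * 1" using C D r(1) by (intro mult_left_mono) auto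
  finally have "g t - g 0 \<le> 0"
    unfolding r(2) using t by (intro mult_nonpos_nonneg) auto
  then have "f t * exp (- (C * t)) \<le> f 0 + D * t" by (simp add: g_def)
  from mult_right_mono[OF this exp_ge_zero[of "C * t"]]
  show ?thesis by (simp add: mult.assoc flip: exp_add)
qed

lemma integrable_bounded_mult_real:
  fixes f g :: "real \<Rightarrow> real"
  assumes f: "integrable lborel f" and [measurable]: "g \<in> borel_measurable borel" and g: "\<And>x. \<bar>g x\<bar> \<le> C"
  shows "integrable lborel (\<lambda>x. g x * f x)"
proof (rule Bochner_Integration.integrable_bound[OF integrable_mult_right[OF integrable_norm[OF f], of C]])
  note [measurable] = borel_measurable_integrable[OF f]
  show "(\<lambda>x. g x * f x) \<in> borel_measurable lborel" by measurable
  have "0 \<le> C" using order_trans[OF abs_ge_zero g] .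
  then show "AE x in lborel. norm (g x * f x) \<le> norm (C * norm (f x))"
    by (intro AE_I2) (auto simp: abs_mult intro!: mult_right_mono g)
qed

lemma abs_integral_bounded_mult:
  fixes f g :: "real \<Rightarrow> real"
  assumes f: "integrable lborel f" "\<And>x. 0 \<le> f x" and m: "g \<in> borel_measurable borel" and g: "\<And>x. \<bar>g x\<bar> \<le> C"
  shows "\<bar>\<integral>x. g x * f x \<partial>lborel\<bar> \<le> C * (\<integral>x. f x \<partial>lborel)"
proof -
  have "\<bar>\<integral>x. g x * f x \<partial>lborel\<bar> \<le> (\<integral>x. \<bar>g x * f x\<bar> \<partial>lborel)" by (rule integral_abs_bound)
  also have "\<dots> \<le> (\<integral>x. C * f x \<partial>lborel)"
  proof (rule integral_mono)
    show "integrable lborel (\<lambda>x. \<bar>g x * f x\<bar>)"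
      by (rule integrable_abs[OF integrable_bounded_mult_real[OF f(1) m g]])
    show "\<bar>g x * f x\<bar> \<le> C * f x" for x
      using mult_right_mono[OF g f(2), of x x] f(2)[of x] by (simp add: abs_mult)
  qed (use f in simp)
  finally show ?thesis by simp
qed

lemma rift_measurable: "integrable lborel a \<Longrightarrow> rift a \<in> borel_measurable borel"
  unfolding rift_def[abs_def]
  by (intro measurable_compose[OF borel_measurable_continuous_onI[OF ift_continuous]] borel_measurable_continuous_onI continuous_intros)

text \<open>With $u$ and $w$ the functions with transforms \<^term>\<open>a\<close> and \<^term>\<open>z\<close>, this is the
  integration by parts $2 \int u\, w\, w_x = - \int u_x w^2$. Since $w$ is only in $H^1$, the derivative
  is replaced by a difference quotient.\<close>
lemma transport_pairing:
  assumes a: "integrable lborel a" "a \<in> L2" "realv a"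
    and M: "\<And>x y. \<bar>rift a x - rift a y\<bar> \<le> M * \<bar>x - y\<bar>"
    and z: "integrable lborel z" "z \<in> L2" "dx z \<in> L2"
  shows "\<bar>Re (\<integral>\<xi>. dx z \<xi> * cnj (conv a z \<xi>) \<partial>lborel)\<bar> \<le> pi * M * (L2_norm z)\<^sup>2"
proof -
  define w where "w = ift z"
  define u where "u = rift a"
  define U where "U = (\<integral>\<xi>. norm (a \<xi>) \<partial>lborel) / (2 * pi)"
  have U: "\<bar>u x\<bar> \<le> U" for x unfolding u_def U_def by (rule abs_rift_le)
  have [measurable]: "u \<in> borel_measurable borel" unfolding u_def by (rule rift_measurable[OF a(1)])
  have w2: "w \<in> L2" "(L2_norm w)\<^sup>2 = (L2_norm z)\<^sup>2 / (2 * pi)" unfolding w_def by (rule ift_L2[OF z(1,2)])+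
  note [measurable] = L2_measurable[OF w2(1)] L2_measurable[OF z(2)]
  define cz where "cz = conv a z"
  have cz: "integrable lborel cz" "cz \<in> L2"
    unfolding cz_def using conv_integrable[OF a(1) z(1)] conv_Young(1)[OF a(1) z(2)] by auto
  have icz: "ift cz x = of_real (2 * pi * u x) * w x" for x
    unfolding cz_def ift_conv[OF a(1) z(1)] realv_ift[OF a(3)] u_def w_def by simp
  \<comment> \<open>After division by \<open>h\<close> the first term is the desired bound and the
    second one tends to 0.\<close>
  have est: "\<bar>Re (\<integral>\<xi>. (cis (h * \<xi>) - 1) * z \<xi> * cnj (cz \<xi>) \<partial>lborel)\<bar>
      \<le> pi * M * (L2_norm z)\<^sup>2 * h + pi * U * (L2_norm (dx z))\<^sup>2 * h\<^sup>2" if h: "0 < h" for h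
  proof -
    define m where "m = (\<lambda>\<xi>. (cis (h * \<xi>) - 1) * z \<xi>)"
    have bd: "norm (cis (h * \<xi>) - 1) \<le> 2" for \<xi>
      using norm_triangle_ineq4[of "cis (h * \<xi>)" 1] by simp
    have m1: "integrable lborel m"
      unfolding m_def by (rule integrable_bounded_mult[OF z(1) _ bd]) measurable
    have mle: "norm (m \<xi>) \<le> norm (h *\<^sub>R dx z \<xi>)" for \<xi>
      using mult_right_mono[OF norm_cis_minus_1_le[of "h * \<xi>"], of "norm (z \<xi>)"] h
      by (simp add: m_def norm_mult norm_dx abs_mult mult_ac)
    have [measurable]: "m \<in> borel_measurable borel" unfolding m_def by measurable
    have m2: "m \<in> L2" "L2_norm m \<le> h * L2_norm (dx z)"
      using L2_dominated[OF L2_scaleR[OF z(3), of h], of m] mle h L2_norm_scaleR[of h "dx z"] by auto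
    define dw where "dw = ift m"
    have dw: "dw x = w (x + h) - w x" for x
      unfolding dw_def m_def w_def ift_translate_diff[OF z(1), symmetric] ..
    have dw2: "dw \<in> L2" "(L2_norm dw)\<^sup>2 = (L2_norm m)\<^sup>2 / (2 * pi)" unfolding dw_def by (rule ift_L2[OF m1 m2(1)])+
    note [measurable] = L2_measurable[OF dw2(1)]
    have wh: "integrable lborel (\<lambda>x. (norm (w (x + h)))\<^sup>2)"
      using integrable_shift[of "\<lambda>x. (norm (w x))\<^sup>2" "-h"] L2_integrable[OF w2(1)] by simp
    note wi = L2_integrable[OF w2(1)] L2_integrable[OF dw2(1)] wh
    \<comment> \<open>A discrete product rule: twice the real part of \<open>dw * cnj w\<close> is
      the increment of the squared modulus minus the squared modulus of the increment, and the
      latter has integral of order \<open>h^2\<close>.\<close>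
    have pt: "Re (dw x * cnj (ift cz x)) = pi * (u x * (norm (w (x + h)))\<^sup>2) - pi * (u x * (norm (w x))\<^sup>2) - pi * (u x * (norm (dw x))\<^sup>2)" for x
    proof -
      have "Re (dw x * cnj (w x)) = ((norm (w (x + h)))\<^sup>2 - (norm (w x))\<^sup>2 - (norm (dw x))\<^sup>2) / 2"
        unfolding dw cmod_power2 by (simp add: power2_eq_square field_simps)
      then have "2 * pi * u x * Re (dw x * cnj (w x)) = pi * u x * ((norm (w (x + h)))\<^sup>2 - (norm (w x))\<^sup>2 - (norm (dw x))\<^sup>2)" by simp
      moreover have "Re (dw x * cnj (ift cz x)) = 2 * pi * u x * Re (dw x * cnj (w x))"
        unfolding icz by (simp add: algebra_simps)
      ultimately show ?thesis by (simp add: algebra_simps)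
    qed
    have i1: "integrable lborel (\<lambda>x. u x * (norm (w (x + h)))\<^sup>2)" "integrable lborel (\<lambda>x. u x * (norm (w x))\<^sup>2)"
      "integrable lborel (\<lambda>x. u x * (norm (dw x))\<^sup>2)"
      by (rule integrable_bounded_mult_real[OF _ _ U]; use wi in simp)+
    have us: "integrable lborel (\<lambda>x. u (x - h) * (norm (w x))\<^sup>2)"
      by (rule integrable_bounded_mult_real[where C = U]) (use wi U in auto)
    have "Re (\<integral>\<xi>. m \<xi> * cnj (cz \<xi>) \<partial>lborel) = 2 * pi * Re (\<integral>x. dw x * cnj (ift cz x) \<partial>lborel)"
      unfolding dw_def by (rule Parseval_Re[OF m1 m2(1) cz])
    also have "Re (\<integral>x. dw x * cnj (ift cz x) \<partial>lborel) = (\<integral>x. Re (dw x * cnj (ift cz x)) \<partial>lborel)"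
      by (rule Bochner_Integration.integral_Re[symmetric, OF L2_inner_integrable(1)[OF dw2(1) ift_L2(1)[OF cz]]])
    also have "\<dots> = pi * (\<integral>x. u x * (norm (w (x + h)))\<^sup>2 \<partial>lborel) - pi * (\<integral>x. u x * (norm (w x))\<^sup>2 \<partial>lborel)
        - pi * (\<integral>x. u x * (norm (dw x))\<^sup>2 \<partial>lborel)"
      unfolding pt using i1 by simp
    \<comment> \<open>Summation by parts: the shift passes from \<open>w\<close> to
      \<open>u\<close>, and the Lipschitz bound for \<open>u\<close> gains the factor
      \<open>h\<close>.\<close>
    also have "(\<integral>x. u x * (norm (w (x + h)))\<^sup>2 \<partial>lborel) = (\<integral>x. u (x - h) * (norm (w x))\<^sup>2 \<partial>lborel)"
      using integral_shift[of "\<lambda>x. u (x - h) * (norm (w x))\<^sup>2" "-h"] by simp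
    also have "pi * (\<integral>x. u (x - h) * (norm (w x))\<^sup>2 \<partial>lborel) - pi * (\<integral>x. u x * (norm (w x))\<^sup>2 \<partial>lborel)
        = pi * (\<integral>x. (u (x - h) - u x) * (norm (w x))\<^sup>2 \<partial>lborel)"
      using i1 us by (simp add: left_diff_distrib right_diff_distrib)
    finally have eq: "Re (\<integral>\<xi>. m \<xi> * cnj (cz \<xi>) \<partial>lborel)
      = 2 * pi * (pi * (\<integral>x. (u (x - h) - u x) * (norm (w x))\<^sup>2 \<partial>lborel) - pi * (\<integral>x. u x * (norm (dw x))\<^sup>2 \<partial>lborel))" .
    have e1: "\<bar>\<integral>x. (u (x - h) - u x) * (norm (w x))\<^sup>2 \<partial>lborel\<bar> \<le> (M * h) * (L2_norm w)\<^sup>2"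
      unfolding L2_norm_sq using M[of "x - h" x for x] h wi
      by (intro abs_integral_bounded_mult) (auto simp: u_def[symmetric])
    have e2: "\<bar>\<integral>x. u x * (norm (dw x))\<^sup>2 \<partial>lborel\<bar> \<le> U * (L2_norm dw)\<^sup>2"
      unfolding L2_norm_sq using wi U by (intro abs_integral_bounded_mult) auto
    have U0: "0 \<le> U" using order_trans[OF abs_ge_zero U] .
    have "\<bar>Re (\<integral>\<xi>. m \<xi> * cnj (cz \<xi>) \<partial>lborel)\<bar> \<le> 2 * pi * (pi * ((M * h) * (L2_norm w)\<^sup>2) + pi * (U * (L2_norm dw)\<^sup>2))"
    proof -
      have "\<bar>pi * (\<integral>x. (u (x - h) - u x) * (norm (w x))\<^sup>2 \<partial>lborel) - pi * (\<integral>x. u x * (norm (dw x))\<^sup>2 \<partial>lborel)\<bar>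
         \<le> \<bar>pi * (\<integral>x. (u (x - h) - u x) * (norm (w x))\<^sup>2 \<partial>lborel)\<bar> + \<bar>pi * (\<integral>x. u x * (norm (dw x))\<^sup>2 \<partial>lborel)\<bar>"
        by (rule abs_triangle_ineq4)
      also have "\<dots> \<le> pi * ((M * h) * (L2_norm w)\<^sup>2) + pi * (U * (L2_norm dw)\<^sup>2)"
        using e1 e2 by (intro add_mono) (auto simp: abs_mult)
      finally show ?thesis unfolding eq abs_mult by (intro mult_mono) auto
    qed
    also have "\<dots> = pi * M * (L2_norm z)\<^sup>2 * h + pi * U * (L2_norm m)\<^sup>2"
      unfolding w2(2) dw2(2) by (simp add: field_simps)
    also have "\<dots> \<le> pi * M * (L2_norm z)\<^sup>2 * h + pi * U * (h * L2_norm (dx z))\<^sup>2"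
      using m2(2) U0 h by (intro add_left_mono mult_left_mono power_mono) auto
    finally show ?thesis by (simp add: m_def power_mult_distrib mult_ac)
  qed
  define h where "h n = inverse (real (Suc n))" for n
  have h: "0 < h n" "h \<longlonglongrightarrow> 0" for n unfolding h_def using LIMSEQ_inverse_real_of_nat by auto
  note [measurable] = L2_measurable[OF cz(2)]
  have [measurable]: "cnj \<in> borel_measurable borel"
    by (intro borel_measurable_continuous_onI continuous_intros)
  have "(\<lambda>n. \<integral>\<xi>. (cis (h n * \<xi>) - 1) / of_real (h n) * z \<xi> * cnj (cz \<xi>) \<partial>lborel) \<longlonglongrightarrow> (\<integral>\<xi>. dx z \<xi> * cnj (cz \<xi>) \<partial>lborel)"
  proof (rule integral_dominated_convergence[where w = "\<lambda>\<xi>. norm (dx z \<xi>) * norm (cz \<xi>)"])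
    show "integrable lborel (\<lambda>\<xi>. norm (dx z \<xi>) * norm (cz \<xi>))" by (rule L2_Cauchy_Schwarz(1)[OF z(3) cz(2)])
    show "AE \<xi> in lborel. (\<lambda>n. (cis (h n * \<xi>) - 1) / of_real (h n) * z \<xi> * cnj (cz \<xi>)) \<longlonglongrightarrow> dx z \<xi> * cnj (cz \<xi>)"
      unfolding dx_def using h(1) by (intro AE_I2 tendsto_intros cis_difference_quotient h(2)) (auto simp: less_le)
    show "AE \<xi> in lborel. norm ((cis (h n * \<xi>) - 1) / of_real (h n) * z \<xi> * cnj (cz \<xi>)) \<le> norm (dx z \<xi>) * norm (cz \<xi>)" for n
    proof (intro AE_I2)
      fix \<xi>
      have "norm (cis (h n * \<xi>) - 1) / h n \<le> \<bar>\<xi>\<bar>"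
        using norm_cis_minus_1_le[of "h n * \<xi>"] h(1)[of n] by (simp add: abs_mult field_simps)
      then have "norm (cis (h n * \<xi>) - 1) / h n * (norm (z \<xi>) * norm (cz \<xi>)) \<le> \<bar>\<xi>\<bar> * (norm (z \<xi>) * norm (cz \<xi>))"
        by (intro mult_right_mono) auto
      then show "norm ((cis (h n * \<xi>) - 1) / of_real (h n) * z \<xi> * cnj (cz \<xi>)) \<le> norm (dx z \<xi>) * norm (cz \<xi>)"
        using h(1)[of n] by (simp add: norm_mult norm_divide norm_dx mult_ac)
    qed
  qed (use z in \<open>auto intro!: dx_measurable borel_measurable_times borel_measurable_divide\<close>)
  then have L: "(\<lambda>n. \<bar>Re (\<integral>\<xi>. (cis (h n * \<xi>) - 1) / of_real (h n) * z \<xi> * cnj (cz \<xi>) \<partial>lborel)\<bar>) \<longlonglongrightarrow> \<bar>Re (\<integral>\<xi>. dx z \<xi> * cnj (cz \<xi>) \<partial>lborel)\<bar>"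
    by (intro tendsto_intros)
  have le: "\<bar>Re (\<integral>\<xi>. (cis (h n * \<xi>) - 1) / of_real (h n) * z \<xi> * cnj (cz \<xi>) \<partial>lborel)\<bar>
      \<le> pi * M * (L2_norm z)\<^sup>2 + pi * U * (L2_norm (dx z))\<^sup>2 * h n" for n
  proof -
    have "(\<integral>\<xi>. (cis (h n * \<xi>) - 1) / of_real (h n) * z \<xi> * cnj (cz \<xi>) \<partial>lborel)
      = (\<integral>\<xi>. (cis (h n * \<xi>) - 1) * z \<xi> * cnj (cz \<xi>) / of_real (h n) \<partial>lborel)" by simp
    also have "\<dots> = (\<integral>\<xi>. (cis (h n * \<xi>) - 1) * z \<xi> * cnj (cz \<xi>) \<partial>lborel) / of_real (h n)"
      by (rule integral_divide_zero)
    finally have "\<bar>Re (\<integral>\<xi>. (cis (h n * \<xi>) - 1) / of_real (h n) * z \<xi> * cnj (cz \<xi>) \<partial>lborel)\<bar>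
      = \<bar>Re (\<integral>\<xi>. (cis (h n * \<xi>) - 1) * z \<xi> * cnj (cz \<xi>) \<partial>lborel)\<bar> / h n"
      using h(1)[of n] by (simp add: Re_divide_of_real)
    also have "\<dots> \<le> (pi * M * (L2_norm z)\<^sup>2 * h n + pi * U * (L2_norm (dx z))\<^sup>2 * (h n)\<^sup>2) / h n"
      using h(1)[of n] by (intro divide_right_mono est) auto
    also have "\<dots> = pi * M * (L2_norm z)\<^sup>2 + pi * U * (L2_norm (dx z))\<^sup>2 * h n"
      using h(1)[of n] by (simp add: add_divide_distrib power2_eq_square)
    finally show ?thesis .
  qed
  have "(\<lambda>n. pi * M * (L2_norm z)\<^sup>2 + pi * U * (L2_norm (dx z))\<^sup>2 * h n) \<longlonglongrightarrow> pi * M * (L2_norm z)\<^sup>2 + pi * U * (L2_norm (dx z))\<^sup>2 * 0"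
    by (intro tendsto_intros h)
  from LIMSEQ_le[OF L this] le show ?thesis unfolding cz_def by auto
qed

lemma dx_conv:
  assumes "a \<in> L2" "c \<in> L2" "dx a \<in> L2" "dx c \<in> L2"
  shows "dx (conv a c) \<xi> = conv (dx a) c \<xi> + conv a (dx c) \<xi>"
proof -
  have "dx (conv a c) \<xi> = (\<integral>\<eta>. \<i> * of_real \<xi> * (a (\<xi> - \<eta>) * c \<eta>) \<partial>lborel)"
    by (simp add: dx_def conv_def)
  also have "\<dots> = (\<integral>\<eta>. dx a (\<xi> - \<eta>) * c \<eta> + a (\<xi> - \<eta>) * dx c \<eta> \<partial>lborel)"
    by (intro Bochner_Integration.integral_cong refl) (simp add: dx_def algebra_simps)
  also have "\<dots> = conv (dx a) c \<xi> + conv a (dx c) \<xi>"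
    unfolding conv_def by (intro Bochner_Integration.integral_add conv_L2_integrable assms)
  finally show ?thesis .
qed

lemma Re_inner_dx:
  "Re (\<integral>\<xi>. dx f \<xi> * cnj (g \<xi>) \<partial>lborel) = - Re (\<integral>\<xi>. dx g \<xi> * cnj (f \<xi>) \<partial>lborel)"
proof -
  have "Re (\<integral>\<xi>. dx f \<xi> * cnj (g \<xi>) \<partial>lborel) = Re (cnj (\<integral>\<xi>. dx f \<xi> * cnj (g \<xi>) \<partial>lborel))" by simp
  also have "cnj (\<integral>\<xi>. dx f \<xi> * cnj (g \<xi>) \<partial>lborel) = (\<integral>\<xi>. cnj (dx f \<xi> * cnj (g \<xi>)) \<partial>lborel)"
    by (rule Bochner_Integration.integral_cnj[symmetric])
  also have "\<dots> = (\<integral>\<xi>. - (dx g \<xi> * cnj (f \<xi>)) \<partial>lborel)"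
    by (intro Bochner_Integration.integral_cong refl) (simp add: dx_def mult_ac)
  also have "\<dots> = - (\<integral>\<xi>. dx g \<xi> * cnj (f \<xi>) \<partial>lborel)"
    by (rule Bochner_Integration.integral_minus)
  finally show ?thesis by simp
qed

lemma Re_rhs_inner:
  fixes p :: "real \<Rightarrow> real"
  defines "P c \<equiv> \<lambda>\<xi>. of_real (p \<xi>) * c \<xi> :: complex"
  assumes L: "P c \<in> L2" "P (rhs B b c) \<in> L2" "P (dx (\<lambda>\<xi>. conv c c \<xi> / (4 * pi))) \<in> L2"
  shows "Re (\<integral>\<xi>. P (rhs B b c) \<xi> * cnj (P c \<xi>) \<partial>lborel)
    = - Re (\<integral>\<xi>. P (dx (\<lambda>\<xi>. conv c c \<xi> / (4 * pi))) \<xi> * cnj (P c \<xi>) \<partial>lborel)"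
proof -
  have "Re (\<integral>\<xi>. P (rhs B b c) \<xi> * cnj (P c \<xi>) \<partial>lborel) = (\<integral>\<xi>. Re (P (rhs B b c) \<xi> * cnj (P c \<xi>)) \<partial>lborel)"
    by (rule Bochner_Integration.integral_Re[OF L2_inner_integrable(1)[OF L(2,1)], symmetric])
  also have "\<dots> = (\<integral>\<xi>. - Re (P (dx (\<lambda>\<xi>. conv c c \<xi> / (4 * pi))) \<xi> * cnj (P c \<xi>)) \<partial>lborel)"
    unfolding P_def Re_rhs_pairing ..
  also have "\<dots> = - (\<integral>\<xi>. Re (P (dx (\<lambda>\<xi>. conv c c \<xi> / (4 * pi))) \<xi> * cnj (P c \<xi>)) \<partial>lborel)"
    by (rule Bochner_Integration.integral_minus)
  finally show ?thesis
    by (simp only: Bochner_Integration.integral_Re[OF L2_inner_integrable(1)[OF L(3,1)]])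
qed

text \<open>On the physical side the pairing costs only the sup of the multiplying function. Young's
  inequality would cost the \<open>L^1\<close> norm of its transform, which the slope bound does not
  control.\<close>

lemma multiplication_pairing:
  assumes a: "integrable lborel a" "a \<in> L2" "realv a" and M: "\<And>x. \<bar>rift a x\<bar> \<le> M"
    and z: "integrable lborel z" "z \<in> L2"
  shows "\<bar>Re (\<integral>\<xi>. conv a z \<xi> * cnj (z \<xi>) \<partial>lborel)\<bar> \<le> 2 * pi * M * (L2_norm z)\<^sup>2"
proof -
  have cz: "integrable lborel (conv a z)" "conv a z \<in> L2"
    using conv_integrable[OF a(1) z(1)] conv_Young(1)[OF a(1) z(2)] by auto
  have [measurable]: "rift a \<in> borel_measurable borel" by (rule rift_measurable[OF a(1)])
  have eq: "ift (conv a z) x * cnj (ift z x) = of_real (2 * pi * rift a x * (norm (ift z x))\<^sup>2)" for x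
    unfolding ift_conv[OF a(1) z(1)] realv_ift[OF a(3)]
    by (simp only: of_real_mult complex_norm_square mult.assoc)
  have "Re (\<integral>\<xi>. conv a z \<xi> * cnj (z \<xi>) \<partial>lborel) = 2 * pi * Re (\<integral>x. ift (conv a z) x * cnj (ift z x) \<partial>lborel)"
    by (rule Parseval_Re[OF cz z])
  also have "(\<integral>x. ift (conv a z) x * cnj (ift z x) \<partial>lborel) = of_real (\<integral>x. 2 * pi * rift a x * (norm (ift z x))\<^sup>2 \<partial>lborel)"
    unfolding eq by (rule integral_complex_of_real)
  also have "(\<integral>x. 2 * pi * rift a x * (norm (ift z x))\<^sup>2 \<partial>lborel) = 2 * pi * (\<integral>x. rift a x * (norm (ift z x))\<^sup>2 \<partial>lborel)"
    by (simp add: mult.assoc)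
  finally have "\<bar>Re (\<integral>\<xi>. conv a z \<xi> * cnj (z \<xi>) \<partial>lborel)\<bar> = 2 * pi * (2 * pi * \<bar>\<integral>x. rift a x * (norm (ift z x))\<^sup>2 \<partial>lborel\<bar>)"
    by (simp add: abs_mult)
  also have "\<dots> \<le> 2 * pi * (2 * pi * (M * (L2_norm (ift z))\<^sup>2))"
    unfolding L2_norm_sq using L2_integrable[OF ift_L2(1)[OF z]] M
    by (intro mult_left_mono abs_integral_bounded_mult) auto
  also have "\<dots> = 2 * pi * M * (L2_norm z)\<^sup>2" unfolding ift_L2(2)[OF z] by simp
  finally show ?thesis .
qed

text \<open>The third derivative of \<open>u^2 / 2\<close> is
  \<open>2 u_x u_xx + (u u_xx)_x\<close>. Against \<open>u_xx\<close>, the first term is a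
  multiplication and accounts for \<open>4 * M\<close>, the second is an integration by parts and
  accounts for \<open>M\<close>.\<close>

lemma second_order_energy:
  assumes c: "c \<in> Hs 3" "realv c" and M: "\<And>x. \<bar>rift (dx c) x\<bar> \<le> M" and b: "0 < b" "0 \<le> B"
  defines "P d \<equiv> \<lambda>\<xi>. of_real (- \<xi>\<^sup>2) * d \<xi> :: complex"
  shows "2 * Re (\<integral>\<xi>. P (rhs B b c) \<xi> * cnj (P c \<xi>) \<partial>lborel) \<le> 5 * M * (L2_norm (P c))\<^sup>2"
proof -
  have Pdx: "P d = dx (dx d)" for d by (auto simp: P_def dx_def power2_eq_square algebra_simps)
  define z where "z = dx (dx c)"
  have Pc: "P c = z" by (simp add: Pdx z_def)
  have H: "c \<in> Hs 2" "c \<in> Hs 1" "dx c \<in> Hs 2" "dx c \<in> Hs 1" "z \<in> Hs 1" "dx z \<in> Hs 0"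
    using c dx_Hs(1)[of c 2] dx_Hs(1)[of "dx c" 1] dx_Hs(1)[of z 0] Hs_mono(1)[of 2 3 c] Hs_mono(1)[of 1 3 c]
      Hs_mono(1)[of 1 2 "dx c"] by (auto simp: z_def)
  note L1 = Hs_integrable[OF _ order_refl]
  have L: "c \<in> L2" "dx c \<in> L2" "z \<in> L2" "dx z \<in> L2"
    using H Hs_L2(1)[of 1] Hs_0 by auto
  have czH: "conv c z \<in> Hs 1" "conv (dx c) z \<in> Hs 1" by (intro conv_Hs H; simp)+
  have cz: "dx (conv c z) \<in> L2" "conv (dx c) z \<in> L2" "integrable lborel (conv (dx c) z)"
    using dx_Hs(1)[of "conv c z" 0] czH Hs_0 Hs_L2(1)[OF _ czH(2)] L1 by auto
  define q where "q = (\<lambda>\<xi>. conv c c \<xi> / (4 * pi))"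
  have d1: "dx (conv c c) = (\<lambda>\<xi>. 2 * conv c (dx c) \<xi>)"
    using dx_conv[OF L(1,1) L(2,2)] conv_commute[of "dx c" c] by auto
  have d2: "dx (dx (conv c c)) = (\<lambda>\<xi>. 2 * (conv (dx c) (dx c) \<xi> + conv c z \<xi>))"
    unfolding d1 dx_cmult using dx_conv[OF L(1,2) L(2) L(3)[unfolded z_def]] by (auto simp: z_def)
  have d2': "dx (dx (conv c c)) = (\<lambda>\<xi>. 2 * conv (dx c) (dx c) \<xi> + 2 * conv c z \<xi>)"
    unfolding d2 by (simp add: distrib_left)
  have dadd: "dx (\<lambda>\<xi>. f \<xi> + g \<xi>) = (\<lambda>\<xi>. dx f \<xi> + dx g \<xi>)" for f g by (auto simp: dx_def distrib_left)
  have d3: "dx (dx (dx (conv c c))) = (\<lambda>\<xi>. 4 * conv (dx c) z \<xi> + 2 * dx (conv c z) \<xi>)"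
    unfolding d2' dadd dx_cmult using dx_conv[OF L(2,2) L(3,3)[unfolded z_def]] conv_commute[of z "dx c"]
    by (auto simp: z_def)
  have qeq: "q = (\<lambda>\<xi>. of_real (1 / (4 * pi)) * conv c c \<xi>)" by (simp add: q_def)
  have Pq: "P (dx q) \<xi> = of_real (1 / pi) * conv (dx c) z \<xi> + of_real (1 / (2 * pi)) * dx (conv c z) \<xi>" for \<xi>
    unfolding Pdx qeq dx_cmult d3 by (simp add: field_simps)
  have PqL: "P (dx q) \<in> L2" unfolding Pq[abs_def] by (intro L2_add L2_cmult cz)
  have PrL: "P (rhs B b c) \<in> L2"
  proof -
    have "rhs B b c \<in> Hs (3 - 1)" by (rule rhs_Hs[OF b _ c(1)]) simp
    then have "dx (dx (rhs B b c)) \<in> Hs 0" using dx_Hs(1)[of "rhs B b c" 1] dx_Hs(1)[of "dx (rhs B b c)" 0] by simp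
    then show ?thesis by (simp add: Pdx Hs_0)
  qed
  have "Re (\<integral>\<xi>. P (rhs B b c) \<xi> * cnj (P c \<xi>) \<partial>lborel) = - Re (\<integral>\<xi>. P (dx q) \<xi> * cnj (P c \<xi>) \<partial>lborel)"
    unfolding P_def q_def
    by (rule Re_rhs_inner) (use PqL PrL L(3)[folded Pc] in \<open>simp_all only: P_def q_def\<close>)
  also have "(\<integral>\<xi>. P (dx q) \<xi> * cnj (P c \<xi>) \<partial>lborel)
     = (\<integral>\<xi>. of_real (1 / pi) * (conv (dx c) z \<xi> * cnj (z \<xi>)) + of_real (1 / (2 * pi)) * (dx (conv c z) \<xi> * cnj (z \<xi>)) \<partial>lborel)"
    unfolding Pc Pq by (simp add: algebra_simps)
  also have "\<dots> = of_real (1 / pi) * (\<integral>\<xi>. conv (dx c) z \<xi> * cnj (z \<xi>) \<partial>lborel)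
      + of_real (1 / (2 * pi)) * (\<integral>\<xi>. dx (conv c z) \<xi> * cnj (z \<xi>) \<partial>lborel)"
    using L2_inner_integrable(1)[OF cz(2) L(3)] L2_inner_integrable(1)[OF cz(1) L(3)]
    by (subst Bochner_Integration.integral_add) (simp_all only: integrable_mult_right integral_mult_right_zero)
  finally have eq: "2 * Re (\<integral>\<xi>. P (rhs B b c) \<xi> * cnj (P c \<xi>) \<partial>lborel)
     = - (2 / pi) * Re (\<integral>\<xi>. conv (dx c) z \<xi> * cnj (z \<xi>) \<partial>lborel) - (1 / pi) * Re (\<integral>\<xi>. dx (conv c z) \<xi> * cnj (z \<xi>) \<partial>lborel)"
  proof -
    have re: "Re (of_real k * w) = k * Re w" for k w by simp
    assume "Re (\<integral>\<xi>. P (rhs B b c) \<xi> * cnj (P c \<xi>) \<partial>lborel) = - Re (of_real (1 / pi) * (\<integral>\<xi>. conv (dx c) z \<xi> * cnj (z \<xi>) \<partial>lborel)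
      + of_real (1 / (2 * pi)) * (\<integral>\<xi>. dx (conv c z) \<xi> * cnj (z \<xi>) \<partial>lborel))"
    then show ?thesis unfolding plus_complex.sel re by (simp add: field_simps)
  qed
  have "\<bar>Re (\<integral>\<xi>. conv (dx c) z \<xi> * cnj (z \<xi>) \<partial>lborel)\<bar> \<le> 2 * pi * M * (L2_norm z)\<^sup>2"
    by (rule multiplication_pairing[OF L1[OF H(4)] L(2) realv_dx_Hs[OF c(1) _ c(2)] M L1[OF H(5)] L(3)]) simp
  moreover have "\<bar>Re (\<integral>\<xi>. dx (conv c z) \<xi> * cnj (z \<xi>) \<partial>lborel)\<bar> \<le> pi * M * (L2_norm z)\<^sup>2"
    unfolding Re_inner_dx[of "conv c z"]
    using transport_pairing[OF L1[OF H(2)] L(1) c(2) Lipschitz_DERIV_bound[OF DERIV_rift_Hs[OF c(1)] M] L1[OF H(5)] L(3,4)]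
    by simp
  ultimately have "(2 / pi) * \<bar>Re (\<integral>\<xi>. conv (dx c) z \<xi> * cnj (z \<xi>) \<partial>lborel)\<bar> + (1 / pi) * \<bar>Re (\<integral>\<xi>. dx (conv c z) \<xi> * cnj (z \<xi>) \<partial>lborel)\<bar>
      \<le> (2 / pi) * (2 * pi * M * (L2_norm z)\<^sup>2) + (1 / pi) * (pi * M * (L2_norm z)\<^sup>2)"
    by (intro add_mono mult_left_mono) auto
  also have "\<dots> = 5 * M * (L2_norm z)\<^sup>2" by (simp add: field_simps)
  finally have le: "(2 / pi) * \<bar>Re (\<integral>\<xi>. conv (dx c) z \<xi> * cnj (z \<xi>) \<partial>lborel)\<bar> + (1 / pi) * \<bar>Re (\<integral>\<xi>. dx (conv c z) \<xi> * cnj (z \<xi>) \<partial>lborel)\<bar> \<le> 5 * M * (L2_norm z)\<^sup>2" .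
  have "- k * x \<le> k * \<bar>x\<bar>" if "0 \<le> k" for k x :: real
    using mult_left_mono[OF abs_ge_minus_self[of x] that] by simp
  from this[of "2 / pi" "Re (\<integral>\<xi>. conv (dx c) z \<xi> * cnj (z \<xi>) \<partial>lborel)"] this[of "1 / pi" "Re (\<integral>\<xi>. dx (conv c z) \<xi> * cnj (z \<xi>) \<partial>lborel)"]
  show ?thesis unfolding eq unfolding Pc using le by simp
qed

context fw_spec
begin

text \<open>The weight of order 2 is \<open>1 + \<xi>^2\<close>, so the norm is at most the
  conserved \<open>L2\<close> norm plus the norm of \<open>u_xx\<close>, to which Gronwall's
  inequality applies.\<close>

lemma H2_bound:
  assumes M: "\<And>t x. t \<in> {0..T} \<Longrightarrow> \<bar>rift (dx (a t)) x\<bar> \<le> M" and t: "t \<in> {0..T}"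
  shows "Hn 2 (a t) \<le> 2 * Hn 2 (a 0) * exp (5 * M * T)"
proof -
  define P where "P d = (\<lambda>\<xi>. of_real (- \<xi>\<^sup>2) * d \<xi> :: complex)" for d
  have M0: "0 \<le> M" using order_trans[OF abs_ge_zero M[of 0]] T by simp
  have a3: "a r \<in> Hs 3" "a r \<in> Hs 2" if "r \<in> {0..T}" for r using Hs_mono(1)[OF _ aH[OF that]] s by auto
  have le: "norm (complex_of_real (- \<xi>\<^sup>2)) \<le> 1 * wt 2 \<xi>" for \<xi>
    unfolding norm_of_real by (simp add: wt_2)
  have Pb: "P d \<in> L2" "L2_norm (P d) \<le> Hn 2 d" if "d \<in> Hs 2" for d
    using Hs_multiplier[of d 0 2 "\<lambda>\<xi>. of_real (- \<xi>\<^sup>2)" 1, OF _ _ le] that by (simp_all add: P_def Hs_0 Hn_0)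
  have "(L2_norm (P (a t)))\<^sup>2 \<le> ((L2_norm (P (a 0)))\<^sup>2 + 0 * t) * exp (5 * M * t)"
  proof (rule gronwall[where T = T and f = "\<lambda>t. (L2_norm (P (a t)))\<^sup>2"
        and f' = "\<lambda>t. 2 * Re (\<integral>\<xi>. P (rhs B b (a t)) \<xi> * cnj (P (a t) \<xi>) \<partial>lborel)"])
    fix t assume t: "t \<in> {0..T}"
    show "((\<lambda>t. (L2_norm (P (a t)))\<^sup>2) has_real_derivative 2 * Re (\<integral>\<xi>. P (rhs B b (a t)) \<xi> * cnj (P (a t) \<xi>) \<partial>lborel)) (at t within {0..T})"
      unfolding P_def
    proof (rule quadratic_deriv[where C = 1 and \<sigma> = "s - 1"])
      show "\<bar>- \<xi>\<^sup>2\<bar> \<le> 1 * wt (s - 1) \<xi>" for \<xi>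
        using wt_mono[of 2 "s - 1" \<xi>] s by (simp add: wt_2)
      show "a r \<in> Hs (s - 1)" if "r \<in> {0..T}" for r by (rule Hs_mono(1)[OF _ aH[OF that]]) simp
    qed (use t a_deriv rhsH in auto)
    show "2 * Re (\<integral>\<xi>. P (rhs B b (a t)) \<xi> * cnj (P (a t) \<xi>) \<partial>lborel) \<le> 5 * M * (L2_norm (P (a t)))\<^sup>2 + 0"
      using second_order_energy[OF a3(1)[OF t] ar[OF t] M[OF t] b B] by (simp add: P_def)
  qed (use M0 t in auto)
  also have "\<dots> \<le> (L2_norm (P (a 0)))\<^sup>2 * (exp (5 * M * T))\<^sup>2"
  proof -
    have "5 * M * t \<le> 5 * M * T" using t M0 by (intro mult_left_mono) auto
    \<comment> \<open>The exponent is doubled to make the right-hand side a square.\<close>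
    also have "\<dots> \<le> 2 * (5 * M * T)" using M0 T by simp
    finally have "exp (5 * M * t) \<le> exp (2 * (5 * M * T))" by simp
    also have "exp (2 * (5 * M * T)) = (exp (5 * M * T))\<^sup>2" by (rule exp_double)
    finally show ?thesis by (auto intro!: mult_left_mono)
  qed
  finally have Pt: "L2_norm (P (a t)) \<le> L2_norm (P (a 0)) * exp (5 * M * T)"
    by (intro power2_le_imp_le[OF _ mult_nonneg_nonneg]) (auto simp: power_mult_distrib)
  have 0: "0 \<in> {0..T}" using T by simp
  have e1: "1 \<le> exp (5 * M * T)" using M0 T by simp
  have "Hn 2 (a t) = L2_norm (\<lambda>\<xi>. a t \<xi> - P (a t) \<xi>)"
    unfolding Hn_def by (intro arg_cong[where f = L2_norm] ext) (simp add: wa_def wt_2 P_def algebra_simps)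
  also have "\<dots> \<le> L2_norm (a t) + L2_norm (P (a t))"
    by (rule L2_norm_diff_le[OF aL(2)[OF t] Pb(1)[OF a3(2)[OF t]]])
  also have "\<dots> \<le> L2_norm (a 0) * exp (5 * M * T) + L2_norm (P (a 0)) * exp (5 * M * T)"
    unfolding L2_conserved[OF t] using mult_left_mono[OF e1 L2_norm_nonneg[of "a 0"]] Pt by simp
  also have "\<dots> \<le> Hn 2 (a 0) * exp (5 * M * T) + Hn 2 (a 0) * exp (5 * M * T)"
    using Pb(2)[OF a3(2)[OF 0]] Hs_L2(2)[OF _ a3(2)[OF 0]] by (intro add_mono mult_right_mono) auto
  finally show ?thesis by simp
qed

end

section \<open>Regularized weights and their commutators\<close>

lemma powr_diff_le:
  fixes x y k :: real
  assumes k: "1 \<le> k" and x: "0 < x" "x \<le> y"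
  shows "y powr k - x powr k \<le> k * y powr (k - 1) * (y - x)"
proof (cases "x = y")
  case False
  then have lt: "x < y" using x by simp
  have "\<exists>z>x. z < y \<and> y powr k - x powr k = (y - x) * (k * z powr (k - 1))"
    using lt x by (intro MVT2) (auto intro!: derivative_eq_intros)
  then obtain z where z: "x < z" "z < y" "y powr k - x powr k = (y - x) * (k * z powr (k - 1))" by blast
  have "z powr (k - 1) \<le> y powr (k - 1)" using z x k by (intro powr_mono2) auto
  then have "(y - x) * (k * z powr (k - 1)) \<le> (y - x) * (k * y powr (k - 1))"
    using lt k by (intro mult_left_mono) auto
  then show ?thesis using z(3) by (simp add: mult_ac)
qed simp

text \<open>The identity for \<open>e = 0\<close>, bounded by \<open>1 / e\<close> for
  \<open>e > 0\<close>. Its square in \<open>hi\<close> removes two orders, while the bounds on its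
  differences and on doubling hold with constants independent of \<open>e\<close>.\<close>

definition damp :: "real \<Rightarrow> real \<Rightarrow> real" where
  "damp e x = x / (1 + e * x)"

lemma damp_nonneg: "0 \<le> e \<Longrightarrow> 0 \<le> x \<Longrightarrow> 0 \<le> damp e x"
  by (simp add: damp_def)

lemma damp_diff:
  assumes "0 \<le> e" "0 < x" "x \<le> y"
  shows "0 \<le> damp e y - damp e x" "damp e y - damp e x \<le> (y - x) * (damp e y / y)"
proof -
  have p: "0 < 1 + e * x" "0 < 1 + e * y" using assms by (simp_all add: add_pos_nonneg)
  have eq: "damp e y - damp e x = (y - x) / ((1 + e * x) * (1 + e * y))"
    using p by (simp add: damp_def field_simps)
  show "0 \<le> damp e y - damp e x" unfolding eq using p assms by simp
  have "(y - x) / ((1 + e * x) * (1 + e * y)) \<le> (y - x) / (1 * (1 + e * y))"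
    using p assms by (intro divide_left_mono mult_right_mono) auto
  then show "damp e y - damp e x \<le> (y - x) * (damp e y / y)"
    unfolding eq using assms by (simp add: damp_def)
qed

lemma damp_double: "0 \<le> e \<Longrightarrow> 0 < x \<Longrightarrow> damp e (2 * x) \<le> 2 * damp e x"
  unfolding damp_def times_divide_eq_right by (intro divide_left_mono) (auto simp: add_pos_nonneg)

definition hi :: "real \<Rightarrow> real \<Rightarrow> real \<Rightarrow> real" where
  "hi s e x = x powr (s - 2) * (damp e x)\<^sup>2"

text \<open>This is \<open>hi\<close> divided by \<open>x\<close>, which up to the factor
  \<open>s\<close> bounds the derivative of \<open>hi\<close>.\<close>

definition lo :: "real \<Rightarrow> real \<Rightarrow> real \<Rightarrow> real" where
  "lo s e x = x powr (s - 3) * (damp e x)\<^sup>2"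

lemma hi_lo: "0 < x \<Longrightarrow> hi s e x = x * lo s e x"
  using powr_mult_base[of x "s - 3"] by (simp add: hi_def lo_def mult.assoc[symmetric])

lemma lo_nonneg [simp]: "0 \<le> lo s e x" by (simp add: lo_def)

lemma lo_mono:
  assumes "3 \<le> s" "0 \<le> e" "0 < x" "x \<le> y"
  shows "lo s e x \<le> lo s e y"
  unfolding lo_def using assms damp_diff(1)[of e x y] damp_nonneg[of e x]
  by (intro mult_mono powr_mono2 power_mono) auto

lemma lo_double:
  assumes "3 \<le> s" "0 \<le> e" "0 < x"
  shows "lo s e (2 * x) \<le> 2 powr (s - 1) * lo s e x"
proof -
  have "lo s e (2 * x) \<le> (2 * x) powr (s - 3) * (2 * damp e x)\<^sup>2"
    unfolding lo_def using assms damp_double[of e x] damp_nonneg[of e "2 * x"]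
    by (intro mult_left_mono power_mono) auto
  also have "\<dots> = (2 powr (s - 3) * 2 powr 2) * lo s e x"
    using assms by (simp add: lo_def powr_mult power_mult_distrib mult_ac)
  also have "2 powr (s - 3) * 2 powr 2 = (2::real) powr (s - 1)"
    by (simp only: powr_add[symmetric]) simp
  finally show ?thesis .
qed

text \<open>By the product rule: the power contributes \<open>s - 2\<close> and the squared damping
  factor contributes 2.\<close>

lemma hi_diff_ordered:
  assumes s: "3 \<le> s" and e: "0 \<le> e" and x: "0 < x" "x \<le> y"
  shows "\<bar>hi s e y - hi s e x\<bar> \<le> s * (y - x) * lo s e y"
proof -
  have y: "0 < y" using x by simp
  have hm: "hi s e x \<le> hi s e y"
    unfolding hi_lo[OF x(1)] hi_lo[OF y] using lo_mono[OF s e x] x by (intro mult_mono) auto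
  have d: "0 \<le> damp e x" "damp e x \<le> damp e y" "damp e y - damp e x \<le> (y - x) * (damp e y / y)"
    using damp_diff[OF e x] damp_nonneg[of e x] e x by auto
  have "hi s e y - hi s e x = (y powr (s - 2) - x powr (s - 2)) * (damp e y)\<^sup>2 + x powr (s - 2) * ((damp e y)\<^sup>2 - (damp e x)\<^sup>2)"
    by (simp add: hi_def algebra_simps)
  also have "(y powr (s - 2) - x powr (s - 2)) * (damp e y)\<^sup>2 \<le> ((s - 2) * y powr (s - 2 - 1) * (y - x)) * (damp e y)\<^sup>2"
    using s x by (intro mult_right_mono powr_diff_le) auto
  also have "\<dots> = (s - 2) * (y - x) * lo s e y" by (simp add: lo_def mult_ac)
  also have "x powr (s - 2) * ((damp e y)\<^sup>2 - (damp e x)\<^sup>2) \<le> 2 * (y - x) * lo s e y"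
  proof -
    have "(damp e y)\<^sup>2 - (damp e x)\<^sup>2 = (damp e y - damp e x) * (damp e y + damp e x)"
      by (simp add: power2_eq_square algebra_simps)
    also have "\<dots> \<le> ((y - x) * (damp e y / y)) * (2 * damp e y)"
      using d x y by (intro mult_mono) auto
    also have "\<dots> = 2 * (y - x) * ((damp e y)\<^sup>2 / y)"
      by (simp only: power2_eq_square times_divide_eq_left times_divide_eq_right mult_ac)
    finally have "(damp e y)\<^sup>2 - (damp e x)\<^sup>2 \<le> 2 * (y - x) * ((damp e y)\<^sup>2 / y)" .
    then have "x powr (s - 2) * ((damp e y)\<^sup>2 - (damp e x)\<^sup>2) \<le> y powr (s - 2) * (2 * (y - x) * ((damp e y)\<^sup>2 / y))"
      using d x y s by (intro mult_mono powr_mono2) (auto intro: power_mono)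
    also have "\<dots> = 2 * (y - x) * (hi s e y / y)" by (simp add: hi_def)
    also have "hi s e y / y = lo s e y" using y by (simp add: hi_lo)
    finally show ?thesis .
  qed
  finally have "hi s e y - hi s e x \<le> s * (y - x) * lo s e y" by (simp add: algebra_simps)
  then show ?thesis using hm by simp
qed

text \<open>For \<^term>\<open>e = 0\<close> this is \<^term>\<open>wt s\<close>. For \<^term>\<open>e > 0\<close> it has order $s - 2$ only, so that pairing with the
  right-hand side, which lies in $H^{s-1}$, loses no regularity; the estimates are uniform in \<^term>\<open>e\<close>.\<close>
definition wreg :: "real \<Rightarrow> real \<Rightarrow> real \<Rightarrow> real" where
  "wreg s e \<xi> = hi s e (wt 1 \<xi>)"

lemma wreg_measurable [measurable]: "wreg s e \<in> borel_measurable borel"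
  unfolding wreg_def[abs_def] hi_def[abs_def] damp_def[abs_def] by measurable

lemma wreg_eq: "wreg s e \<xi> = wt s \<xi> / (1 + e * wt 1 \<xi>)\<^sup>2"
proof -
  have "wt 1 \<xi> powr (s - 2) * (wt 1 \<xi>)\<^sup>2 = wt s \<xi>"
    unfolding wt_powr[of "s - 2", symmetric] using wt_add[of "s - 2" 2 \<xi>] by (simp add: wt_1 wt_2)
  then show ?thesis by (simp add: wreg_def hi_def damp_def power_divide)
qed

lemma wreg_nonneg [simp]: "0 \<le> wreg s e \<xi>" "\<bar>wreg s e \<xi>\<bar> = wreg s e \<xi>"
  by (simp_all add: wreg_eq)

lemma wreg_le:
  assumes "0 < e"
  shows "wreg s e \<xi> \<le> wt s \<xi>" "wreg s e \<xi> \<le> (1 / e\<^sup>2) * wt (s - 2) \<xi>"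
proof -
  have p: "1 \<le> 1 + e * wt 1 \<xi>" using assms by simp
  have "wt s \<xi> / (1 + e * wt 1 \<xi>)\<^sup>2 \<le> wt s \<xi> / 1"
    using p by (intro divide_left_mono) (auto intro: one_le_power)
  then show "wreg s e \<xi> \<le> wt s \<xi>" by (simp add: wreg_eq)
  have "wt s \<xi> / (1 + e * wt 1 \<xi>)\<^sup>2 \<le> wt s \<xi> / (e * wt 1 \<xi>)\<^sup>2"
  proof (intro divide_left_mono power_mono mult_pos_pos zero_less_power)
    show "0 < 1 + e * wt 1 \<xi>" using p by linarith
  qed (use assms in auto)
  also have "(e * wt 1 \<xi>)\<^sup>2 = e\<^sup>2 * wt 2 \<xi>" by (simp add: power_mult_distrib wt_1 wt_2)
  also have "wt s \<xi> / (e\<^sup>2 * wt 2 \<xi>) = (1 / e\<^sup>2) * wt (s - 2) \<xi>"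
    using wt_add[of "s - 2" 2 \<xi>] by simp
  finally show "wreg s e \<xi> \<le> (1 / e\<^sup>2) * wt (s - 2) \<xi>" by (simp add: wreg_eq)
qed

lemma wt_1_Lipschitz: "\<bar>wt 1 \<xi> - wt 1 \<eta>\<bar> \<le> \<bar>\<xi> - \<eta>\<bar>"
proof -
  have "wt 1 x \<le> wt 1 y + \<bar>x - y\<bar>" for x y
    using real_sqrt_sum_squares_triangle_ineq[of 1 0 y "x - y"] by (simp add: wt_1)
  from this[of \<xi> \<eta>] this[of \<eta> \<xi>] show ?thesis by (simp add: abs_le_iff abs_minus_commute)
qed

definition Kcom :: "real \<Rightarrow> real" where "Kcom s = s * 2 powr (s - 1)"

text \<open>A Kato-Ponce estimate frequency by frequency. The mean value bound produces
  \<open>\<xi> - \<eta>\<close> and one order less of the weight, taken at a frequency that is at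
  most twice the larger of \<open>\<xi> - \<eta>\<close> and \<open>\<eta>\<close>. Doubling costs
  \<open>2 powr (s - 1)\<close>, and in either case the missing order is restored by one of the
  factors \<open>\<eta>\<close> and \<open>\<xi> - \<eta>\<close>.\<close>

lemma wreg_commutator:
  assumes s: "3 \<le> s" and e: "0 \<le> e"
  shows "\<bar>wreg s e \<xi> - wreg s e \<eta>\<bar> * \<bar>\<eta>\<bar> \<le> Kcom s * (\<bar>\<xi> - \<eta>\<bar> * wreg s e \<eta> + wreg s e (\<xi> - \<eta>) * \<bar>\<eta>\<bar>)"
proof -
  define x where "x = wt 1 \<xi>"
  define y where "y = wt 1 \<eta>"
  define k where "k = wt 1 (\<xi> - \<eta>)"
  have pos: "0 < x" "0 < y" "0 < k" by (simp_all add: x_def y_def k_def)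
  have "\<bar>hi s e x - hi s e y\<bar> \<le> s * \<bar>x - y\<bar> * lo s e (max x y)"
    using hi_diff_ordered[OF s e, of x y] hi_diff_ordered[OF s e, of y x] pos
    by (cases "x \<le> y") (auto simp: max_def abs_minus_commute)
  also have "\<dots> \<le> s * \<bar>\<xi> - \<eta>\<bar> * lo s e (2 * max k y)"
  proof (intro mult_mono lo_mono s e)
    show "max x y \<le> 2 * max k y"
      using wt_1_triangle[of \<xi> \<eta>] pos unfolding x_def y_def k_def by linarith
  qed (use s pos wt_1_Lipschitz in \<open>auto simp: x_def y_def less_max_iff_disj\<close>)
  also have "\<dots> \<le> s * \<bar>\<xi> - \<eta>\<bar> * (2 powr (s - 1) * lo s e (max k y))"
    using s pos by (intro mult_left_mono lo_double s e) (auto simp: less_max_iff_disj)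
  also have "lo s e (max k y) \<le> lo s e k + lo s e y" by (simp add: max_def)
  finally have "\<bar>wreg s e \<xi> - wreg s e \<eta>\<bar> \<le> s * \<bar>\<xi> - \<eta>\<bar> * (2 powr (s - 1) * (lo s e k + lo s e y))"
    using s by (simp add: wreg_def x_def y_def mult_left_mono)
  from mult_right_mono[OF this abs_ge_zero[of \<eta>]]
  have 1: "\<bar>wreg s e \<xi> - wreg s e \<eta>\<bar> * \<bar>\<eta>\<bar> \<le> Kcom s * (\<bar>\<xi> - \<eta>\<bar> * (\<bar>\<eta>\<bar> * lo s e y) + (\<bar>\<xi> - \<eta>\<bar> * lo s e k) * \<bar>\<eta>\<bar>)"
    by (simp add: Kcom_def algebra_simps)
  have 2: "\<bar>\<eta>\<bar> * lo s e y \<le> wreg s e \<eta>" "\<bar>\<xi> - \<eta>\<bar> * lo s e k \<le> wreg s e (\<xi> - \<eta>)"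
    unfolding wreg_def y_def k_def by (simp_all add: hi_lo mult_right_mono abs_le_wt_1)
  have K: "0 \<le> Kcom s" using s by (simp add: Kcom_def)
  show ?thesis
    by (rule order_trans[OF 1]) (intro mult_left_mono add_mono mult_right_mono 2 K; simp)
qed

text \<open>The energy estimate: in $p\,(u u_x)$ the multiplier \<^term>\<open>wreg s e\<close> is commuted past $u$. The leading
  term is then an integration by parts and the commutator costs only the $L^1$ norm of the transform of $u_x$.\<close>
lemma Hs_energy:
  assumes s: "3 \<le> s" and e: "0 < e" and c: "c \<in> Hs s" "realv c" and b: "0 < b" "0 \<le> B"
  defines "P d \<equiv> \<lambda>\<xi>. of_real (wreg s e \<xi>) * d \<xi> :: complex"
  shows "\<bar>2 * Re (\<integral>\<xi>. P (rhs B b c) \<xi> * cnj (P c \<xi>) \<partial>lborel)\<bar>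
     \<le> (2 + 2 * Kcom s) * (\<integral>\<xi>. norm (dx c \<xi>) \<partial>lborel) * (L2_norm (P c))\<^sup>2"
proof -
  define z where "z = P c"
  define N where "N = (\<integral>\<xi>. norm (dx c \<xi>) \<partial>lborel)"
  have N0: "0 \<le> N" by (simp add: N_def)
  have PH: "P d \<in> Hs r" if "d \<in> Hs (r + (s - 2))" for d r
    unfolding P_def by (rule Hs_multiplier(1)[OF that, where C = "1 / e\<^sup>2"]) (use wreg_le(2)[OF e, of s] in auto)
  have cH: "c \<in> Hs 1" "c \<in> Hs 2" "dx c \<in> Hs (s - 1)" "dx c \<in> Hs 1"
    using Hs_mono(1)[OF _ c(1), of 1] Hs_mono(1)[OF _ c(1), of 2] dx_Hs'(1)[OF c(1)] Hs_mono(1)[OF _ dx_Hs'(1)[OF c(1)], of 1] s by auto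
  have zH: "z \<in> Hs 2" unfolding z_def by (rule PH) (simp add: c)
  have zH1: "z \<in> Hs 1" "dx z \<in> Hs 1" using Hs_mono(1)[OF _ zH, of 1] dx_Hs(1)[of z 1] zH by auto
  note L1 = Hs_integrable[OF _ order_refl]
  have L: "c \<in> L2" "dx c \<in> L2" "z \<in> L2" "dx z \<in> L2"
    using Hs_L2(1)[OF _ cH(1)] Hs_L2(1)[OF _ cH(4)] Hs_L2(1)[OF _ zH1(1)] Hs_L2(1)[OF _ zH1(2)] by auto
  note [measurable] = L2_measurable[OF L(1)] L2_measurable[OF L(2)] L2_measurable[OF L(3)] L2_measurable[OF L(4)]
  have i: "integrable lborel c" "integrable lborel (dx c)" "integrable lborel z" "integrable lborel (dx z)"
    using L1 cH zH1 by auto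
  have Pdx: "P (dx c) = dx z" by (auto simp: P_def z_def dx_def)
  define q where "q = (\<lambda>\<xi>. conv c c \<xi> / (4 * pi))"
  have dq: "dx q = (\<lambda>\<xi>. of_real (1 / (2 * pi)) * conv c (dx c) \<xi>)"
  proof -
    have "q = (\<lambda>\<xi>. of_real (1 / (4 * pi)) * conv c c \<xi>)" by (simp add: q_def)
    moreover have "dx (conv c c) = (\<lambda>\<xi>. 2 * conv c (dx c) \<xi>)"
      using dx_conv[OF L(1,1) L(2,2)] conv_commute[of "dx c" c] by auto
    ultimately show ?thesis by (simp only: dx_cmult) (simp add: fun_eq_iff)
  qed
  have pc2: "conv c (dx z) \<in> L2" "conv (dx c) z \<in> L2" "dx (conv c z) \<in> L2"
  proof -
    show 1: "conv c (dx z) \<in> L2" "conv (dx c) z \<in> L2" by (intro conv_Young i L)+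
    have "dx (conv c z) = (\<lambda>\<xi>. conv (dx c) z \<xi> + conv c (dx z) \<xi>)"
      using dx_conv[OF L(1) L(3) L(2) L(4)] by auto
    then show "dx (conv c z) \<in> L2" using L2_add(1)[OF 1(2,1)] by simp
  qed
  \<comment> \<open>Up to a constant, the commutator of the multiplier with \<open>u\<close>,
    applied to \<open>u_x\<close>.\<close>
  define R where "R = (\<lambda>\<xi>. of_real (wreg s e \<xi>) * conv c (dx c) \<xi> - conv c (dx z) \<xi>)"
  define nz where "nz = (\<lambda>\<xi>. complex_of_real (norm (z \<xi>)))"
  define nd where "nd = (\<lambda>\<xi>. complex_of_real (norm (dx c \<xi>)))"
  have nzd: "nz \<in> L2" "L2_norm nz = L2_norm z" "integrable lborel nd" "(\<integral>\<xi>. norm (nd \<xi>) \<partial>lborel) = N" "nd \<in> L2" "integrable lborel nz"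
    using L i norm_complex_L2 by (auto simp: nz_def nd_def N_def L2_norm_norm_complex)
  have Rle: "norm (R \<xi>) \<le> norm ((2 * Kcom s) *\<^sub>R conv nd nz \<xi>)" for \<xi>
  proof -
    have "norm (R \<xi>) = norm (\<integral>\<eta>. of_real (wreg s e \<xi>) * (c (\<xi> - \<eta>) * dx c \<eta>) - c (\<xi> - \<eta>) * dx z \<eta> \<partial>lborel)"
      unfolding R_def conv_def using conv_L2_integrable(1)[OF L(1,2), of \<xi>] conv_L2_integrable(1)[OF L(1,4), of \<xi>] by simp
    also have "\<dots> \<le> (\<integral>\<eta>. norm (of_real (wreg s e \<xi>) * (c (\<xi> - \<eta>) * dx c \<eta>) - c (\<xi> - \<eta>) * dx z \<eta>) \<partial>lborel)"
      by (rule integral_norm_bound)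
    also have "\<dots> \<le> (\<integral>\<eta>. Kcom s * (norm (dx c (\<xi> - \<eta>)) * norm (z \<eta>) + norm (z (\<xi> - \<eta>)) * norm (dx c \<eta>)) \<partial>lborel)"
    proof (rule integral_mono)
      show "integrable lborel (\<lambda>\<eta>. norm (of_real (wreg s e \<xi>) * (c (\<xi> - \<eta>) * dx c \<eta>) - c (\<xi> - \<eta>) * dx z \<eta>))"
        using conv_L2_integrable(1)[OF L(1,2), of \<xi>] conv_L2_integrable(1)[OF L(1,4), of \<xi>] by simp
      show "integrable lborel (\<lambda>\<eta>. Kcom s * (norm (dx c (\<xi> - \<eta>)) * norm (z \<eta>) + norm (z (\<xi> - \<eta>)) * norm (dx c \<eta>)))"
        by (intro integrable_mult_right Bochner_Integration.integrable_add L2_Cauchy_Schwarz(1) L2_reflect_shift L)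
      fix \<eta>
      have "of_real (wreg s e \<xi>) * (c (\<xi> - \<eta>) * dx c \<eta>) - c (\<xi> - \<eta>) * dx z \<eta>
         = of_real (wreg s e \<xi> - wreg s e \<eta>) * (c (\<xi> - \<eta>) * dx c \<eta>)"
        by (simp add: z_def P_def dx_def algebra_simps)
      then have "norm (of_real (wreg s e \<xi>) * (c (\<xi> - \<eta>) * dx c \<eta>) - c (\<xi> - \<eta>) * dx z \<eta>)
         = (\<bar>wreg s e \<xi> - wreg s e \<eta>\<bar> * \<bar>\<eta>\<bar>) * (norm (c (\<xi> - \<eta>)) * norm (c \<eta>))"
        by (simp only: norm_mult norm_of_real norm_dx mult_ac)
      also have "\<dots> \<le> (Kcom s * (\<bar>\<xi> - \<eta>\<bar> * wreg s e \<eta> + wreg s e (\<xi> - \<eta>) * \<bar>\<eta>\<bar>)) * (norm (c (\<xi> - \<eta>)) * norm (c \<eta>))"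
        by (intro mult_right_mono wreg_commutator s) (use e in auto)
      also have "\<dots> = Kcom s * (norm (dx c (\<xi> - \<eta>)) * norm (z \<eta>) + norm (z (\<xi> - \<eta>)) * norm (dx c \<eta>))"
        by (simp add: norm_dx z_def P_def norm_mult algebra_simps)
      finally show "norm (of_real (wreg s e \<xi>) * (c (\<xi> - \<eta>) * dx c \<eta>) - c (\<xi> - \<eta>) * dx z \<eta>)
        \<le> Kcom s * (norm (dx c (\<xi> - \<eta>)) * norm (z \<eta>) + norm (z (\<xi> - \<eta>)) * norm (dx c \<eta>))" .
    qed
    \<comment> \<open>Convolution is commutative, so both integrals have the same value: this is the
      factor 2.\<close>
    also have "\<dots> = norm ((2 * Kcom s) *\<^sub>R conv nd nz \<xi>)"
    proof -
      define A where "A = (\<integral>\<eta>. norm (dx c (\<xi> - \<eta>)) * norm (z \<eta>) \<partial>lborel)"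
      define A' where "A' = (\<integral>\<eta>. norm (z (\<xi> - \<eta>)) * norm (dx c \<eta>) \<partial>lborel)"
      have ii: "integrable lborel (\<lambda>\<eta>. norm (dx c (\<xi> - \<eta>)) * norm (z \<eta>))" "integrable lborel (\<lambda>\<eta>. norm (z (\<xi> - \<eta>)) * norm (dx c \<eta>))"
        by (intro L2_Cauchy_Schwarz(1) L2_reflect_shift L)+
      have "conv nd nz \<xi> = of_real A" "conv nz nd \<xi> = of_real A'"
        unfolding nd_def nz_def A_def A'_def by (rule conv_of_real)+
      then have eq: "conv nd nz \<xi> = of_real A" "A' = A" using conv_commute[of nd nz \<xi>] by (auto simp: of_real_eq_iff)
      have "0 \<le> A" by (simp add: A_def)
      moreover have "(\<integral>\<eta>. Kcom s * (norm (dx c (\<xi> - \<eta>)) * norm (z \<eta>) + norm (z (\<xi> - \<eta>)) * norm (dx c \<eta>)) \<partial>lborel) = Kcom s * (A + A')"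
        unfolding A_def A'_def using ii by simp
      moreover have "0 \<le> Kcom s" using s by (simp add: Kcom_def)
      ultimately show ?thesis by (simp add: eq)
    qed
    finally show ?thesis .
  qed
  have [measurable]: "R \<in> borel_measurable borel" unfolding R_def by measurable
  note Rd = L2_dominated[OF L2_scaleR[OF conv_Young(1)[OF nzd(3,1)]], of R "2 * Kcom s"]
  have K0: "0 \<le> Kcom s" using s by (simp add: Kcom_def)
  have R: "R \<in> L2" "L2_norm R \<le> 2 * Kcom s * (N * L2_norm z)"
  proof -
    show "R \<in> L2" using Rd(1) Rle by simp
    have "L2_norm R \<le> 2 * Kcom s * L2_norm (conv nd nz)"
      using Rd(2) Rle K0 by (simp add: L2_norm_scaleR)
    also have "\<dots> \<le> 2 * Kcom s * (N * L2_norm z)"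
      using conv_Young(2)[OF nzd(3,1)] K0 by (intro mult_left_mono) (auto simp: nzd)
    finally show "L2_norm R \<le> 2 * Kcom s * (N * L2_norm z)" .
  qed
  \<comment> \<open>The leading term \<open>u (Pu)_x\<close> is put into divergence form as
    \<open>(u Pu)_x - u_x Pu\<close>.\<close>
  have Pq: "P (dx q) \<xi> = of_real (1 / (2 * pi)) * (dx (conv c z) \<xi> - conv (dx c) z \<xi> + R \<xi>)" for \<xi>
    unfolding P_def dq R_def dx_conv[OF L(1) L(3) L(2) L(4)] by (simp add: algebra_simps)
  have PqL: "P (dx q) \<in> L2" unfolding Pq[abs_def] by (intro L2_cmult L2_add L2_diff pc2 R)
  have PrL: "P (rhs B b c) \<in> L2"
  proof -
    have "rhs B b c \<in> Hs (0 + (s - 2))" using s by (intro Hs_mono(1)[OF _ rhs_Hs[OF b _ c(1)]]) auto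
    from PH[OF this] show ?thesis by (simp add: Hs_0)
  qed
  have I1: "integrable lborel (\<lambda>\<xi>. dx (conv c z) \<xi> * cnj (z \<xi>))" "integrable lborel (\<lambda>\<xi>. conv (dx c) z \<xi> * cnj (z \<xi>))" "integrable lborel (\<lambda>\<xi>. R \<xi> * cnj (z \<xi>))"
    by (intro L2_inner_integrable pc2 R L)+
  have "Re (\<integral>\<xi>. P (rhs B b c) \<xi> * cnj (P c \<xi>) \<partial>lborel) = - Re (\<integral>\<xi>. P (dx q) \<xi> * cnj (P c \<xi>) \<partial>lborel)"
    unfolding P_def q_def
    by (rule Re_rhs_inner) (use PqL PrL L(3)[unfolded z_def] in \<open>simp_all only: P_def q_def\<close>)
  also have "(\<integral>\<xi>. P (dx q) \<xi> * cnj (P c \<xi>) \<partial>lborel)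
    = (\<integral>\<xi>. of_real (1 / (2 * pi)) * (dx (conv c z) \<xi> * cnj (z \<xi>) - conv (dx c) z \<xi> * cnj (z \<xi>) + R \<xi> * cnj (z \<xi>)) \<partial>lborel)"
    unfolding z_def[symmetric] Pq
    by (intro Bochner_Integration.integral_cong refl) (simp only: distrib_left distrib_right left_diff_distrib right_diff_distrib mult.assoc)
  also have "\<dots> = of_real (1 / (2 * pi)) * ((\<integral>\<xi>. dx (conv c z) \<xi> * cnj (z \<xi>) \<partial>lborel) - (\<integral>\<xi>. conv (dx c) z \<xi> * cnj (z \<xi>) \<partial>lborel) + (\<integral>\<xi>. R \<xi> * cnj (z \<xi>) \<partial>lborel))"
    using I1 by (subst integral_mult_right_zero) simp
  finally have eq: "2 * Re (\<integral>\<xi>. P (rhs B b c) \<xi> * cnj (P c \<xi>) \<partial>lborel) = - (1 / pi) * (Re (\<integral>\<xi>. dx (conv c z) \<xi> * cnj (z \<xi>) \<partial>lborel)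
     - Re (\<integral>\<xi>. conv (dx c) z \<xi> * cnj (z \<xi>) \<partial>lborel) + Re (\<integral>\<xi>. R \<xi> * cnj (z \<xi>) \<partial>lborel))"
  proof -
    have re: "Re (of_real k * w) = k * Re w" for k w by simp
    assume "Re (\<integral>\<xi>. P (rhs B b c) \<xi> * cnj (P c \<xi>) \<partial>lborel) = - Re (of_real (1 / (2 * pi)) * ((\<integral>\<xi>. dx (conv c z) \<xi> * cnj (z \<xi>) \<partial>lborel) - (\<integral>\<xi>. conv (dx c) z \<xi> * cnj (z \<xi>) \<partial>lborel) + (\<integral>\<xi>. R \<xi> * cnj (z \<xi>) \<partial>lborel)))"
    then show ?thesis unfolding re plus_complex.sel minus_complex.sel by (simp add: field_simps)
  qed
  have Lip: "\<bar>rift c x - rift c y\<bar> \<le> N / (2 * pi) * \<bar>x - y\<bar>" for x y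
    by (rule Lipschitz_DERIV_bound[OF DERIV_rift[OF i(1,2)]]) (unfold N_def, rule abs_rift_le)
  have e1: "\<bar>Re (\<integral>\<xi>. dx (conv c z) \<xi> * cnj (z \<xi>) \<partial>lborel)\<bar> \<le> N * (L2_norm z)\<^sup>2"
  proof -
    have "\<bar>Re (\<integral>\<xi>. dx (conv c z) \<xi> * cnj (z \<xi>) \<partial>lborel)\<bar> \<le> pi * (N / (2 * pi)) * (L2_norm z)\<^sup>2"
      unfolding Re_inner_dx[of "conv c z"] using transport_pairing[OF i(1) L(1) c(2) Lip i(3) L(3,4)] by simp
    also have "pi * (N / (2 * pi)) = N / 2" by simp
    also have "N / 2 * (L2_norm z)\<^sup>2 \<le> N * (L2_norm z)\<^sup>2" using N0 by (intro mult_right_mono) auto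
    finally show ?thesis .
  qed
  have e2: "\<bar>Re (\<integral>\<xi>. conv (dx c) z \<xi> * cnj (z \<xi>) \<partial>lborel)\<bar> \<le> N * (L2_norm z)\<^sup>2"
  proof -
    have "\<bar>Re (\<integral>\<xi>. conv (dx c) z \<xi> * cnj (z \<xi>) \<partial>lborel)\<bar> \<le> L2_norm (conv (dx c) z) * L2_norm z"
      by (rule order_trans[OF abs_Re_le_cmod L2_inner_integrable(2)[OF pc2(2) L(3)]])
    also have "\<dots> \<le> (N * L2_norm z) * L2_norm z"
      using conv_Young(2)[OF i(2) L(3)] by (intro mult_right_mono) (auto simp: N_def)
    finally show ?thesis by (simp add: power2_eq_square mult_ac)
  qed
  have e3: "\<bar>Re (\<integral>\<xi>. R \<xi> * cnj (z \<xi>) \<partial>lborel)\<bar> \<le> 2 * Kcom s * N * (L2_norm z)\<^sup>2"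
  proof -
    have "\<bar>Re (\<integral>\<xi>. R \<xi> * cnj (z \<xi>) \<partial>lborel)\<bar> \<le> L2_norm R * L2_norm z"
      by (rule order_trans[OF abs_Re_le_cmod L2_inner_integrable(2)[OF R(1) L(3)]])
    also have "\<dots> \<le> (2 * Kcom s * (N * L2_norm z)) * L2_norm z"
      by (intro mult_right_mono R) auto
    finally show ?thesis by (simp add: power2_eq_square mult_ac)
  qed
  define X where "X = Re (\<integral>\<xi>. dx (conv c z) \<xi> * cnj (z \<xi>) \<partial>lborel)
     - Re (\<integral>\<xi>. conv (dx c) z \<xi> * cnj (z \<xi>) \<partial>lborel) + Re (\<integral>\<xi>. R \<xi> * cnj (z \<xi>) \<partial>lborel)"
  have X: "\<bar>X\<bar> \<le> (2 + 2 * Kcom s) * N * (L2_norm z)\<^sup>2"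
  proof -
    have "\<bar>X\<bar> \<le> N * (L2_norm z)\<^sup>2 + N * (L2_norm z)\<^sup>2 + 2 * Kcom s * N * (L2_norm z)\<^sup>2"
      unfolding X_def using e1 e2 e3 by linarith
    then show ?thesis by (simp add: algebra_simps)
  qed
  have "\<bar>2 * Re (\<integral>\<xi>. P (rhs B b c) \<xi> * cnj (P c \<xi>) \<partial>lborel)\<bar> = \<bar>X\<bar> / pi"
    unfolding eq X_def[symmetric] by (simp add: abs_mult)
  also have "\<dots> \<le> \<bar>X\<bar> / 1" using pi_gt3 by (intro divide_left_mono) auto
  finally show ?thesis using X unfolding z_def N_def by simp
qed

lemma L2_norm_dominated_tendsto:
  fixes f :: "nat \<Rightarrow> real \<Rightarrow> complex"
  assumes w: "w \<in> L2" and m: "\<And>n. f n \<in> borel_measurable borel" "g \<in> borel_measurable borel"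
    and le: "\<And>n x. norm (f n x) \<le> norm (w x)" and lim: "\<And>x. (\<lambda>n. f n x) \<longlonglongrightarrow> g x"
  shows "(\<lambda>n. (L2_norm (f n))\<^sup>2) \<longlonglongrightarrow> (L2_norm g)\<^sup>2"
  unfolding L2_norm_sq
proof (rule integral_dominated_convergence[where w = "\<lambda>x. (norm (w x))\<^sup>2"])
  show "AE x in lborel. (\<lambda>n. (norm (f n x))\<^sup>2) \<longlonglongrightarrow> (norm (g x))\<^sup>2"
    by (intro AE_I2 tendsto_intros lim)
qed (use m le in \<open>auto simp: L2_integrable[OF w] intro!: power_mono\<close>)

text \<open>Differentiability is asked only in \<open>Hs (s - 2)\<close>, the order of the
  regularized weights, so the lemma covers the limit curve as well as solutions: for that curve the
  second conclusion provides the continuity of the norm. All estimates are uniform in the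
  regularization, which is removed by dominated convergence.\<close>

lemma Hs_norm_control:
  assumes s: "3 \<le> s" and b: "0 < b" "0 \<le> B" and T: "0 \<le> T"
    and aH: "\<And>t. t \<in> {0..T} \<Longrightarrow> a t \<in> Hs s" and ar: "\<And>t. t \<in> {0..T} \<Longrightarrow> realv (a t)"
    and N: "\<And>t. t \<in> {0..T} \<Longrightarrow> (\<integral>\<xi>. norm (dx (a t) \<xi>) \<partial>lborel) \<le> N"
    and lim: "\<And>t. t \<in> {0..T} \<Longrightarrow>
      ((\<lambda>r. Hn (s - 2) (\<lambda>\<xi>. (a r \<xi> - a t \<xi>) / of_real (r - t) - rhs B b (a t) \<xi>)) \<longlongrightarrow> 0) (at t within {0..T})"
  defines "C \<equiv> (2 + 2 * Kcom s) * N"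
  shows "t \<in> {0..T} \<Longrightarrow> (Hn s (a t))\<^sup>2 \<le> (Hn s (a 0))\<^sup>2 * exp (C * T)"
    and "r \<in> {0..T} \<Longrightarrow> t \<in> {0..T} \<Longrightarrow>
      \<bar>(Hn s (a r))\<^sup>2 - (Hn s (a t))\<^sup>2\<bar> \<le> C * ((Hn s (a 0))\<^sup>2 * exp (C * T)) * \<bar>r - t\<bar>"
proof -
  have 0: "0 \<in> {0..T}" using T by simp
  have N0: "0 \<le> N" using order_trans[OF _ N[OF 0]] by simp
  have C0: "0 \<le> C" using N0 s by (simp add: C_def Kcom_def)
  define P where "P e d = (\<lambda>\<xi>. of_real (wreg s e \<xi>) * d \<xi> :: complex)" for e d
  define E where "E e t = (L2_norm (P e (a t)))\<^sup>2" for e t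
  define E' where "E' e t = 2 * Re (\<integral>\<xi>. P e (rhs B b (a t)) \<xi> * cnj (P e (a t) \<xi>) \<partial>lborel)" for e t
  define X where "X = (Hn s (a 0))\<^sup>2 * exp (C * T)"
  have am: "a t \<in> borel_measurable borel" if "t \<in> {0..T}" for t using Hs_measurable[OF aH[OF that]] .
  have der: "((\<lambda>t. E e t) has_real_derivative E' e t) (at t within {0..T})" if e: "0 < e" and t: "t \<in> {0..T}" for e t
    unfolding E_def E'_def P_def
  proof (rule quadratic_deriv[where C = "1 / e\<^sup>2" and \<sigma> = "s - 2"])
    show "\<bar>wreg s e \<xi>\<bar> \<le> 1 / e\<^sup>2 * wt (s - 2) \<xi>" for \<xi> using wreg_le(2)[OF e, of s \<xi>] by simp
    show "a r \<in> Hs (s - 2)" if "r \<in> {0..T}" for r by (rule Hs_mono(1)[OF _ aH[OF that]]) simp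
    show "rhs B b (a t) \<in> Hs (s - 2)" using s by (intro Hs_mono(1)[OF _ rhs_Hs[OF b _ aH[OF t]]]) auto
  qed (use t lim in auto)
  have E'le: "\<bar>E' e t\<bar> \<le> C * E e t" if e: "0 < e" and t: "t \<in> {0..T}" for e t
  proof -
    have "\<bar>E' e t\<bar> \<le> (2 + 2 * Kcom s) * (\<integral>\<xi>. norm (dx (a t) \<xi>) \<partial>lborel) * E e t"
      unfolding E_def E'_def P_def by (rule Hs_energy[OF s e aH[OF t] ar[OF t] b])
    also have "\<dots> \<le> C * E e t"
      unfolding C_def using N[OF t] s by (intro mult_right_mono mult_left_mono) (auto simp: E_def Kcom_def)
    finally show ?thesis .
  qed
  have Ple: "norm (P e (a t) \<xi>) \<le> norm (wa s (a t) \<xi>)" if "0 < e" for e t \<xi>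
    using wreg_le(1)[OF that, of s \<xi>] by (simp add: P_def wa_def norm_mult mult_right_mono)
  have Pm: "P e (a t) \<in> borel_measurable borel" if "t \<in> {0..T}" for e t
    using am[OF that] unfolding P_def by measurable
  have waL: "wa s (a t) \<in> L2" if "t \<in> {0..T}" for t using aH[OF that] by (simp add: Hs_def)
  have E_le: "E e t \<le> (Hn s (a t))\<^sup>2" if e: "0 < e" and t: "t \<in> {0..T}" for e t
    unfolding E_def Hn_def using L2_dominated(2)[OF waL[OF t] Pm[OF t]] Ple[OF e] by (intro power_mono) auto
  have E_X: "E e t \<le> X" if e: "0 < e" and t: "t \<in> {0..T}" for e t
  proof -
    have "E e t \<le> (E e 0 + 0 * t) * exp (C * t)"
    proof (rule gronwall[OF der[OF e]])
      show "E' e t \<le> C * E e t + 0" if "t \<in> {0..T}" for t using E'le[OF e that] by simp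
    qed (use C0 t in auto)
    also have "\<dots> \<le> (Hn s (a 0))\<^sup>2 * exp (C * T)"
      using E_le[OF e 0] t C0 by (auto intro!: mult_mono mult_left_mono)
    finally show ?thesis by (simp add: X_def)
  qed
  define \<epsilon> where "\<epsilon> n = inverse (real (Suc n))" for n
  have \<epsilon>: "0 < \<epsilon> n" "\<epsilon> \<longlonglongrightarrow> 0" for n unfolding \<epsilon>_def using LIMSEQ_inverse_real_of_nat by auto
  have E_lim: "(\<lambda>n. E (\<epsilon> n) t) \<longlonglongrightarrow> (Hn s (a t))\<^sup>2" if t: "t \<in> {0..T}" for t
    unfolding E_def Hn_def
  proof (rule L2_norm_dominated_tendsto[OF waL[OF t] Pm[OF t]])
    show "wa s (a t) \<in> borel_measurable borel" by (rule wa_measurable[OF am[OF t]])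
    show "norm (P (\<epsilon> n) (a t) x) \<le> norm (wa s (a t) x)" for n x by (rule Ple[OF \<epsilon>(1)])
    show "(\<lambda>n. P (\<epsilon> n) (a t) x) \<longlonglongrightarrow> wa s (a t) x" for x
    proof -
      have "(\<lambda>n. wreg s (\<epsilon> n) x) \<longlonglongrightarrow> wt s x / (1 + 0 * wt 1 x)\<^sup>2"
        unfolding wreg_eq by (intro tendsto_intros \<epsilon>) auto
      then show ?thesis unfolding P_def wa_def by (intro tendsto_intros) simp
    qed
  qed
  show "(Hn s (a t))\<^sup>2 \<le> (Hn s (a 0))\<^sup>2 * exp (C * T)" if t: "t \<in> {0..T}"
    using LIMSEQ_le_const2[OF E_lim[OF t], of X] E_X[OF \<epsilon>(1) t] by (auto simp: X_def)
  show "\<bar>(Hn s (a r))\<^sup>2 - (Hn s (a t))\<^sup>2\<bar> \<le> C * ((Hn s (a 0))\<^sup>2 * exp (C * T)) * \<bar>r - t\<bar>" if r: "r \<in> {0..T}" and t: "t \<in> {0..T}"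
  proof -
    have "\<bar>E (\<epsilon> n) r - E (\<epsilon> n) t\<bar> \<le> C * X * \<bar>r - t\<bar>" for n
    proof -
      have "norm (E (\<epsilon> n) r - E (\<epsilon> n) t) \<le> C * X * norm (r - t)"
      proof (rule field_differentiable_bound[OF convex_real_interval(5) der[OF \<epsilon>(1)]])
        show "norm (E' (\<epsilon> n) t) \<le> C * X" if "t \<in> {0..T}" for t
          using order_trans[OF E'le[OF \<epsilon>(1) that] mult_left_mono[OF E_X[OF \<epsilon>(1) that] C0]] by simp
      qed (use r t in auto)
      then show ?thesis by simp
    qed
    moreover have "(\<lambda>n. \<bar>E (\<epsilon> n) r - E (\<epsilon> n) t\<bar>) \<longlonglongrightarrow> \<bar>(Hn s (a r))\<^sup>2 - (Hn s (a t))\<^sup>2\<bar>"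
      by (intro tendsto_intros E_lim r t)
    ultimately show ?thesis unfolding X_def[symmetric] by (intro LIMSEQ_le_const2) auto
  qed
qed

section \<open>Testing on bounded frequencies\<close>

lemma wt_mono_arg: "0 \<le> s \<Longrightarrow> \<bar>\<xi>\<bar> \<le> \<bar>\<eta>\<bar> \<Longrightarrow> wt s \<xi> \<le> wt s \<eta>"
  unfolding wt_def by (intro powr_mono2) (auto simp: abs_le_square_iff)

text \<open>Up to frequency \<open>k\<close> the weight is at most \<open>wt s (real k)\<close>, so
  there convergence in \<open>L2\<close> is convergence in every order.\<close>

lemma trunc_wa:
  assumes s: "0 \<le> s" and d: "d \<in> L2"
  shows "trunc k (wa s d) \<in> L2" "L2_norm (trunc k (wa s d)) \<le> wt s (real k) * L2_norm d"
proof -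
  have le: "norm (trunc k (wa s d) \<xi>) \<le> norm (wt s (real k) *\<^sub>R d \<xi>)" for \<xi>
    using wt_mono_arg[OF s, of \<xi> "real k"]
    by (auto simp: trunc_def indicator_def norm_wa abs_le_iff intro!: mult_right_mono)
  note D = L2_dominated[OF L2_scaleR[OF d, of "wt s (real k)"] trunc_measurable[OF wa_measurable[OF L2_measurable[OF d]]], of k s]
  show "trunc k (wa s d) \<in> L2" using D(1) le by simp
  show "L2_norm (trunc k (wa s d)) \<le> wt s (real k) * L2_norm d"
    using D(2) le by (simp add: L2_norm_scaleR)
qed

lemma Hs_of_truncations:
  assumes m: "d \<in> borel_measurable borel" and C: "0 \<le> C"
    and L: "\<And>k. trunc k (wa s d) \<in> L2" "\<And>k. L2_norm (trunc k (wa s d)) \<le> C"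
  shows "d \<in> Hs s" "Hn s d \<le> C"
  using L2_of_truncations[OF wa_measurable[OF m] C] L unfolding trunc_def[abs_def] Hs_def Hn_def by auto

lemma trunc_eq_mult: "trunc k f x * cnj (trunc k f x) = f x * cnj (trunc k f x)" for f :: "real \<Rightarrow> complex"
  by (simp add: trunc_def indicator_def)

text \<open>A mean value inequality in $H^\sigma$ for a curve which is differentiable only in the weaker
  norm of $H^\tau$: one tests against a frequency truncation of the increment itself.\<close>
lemma Hs_mean_value:
  assumes \<tau>: "\<tau> \<le> \<sigma>" "0 \<le> \<tau>" and t: "t1 \<le> t2" "{t1..t2} \<subseteq> I"
    and aH: "\<And>t. t \<in> I \<Longrightarrow> a t \<in> Hs \<sigma>" and cH: "\<And>t. t \<in> I \<Longrightarrow> c t \<in> Hs \<sigma>" and gH: "g \<in> Hs \<sigma>"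
    and lim: "\<And>t. t \<in> I \<Longrightarrow> ((\<lambda>r. Hn \<tau> (\<lambda>\<xi>. (a r \<xi> - a t \<xi>) / of_real (r - t) - c t \<xi>)) \<longlongrightarrow> 0) (at t within I)"
    and K: "\<And>t. t \<in> {t1..t2} \<Longrightarrow> Hn \<sigma> (\<lambda>\<xi>. c t \<xi> - g \<xi>) \<le> K"
  shows "Hn \<sigma> (\<lambda>\<xi>. a t2 \<xi> - a t1 \<xi> - of_real (t2 - t1) * g \<xi>) \<le> K * (t2 - t1)"
proof -
  define \<phi> where "\<phi> = (\<lambda>\<xi>. a t2 \<xi> - a t1 \<xi> - of_real (t2 - t1) * g \<xi>)"
  have tI: "t1 \<in> I" "t2 \<in> I" using t by auto
  have \<phi>H: "\<phi> \<in> Hs \<sigma>" unfolding \<phi>_def by (intro Hs_diff Hs_cmult aH gH tI)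
  have K0: "0 \<le> K" using order_trans[OF Hn_nonneg K[of t1]] t by simp
  have L: "d \<in> Hs \<sigma> \<Longrightarrow> wa \<sigma> d \<in> L2" for d by (simp add: Hs_def)
  have "L2_norm (trunc k (wa \<sigma> \<phi>)) \<le> K * (t2 - t1)" for k
  proof -
    define z where "z = trunc k (wa \<sigma> \<phi>)"
    have z: "z \<in> L2" unfolding z_def by (rule trunc_L2(1)[OF L[OF \<phi>H]])
    have z': "wa (\<sigma> - \<tau>) z \<in> L2"
    proof -
      have "wa (\<sigma> - \<tau>) z = trunc k (wa (\<sigma> - \<tau>) z)"
        by (auto simp: z_def trunc_def wa_def indicator_def)
      then show ?thesis using trunc_wa(1)[OF _ z, of "\<sigma> - \<tau>" k] \<tau> by simp
    qed
    define pr where "pr d = Re (\<integral>\<xi>. wa \<sigma> d \<xi> * cnj (z \<xi>) \<partial>lborel)" for d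
    have pr_diff: "pr (\<lambda>\<xi>. d \<xi> - d' \<xi>) = pr d - pr d'" if "d \<in> Hs \<sigma>" "d' \<in> Hs \<sigma>" for d d'
      using L2_inner_integrable(1)[OF L[OF that(1)] z] L2_inner_integrable(1)[OF L[OF that(2)] z]
      by (simp add: pr_def wa_diff left_diff_distrib)
    have pr_mult: "pr (\<lambda>\<xi>. of_real x * d \<xi>) = x * pr d" for x d
    proof -
      have "(\<integral>\<xi>. wa \<sigma> (\<lambda>\<xi>. of_real x * d \<xi>) \<xi> * cnj (z \<xi>) \<partial>lborel) = of_real x * (\<integral>\<xi>. wa \<sigma> d \<xi> * cnj (z \<xi>) \<partial>lborel)"
        unfolding wa_cmult mult.assoc by (rule integral_mult_right_zero)
      then show ?thesis by (simp add: pr_def)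
    qed
    have pr_le: "\<bar>pr d\<bar> \<le> Hn \<sigma> d * L2_norm z" if "d \<in> Hs \<sigma>" for d
      unfolding pr_def Hn_def by (rule order_trans[OF abs_Re_le_cmod L2_inner_integrable(2)[OF L[OF that] z]])
    \<comment> \<open>The surplus order \<open>\<sigma> - \<tau>\<close> is moved onto
      \<open>z\<close>, whose frequencies are bounded. The pairing is therefore continuous in the
      weak norm and may be differentiated along the curve.\<close>
    have pr_le': "\<bar>pr d\<bar> \<le> Hn \<tau> d * L2_norm (wa (\<sigma> - \<tau>) z)" if "d \<in> Hs \<sigma>" for d
    proof -
      have d: "wa \<tau> d \<in> L2" using Hs_mono(1)[OF \<tau>(1) that] by (simp add: Hs_def)
      have "wa \<sigma> d \<xi> * cnj (z \<xi>) = wa \<tau> d \<xi> * cnj (wa (\<sigma> - \<tau>) z \<xi>)" for \<xi>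
        using wt_add[of \<tau> "\<sigma> - \<tau>" \<xi>] by (simp add: wa_def mult_ac)
      then have "pr d = Re (\<integral>\<xi>. wa \<tau> d \<xi> * cnj (wa (\<sigma> - \<tau>) z \<xi>) \<partial>lborel)" by (simp add: pr_def)
      then show ?thesis unfolding Hn_def
        using order_trans[OF abs_Re_le_cmod L2_inner_integrable(2)[OF d z']] by simp
    qed
    define h where "h t = pr (a t) - t * pr g" for t
    have hder: "(h has_real_derivative pr (\<lambda>\<xi>. c t \<xi> - g \<xi>)) (at t within {t1..t2})" if t': "t \<in> {t1..t2}" for t
    proof -
      have tI': "t \<in> I" using t' t by auto
      have "((\<lambda>t. pr (a t)) has_real_derivative pr (c t)) (at t within I)"
        unfolding has_field_derivative_iff
      proof (rule LIM_zero_cancel, rule Lim_null_comparison)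
        show "((\<lambda>r. Hn \<tau> (\<lambda>\<xi>. (a r \<xi> - a t \<xi>) / of_real (r - t) - c t \<xi>) * L2_norm (wa (\<sigma> - \<tau>) z)) \<longlongrightarrow> 0) (at t within I)"
          using tendsto_mult_right[OF lim[OF tI'], of "L2_norm (wa (\<sigma> - \<tau>) z)"] by simp
        have "norm ((pr (a r) - pr (a t)) / (r - t) - pr (c t)) \<le> Hn \<tau> (\<lambda>\<xi>. (a r \<xi> - a t \<xi>) / of_real (r - t) - c t \<xi>) * L2_norm (wa (\<sigma> - \<tau>) z)"
          if r: "r \<in> I" for r
        proof -
          have d: "(\<lambda>\<xi>. a r \<xi> - a t \<xi>) \<in> Hs \<sigma>" by (intro Hs_diff aH r tI')
          have "(pr (a r) - pr (a t)) / (r - t) = pr (\<lambda>\<xi>. of_real (1 / (r - t)) * (a r \<xi> - a t \<xi>))"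
            unfolding pr_mult pr_diff[OF aH[OF r] aH[OF tI']] by simp
          then have "(pr (a r) - pr (a t)) / (r - t) - pr (c t) = pr (\<lambda>\<xi>. of_real (1 / (r - t)) * (a r \<xi> - a t \<xi>) - c t \<xi>)"
            using pr_diff[OF Hs_cmult[OF d] cH[OF tI'], of "of_real (1 / (r - t))"] by simp
          moreover have "(\<lambda>\<xi>. of_real (1 / (r - t)) * (a r \<xi> - a t \<xi>) - c t \<xi>) \<in> Hs \<sigma>"
            by (intro Hs_diff Hs_cmult aH cH r tI')
          ultimately show ?thesis using pr_le'[of "\<lambda>\<xi>. of_real (1 / (r - t)) * (a r \<xi> - a t \<xi>) - c t \<xi>"] by simp
        qed
        then show "\<forall>\<^sub>F r in at t within I. norm ((pr (a r) - pr (a t)) / (r - t) - pr (c t)) \<le> Hn \<tau> (\<lambda>\<xi>. (a r \<xi> - a t \<xi>) / of_real (r - t) - c t \<xi>) * L2_norm (wa (\<sigma> - \<tau>) z)"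
          unfolding eventually_at_filter by (auto intro!: always_eventually)
      qed
      then have d1: "((\<lambda>t. pr (a t)) has_real_derivative pr (c t)) (at t within {t1..t2})"
        by (rule DERIV_subset) (use t in auto)
      have "(h has_real_derivative pr (c t) - (1 * pr g)) (at t within {t1..t2})"
        unfolding h_def by (rule DERIV_diff[OF d1]) (auto intro!: derivative_eq_intros)
      then show ?thesis by (simp add: pr_diff[OF cH[OF tI'] gH])
    qed
    have "norm (h t2 - h t1) \<le> (K * L2_norm z) * norm (t2 - t1)"
    proof (rule field_differentiable_bound[OF convex_real_interval(5) hder])
      show "norm (pr (\<lambda>\<xi>. c t \<xi> - g \<xi>)) \<le> K * L2_norm z" if "t \<in> {t1..t2}" for t
      proof -
        have "t \<in> I" using that t by auto
        then show ?thesis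
          using pr_le[OF Hs_diff[OF cH gH], of t] mult_right_mono[OF K[OF that] L2_norm_nonneg[of z]] by simp
      qed
    qed (use t in auto)
    \<comment> \<open>Since \<open>z\<close> is a truncation of the increment itself, the pairing
      reproduces its squared norm, and one factor \<open>L2_norm z\<close> cancels.\<close>
    moreover have "h t2 - h t1 = (L2_norm z)\<^sup>2"
    proof -
      have "h t2 - h t1 = pr (a t2) - pr (a t1) - (t2 - t1) * pr g" by (simp add: h_def algebra_simps)
      also have "\<dots> = pr \<phi>"
        unfolding \<phi>_def pr_diff[OF Hs_diff[OF aH[OF tI(2)] aH[OF tI(1)]] Hs_cmult[OF gH]] pr_diff[OF aH[OF tI(2)] aH[OF tI(1)]] pr_mult ..
      also have "\<dots> = Re (\<integral>\<xi>. z \<xi> * cnj (z \<xi>) \<partial>lborel)" by (simp add: pr_def z_def trunc_eq_mult)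
      also have "\<dots> = (L2_norm z)\<^sup>2" by (simp only: integral_mult_cnj_self[OF z] Re_complex_of_real)
      finally show ?thesis .
    qed
    ultimately have "L2_norm z * L2_norm z \<le> (K * (t2 - t1)) * L2_norm z"
      using t by (simp add: power2_eq_square mult_ac)
    then show ?thesis unfolding z_def[symmetric]
    proof (cases "L2_norm z = 0")
      case False
      then have "0 < L2_norm z" using L2_norm_nonneg[of z] by linarith
      then show "L2_norm z * L2_norm z \<le> (K * (t2 - t1)) * L2_norm z \<Longrightarrow> L2_norm z \<le> K * (t2 - t1)"
        by simp
    qed (use K0 t in simp)
  qed
  then show ?thesis
    unfolding \<phi>_def[symmetric] using K0 t trunc_L2(1)[OF L[OF \<phi>H]]
    by (intro Hs_of_truncations Hs_measurable[OF \<phi>H]) auto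
qed

context fw_spec
begin

lemma a_deriv_weak:
  assumes t: "t \<in> {0..T}"
  shows "((\<lambda>r. Hn (s - 2) (\<lambda>\<xi>. (a r \<xi> - a t \<xi>) / of_real (r - t) - rhs B b (a t) \<xi>)) \<longlongrightarrow> 0) (at t within {0..T})"
proof (rule Lim_null_comparison[OF _ a_deriv[OF t]])
  have "norm (Hn (s - 2) (\<lambda>\<xi>. (a r \<xi> - a t \<xi>) / of_real (r - t) - rhs B b (a t) \<xi>))
      \<le> Hn (s - 1) (\<lambda>\<xi>. (a r \<xi> - a t \<xi>) / of_real (r - t) - rhs B b (a t) \<xi>)" if r: "r \<in> {0..T}" for r
  proof -
    have "a r \<in> Hs (s - 1)" "a t \<in> Hs (s - 1)" by (rule Hs_mono(1)[OF _ aH]; use r t in simp)+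
    then have "(\<lambda>\<xi>. (a r \<xi> - a t \<xi>) / of_real (r - t) - rhs B b (a t) \<xi>) \<in> Hs (s - 1)"
      by (intro Hs_diff Hs_divide rhsH t)
    then show ?thesis using Hs_mono(2)[of "s - 2" "s - 1"] by simp
  qed
  then show "\<forall>\<^sub>F r in at t within {0..T}. norm (Hn (s - 2) (\<lambda>\<xi>. (a r \<xi> - a t \<xi>) / of_real (r - t) - rhs B b (a t) \<xi>))
      \<le> Hn (s - 1) (\<lambda>\<xi>. (a r \<xi> - a t \<xi>) / of_real (r - t) - rhs B b (a t) \<xi>)"
    unfolding eventually_at_filter by (auto intro!: always_eventually)
qed

lemma Hs_bound:
  assumes M: "\<And>t x. t \<in> {0..T} \<Longrightarrow> \<bar>rift (dx (a t)) x\<bar> \<le> M" and t: "t \<in> {0..T}"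
  shows "(Hn s (a t))\<^sup>2 \<le> (Hn s (a 0))\<^sup>2 * exp ((2 + 2 * Kcom s) * (sqrt pi * (2 * Hn 2 (a 0) * exp (5 * M * T))) * T)"
proof (rule Hs_norm_control(1)[OF s b B T aH ar _ a_deriv_weak t])
  fix t assume t: "t \<in> {0..T}"
  have d: "dx (a t) \<in> Hs 1" "Hn 1 (dx (a t)) \<le> Hn 2 (a t)"
    using dx_Hs[of "a t" 1] Hs_mono(1)[OF _ aH[OF t], of 2] s by auto
  have "(\<integral>\<xi>. norm (dx (a t) \<xi>) \<partial>lborel) \<le> sqrt pi * Hn 1 (dx (a t))"
    by (rule Hs_L1(2)[OF order_refl d(1)])
  also have "\<dots> \<le> sqrt pi * (2 * Hn 2 (a 0) * exp (5 * M * T))"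
    using d(2) H2_bound[OF M t] by (intro mult_left_mono) auto
  finally show "(\<integral>\<xi>. norm (dx (a t) \<xi>) \<partial>lborel) \<le> sqrt pi * (2 * Hn 2 (a 0) * exp (5 * M * T))" .
qed

lemma slope_bound:
  assumes U0: "\<And>x. \<bar>rift (a 0) x\<bar> \<le> U0" and M0: "\<And>x. \<bar>rift (dx (a 0)) x\<bar> \<le> M0"
    and F: "Fb U0 \<le> F" and t: "t \<in> {0..T - 1}"
  shows "\<bar>rift (dx (a t)) x\<bar> \<le> M0 + F * T + 2 * (1 + F)"
proof -
  have F0: "0 \<le> F" using Fb_nonneg[OF U0] F by linarith
  have M00: "0 \<le> M0" using order_trans[OF abs_ge_zero M0] .
  \<comment> \<open>Breaking from a slope of \<open>- 1 / c\<close> takes time \<open>2 * c\<close>,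
    which is at most the unit in reserve, and \<open>1 / (2 * c^2) = 2 * (1 + F)^2\<close> exceeds
    the forcing.\<close>
  define c where "c = 1 / (2 * (1 + F))"
  have c: "0 < c" "2 * c \<le> 1" "1 / c = 2 * (1 + F)" using F0 by (auto simp: c_def)
  have "F < 2 * (1 + F)\<^sup>2" using F0 by (simp add: power2_eq_square algebra_simps add_pos_nonneg)
  also have "2 * (1 + F)\<^sup>2 = 1 / (2 * c\<^sup>2)" using F0 by (simp add: c_def power_divide power2_eq_square algebra_simps)
  finally have "Fb U0 < 1 / (2 * c\<^sup>2)" using F by simp
  from wave_breaking[OF U0 _ c(1) _ this, of t x] t c have lo: "- (2 * (1 + F)) < rift (dx (a t)) x" by simp
  have "rift (dx (a t)) x \<le> M0 + Fb U0 * t" by (rule slope_upper[OF U0 M0]) (use t in auto)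
  also have "\<dots> \<le> M0 + F * T" using F F0 t by (intro add_left_mono mult_mono) auto
  finally have up: "rift (dx (a t)) x \<le> M0 + F * T" .
  have "0 \<le> F * T" using F0 T by simp
  then show ?thesis using lo up M00 F0 by (simp add: abs_le_iff)
qed

end

section \<open>Limits of solutions\<close>

text \<open>Over a common denominator the difference of the symbols is bounded uniformly in
  frequency by dropping \<open>\<xi>^2\<close> from the denominators. The result depends on the
  parameters only and tends to 0 as they converge to \<open>(B, b)\<close> with
  \<open>b > 0\<close>.\<close>

definition kdiff :: "real \<Rightarrow> real \<Rightarrow> real \<Rightarrow> real \<Rightarrow> real" where
  "kdiff B' b' B b = 2 * (\<bar>B' * b' - B * b\<bar> / b'\<^sup>2 + B * b * \<bar>b\<^sup>2 - b'\<^sup>2\<bar> / (b'\<^sup>2 * b\<^sup>2))"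

lemma fw_kernel_diff:
  assumes "0 < b" "0 \<le> B" "0 < b'"
  shows "\<bar>fw_kernel B' b' \<xi> - fw_kernel B b \<xi>\<bar> \<le> kdiff B' b' B b"
proof -
  have p: "0 < b\<^sup>2 + \<xi>\<^sup>2" "0 < b'\<^sup>2 + \<xi>\<^sup>2" using assms by (simp_all add: add_pos_nonneg)
  have "fw_kernel B' b' \<xi> - fw_kernel B b \<xi>
      = 2 * ((B' * b' - B * b) / (b'\<^sup>2 + \<xi>\<^sup>2) + B * b * (b\<^sup>2 - b'\<^sup>2) / ((b'\<^sup>2 + \<xi>\<^sup>2) * (b\<^sup>2 + \<xi>\<^sup>2)))"
    proof -
    have "x / p - y / q = (x - y) / p + y * (q - p) / (p * q)" if "0 < p" "0 < q" for x y p q :: real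
      using that by (simp add: divide_simps) (simp add: algebra_simps)
    from this[OF p(2,1), of "B' * b'" "B * b"]
    have "B' * b' / (b'\<^sup>2 + \<xi>\<^sup>2) - B * b / (b\<^sup>2 + \<xi>\<^sup>2)
      = (B' * b' - B * b) / (b'\<^sup>2 + \<xi>\<^sup>2) + B * b * (b\<^sup>2 - b'\<^sup>2) / ((b'\<^sup>2 + \<xi>\<^sup>2) * (b\<^sup>2 + \<xi>\<^sup>2))" by simp
    then have "2 * (B' * b' / (b'\<^sup>2 + \<xi>\<^sup>2) - B * b / (b\<^sup>2 + \<xi>\<^sup>2))
      = 2 * ((B' * b' - B * b) / (b'\<^sup>2 + \<xi>\<^sup>2) + B * b * (b\<^sup>2 - b'\<^sup>2) / ((b'\<^sup>2 + \<xi>\<^sup>2) * (b\<^sup>2 + \<xi>\<^sup>2)))" by simp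
    then show ?thesis unfolding fw_kernel_def by (simp only: right_diff_distrib times_divide_eq_right mult.assoc)
  qed
  also have "\<bar>\<dots>\<bar> \<le> 2 * (\<bar>B' * b' - B * b\<bar> / (b'\<^sup>2 + \<xi>\<^sup>2) + B * b * \<bar>b\<^sup>2 - b'\<^sup>2\<bar> / ((b'\<^sup>2 + \<xi>\<^sup>2) * (b\<^sup>2 + \<xi>\<^sup>2)))"
    unfolding abs_mult using assms p
    by (intro mult_mono order_trans[OF abs_triangle_ineq] add_mono) (auto simp: abs_mult)
  also have "\<dots> \<le> kdiff B' b' B b"
    unfolding kdiff_def using assms p
    by (intro mult_left_mono add_mono divide_left_mono mult_mono) (auto intro!: mult_pos_pos)
  finally show ?thesis .
qed

text \<open>Boundedness in \<open>Hs s\<close> together with convergence in \<open>L2\<close> gives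
  weak convergence: on bounded frequencies the weight is bounded, and the remaining part of the test
  function is small in \<open>L2\<close> against the uniform bound \<open>C\<close>.\<close>

lemma L2_inner_continuous_Hs:
  assumes "0 \<le> s" and I: "\<And>r. r \<in> I \<Longrightarrow> d r \<in> Hs s" "\<And>r. r \<in> I \<Longrightarrow> Hn s (d r) \<le> C" and g: "g \<in> L2"
    and lim: "((\<lambda>r. L2_norm (d r)) \<longlongrightarrow> 0) (at t within I)"
  shows "((\<lambda>r. Re (\<integral>\<xi>. wa s (d r) \<xi> * cnj (g \<xi>) \<partial>lborel)) \<longlongrightarrow> 0) (at t within I)"
proof (cases "I = {}")
  case True
  then show ?thesis by simp
next
  case False
  then obtain r0 where "r0 \<in> I" by blast
  then have C: "0 \<le> C" using order_trans[OF Hn_nonneg I(2)] by blast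
  show ?thesis
  proof (rule tendstoI)
    fix e :: real assume e: "0 < e"
    from LIMSEQ_D[OF L2_norm_trunc_diff[OF g], of "e / (2 * (C + 1))"] e C obtain k where
      k: "L2_norm (\<lambda>x. trunc k g x - g x) < e / (2 * (C + 1))" by auto
    have L: "wa s (d r) \<in> L2" "d r \<in> L2" if "r \<in> I" for r
      using I(1)[OF that] Hs_L2(1)[OF assms(1) I(1)[OF that]] by (simp_all add: Hs_def)
    have est: "\<bar>Re (\<integral>\<xi>. wa s (d r) \<xi> * cnj (g \<xi>) \<partial>lborel)\<bar> < wt s (real k) * L2_norm (d r) * L2_norm g + e / 2" if r: "r \<in> I" for r
    proof -
      have tk: "trunc k (wa s (d r)) \<in> L2" by (rule trunc_L2(1)[OF L(1)[OF r]])
      have g2: "(\<lambda>x. g x - trunc k g x) \<in> L2" by (rule L2_diff[OF g trunc_L2(1)[OF g]])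
      have "wa s (d r) \<xi> * cnj (g \<xi>) = trunc k (wa s (d r)) \<xi> * cnj (g \<xi>) + wa s (d r) \<xi> * cnj (g \<xi> - trunc k g \<xi>)" for \<xi>
        by (simp add: trunc_def indicator_def)
      then have "(\<integral>\<xi>. wa s (d r) \<xi> * cnj (g \<xi>) \<partial>lborel) = (\<integral>\<xi>. trunc k (wa s (d r)) \<xi> * cnj (g \<xi>) \<partial>lborel) + (\<integral>\<xi>. wa s (d r) \<xi> * cnj (g \<xi> - trunc k g \<xi>) \<partial>lborel)"
        using L2_inner_integrable(1)[OF tk g] L2_inner_integrable(1)[OF L(1)[OF r] g2] by simp
      then have "\<bar>Re (\<integral>\<xi>. wa s (d r) \<xi> * cnj (g \<xi>) \<partial>lborel)\<bar> \<le> norm (\<integral>\<xi>. trunc k (wa s (d r)) \<xi> * cnj (g \<xi>) \<partial>lborel) + norm (\<integral>\<xi>. wa s (d r) \<xi> * cnj (g \<xi> - trunc k g \<xi>) \<partial>lborel)"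
        using order_trans[OF abs_Re_le_cmod norm_triangle_ineq] by simp
      also have "norm (\<integral>\<xi>. trunc k (wa s (d r)) \<xi> * cnj (g \<xi>) \<partial>lborel) \<le> L2_norm (trunc k (wa s (d r))) * L2_norm g"
        by (rule L2_inner_integrable(2)[OF tk g])
      also have "\<dots> \<le> (wt s (real k) * L2_norm (d r)) * L2_norm g"
        by (intro mult_right_mono trunc_wa(2) assms L r) auto
      also have "norm (\<integral>\<xi>. wa s (d r) \<xi> * cnj (g \<xi> - trunc k g \<xi>) \<partial>lborel) \<le> L2_norm (wa s (d r)) * L2_norm (\<lambda>x. g x - trunc k g x)"
        by (rule L2_inner_integrable(2)[OF L(1)[OF r] g2])
      also have "\<dots> \<le> C * (e / (2 * (C + 1)))"
        using I(2)[OF r] k L2_norm_minus_commute[of g "trunc k g"] C by (intro mult_mono) (auto simp: Hn_def)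
      also have "\<dots> < e / 2" using e C by (simp add: field_simps)
      finally show ?thesis by simp
    qed
    have "((\<lambda>r. wt s (real k) * L2_norm (d r) * L2_norm g) \<longlongrightarrow> wt s (real k) * 0 * L2_norm g) (at t within I)"
      by (intro tendsto_intros lim)
    then have "\<forall>\<^sub>F r in at t within I. wt s (real k) * L2_norm (d r) * L2_norm g < e / 2"
      using e by (intro order_tendstoD(2)[where y = 0]) auto
    moreover have "\<forall>\<^sub>F r in at t within I. r \<in> I" by (simp add: eventually_at_filter)
    ultimately show "\<forall>\<^sub>F r in at t within I. dist (Re (\<integral>\<xi>. wa s (d r) \<xi> * cnj (g \<xi>) \<partial>lborel)) 0 < e"
    proof eventually_elim
      case (elim r)
      then show ?case using est[OF elim(2)] by simp
    qed
  qed
qed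

text \<open>Frequencies with \<open>wt 1 \<xi> \<le> R\<close> cost a power of \<open>R\<close> over
  \<open>L2\<close>; the others gain \<open>1 / R\<close> over the norm of order
  \<open>s\<close>.\<close>

lemma Hn_interpolation:
  assumes d: "d \<in> Hs s" and s: "1 \<le> s" and R: "1 \<le> R"
  shows "Hn (s - 1) d \<le> R powr (s - 1) * L2_norm d + Hn s d / R"
proof -
  have L: "d \<in> L2" "wa s d \<in> L2" using Hs_L2(1)[OF _ d] d s by (auto simp: Hs_def)
  define f where "f = (\<lambda>\<xi>. R powr (s - 1) *\<^sub>R norm (d \<xi>))"
  define g where "g = (\<lambda>\<xi>. (1 / R) *\<^sub>R norm (wa s d \<xi>))"
  have fg: "f \<in> L2" "g \<in> L2" unfolding f_def g_def by (intro L2_scaleR norm_complex_L2 L)+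
  have nn: "L2_norm (\<lambda>\<xi>. norm (h \<xi>)) = L2_norm h" for h :: "real \<Rightarrow> complex" by (simp add: L2_norm_def)
  have le: "norm (wa (s - 1) d \<xi>) \<le> norm (f \<xi> + g \<xi>)" for \<xi>
  proof -
    have "wt (s - 1) \<xi> \<le> R powr (s - 1) + wt s \<xi> / R"
    proof (cases "wt 1 \<xi> \<le> R")
      case True
      then have "wt (s - 1) \<xi> \<le> R powr (s - 1)" unfolding wt_powr[of "s - 1"] using s by (intro powr_mono2) auto
      moreover have "0 \<le> wt s \<xi> / R" using R by simp
      ultimately show ?thesis by linarith
    next
      case False
      have "R * wt (s - 1) \<xi> \<le> wt 1 \<xi> * wt (s - 1) \<xi>" using False by (intro mult_right_mono) auto
      also have "\<dots> = wt s \<xi>" using wt_add[of 1 "s - 1" \<xi>] by simp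
      finally have "wt (s - 1) \<xi> \<le> wt s \<xi> / R" using R by (simp add: field_simps)
      then show ?thesis by (simp add: add_increasing)
    qed
    from mult_right_mono[OF this norm_ge_zero[of "d \<xi>"]]
    show ?thesis using R by (simp add: norm_wa f_def g_def distrib_right)
  qed
  have "Hn (s - 1) d \<le> L2_norm (\<lambda>\<xi>. f \<xi> + g \<xi>)"
    unfolding Hn_def by (rule L2_dominated(2)[OF L2_add(1)[OF fg] wa_measurable[OF L2_measurable[OF L(1)]]]) (use le in simp)
  also have "\<dots> \<le> L2_norm f + L2_norm g" by (rule L2_norm_triangle[OF fg])
  also have "L2_norm f = R powr (s - 1) * L2_norm d" unfolding f_def L2_norm_scaleR nn by simp
  also have "L2_norm g = Hn s d / R" unfolding g_def L2_norm_scaleR nn using R by (simp add: Hn_def)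
  finally show ?thesis .
qed

section \<open>Approximating solutions form a Cauchy sequence\<close>

locale fw_limit =
  fixes s B b T C :: real and Bn bn :: "nat \<Rightarrow> real" and a :: "nat \<Rightarrow> real \<Rightarrow> real \<Rightarrow> complex"
    and c0 :: "real \<Rightarrow> complex"
  assumes s: "3 \<le> s" and b: "0 < b" and B: "0 \<le> B"
    and Bn: "Bn \<longlonglongrightarrow> B" and bn: "bn \<longlonglongrightarrow> b"
    and sol: "\<And>n. fw_spec s (Bn n) (bn n) T (a n)" and init: "\<And>n. a n 0 = c0"
    and bound: "\<And>n t. t \<in> {0..T} \<Longrightarrow> Hn s (a n t) \<le> C"
begin

lemma T: "0 \<le> T" and bn_pos: "0 < bn n" and Bn_nonneg: "0 \<le> Bn n"
  using fw_spec.T[OF sol] fw_spec.b[OF sol] fw_spec.B[OF sol] by auto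

lemma aH: "t \<in> {0..T} \<Longrightarrow> a n t \<in> Hs s" and ar: "t \<in> {0..T} \<Longrightarrow> realv (a n t)"
  using fw_spec.aH[OF sol] fw_spec.ar[OF sol] by auto

lemma aL: "t \<in> {0..T} \<Longrightarrow> a n t \<in> L2" "t \<in> {0..T} \<Longrightarrow> integrable lborel (a n t)"
  using fw_spec.aL[OF sol] by auto

lemma C0: "0 \<le> C"
  using order_trans[OF Hn_nonneg bound[of 0]] T by auto

definition \<kappa> :: "nat \<Rightarrow> real" where "\<kappa> n = kdiff (Bn n) (bn n) B b"

lemma \<kappa>_nonneg: "0 \<le> \<kappa> n"
  using b B by (simp add: \<kappa>_def kdiff_def)

lemma \<kappa>_lim: "\<kappa> \<longlonglongrightarrow> 0"
proof -
  have "(\<lambda>n. kdiff (Bn n) (bn n) B b) \<longlonglongrightarrow> kdiff B b B b"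
    unfolding kdiff_def using b by (intro tendsto_intros Bn bn) auto
  then show ?thesis by (simp add: \<kappa>_def[abs_def] kdiff_def)
qed

lemma kernel_diff: "\<bar>fw_kernel (Bn n) (bn n) \<xi> - fw_kernel B b \<xi>\<bar> \<le> \<kappa> n"
  unfolding \<kappa>_def by (rule fw_kernel_diff[OF b B bn_pos])

lemma kernel_diff2: "\<bar>fw_kernel (Bn n) (bn n) \<xi> - fw_kernel (Bn m) (bn m) \<xi>\<bar> \<le> \<kappa> n + \<kappa> m"
  using kernel_diff[of n \<xi>] kernel_diff[of m \<xi>] by linarith

text \<open>The difference \<open>w\<close> is transported by the mean of the two solutions, of
  Lipschitz constant at most \<open>C\<close>. The kernel acting on \<open>w\<close> drops out by
  skewness, and the change of kernel acts on one solution as a source of size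
  \<open>(\<kappa> n + \<kappa> m) * C\<close>. Splitting the product of the source with
  \<open>w\<close> into squares adds the 1 to \<open>C\<close>.\<close>

lemma difference_energy:
  assumes t: "t \<in> {0..T}"
  shows "2 * Re (\<integral>\<xi>. (rhs (Bn n) (bn n) (a n t) \<xi> - rhs (Bn m) (bn m) (a m t) \<xi>) * cnj (a n t \<xi> - a m t \<xi>) \<partial>lborel)
    \<le> (C + 1) * (L2_norm (\<lambda>\<xi>. a n t \<xi> - a m t \<xi>))\<^sup>2 + ((\<kappa> n + \<kappa> m) * C)\<^sup>2"
proof -
  define w where "w = (\<lambda>\<xi>. a n t \<xi> - a m t \<xi>)"
  define \<sigma> where "\<sigma> = (\<lambda>\<xi>. a n t \<xi> + a m t \<xi>)"
  define k where "k = kmult (Bn n) (bn n) w"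
  define k' where "k' = (\<lambda>\<xi>. of_real (fw_kernel (Bn n) (bn n) \<xi> - fw_kernel (Bn m) (bn m) \<xi>) * a m t \<xi>)"
  have w: "w \<in> Hs s" and \<sigma>: "\<sigma> \<in> Hs s" and \<sigma>r: "realv \<sigma>"
    unfolding w_def \<sigma>_def by (intro Hs_diff Hs_add realv_add aH ar aL t)+
  have \<sigma>n: "Hn s \<sigma> \<le> 2 * C" unfolding \<sigma>_def using Hn_add[OF aH[OF t, of n] aH[OF t, of m]] bound[OF t, of n] bound[OF t, of m] by linarith
  have kH: "k \<in> Hs s" unfolding k_def by (rule kernel_Hs(1)[OF bn_pos Bn_nonneg w])
  have k'H: "k' \<in> Hs s" "Hn s k' \<le> (\<kappa> n + \<kappa> m) * Hn s (a m t)"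
    unfolding k'_def using Hs_multiplier[of "a m t" s 0 "\<lambda>\<xi>. of_real (fw_kernel (Bn n) (bn n) \<xi> - fw_kernel (Bn m) (bn m) \<xi>)" "\<kappa> n + \<kappa> m"] aH[OF t, of m]
      kernel_diff2[of n _ m] by (auto simp del: of_real_diff)
  have cH: "conv \<sigma> w \<in> Hs s" using s by (intro conv_Hs \<sigma> w) auto
  have L: "dx d \<in> L2" "d \<in> L2" if "d \<in> Hs s" for d
    using Hs_L2(1)[OF _ dx_Hs'(1)[OF that]] Hs_L2(1)[OF _ that] s by auto
  have i: "integrable lborel d" if "d \<in> Hs s" for d using Hs_integrable[OF that] s by simp
  have eq: "rhs (Bn n) (bn n) (a n t) \<xi> - rhs (Bn m) (bn m) (a m t) \<xi>
     = - (of_real (1 / (4 * pi)) * dx (conv \<sigma> w) \<xi> + dx k \<xi> + dx k' \<xi>)" for \<xi>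
  proof -
    have "conv (a n t) (a n t) \<xi> = conv (a m t) (a m t) \<xi> + conv \<sigma> w \<xi>"
      unfolding \<sigma>_def w_def using conv_square_diff[OF aL(1)[OF t, of n] aL(1)[OF t, of m], of \<xi>] by (simp add: algebra_simps)
    moreover have "a n t \<xi> = a m t \<xi> + w \<xi>" by (simp add: w_def)
    ultimately show ?thesis by (simp add: rhs_def dx_def k_def k'_def algebra_simps add_divide_distrib)
  qed
  define X1 where "X1 = Re (\<integral>\<xi>. dx (conv \<sigma> w) \<xi> * cnj (w \<xi>) \<partial>lborel)"
  define X2 where "X2 = Re (\<integral>\<xi>. dx k \<xi> * cnj (w \<xi>) \<partial>lborel)"
  define X3 where "X3 = Re (\<integral>\<xi>. dx k' \<xi> * cnj (w \<xi>) \<partial>lborel)"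
  note I = L2_inner_integrable(1)[OF L(1)[OF cH] L(2)[OF w]] L2_inner_integrable(1)[OF L(1)[OF kH] L(2)[OF w]]
    L2_inner_integrable(1)[OF L(1)[OF k'H(1)] L(2)[OF w]]
  have "(\<integral>\<xi>. (rhs (Bn n) (bn n) (a n t) \<xi> - rhs (Bn m) (bn m) (a m t) \<xi>) * cnj (a n t \<xi> - a m t \<xi>) \<partial>lborel)
     = (\<integral>\<xi>. - (of_real (1 / (4 * pi)) * (dx (conv \<sigma> w) \<xi> * cnj (w \<xi>)) + dx k \<xi> * cnj (w \<xi>) + dx k' \<xi> * cnj (w \<xi>)) \<partial>lborel)"
  proof -
    have cw: "a n t \<xi> - a m t \<xi> = w \<xi>" for \<xi> by (simp add: w_def)
    show ?thesis by (simp only: eq cw minus_mult_left[symmetric] distrib_right mult.assoc)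
  qed
  also have "\<dots> = - (of_real (1 / (4 * pi)) * (\<integral>\<xi>. dx (conv \<sigma> w) \<xi> * cnj (w \<xi>) \<partial>lborel) + (\<integral>\<xi>. dx k \<xi> * cnj (w \<xi>) \<partial>lborel) + (\<integral>\<xi>. dx k' \<xi> * cnj (w \<xi>) \<partial>lborel))"
    using I by (simp only: Bochner_Integration.integral_minus Bochner_Integration.integral_add integrable_mult_right Bochner_Integration.integrable_add integral_mult_right_zero)
  finally have E: "2 * Re (\<integral>\<xi>. (rhs (Bn n) (bn n) (a n t) \<xi> - rhs (Bn m) (bn m) (a m t) \<xi>) * cnj (a n t \<xi> - a m t \<xi>) \<partial>lborel)
     = - ((1 / (2 * pi)) * X1 + 2 * X2 + 2 * X3)"
  proof -
    have re: "Re (of_real y * z) = y * Re z" for y z by simp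
    assume *: "(\<integral>\<xi>. (rhs (Bn n) (bn n) (a n t) \<xi> - rhs (Bn m) (bn m) (a m t) \<xi>) * cnj (a n t \<xi> - a m t \<xi>) \<partial>lborel) =
      - (of_real (1 / (4 * pi)) * (\<integral>\<xi>. dx (conv \<sigma> w) \<xi> * cnj (w \<xi>) \<partial>lborel) + (\<integral>\<xi>. dx k \<xi> * cnj (w \<xi>) \<partial>lborel) + (\<integral>\<xi>. dx k' \<xi> * cnj (w \<xi>) \<partial>lborel))"
    show ?thesis unfolding * uminus_complex.sel plus_complex.sel re X1_def X2_def X3_def by simp
  qed
  have "\<bar>rift \<sigma> x - rift \<sigma> y\<bar> \<le> 2 * C * \<bar>x - y\<bar>" for x y
    using rift_Lipschitz[OF \<sigma>, of x y] s mult_right_mono[OF \<sigma>n, of "\<bar>x - y\<bar>"] by simp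
  from transport_pairing[OF i[OF \<sigma>] L(2)[OF \<sigma>] \<sigma>r this i[OF w] L(2)[OF w] L(1)[OF w]]
  have x1: "\<bar>X1\<bar> \<le> pi * (2 * C) * (L2_norm w)\<^sup>2"
    unfolding X1_def Re_inner_dx[of "conv \<sigma> w"] by simp
  have x2: "X2 = 0"
  proof -
    have "X2 = - Re (\<integral>\<xi>. dx w \<xi> * cnj (k \<xi>) \<partial>lborel)" unfolding X2_def by (rule Re_inner_dx)
    also have "(\<integral>\<xi>. dx w \<xi> * cnj (k \<xi>) \<partial>lborel) = (\<integral>\<xi>. dx k \<xi> * cnj (w \<xi>) \<partial>lborel)"
      by (intro Bochner_Integration.integral_cong refl) (simp add: k_def dx_def mult_ac)
    finally show ?thesis by (simp add: X2_def)
  qed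
  have x3: "\<bar>X3\<bar> \<le> ((\<kappa> n + \<kappa> m) * C) * L2_norm w"
  proof -
    have "\<bar>X3\<bar> \<le> L2_norm (dx k') * L2_norm w"
      unfolding X3_def by (rule order_trans[OF abs_Re_le_cmod L2_inner_integrable(2)[OF L(1)[OF k'H(1)] L(2)[OF w]]])
    also have "\<dots> \<le> Hn s k' * L2_norm w"
      using Hs_L2(2)[OF _ dx_Hs'(1)[OF k'H(1)]] dx_Hs'(2)[OF k'H(1)] s by (intro mult_right_mono) auto
    also have "\<dots> \<le> ((\<kappa> n + \<kappa> m) * C) * L2_norm w"
      using k'H(2) mult_left_mono[OF bound[OF t, of m], of "\<kappa> n + \<kappa> m"] \<kappa>_nonneg[of n] \<kappa>_nonneg[of m]
      by (intro mult_right_mono) auto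
    finally show ?thesis .
  qed
  have "- ((1 / (2 * pi)) * X1 + 2 * X2 + 2 * X3) \<le> (1 / (2 * pi)) * \<bar>X1\<bar> + 2 * \<bar>X3\<bar>"
    using abs_ge_minus_self[of X1] abs_ge_minus_self[of X3] mult_left_mono[OF abs_ge_minus_self[of X1], of "1 / (2 * pi)"]
    unfolding x2 by simp
  also have "\<dots> \<le> (1 / (2 * pi)) * (pi * (2 * C) * (L2_norm w)\<^sup>2) + 2 * (((\<kappa> n + \<kappa> m) * C) * L2_norm w)"
    by (intro add_mono mult_left_mono x1 x3) auto
  also have "(1 / (2 * pi)) * (pi * (2 * C) * (L2_norm w)\<^sup>2) = C * (L2_norm w)\<^sup>2" by simp
  also have "2 * (((\<kappa> n + \<kappa> m) * C) * L2_norm w) \<le> ((\<kappa> n + \<kappa> m) * C)\<^sup>2 + (L2_norm w)\<^sup>2"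
    using sum_squares_bound[of "(\<kappa> n + \<kappa> m) * C" "L2_norm w"] by (simp only: mult.assoc)
  finally show ?thesis unfolding E w_def[symmetric] by (simp add: algebra_simps)
qed

text \<open>The square root of the Gronwall factor; all solutions start from \<open>c0\<close>, so
  only the source contributes.\<close>

definition K where "K = C * sqrt (T * exp ((C + 1) * T))"

lemma K_nonneg: "0 \<le> K" using C0 T by (simp add: K_def)

lemma difference_bound:
  assumes t: "t \<in> {0..T}"
  shows "L2_norm (\<lambda>\<xi>. a n t \<xi> - a m t \<xi>) \<le> (\<kappa> n + \<kappa> m) * K"
proof -
  define w where "w t = (\<lambda>\<xi>. a n t \<xi> - a m t \<xi>)" for t
  define v where "v t = (\<lambda>\<xi>. rhs (Bn n) (bn n) (a n t) \<xi> - rhs (Bn m) (bn m) (a m t) \<xi>)" for t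
  have s1: "a k r \<in> Hs (s - 1)" if "r \<in> {0..T}" for k r by (rule Hs_mono(1)[OF _ aH[OF that]]) simp
  have rH: "rhs (Bn k) (bn k) (a k r) \<in> Hs (s - 1)" if "r \<in> {0..T}" for k r
    using s by (intro rhs_Hs bn_pos Bn_nonneg aH that) auto
  have der: "((\<lambda>r. (L2_norm (w r))\<^sup>2) has_real_derivative 2 * Re (\<integral>\<xi>. v t \<xi> * cnj (w t \<xi>) \<partial>lborel)) (at t within {0..T})"
    if t: "t \<in> {0..T}" for t
  proof -
    have "((\<lambda>r. (L2_norm (\<lambda>\<xi>. of_real 1 * w r \<xi>))\<^sup>2) has_real_derivative 2 * Re (\<integral>\<xi>. (of_real 1 * v t \<xi>) * cnj (of_real 1 * w t \<xi>) \<partial>lborel)) (at t within {0..T})"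
    proof (rule quadratic_deriv[where C = 1 and \<sigma> = "s - 1"])
      show "\<bar>1\<bar> \<le> 1 * wt (s - 1) \<xi>" for \<xi> using wt_ge_1[of "s - 1" \<xi>] s by simp
      show "w r \<in> Hs (s - 1)" if "r \<in> {0..T}" for r unfolding w_def by (intro Hs_diff s1 that)
      show "v t \<in> Hs (s - 1)" unfolding v_def by (intro Hs_diff rH t)
      define Q where "Q k r = (\<lambda>\<xi>. (a k r \<xi> - a k t \<xi>) / of_real (r - t) - rhs (Bn k) (bn k) (a k t) \<xi>)" for k r
      have QH: "Q k r \<in> Hs (s - 1)" if "r \<in> {0..T}" for k r unfolding Q_def by (intro Hs_diff Hs_divide s1 rH t that)
      show "((\<lambda>r. Hn (s - 1) (\<lambda>\<xi>. (w r \<xi> - w t \<xi>) / of_real (r - t) - v t \<xi>)) \<longlongrightarrow> 0) (at t within {0..T})"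
      proof (rule Lim_null_comparison)
        have "((\<lambda>r. Hn (s - 1) (Q n r) + Hn (s - 1) (Q m r)) \<longlongrightarrow> 0 + 0) (at t within {0..T})"
          unfolding Q_def by (intro tendsto_add fw_spec.a_deriv[OF sol] t)
        then show "((\<lambda>r. Hn (s - 1) (Q n r) + Hn (s - 1) (Q m r)) \<longlongrightarrow> 0) (at t within {0..T})" by simp
        have "norm (Hn (s - 1) (\<lambda>\<xi>. (w r \<xi> - w t \<xi>) / of_real (r - t) - v t \<xi>)) \<le> Hn (s - 1) (Q n r) + Hn (s - 1) (Q m r)" if r: "r \<in> {0..T}" for r
        proof -
          have "(\<lambda>\<xi>. (w r \<xi> - w t \<xi>) / of_real (r - t) - v t \<xi>) = (\<lambda>\<xi>. Q n r \<xi> - Q m r \<xi>)"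
            by (auto simp: w_def v_def Q_def diff_divide_distrib)
          then show ?thesis using Hn_diff_le[OF QH[OF r, of n] QH[OF r, of m]] by simp
        qed
        then show "\<forall>\<^sub>F r in at t within {0..T}. norm (Hn (s - 1) (\<lambda>\<xi>. (w r \<xi> - w t \<xi>) / of_real (r - t) - v t \<xi>)) \<le> Hn (s - 1) (Q n r) + Hn (s - 1) (Q m r)"
          unfolding eventually_at_filter by (auto intro!: always_eventually)
      qed
    qed (use t in auto)
    then show ?thesis by simp
  qed
  have "(L2_norm (w t))\<^sup>2 \<le> ((L2_norm (w 0))\<^sup>2 + ((\<kappa> n + \<kappa> m) * C)\<^sup>2 * t) * exp ((C + 1) * t)"
  proof (rule gronwall[OF der])
    show "2 * Re (\<integral>\<xi>. v t \<xi> * cnj (w t \<xi>) \<partial>lborel) \<le> (C + 1) * (L2_norm (w t))\<^sup>2 + ((\<kappa> n + \<kappa> m) * C)\<^sup>2" if "t \<in> {0..T}" for t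
      unfolding v_def w_def by (rule difference_energy[OF that])
  qed (use C0 t in auto)
  also have "\<dots> = ((\<kappa> n + \<kappa> m) * C)\<^sup>2 * (t * exp ((C + 1) * t))" by (simp add: w_def init)
  also have "\<dots> \<le> ((\<kappa> n + \<kappa> m) * C)\<^sup>2 * (T * exp ((C + 1) * T))"
    using t C0 T by (intro mult_left_mono mult_mono) auto
  also have "\<dots> = ((\<kappa> n + \<kappa> m) * K)\<^sup>2"
    using T by (simp add: K_def power_mult_distrib)
  finally have "(L2_norm (w t))\<^sup>2 \<le> ((\<kappa> n + \<kappa> m) * K)\<^sup>2" .
  moreover have "0 \<le> (\<kappa> n + \<kappa> m) * K" using \<kappa>_nonneg[of n] \<kappa>_nonneg[of m] K_nonneg by simp
  ultimately show ?thesis unfolding w_def by (rule power2_le_imp_le)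
qed

end

text \<open>The mean value inequality divided by the length of the interval, for either order of
  \<open>r\<close> and \<open>t\<close>. With \<open>g\<close> the candidate derivative at
  \<open>t\<close>, it converts continuity of the derivative into differentiability in the stronger
  norm.\<close>

lemma Hs_mean_value_quotient:
  assumes \<tau>: "\<tau> \<le> \<sigma>" "0 \<le> \<tau>" and r: "r \<in> {0..T}" and t: "t \<in> {0..T}" and rt: "r \<noteq> t"
    and aH: "\<And>t. t \<in> {0..T} \<Longrightarrow> a t \<in> Hs \<sigma>" and cH: "\<And>t. t \<in> {0..T} \<Longrightarrow> c t \<in> Hs \<sigma>" and gH: "g \<in> Hs \<sigma>"
    and lim: "\<And>t. t \<in> {0..T} \<Longrightarrow> ((\<lambda>r. Hn \<tau> (\<lambda>\<xi>. (a r \<xi> - a t \<xi>) / of_real (r - t) - c t \<xi>)) \<longlongrightarrow> 0) (at t within {0..T})"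
    and K: "\<And>v. v \<in> {0..T} \<Longrightarrow> \<bar>v - t\<bar> \<le> \<bar>r - t\<bar> \<Longrightarrow> Hn \<sigma> (\<lambda>\<xi>. c v \<xi> - g \<xi>) \<le> K"
  shows "Hn \<sigma> (\<lambda>\<xi>. (a r \<xi> - a t \<xi>) / of_real (r - t) - g \<xi>) \<le> K"
proof -
  define t1 where "t1 = min r t"
  define t2 where "t2 = max r t"
  have t12: "t1 < t2" using rt by (auto simp: t1_def t2_def)
  have "Hn \<sigma> (\<lambda>\<xi>. a t2 \<xi> - a t1 \<xi> - of_real (t2 - t1) * g \<xi>) \<le> K * (t2 - t1)"
  proof (rule Hs_mean_value[OF \<tau> _ _ aH cH gH lim K])
    show "{t1..t2} \<subseteq> {0..T}" using r t by (auto simp: t1_def t2_def)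
  qed (use t12 r t in \<open>auto simp: t1_def t2_def\<close>)
  moreover have "(\<lambda>\<xi>. (a r \<xi> - a t \<xi>) / of_real (r - t) - g \<xi>) = (\<lambda>\<xi>. of_real (1 / (t2 - t1)) * (a t2 \<xi> - a t1 \<xi> - of_real (t2 - t1) * g \<xi>))"
  proof
    fix \<xi>
    have "of_real (1 / (t2 - t1)) * (a t2 \<xi> - a t1 \<xi> - of_real (t2 - t1) * g \<xi>) = (a t2 \<xi> - a t1 \<xi>) / of_real (t2 - t1) - g \<xi>"
      using t12 by (simp add: field_simps del: of_real_diff)
    moreover have "(a t2 \<xi> - a t1 \<xi>) / of_real (t2 - t1) = (a r \<xi> - a t \<xi>) / of_real (r - t)"
    proof (cases "r \<le> t")
      case True
      then have "t2 = t" "t1 = r" by (auto simp: t1_def t2_def)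
      then show ?thesis using minus_divide_divide[of "a r \<xi> - a t \<xi>" "of_real (r - t)"] by simp
    next
      case False
      then have "t2 = r" "t1 = t" by (auto simp: t1_def t2_def)
      then show ?thesis by simp
    qed
    ultimately show "(a r \<xi> - a t \<xi>) / of_real (r - t) - g \<xi> = of_real (1 / (t2 - t1)) * (a t2 \<xi> - a t1 \<xi> - of_real (t2 - t1) * g \<xi>)" by simp
  qed
  moreover have "\<bar>1 / (t2 - t1)\<bar> = 1 / (t2 - t1)" using t12 by simp
  ultimately show ?thesis
    using t12 by (simp only: Hn_cmult norm_of_real) (simp add: field_simps)
qed

lemma norm_ift_Hs:
  assumes "a \<in> Hs s" "1 \<le> s"
  shows "norm (ift a x) \<le> Hn s a"
proof -
  have "norm (ift a x) \<le> (sqrt pi * Hn s a) / (2 * pi)"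
    by (rule order_trans[OF norm_ift_le divide_right_mono[OF Hs_L1(2)]]) (use assms in auto)
  also have "\<dots> \<le> Hn s a"
  proof -
    have "sqrt pi \<le> 2 * pi" using pi_gt3 real_sqrt_le_mono[of pi "pi * pi"] by (simp add: real_sqrt_mult)
    from mult_right_mono[OF this Hn_nonneg[of s a]] show ?thesis by (simp add: field_simps)
  qed
  finally show ?thesis .
qed

lemma (in fw_limit) limit_exists:
  "\<exists>\<alpha>. \<forall>t\<in>{0..T}. \<alpha> t \<in> L2 \<and> (\<lambda>n. L2_norm (\<lambda>\<xi>. a n t \<xi> - \<alpha> t \<xi>)) \<longlonglongrightarrow> 0"
proof (rule bchoice, rule ballI)
  fix t assume t: "t \<in> {0..T}"
  have "\<exists>g\<in>L2. (\<lambda>n. L2_norm (\<lambda>\<xi>. a n t \<xi> - g \<xi>)) \<longlonglongrightarrow> 0"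
  proof (rule L2_complete[OF aL(1)[OF t]])
    fix e :: real assume e: "0 < e"
    from LIMSEQ_D[OF \<kappa>_lim, of "e / (2 * (K + 1))"] e K_nonneg obtain N where
      N: "\<And>n. n \<ge> N \<Longrightarrow> \<kappa> n < e / (2 * (K + 1))" by (auto simp: abs_less_iff)
    have "L2_norm (\<lambda>\<xi>. a m t \<xi> - a n t \<xi>) < e" if "m \<ge> N" "n \<ge> N" for m n
    proof -
      have "L2_norm (\<lambda>\<xi>. a m t \<xi> - a n t \<xi>) \<le> (\<kappa> m + \<kappa> n) * K" by (rule difference_bound[OF t])
      also have "\<dots> \<le> (e / (2 * (K + 1)) + e / (2 * (K + 1))) * K"
        using N[OF that(1)] N[OF that(2)] K_nonneg by (intro mult_right_mono add_mono) auto
      also have "e / (2 * (K + 1)) + e / (2 * (K + 1)) = e / (K + 1)"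
        using field_sum_of_halves[of "e / (K + 1)"] by (simp only: divide_divide_eq_left mult.commute[of 2])
      also have "e / (K + 1) * K < e" using e K_nonneg by (simp add: field_simps)
      finally show ?thesis .
    qed
    then show "\<exists>N. \<forall>m\<ge>N. \<forall>n\<ge>N. L2_norm (\<lambda>\<xi>. a m t \<xi> - a n t \<xi>) < e" by blast
  qed
  then show "\<exists>g. g \<in> L2 \<and> (\<lambda>n. L2_norm (\<lambda>\<xi>. a n t \<xi> - g \<xi>)) \<longlonglongrightarrow> 0" by blast
qed

section \<open>Regularity of the limit curve\<close>

locale fw_limit_curve = fw_limit +
  fixes \<alpha> :: "real \<Rightarrow> real \<Rightarrow> complex"
  assumes \<alpha>L: "t \<in> {0..T} \<Longrightarrow> \<alpha> t \<in> L2"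
    and \<alpha>lim: "t \<in> {0..T} \<Longrightarrow> (\<lambda>n. L2_norm (\<lambda>\<xi>. a n t \<xi> - \<alpha> t \<xi>)) \<longlonglongrightarrow> 0"
begin

text \<open>Letting \<open>m\<close> tend to infinity in \<open>difference_bound\<close> gives a
  rate that does not depend on \<open>t\<close>, so the limits taken separately at each time are in
  fact uniform.\<close>

lemma rate:
  assumes t: "t \<in> {0..T}"
  shows "L2_norm (\<lambda>\<xi>. a n t \<xi> - \<alpha> t \<xi>) \<le> \<kappa> n * K"
proof (rule LIMSEQ_le_const)
  show "(\<lambda>m. (\<kappa> n + \<kappa> m) * K + L2_norm (\<lambda>\<xi>. a m t \<xi> - \<alpha> t \<xi>)) \<longlonglongrightarrow> \<kappa> n * K"
    using tendsto_add[OF tendsto_mult_right[OF tendsto_add[OF tendsto_const \<kappa>_lim, of "\<kappa> n"], of K] \<alpha>lim[OF t]] by simp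
  show "\<exists>N. \<forall>m\<ge>N. L2_norm (\<lambda>\<xi>. a n t \<xi> - \<alpha> t \<xi>) \<le> (\<kappa> n + \<kappa> m) * K + L2_norm (\<lambda>\<xi>. a m t \<xi> - \<alpha> t \<xi>)"
  proof (intro exI[of _ 0] allI impI)
    fix m
    show "L2_norm (\<lambda>\<xi>. a n t \<xi> - \<alpha> t \<xi>) \<le> (\<kappa> n + \<kappa> m) * K + L2_norm (\<lambda>\<xi>. a m t \<xi> - \<alpha> t \<xi>)"
      using L2_norm_triangle3[OF aL(1)[OF t, of n] aL(1)[OF t, of m] \<alpha>L[OF t]] difference_bound[OF t, of n m] by linarith
  qed
qed

text \<open>Lower semicontinuity of the norm: on frequencies up to \<open>k\<close> convergence in
  \<open>L2\<close> controls order \<open>s\<close>, and the resulting bound \<open>C\<close> does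
  not depend on \<open>k\<close>.\<close>

lemma \<alpha>H:
  assumes t: "t \<in> {0..T}"
  shows "\<alpha> t \<in> Hs s" "Hn s (\<alpha> t) \<le> C"
proof -
  have le: "L2_norm (trunc k (wa s (\<alpha> t))) \<le> C" for k
  proof (rule LIMSEQ_le_const)
    show "(\<lambda>n. wt s (real k) * L2_norm (\<lambda>\<xi>. a n t \<xi> - \<alpha> t \<xi>) + C) \<longlonglongrightarrow> C"
      using tendsto_add[OF tendsto_mult_left[OF \<alpha>lim[OF t], of "wt s (real k)"] tendsto_const[of C]] by simp
    have "L2_norm (trunc k (wa s (\<alpha> t))) \<le> wt s (real k) * L2_norm (\<lambda>\<xi>. a n t \<xi> - \<alpha> t \<xi>) + C" for n
    proof -
      have d: "(\<lambda>\<xi>. a n t \<xi> - \<alpha> t \<xi>) \<in> L2" by (rule L2_diff[OF aL(1)[OF t] \<alpha>L[OF t]])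
      have s0: "0 \<le> s" using s by simp
      have w: "wa s (a n t) \<in> L2" using aH[OF t] by (simp add: Hs_def)
      have "trunc k (wa s (\<alpha> t)) = (\<lambda>\<xi>. trunc k (wa s (a n t)) \<xi> - trunc k (wa s (\<lambda>\<xi>. a n t \<xi> - \<alpha> t \<xi>)) \<xi>)"
        by (auto simp: trunc_def indicator_def wa_def algebra_simps)
      then have "L2_norm (trunc k (wa s (\<alpha> t))) \<le> L2_norm (trunc k (wa s (a n t))) + L2_norm (trunc k (wa s (\<lambda>\<xi>. a n t \<xi> - \<alpha> t \<xi>)))"
        using L2_norm_diff_le[OF trunc_L2(1)[OF w] trunc_wa(1)[OF s0 d]] by simp
      moreover have "L2_norm (trunc k (wa s (a n t))) \<le> C"
        using trunc_L2(2)[OF w] bound[OF t, of n] unfolding Hn_def by (rule order_trans)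
      ultimately show ?thesis using trunc_wa(2)[OF s0 d, of k] by linarith
    qed
    then show "\<exists>N. \<forall>n\<ge>N. L2_norm (trunc k (wa s (\<alpha> t))) \<le> wt s (real k) * L2_norm (\<lambda>\<xi>. a n t \<xi> - \<alpha> t \<xi>) + C" by blast
  qed
  have "trunc k (wa s (\<alpha> t)) \<in> L2" for k
    by (rule trunc_wa(1)[OF _ \<alpha>L[OF t]]) (use s in simp)
  then show "\<alpha> t \<in> Hs s" "Hn s (\<alpha> t) \<le> C"
    using Hs_of_truncations[OF L2_measurable[OF \<alpha>L[OF t]] C0] le by auto
qed

lemma \<alpha>H1: "t \<in> {0..T} \<Longrightarrow> \<alpha> t \<in> Hs (s - 1)" and aH1: "t \<in> {0..T} \<Longrightarrow> a n t \<in> Hs (s - 1)"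
  by (rule Hs_mono(1)[OF _ \<alpha>H(1)]; simp) (rule Hs_mono(1)[OF _ aH]; simp)

lemma uniform_limit:
  assumes e: "0 < e"
  shows "\<exists>N. \<forall>n\<ge>N. \<forall>t\<in>{0..T}. Hn (s - 1) (\<lambda>\<xi>. a n t \<xi> - \<alpha> t \<xi>) \<le> e"
proof -
  \<comment> \<open>The difference has norm at most \<open>2 * C\<close> in \<open>Hs s\<close>;
    this \<open>R\<close> makes the high frequencies contribute at most \<open>e / 2\<close>,
    uniformly in \<open>n\<close> and \<open>t\<close>.\<close>
  define R where "R = 1 + 4 * C / e"
  have R: "1 \<le> R" "2 * C / R \<le> e / 2" using C0 e by (auto simp: R_def field_simps)
  define D where "D = R powr (s - 1) * K"
  have D: "0 \<le> D" using K_nonneg by (simp add: D_def)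
  from LIMSEQ_D[OF \<kappa>_lim, of "e / (2 * (D + 1))"] e D obtain N where
    N: "\<And>n. n \<ge> N \<Longrightarrow> \<kappa> n < e / (2 * (D + 1))" by (auto simp: abs_less_iff)
  have "Hn (s - 1) (\<lambda>\<xi>. a n t \<xi> - \<alpha> t \<xi>) \<le> e" if n: "n \<ge> N" and t: "t \<in> {0..T}" for n t
  proof -
    have d: "(\<lambda>\<xi>. a n t \<xi> - \<alpha> t \<xi>) \<in> Hs s" "Hn s (\<lambda>\<xi>. a n t \<xi> - \<alpha> t \<xi>) \<le> 2 * C"
      using Hs_diff[OF aH[OF t] \<alpha>H(1)[OF t]] Hn_diff_le[OF aH[OF t, of n] \<alpha>H(1)[OF t]] bound[OF t, of n] \<alpha>H(2)[OF t] by auto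
    have "Hn (s - 1) (\<lambda>\<xi>. a n t \<xi> - \<alpha> t \<xi>) \<le> R powr (s - 1) * L2_norm (\<lambda>\<xi>. a n t \<xi> - \<alpha> t \<xi>) + Hn s (\<lambda>\<xi>. a n t \<xi> - \<alpha> t \<xi>) / R"
      using s by (intro Hn_interpolation d R) auto
    also have "\<dots> \<le> R powr (s - 1) * (\<kappa> n * K) + 2 * C / R"
      using R(1) d(2) rate[OF t, of n] by (intro add_mono mult_left_mono divide_right_mono) auto
    also have "R powr (s - 1) * (\<kappa> n * K) = \<kappa> n * D" by (simp add: D_def)
    also have "\<kappa> n * D \<le> e / (2 * (D + 1)) * D" using N[OF n] D by (intro mult_right_mono) auto
    also have "\<dots> \<le> e / 2" using e D by (simp add: field_simps)
    finally show ?thesis using R(2) by linarith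
  qed
  then show ?thesis by blast
qed

lemma \<alpha>r:
  assumes t: "t \<in> {0..T}"
  shows "realv (\<alpha> t)"
  unfolding realv_def
proof
  fix x
  have "\<bar>Im (ift (\<alpha> t) x)\<bar> \<le> 0"
  proof (rule field_le_epsilon)
    fix e :: real assume e: "0 < e"
    obtain n where n: "Hn (s - 1) (\<lambda>\<xi>. a n t \<xi> - \<alpha> t \<xi>) \<le> e" using uniform_limit[OF e] t by blast
    have i: "integrable lborel (\<alpha> t)" using Hs_integrable[OF \<alpha>H(1)[OF t]] s by simp
    have "Im (ift (\<lambda>\<xi>. a n t \<xi> - \<alpha> t \<xi>) x) = - Im (ift (\<alpha> t) x)"
      using ar[OF t, of n] by (simp add: ift_diff[OF aL(2)[OF t] i] realv_def)
    moreover have "\<bar>Im (ift (\<lambda>\<xi>. a n t \<xi> - \<alpha> t \<xi>) x)\<bar> \<le> Hn (s - 1) (\<lambda>\<xi>. a n t \<xi> - \<alpha> t \<xi>)"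
      by (rule order_trans[OF abs_Im_le_cmod norm_ift_Hs[OF Hs_diff[OF aH1[OF t] \<alpha>H1[OF t]]]]) (use s in simp)
    ultimately show "\<bar>Im (ift (\<alpha> t) x)\<bar> \<le> 0 + e" using n by simp
  qed
  then show "Im (ift (\<alpha> t) x) = 0" by simp
qed

lemma \<alpha>_initial: "AE \<xi> in lborel. \<alpha> 0 \<xi> = c0 \<xi>"
proof -
  have 0: "0 \<in> {0..T}" using T by simp
  have d: "(\<lambda>\<xi>. c0 \<xi> - \<alpha> 0 \<xi>) \<in> L2" using L2_diff[OF aL(1)[OF 0] \<alpha>L[OF 0]] by (simp add: init)
  have "L2_norm (\<lambda>\<xi>. c0 \<xi> - \<alpha> 0 \<xi>) = 0"
    using \<alpha>lim[OF 0] by (simp add: init LIMSEQ_const_iff)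
  then have "AE \<xi> in lborel. c0 \<xi> - \<alpha> 0 \<xi> = 0" using L2_norm_eq_0_iff[OF d] by simp
  then show ?thesis by eventually_elim simp
qed

lemma rhs_\<alpha>H: "t \<in> {0..T} \<Longrightarrow> rhs B b (\<alpha> t) \<in> Hs (s - 1)"
  using s by (intro rhs_Hs b B \<alpha>H) auto

lemma rhs_\<alpha>H2: "t \<in> {0..T} \<Longrightarrow> rhs B b (\<alpha> t) \<in> Hs (s - 2)"
  by (rule Hs_mono(1)[OF _ rhs_\<alpha>H]) auto

lemma rhs_nH: "c \<in> Hs (s - 1) \<Longrightarrow> rhs (Bn n) (bn n) c \<in> Hs (s - 2)"
  using rhs_Hs[OF bn_pos Bn_nonneg, of "s - 1" c n] s by simp

text \<open>Uniform convergence is available in order \<open>s - 1\<close> and the right-hand side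
  loses one more, so the derivative of the limit is first identified in order \<open>s - 2\<close>.
  The comparison passes through the \<open>n\<close>-th right-hand side evaluated at the
  limit.\<close>

lemma rhs_uniform_limit:
  assumes e: "0 < e"
  shows "\<exists>N. \<forall>n\<ge>N. \<forall>t\<in>{0..T}. Hn (s - 2) (\<lambda>\<xi>. rhs (Bn n) (bn n) (a n t) \<xi> - rhs B b (\<alpha> t) \<xi>) \<le> e"
proof -
  have "(\<lambda>n. 2 * Bn n / bn n) \<longlonglongrightarrow> 2 * B / b" using b by (intro tendsto_intros Bn bn) auto
  from convergent_imp_Bseq[OF convergentI[OF this]] obtain D where "0 < D" "\<forall>n. norm (2 * Bn n / bn n) \<le> D"
    unfolding Bseq_def by blast
  then have D: "0 < D" "\<And>n. 2 * Bn n / bn n \<le> D" by (auto intro: order_trans[OF abs_ge_self])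
  define L where "L = Calg (s - 1) * (C + C) + D"
  have L: "0 < L" using D C0 by (simp add: L_def add_nonneg_pos)
  have "0 < e / (2 * L)" using e L by simp
  from uniform_limit[OF this] obtain N1 where N1: "\<And>n t. n \<ge> N1 \<Longrightarrow> t \<in> {0..T} \<Longrightarrow> Hn (s - 1) (\<lambda>\<xi>. a n t \<xi> - \<alpha> t \<xi>) \<le> e / (2 * L)"
    by blast
  from LIMSEQ_D[OF \<kappa>_lim, of "e / (2 * (C + 1))"] e C0 obtain N2 where
    N2: "\<And>n. n \<ge> N2 \<Longrightarrow> \<kappa> n < e / (2 * (C + 1))" by (auto simp: abs_less_iff)
  have "Hn (s - 2) (\<lambda>\<xi>. rhs (Bn n) (bn n) (a n t) \<xi> - rhs B b (\<alpha> t) \<xi>) \<le> e" if n: "n \<ge> N1 + N2" and t: "t \<in> {0..T}" for n t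
  proof -
    have "Hn (s - 2) (\<lambda>\<xi>. rhs (Bn n) (bn n) (a n t) \<xi> - rhs (Bn n) (bn n) (\<alpha> t) \<xi>)
       \<le> (Calg (s - 1) * (Hn (s - 1) (a n t) + Hn (s - 1) (\<alpha> t)) + 2 * Bn n / bn n) * Hn (s - 1) (\<lambda>\<xi>. a n t \<xi> - \<alpha> t \<xi>)"
      using rhs_diff_Hs[OF bn_pos Bn_nonneg _ aH1[OF t] \<alpha>H1[OF t], of n n] s by simp
    also have "\<dots> \<le> L * (e / (2 * L))"
      unfolding L_def using Hs_mono(2)[OF _ aH[OF t], of "s - 1" n] Hs_mono(2)[OF _ \<alpha>H(1)[OF t], of "s - 1"]
        bound[OF t, of n] \<alpha>H(2)[OF t] D L N1[OF _ t, of n] n C0 unfolding L_def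
      by (intro mult_mono add_mono mult_left_mono) auto
    also have "\<dots> = e / 2" using L by simp
    finally have 1: "Hn (s - 2) (\<lambda>\<xi>. rhs (Bn n) (bn n) (a n t) \<xi> - rhs (Bn n) (bn n) (\<alpha> t) \<xi>) \<le> e / 2" .
    define k where "k = (\<lambda>\<xi>. of_real (fw_kernel (Bn n) (bn n) \<xi> - fw_kernel B b \<xi>) * \<alpha> t \<xi>)"
    have k: "k \<in> Hs (s - 1)" "Hn (s - 1) k \<le> \<kappa> n * Hn (s - 1) (\<alpha> t)"
      unfolding k_def using Hs_multiplier[of "\<alpha> t" "s - 1" 0 "\<lambda>\<xi>. of_real (fw_kernel (Bn n) (bn n) \<xi> - fw_kernel B b \<xi>)" "\<kappa> n"] \<alpha>H1[OF t]
      kernel_diff[of n] by (auto simp del: of_real_diff)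
    have "(\<lambda>\<xi>. rhs (Bn n) (bn n) (\<alpha> t) \<xi> - rhs B b (\<alpha> t) \<xi>) = (\<lambda>\<xi>. (-1) * dx k \<xi>)"
      by (auto simp: rhs_def dx_def k_def algebra_simps)
    then have "Hn (s - 2) (\<lambda>\<xi>. rhs (Bn n) (bn n) (\<alpha> t) \<xi> - rhs B b (\<alpha> t) \<xi>) = Hn (s - 2) (dx k)"
      by (simp only: Hn_cmult) simp
    also have "\<dots> \<le> Hn (s - 1) k" using dx_Hs'(2)[OF k(1)] by simp
    also have "\<dots> \<le> \<kappa> n * Hn (s - 1) (\<alpha> t)" by (rule k(2))
    also have "\<dots> \<le> (e / (2 * (C + 1))) * C"
      using N2[of n] n Hs_mono(2)[OF _ \<alpha>H(1)[OF t], of "s - 1"] \<alpha>H(2)[OF t] e C0 \<kappa>_nonneg[of n] by (intro mult_mono) auto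
    also have "\<dots> \<le> e / 2" using e C0 by (simp add: field_simps)
    finally have 2: "Hn (s - 2) (\<lambda>\<xi>. rhs (Bn n) (bn n) (\<alpha> t) \<xi> - rhs B b (\<alpha> t) \<xi>) \<le> e / 2" .
    show ?thesis
      using Hn_triangle3[OF rhs_nH[OF aH1[OF t]] rhs_nH[OF \<alpha>H1[OF t]] rhs_\<alpha>H2[OF t], of n n n] 1 2 by linarith
  qed
  then show ?thesis by blast
qed

lemma a_continuous_weak:
  assumes t: "t \<in> {0..T}" and e: "0 < e"
  shows "\<exists>d>0. \<forall>r\<in>{0..T}. \<bar>r - t\<bar> < d \<longrightarrow> Hn (s - 1) (\<lambda>\<xi>. \<alpha> r \<xi> - \<alpha> t \<xi>) \<le> e"
proof -
  have "0 < e / 3" using e by simp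
  from uniform_limit[OF this] obtain n where n: "\<And>t. t \<in> {0..T} \<Longrightarrow> Hn (s - 1) (\<lambda>\<xi>. a n t \<xi> - \<alpha> t \<xi>) \<le> e / 3"
    by blast
  obtain d where d: "0 < d" "\<And>r. r \<in> {0..T} \<Longrightarrow> \<bar>r - t\<bar> < d \<Longrightarrow> Hn s (\<lambda>\<xi>. a n r \<xi> - a n t \<xi>) < e / 3"
    using fw_spec.near[OF sol t, of "e / 3"] e by fastforce
  have "Hn (s - 1) (\<lambda>\<xi>. \<alpha> r \<xi> - \<alpha> t \<xi>) \<le> e" if r: "r \<in> {0..T}" "\<bar>r - t\<bar> < d" for r
    using Hn_triangle3[OF \<alpha>H1[OF r(1)] aH1[OF r(1)] \<alpha>H1[OF t], of n] Hn_triangle3[OF aH1[OF r(1)] aH1[OF t] \<alpha>H1[OF t], of n n]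
      n[OF r(1)] n[OF t] d(2)[OF r] Hs_mono(2)[OF _ Hs_diff[OF aH[OF r(1)] aH[OF t]], of "s - 1" n n]
      Hn_minus_commute[of "s - 1" "a n r" "\<alpha> r"] by simp
  then show ?thesis using d(1) by blast
qed

lemma rhs_continuous:
  assumes \<sigma>: "\<sigma> \<le> s" "2 \<le> \<sigma>" and t: "t \<in> {0..T}" and e: "0 < e"
    and cont: "\<And>e. 0 < e \<Longrightarrow> \<exists>d>0. \<forall>r\<in>{0..T}. \<bar>r - t\<bar> < d \<longrightarrow> Hn \<sigma> (\<lambda>\<xi>. \<alpha> r \<xi> - \<alpha> t \<xi>) \<le> e"
  shows "\<exists>d>0. \<forall>r\<in>{0..T}. \<bar>r - t\<bar> < d \<longrightarrow> Hn (\<sigma> - 1) (\<lambda>\<xi>. rhs B b (\<alpha> r) \<xi> - rhs B b (\<alpha> t) \<xi>) \<le> e"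
proof -
  define L where "L = Calg \<sigma> * (C + C) + 2 * B / b + 1"
  have L: "0 < L" using C0 b B by (simp add: L_def add_nonneg_pos)
  obtain d where d: "0 < d" "\<And>r. r \<in> {0..T} \<Longrightarrow> \<bar>r - t\<bar> < d \<Longrightarrow> Hn \<sigma> (\<lambda>\<xi>. \<alpha> r \<xi> - \<alpha> t \<xi>) \<le> e / L"
    using cont[of "e / L"] e L by auto
  have \<alpha>\<sigma>: "\<alpha> r \<in> Hs \<sigma>" "Hn \<sigma> (\<alpha> r) \<le> C" if "r \<in> {0..T}" for r
    using Hs_mono[OF \<sigma>(1) \<alpha>H(1)[OF that]] \<alpha>H(2)[OF that] by auto
  have "Hn (\<sigma> - 1) (\<lambda>\<xi>. rhs B b (\<alpha> r) \<xi> - rhs B b (\<alpha> t) \<xi>) \<le> e" if r: "r \<in> {0..T}" "\<bar>r - t\<bar> < d" for r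
  proof -
    have "Hn (\<sigma> - 1) (\<lambda>\<xi>. rhs B b (\<alpha> r) \<xi> - rhs B b (\<alpha> t) \<xi>)
       \<le> (Calg \<sigma> * (Hn \<sigma> (\<alpha> r) + Hn \<sigma> (\<alpha> t)) + 2 * B / b) * Hn \<sigma> (\<lambda>\<xi>. \<alpha> r \<xi> - \<alpha> t \<xi>)"
      using \<sigma> by (intro rhs_diff_Hs b B \<alpha>\<sigma> r t) auto
    also have "\<dots> \<le> L * (e / L)"
    proof (intro mult_mono d(2)[OF r])
      have "Calg \<sigma> * (Hn \<sigma> (\<alpha> r) + Hn \<sigma> (\<alpha> t)) \<le> Calg \<sigma> * (C + C)"
        using \<alpha>\<sigma>(2)[OF r(1)] \<alpha>\<sigma>(2)[OF t] by (intro mult_left_mono add_mono) auto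
      then show "Calg \<sigma> * (Hn \<sigma> (\<alpha> r) + Hn \<sigma> (\<alpha> t)) + 2 * B / b \<le> L" by (simp add: L_def)
    qed (use L in auto)
    also have "\<dots> = e" using L by simp
    finally show ?thesis .
  qed
  then show ?thesis using d(1) by blast
qed

text \<open>The difference quotients of the approximations are within \<open>2 * e\<close> of
  \<open>rhs B b (\<alpha> t)\<close> for all large \<open>n\<close> at once, by the mean value
  inequality and the uniform closeness of their derivatives near \<open>t\<close>. Only afterwards
  is \<open>n\<close> sent to the limit.\<close>

lemma \<alpha>_deriv_weak:
  assumes t: "t \<in> {0..T}"
  shows "((\<lambda>r. Hn (s - 2) (\<lambda>\<xi>. (\<alpha> r \<xi> - \<alpha> t \<xi>) / of_real (r - t) - rhs B b (\<alpha> t) \<xi>)) \<longlongrightarrow> 0) (at t within {0..T})"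
proof (rule tendstoI)
  fix e' :: real assume e': "0 < e'"
  define e where "e = e' / 3"
  have e: "0 < e" using e' by (simp add: e_def)
  have a2: "a n r \<in> Hs (s - 2)" and \<alpha>2: "\<alpha> r \<in> Hs (s - 2)" if "r \<in> {0..T}" for n r
    using Hs_mono(1)[OF _ aH[OF that], of "s - 2"] Hs_mono(1)[OF _ \<alpha>H(1)[OF that], of "s - 2"] by auto
  obtain d where d: "0 < d" "\<And>r. r \<in> {0..T} \<Longrightarrow> \<bar>r - t\<bar> < d \<Longrightarrow> Hn (s - 1 - 1) (\<lambda>\<xi>. rhs B b (\<alpha> r) \<xi> - rhs B b (\<alpha> t) \<xi>) \<le> e"
    using rhs_continuous[of "s - 1", OF _ _ t e a_continuous_weak[OF t]] s by auto
  obtain N where N: "\<And>n t. n \<ge> N \<Longrightarrow> t \<in> {0..T} \<Longrightarrow> Hn (s - 2) (\<lambda>\<xi>. rhs (Bn n) (bn n) (a n t) \<xi> - rhs B b (\<alpha> t) \<xi>) \<le> e"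
    using rhs_uniform_limit[OF e] by blast
  have "Hn (s - 2) (\<lambda>\<xi>. (\<alpha> r \<xi> - \<alpha> t \<xi>) / of_real (r - t) - rhs B b (\<alpha> t) \<xi>) < e'"
    if r: "r \<in> {0..T}" "r \<noteq> t" "\<bar>r - t\<bar> < d" for r
  proof -
    have est: "Hn (s - 2) (\<lambda>\<xi>. (a n r \<xi> - a n t \<xi>) / of_real (r - t) - rhs B b (\<alpha> t) \<xi>) \<le> 2 * e" if n: "n \<ge> N" for n
    proof (rule Hs_mean_value_quotient[OF order_refl _ r(1) t r(2) a2 _ rhs_\<alpha>H2[OF t] fw_spec.a_deriv_weak[OF sol]])
      show "rhs (Bn n) (bn n) (a n v) \<in> Hs (s - 2)" if "v \<in> {0..T}" for v by (rule rhs_nH[OF aH1[OF that]])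
      show "Hn (s - 2) (\<lambda>\<xi>. rhs (Bn n) (bn n) (a n v) \<xi> - rhs B b (\<alpha> t) \<xi>) \<le> 2 * e" if v: "v \<in> {0..T}" "\<bar>v - t\<bar> \<le> \<bar>r - t\<bar>" for v
      proof -
        have "Hn (s - 2) (\<lambda>\<xi>. rhs B b (\<alpha> v) \<xi> - rhs B b (\<alpha> t) \<xi>) \<le> e" using d(2)[OF v(1)] v(2) r(3) by simp
        then show ?thesis
          using Hn_triangle3[OF rhs_nH[OF aH1[OF v(1)]] rhs_\<alpha>H2[OF v(1)] rhs_\<alpha>H2[OF t], of n n] N[OF n v(1)] by linarith
      qed
    qed (use s in auto)
    \<comment> \<open>Here \<open>n\<close> may depend on \<open>r\<close>, since \<open>est\<close>
      holds for every \<open>n \<ge> N\<close>: the error in the numerator is made small relative to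
      the distance of \<open>r\<close> from \<open>t\<close>.\<close>
    define h where "h = e * \<bar>r - t\<bar> / 4"
    have h: "0 < h" using e r by (simp add: h_def)
    obtain n where n: "n \<ge> N" "\<And>t. t \<in> {0..T} \<Longrightarrow> Hn (s - 1) (\<lambda>\<xi>. a n t \<xi> - \<alpha> t \<xi>) \<le> h"
      using uniform_limit[OF h] by (metis le_cases)
    have h2: "Hn (s - 2) (\<lambda>\<xi>. a n v \<xi> - \<alpha> v \<xi>) \<le> h" if "v \<in> {0..T}" for v
      using n(2)[OF that] Hs_mono(2)[OF _ Hs_diff[OF aH1[OF that] \<alpha>H1[OF that]], of "s - 2" n] by simp
    define q where "q = (\<lambda>\<xi>. (\<alpha> r \<xi> - \<alpha> t \<xi>) / of_real (r - t))"
    define p where "p = (\<lambda>\<xi>. (a n r \<xi> - a n t \<xi>) / of_real (r - t))"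
    have pq: "q \<in> Hs (s - 2)" "p \<in> Hs (s - 2)"
      unfolding q_def p_def by (intro Hs_divide Hs_diff a2 \<alpha>2 r t)+
    have "(\<lambda>\<xi>. q \<xi> - p \<xi>) = (\<lambda>\<xi>. ((\<alpha> r \<xi> - a n r \<xi>) - (\<alpha> t \<xi> - a n t \<xi>)) / of_real (r - t))"
      by (auto simp: q_def p_def diff_divide_distrib)
    then have "Hn (s - 2) (\<lambda>\<xi>. q \<xi> - p \<xi>) = Hn (s - 2) (\<lambda>\<xi>. (\<alpha> r \<xi> - a n r \<xi>) - (\<alpha> t \<xi> - a n t \<xi>)) / \<bar>r - t\<bar>"
      by (simp only: Hn_divide norm_of_real)
    also have "\<dots> \<le> (h + h) / \<bar>r - t\<bar>"
      using Hn_diff_le[OF Hs_diff[OF \<alpha>2[OF r(1)] a2[OF r(1)]] Hs_diff[OF \<alpha>2[OF t] a2[OF t]], of n n] h2[OF r(1)] h2[OF t]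
        Hn_minus_commute[of "s - 2" "a n r" "\<alpha> r"] Hn_minus_commute[of "s - 2" "a n t" "\<alpha> t"]
      by (intro divide_right_mono) auto
    also have "\<dots> = e / 2" using r(2) by (simp add: h_def)
    finally have "Hn (s - 2) (\<lambda>\<xi>. q \<xi> - p \<xi>) \<le> e / 2" .
    then have "Hn (s - 2) (\<lambda>\<xi>. q \<xi> - rhs B b (\<alpha> t) \<xi>) \<le> e / 2 + 2 * e"
      using Hn_triangle3[OF pq rhs_\<alpha>H2[OF t]] est[OF n(1)] by (simp add: p_def)
    also have "\<dots> < e'" using e' by (simp add: e_def)
    finally show ?thesis by (simp add: q_def)
  qed
  then show "\<forall>\<^sub>F r in at t within {0..T}. dist (Hn (s - 2) (\<lambda>\<xi>. (\<alpha> r \<xi> - \<alpha> t \<xi>) / of_real (r - t) - rhs B b (\<alpha> t) \<xi>)) 0 < e'"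
    unfolding eventually_at using d(1) by (intro exI[of _ d]) (auto simp: dist_real_def)
qed

lemma \<alpha>_continuous_L2:
  assumes t: "t \<in> {0..T}"
  shows "((\<lambda>r. L2_norm (\<lambda>\<xi>. \<alpha> r \<xi> - \<alpha> t \<xi>)) \<longlongrightarrow> 0) (at t within {0..T})"
proof (rule tendstoI)
  fix e :: real assume e: "0 < e"
  obtain d where d: "0 < d" "\<And>r. r \<in> {0..T} \<Longrightarrow> \<bar>r - t\<bar> < d \<Longrightarrow> Hn (s - 1) (\<lambda>\<xi>. \<alpha> r \<xi> - \<alpha> t \<xi>) \<le> e / 2"
    using a_continuous_weak[OF t, of "e / 2"] e by auto
  have "L2_norm (\<lambda>\<xi>. \<alpha> r \<xi> - \<alpha> t \<xi>) < e" if "r \<in> {0..T}" "\<bar>r - t\<bar> < d" for r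
    using d(2)[OF that] Hs_L2(2)[OF _ Hs_diff[OF \<alpha>H1[OF that(1)] \<alpha>H1[OF t]]] s e by simp
  then show "\<forall>\<^sub>F r in at t within {0..T}. dist (L2_norm (\<lambda>\<xi>. \<alpha> r \<xi> - \<alpha> t \<xi>)) 0 < e"
    unfolding eventually_at using d(1) by (intro exI[of _ d]) (auto simp: dist_real_def)
qed

text \<open>Weak continuity together with continuity of the norm yields strong continuity.\<close>
lemma \<alpha>_continuous:
  assumes t: "t \<in> {0..T}"
  shows "((\<lambda>r. Hn s (\<lambda>\<xi>. \<alpha> r \<xi> - \<alpha> t \<xi>)) \<longlongrightarrow> 0) (at t within {0..T})"
proof -
  have N: "(\<integral>\<xi>. norm (dx (\<alpha> t) \<xi>) \<partial>lborel) \<le> sqrt pi * C" if t: "t \<in> {0..T}" for t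
  proof -
    have d: "dx (\<alpha> t) \<in> Hs 1" "Hn 1 (dx (\<alpha> t)) \<le> Hn 2 (\<alpha> t)" "Hn 2 (\<alpha> t) \<le> Hn s (\<alpha> t)"
      using dx_Hs[of "\<alpha> t" 1] Hs_mono[OF _ \<alpha>H(1)[OF t], of 2] s by auto
    have "(\<integral>\<xi>. norm (dx (\<alpha> t) \<xi>) \<partial>lborel) \<le> sqrt pi * Hn 1 (dx (\<alpha> t))"
      by (rule Hs_L1(2)[OF order_refl d(1)])
    also have "\<dots> \<le> sqrt pi * C"
      using d(2,3) \<alpha>H(2)[OF t] by (intro mult_left_mono) auto
    finally show ?thesis .
  qed
  obtain L where L: "\<And>r. r \<in> {0..T} \<Longrightarrow> \<bar>(Hn s (\<alpha> r))\<^sup>2 - (Hn s (\<alpha> t))\<^sup>2\<bar> \<le> L * \<bar>r - t\<bar>"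
    using Hs_norm_control(2)[of s b B T \<alpha> "sqrt pi * C", OF s b B T \<alpha>H(1) \<alpha>r N \<alpha>_deriv_weak _ t] by blast
  have n: "((\<lambda>r. (Hn s (\<alpha> r))\<^sup>2 - (Hn s (\<alpha> t))\<^sup>2) \<longlongrightarrow> 0) (at t within {0..T})"
  proof (rule Lim_null_comparison)
    have "((\<lambda>r. L * \<bar>r - t\<bar>) \<longlongrightarrow> L * \<bar>t - t\<bar>) (at t within {0..T})" by (intro tendsto_intros)
    then show "((\<lambda>r. L * \<bar>r - t\<bar>) \<longlongrightarrow> 0) (at t within {0..T})" by simp
    show "\<forall>\<^sub>F r in at t within {0..T}. norm ((Hn s (\<alpha> r))\<^sup>2 - (Hn s (\<alpha> t))\<^sup>2) \<le> L * \<bar>r - t\<bar>"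
      unfolding eventually_at_filter using L by (auto intro!: always_eventually)
  qed
  have w: "wa s (\<alpha> r) \<in> L2" if "r \<in> {0..T}" for r using \<alpha>H(1)[OF that] by (simp add: Hs_def)
  have ip: "((\<lambda>r. Re (\<integral>\<xi>. wa s (\<lambda>\<xi>. \<alpha> r \<xi> - \<alpha> t \<xi>) \<xi> * cnj (wa s (\<alpha> t) \<xi>) \<partial>lborel)) \<longlongrightarrow> 0) (at t within {0..T})"
  proof (rule L2_inner_continuous_Hs[where C = "2 * C"])
    show "(\<lambda>\<xi>. \<alpha> r \<xi> - \<alpha> t \<xi>) \<in> Hs s" if "r \<in> {0..T}" for r by (intro Hs_diff \<alpha>H that t)
    show "Hn s (\<lambda>\<xi>. \<alpha> r \<xi> - \<alpha> t \<xi>) \<le> 2 * C" if "r \<in> {0..T}" for r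
      using Hn_diff_le[OF \<alpha>H(1)[OF that] \<alpha>H(1)[OF t]] \<alpha>H(2)[OF that] \<alpha>H(2)[OF t] by linarith
  qed (use s w[OF t] \<alpha>_continuous_L2[OF t] in auto)
  have eq: "(Hn s (\<lambda>\<xi>. \<alpha> r \<xi> - \<alpha> t \<xi>))\<^sup>2 = ((Hn s (\<alpha> r))\<^sup>2 - (Hn s (\<alpha> t))\<^sup>2)
      - 2 * Re (\<integral>\<xi>. wa s (\<lambda>\<xi>. \<alpha> r \<xi> - \<alpha> t \<xi>) \<xi> * cnj (wa s (\<alpha> t) \<xi>) \<partial>lborel)" if r: "r \<in> {0..T}" for r
  proof -
    define X where "X = wa s (\<lambda>\<xi>. \<alpha> r \<xi> - \<alpha> t \<xi>)"
    have X: "X \<in> L2" using Hs_diff[OF \<alpha>H(1)[OF r] \<alpha>H(1)[OF t]] by (simp add: X_def Hs_def)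
    have "wa s (\<alpha> r) = (\<lambda>\<xi>. X \<xi> + wa s (\<alpha> t) \<xi>)" by (simp add: X_def wa_diff)
    then have "(Hn s (\<alpha> r))\<^sup>2 = (L2_norm X)\<^sup>2 + 2 * Re (\<integral>\<xi>. X \<xi> * cnj (wa s (\<alpha> t) \<xi>) \<partial>lborel) + (Hn s (\<alpha> t))\<^sup>2"
      unfolding Hn_def using L2_norm_add_sq[OF X w[OF t]] by simp
    then show ?thesis by (simp add: Hn_def X_def)
  qed
  have "((\<lambda>r. ((Hn s (\<alpha> r))\<^sup>2 - (Hn s (\<alpha> t))\<^sup>2)
      - 2 * Re (\<integral>\<xi>. wa s (\<lambda>\<xi>. \<alpha> r \<xi> - \<alpha> t \<xi>) \<xi> * cnj (wa s (\<alpha> t) \<xi>) \<partial>lborel)) \<longlongrightarrow> 0 - 2 * 0) (at t within {0..T})"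
    by (intro tendsto_diff n tendsto_mult tendsto_const ip)
  then have "((\<lambda>r. (Hn s (\<lambda>\<xi>. \<alpha> r \<xi> - \<alpha> t \<xi>))\<^sup>2) \<longlongrightarrow> 0 - 2 * 0) (at t within {0..T})"
    by (rule Lim_transform_within[OF _ zero_less_one]) (use eq in simp)
  from tendsto_real_sqrt[OF this] show ?thesis by simp
qed

theorem \<alpha>_solution: "spec_solution s B b {0..T} \<alpha>"
  unfolding spec_solution_def
proof (intro conjI ballI)
  fix t assume t: "t \<in> {0..T}"
  show "\<alpha> t \<in> Hs s" "realv (\<alpha> t)" by (rule \<alpha>H(1)[OF t], rule \<alpha>r[OF t])
  show "((\<lambda>r. Hn s (\<lambda>\<xi>. \<alpha> r \<xi> - \<alpha> t \<xi>)) \<longlongrightarrow> 0) (at t within {0..T})" by (rule \<alpha>_continuous[OF t])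
  show "((\<lambda>r. Hn (s - 1) (\<lambda>\<xi>. (\<alpha> r \<xi> - \<alpha> t \<xi>) / of_real (r - t) - rhs B b (\<alpha> t) \<xi>)) \<longlongrightarrow> 0) (at t within {0..T})"
  proof (rule tendstoI)
    fix e :: real assume e: "0 < e"
    have cont: "\<exists>d>0. \<forall>r\<in>{0..T}. \<bar>r - t\<bar> < d \<longrightarrow> Hn s (\<lambda>\<xi>. \<alpha> r \<xi> - \<alpha> t \<xi>) \<le> e" if e: "0 < e" for e
    proof -
      obtain d where d: "0 < d" "\<And>r. r \<in> {0..T} \<Longrightarrow> 0 < dist r t \<Longrightarrow> dist r t < d \<Longrightarrow> dist (Hn s (\<lambda>\<xi>. \<alpha> r \<xi> - \<alpha> t \<xi>)) 0 < e"
        using \<alpha>_continuous[OF t] e unfolding Lim_within by blast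
      have "Hn s (\<lambda>\<xi>. \<alpha> r \<xi> - \<alpha> t \<xi>) \<le> e" if "r \<in> {0..T}" "\<bar>r - t\<bar> < d" for r
      proof (cases "r = t")
        case True
        then show ?thesis using e by (simp add: Hn_def wa_def[abs_def])
      qed (use d(2)[of r] that in \<open>auto simp: dist_real_def\<close>)
      then show ?thesis using d(1) by blast
    qed
    obtain d where d: "0 < d" "\<And>r. r \<in> {0..T} \<Longrightarrow> \<bar>r - t\<bar> < d \<Longrightarrow> Hn (s - 1) (\<lambda>\<xi>. rhs B b (\<alpha> r) \<xi> - rhs B b (\<alpha> t) \<xi>) \<le> e / 2"
      using rhs_continuous[of s, OF order_refl _ t _ cont, of "e / 2"] s e by auto
    have "Hn (s - 1) (\<lambda>\<xi>. (\<alpha> r \<xi> - \<alpha> t \<xi>) / of_real (r - t) - rhs B b (\<alpha> t) \<xi>) < e"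
      if r: "r \<in> {0..T}" "r \<noteq> t" "\<bar>r - t\<bar> < d" for r
    proof -
      \<comment> \<open>Promotion by one order: the curve is differentiable in
        \<open>Hs (s - 2)\<close> and its derivative is continuous in \<open>Hs (s - 1)\<close>, so
        the difference quotients converge there.\<close>
      have "Hn (s - 1) (\<lambda>\<xi>. (\<alpha> r \<xi> - \<alpha> t \<xi>) / of_real (r - t) - rhs B b (\<alpha> t) \<xi>) \<le> e / 2"
        by (rule Hs_mean_value_quotient[where \<tau> = "s - 2", OF _ _ r(1) t r(2) \<alpha>H1 rhs_\<alpha>H rhs_\<alpha>H[OF t] \<alpha>_deriv_weak d(2)])
           (use s r in auto)
      then show ?thesis using e by simp
    qed
    then show "\<forall>\<^sub>F r in at t within {0..T}. dist (Hn (s - 1) (\<lambda>\<xi>. (\<alpha> r \<xi> - \<alpha> t \<xi>) / of_real (r - t) - rhs B b (\<alpha> t) \<xi>)) 0 < e"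
      unfolding eventually_at using d(1) by (intro exI[of _ d]) (auto simp: dist_real_def)
  qed
qed

end

theorem (in fw_limit) limit_solution:
  "\<exists>\<alpha>. spec_solution s B b {0..T} \<alpha> \<and> (AE \<xi> in lborel. \<alpha> 0 \<xi> = c0 \<xi>)"
proof -
  obtain \<alpha> where "\<forall>t\<in>{0..T}. \<alpha> t \<in> L2 \<and> (\<lambda>n. L2_norm (\<lambda>\<xi>. a n t \<xi> - \<alpha> t \<xi>)) \<longlonglongrightarrow> 0"
    using limit_exists by blast
  then interpret fw_limit_curve s B b T C Bn bn a c0 \<alpha> by unfold_locales auto
  show ?thesis using \<alpha>_solution \<alpha>_initial by blast
qed

section \<open>Global existence is a closed condition\<close>

context fw_spec
begin

lemma Fb_le:
  assumes "0 \<le> U0" "B \<le> Bm" "b \<le> bm"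
  shows "Fb U0 \<le> 4 * Bm * bm * (U0 + Bm * sqrt bm * L2_norm (a 0) * T)"
  unfolding Fb_def U_def using assms B b T
  by (intro mult_mono add_mono) (auto intro!: add_nonneg_nonneg mult_nonneg_nonneg)

lemma slope_bound_uniform:
  fixes Bm bm U0 :: real
  defines "F \<equiv> 4 * Bm * bm * (U0 + Bm * sqrt bm * L2_norm (a 0) * T)"
  assumes U0: "\<And>x. \<bar>rift (a 0) x\<bar> \<le> U0" and M0: "\<And>x. \<bar>rift (dx (a 0)) x\<bar> \<le> M0"
    and m: "B \<le> Bm" "b \<le> bm" and t: "t \<in> {0..T - 1}"
  shows "\<bar>rift (dx (a t)) x\<bar> \<le> M0 + F * T + 2 * (1 + F)"
  by (rule slope_bound[OF U0 M0 _ t]) (use Fb_le[OF order_trans[OF abs_ge_zero U0] m] in \<open>simp add: F_def\<close>)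

text \<open>Taking \<open>c = - 1 / u_x\<close> at time 0, the breaking time \<open>2 * c\<close> is
  \<open>T\<close>. As the solution lives that long, the forcing cannot be smaller than
  \<open>1 / (2 * c^2)\<close>, half the square of the slope.\<close>

lemma no_initial_breaking:
  assumes U0: "\<And>x. \<bar>rift (a 0) x\<bar> \<le> U0" and x: "rift (dx (a 0)) x < 0" and T2: "T = 2 / - rift (dx (a 0)) x"
  shows "(rift (dx (a 0)) x)\<^sup>2 / 2 \<le> 4 * B * b * (U0 + B * sqrt b * L2_norm (a 0) * T)"
proof (rule ccontr)
  define c where "c = 1 / - rift (dx (a 0)) x"
  have c: "0 < c" "0 + 2 * c \<le> T" "- 1 / c = rift (dx (a 0)) x" using x by (auto simp: c_def T2)
  assume "\<not> ?thesis"
  then have "Fb U0 < 1 / (2 * c\<^sup>2)" by (simp add: Fb_def U_def c_def power_divide)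
  from wave_breaking[OF U0 order_refl c(1,2) this, of x] c(3) show False by simp
qed

end

section \<open>Fixed initial data and varying parameters\<close>

locale fw_data =
  fixes s :: real and u0 :: "real \<Rightarrow> real"
  assumes s: "3 \<le> s" and u0: "u0 \<in> sobolev s"
begin

text \<open>The transform is a choice from its class. Going through the continuous representative
  selects the same member as \<^term>\<open>fourier_transform (u 0)\<close> for every solution \<^term>\<open>u\<close>.\<close>
definition c0 :: "real \<Rightarrow> complex" where
  "c0 = fourier_transform (rift (fourier_transform u0))"

lemma fH: "fourier_transform u0 \<in> Hs s" and u0_AE: "AE x in lborel. of_real (u0 x) = ift (fourier_transform u0) x"
  using u0 sobolev_eq_rift_AE[OF u0] s by (auto simp: sobolev_iff)

lemma f_cont: "continuous_on UNIV (ift (fourier_transform u0))"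
  by (rule ift_continuous[OF Hs_integrable[OF fH]]) (use s in simp)

lemma f_realv: "realv (fourier_transform u0)"
  unfolding realv_def
proof
  fix x
  have "ift (fourier_transform u0) x = of_real (Re (ift (fourier_transform u0) x))"
  proof (rule continuous_AE_eq[OF f_cont])
    show "continuous_on UNIV (\<lambda>x. complex_of_real (Re (ift (fourier_transform u0) x)))"
      by (intro continuous_intros f_cont)
    show "AE x in lborel. ift (fourier_transform u0) x = of_real (Re (ift (fourier_transform u0) x))"
      using u0_AE by eventually_elim (metis Re_complex_of_real)
  qed
  then show "Im (ift (fourier_transform u0) x) = 0" by (metis Im_complex_of_real)
qed

lemma c0_AE: "AE \<xi> in lborel. c0 \<xi> = fourier_transform u0 \<xi>"
  unfolding c0_def by (rule fourier_transform_rift[OF fH _ f_realv]) (use s in simp)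

lemma c0H: "c0 \<in> Hs s"
proof (rule Hs_cong_AE[OF _ fH])
  show "AE \<xi> in lborel. fourier_transform u0 \<xi> = c0 \<xi>" using c0_AE by eventually_elim simp
  have "rift (fourier_transform u0) \<in> L2" using has_ft_rift(1)[OF fH _ f_realv] s by simp
  then show "c0 \<in> borel_measurable borel"
    unfolding c0_def by (intro L2_measurable fourier_transform_L2)
qed

lemma rift_c0: "rift c0 = rift (fourier_transform u0)"
  using ift_cong_AE[OF c0_AE Hs_measurable[OF c0H] Hs_measurable[OF fH]] by (auto simp: rift_def)

lemma solution_fw_spec:
  assumes b: "0 < b" "0 \<le> B" and T: "0 \<le> T" and sol: "is_solution s u0 B b T' u" and T': "ereal T < T'"
  shows "\<exists>a. fw_spec s B b T a \<and> a 0 = c0"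
proof -
  define a where "a = (\<lambda>t. fourier_transform (u t))"
  note S = solution_imp_spec_solution[OF s b sol, folded a_def]
  have sub: "{0..T} \<subseteq> time_interval T'"
    proof
    fix x assume "x \<in> {0..T}"
    then have "ereal x \<le> ereal T" "0 \<le> x" by auto
    then show "x \<in> time_interval T'" using le_less_trans[OF _ T', of "ereal x"] by (simp add: time_interval_def)
  qed
  have "fw_spec s B b T a"
    by unfold_locales (use s b T spec_solution_subset[OF S(1) sub] in auto)
  \<comment> \<open>The choice in \<open>fourier_transform\<close> depends on the function and not
    on its class, so \<open>u 0\<close> has to be shown equal everywhere to the continuous
    representative before the transforms can coincide.\<close>
  moreover have "a 0 = c0"
  proof -
    have 0: "0 \<in> time_interval T'" using sub T by auto
    have cu: "continuous_on UNIV (u 0)" using sol 0 by (auto simp: is_solution_def)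
    have "of_real (u 0 x) = ift (fourier_transform u0) x" for x
    proof (rule continuous_AE_eq[OF _ f_cont])
      show "continuous_on UNIV (\<lambda>x. complex_of_real (u 0 x))" by (intro continuous_intros cu)
      show "AE x in lborel. of_real (u 0 x) = ift (fourier_transform u0) x"
        using S(3) u0_AE by eventually_elim simp
    qed
    then have "u 0 = rift (fourier_transform u0)" unfolding rift_def by (metis Re_complex_of_real)
    then show ?thesis by (simp add: a_def c0_def)
  qed
  ultimately show ?thesis by blast
qed

lemma global_fw_spec:
  assumes g: "(B, b) \<in> global_set s u0" and T: "0 \<le> T"
  shows "\<exists>a. fw_spec s B b T a \<and> a 0 = c0"
proof -
  have "ereal T < T_max s u0 B b" and pos: "0 < b" "0 < B" using g by (auto simp: global_set_def)
  then obtain T' u where "ereal T < T'" "is_solution s u0 B b T' u"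
    unfolding T_max_def less_Sup_iff by blast
  with solution_fw_spec[OF pos(1) less_imp_le[OF pos(2)] T] show ?thesis by blast
qed

lemma global_limit:
  assumes g: "\<And>n. (Bn n, bn n) \<in> global_set s u0" and lim: "Bn \<longlonglongrightarrow> B" "bn \<longlonglongrightarrow> b" and pos: "0 < B" "0 < b"
  shows "(B, b) \<in> global_set s u0"
proof -
  have "ereal T \<le> T_max s u0 B b" if Tp: "0 < T" for T
  proof -
    \<comment> \<open>The unit of time beyond \<open>T\<close> is what
      \<open>slope_bound_uniform\<close> gives up.\<close>
    have "\<forall>n. \<exists>a. fw_spec s (Bn n) (bn n) (T + 1) a \<and> a 0 = c0"
      using global_fw_spec[OF g, of "T + 1"] Tp by simp
    then obtain a where a: "\<And>n. fw_spec s (Bn n) (bn n) (T + 1) (a n)" "\<And>n. a n 0 = c0" by metis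
    obtain Bm where "\<forall>n. norm (Bn n) \<le> Bm" using convergent_imp_Bseq[OF convergentI[OF lim(1)]] unfolding Bseq_def by blast
    then have Bm: "Bn n \<le> Bm" for n using abs_ge_self[of "Bn n"] order_trans by auto
    obtain bm where "\<forall>n. norm (bn n) \<le> bm" using convergent_imp_Bseq[OF convergentI[OF lim(2)]] unfolding Bseq_def by blast
    then have bm: "bn n \<le> bm" for n using abs_ge_self[of "bn n"] order_trans by auto
    define A where "A = Hn s c0"
    define F where "F = 4 * Bm * bm * (A + Bm * sqrt bm * L2_norm c0 * (T + 1))"
    define M where "M = A + F * (T + 1) + 2 * (1 + F)"
    have sup: "\<bar>rift c0 x\<bar> \<le> A" "\<bar>rift (dx c0) x\<bar> \<le> A" for x
      unfolding A_def using rift_Hs_bounds[OF c0H] rift_dx_Hs_bounds[OF c0H] s by auto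
    have slope: "\<bar>rift (dx (a n t)) x\<bar> \<le> M" if "t \<in> {0..T}" for n t x
      using fw_spec.slope_bound_uniform[OF a(1), of n A A Bm bm t x] sup Bm[of n] bm[of n] that
      by (simp add: a(2) M_def F_def)
    define X where "X = A\<^sup>2 * exp ((2 + 2 * Kcom s) * (sqrt pi * (2 * Hn 2 c0 * exp (5 * M * T))) * T)"
    have aT: "fw_spec s (Bn n) (bn n) T (a n)" for n
      by (rule fw_spec.restrict[OF a(1)]) (use Tp in auto)
    have bound: "Hn s (a n t) \<le> sqrt X" if t: "t \<in> {0..T}" for n t
      using fw_spec.Hs_bound[OF aT slope t] unfolding a(2) A_def[symmetric] X_def[symmetric] by (rule real_le_rsqrt)
    interpret fw_limit s B b T "sqrt X" Bn bn a c0
      by (rule fw_limit.intro) (use s pos lim aT a(2) bound in auto)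
    obtain \<alpha> where \<alpha>: "spec_solution s B b {0..T} \<alpha>" "AE \<xi> in lborel. \<alpha> 0 \<xi> = c0 \<xi>"
      using limit_solution by blast
    have "time_interval (ereal T) \<subseteq> {0..T}" by (auto simp: time_interval_def)
    from spec_solution_subset[OF \<alpha>(1) this] have S: "spec_solution s B b (time_interval (ereal T)) \<alpha>" .
    have "AE \<xi> in lborel. \<alpha> 0 \<xi> = fourier_transform u0 \<xi>"
      using \<alpha>(2) c0_AE by eventually_elim simp
    from spec_solution_imp_solution[OF s pos(2) less_imp_le[OF pos(1)] u0 S _ this] Tp
    have "is_solution s u0 B b (ereal T) (\<lambda>t. rift (\<alpha> t))" by simp
    then show ?thesis unfolding T_max_def using Tp by (intro Sup_upper) auto
  qed
  \<comment> \<open>The construction was for positive times; the others lie below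
    \<open>ereal 1\<close>.\<close>
  then have "ereal T \<le> T_max s u0 B b" for T
    by (cases "0 < T") (auto intro: order_trans[of "ereal T" "ereal 1"])
  then show ?thesis using pos by (simp add: global_set_def ereal_top)
qed

text \<open>Otherwise the datum would be nondecreasing and tend to 0 at both ends of the line, hence
  vanish.\<close>

lemma slope_negative_somewhere:
  assumes "\<not> (AE x in lborel. u0 x = 0)"
  shows "\<exists>x. rift (dx c0) x < 0"
proof (rule ccontr)
  assume "\<not> ?thesis"
  then have nonneg: "\<And>x. 0 \<le> rift (dx c0) x" by (simp add: not_less)
  have d: "DERIV (rift c0) x :> rift (dx c0) x" for x using DERIV_rift_Hs[OF c0H] s by simp
  have mono: "rift c0 x \<le> rift c0 y" if "x \<le> y" for x y
    by (rule DERIV_nonneg_imp_nondecreasing[OF that]) (use d nonneg in blast)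
  have "rift c0 x = 0" for x
  proof -
    have "\<bar>rift c0 x\<bar> \<le> 0 + e" if e: "0 < e" for e
    proof -
      obtain R where R: "\<And>y. R < \<bar>y\<bar> \<Longrightarrow> \<bar>rift c0 y\<bar> < e" using rift_vanishes[OF c0H _ e] s by auto
      define y where "y = \<bar>R\<bar> + \<bar>x\<bar> + 1"
      have "rift c0 x \<le> rift c0 y" "rift c0 (- y) \<le> rift c0 x" by (intro mono; simp add: y_def)+
      moreover have "\<bar>rift c0 y\<bar> < e" "\<bar>rift c0 (- y)\<bar> < e" by (intro R; simp add: y_def)+
      ultimately show ?thesis by linarith
    qed
    then have "\<bar>rift c0 x\<bar> \<le> 0" by (rule field_le_epsilon)
    then show ?thesis by simp
  qed
  then have "Re (ift (fourier_transform u0) x) = 0" for x using rift_c0 by (auto simp: rift_def fun_eq_iff)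
  then have "AE x in lborel. u0 x = 0" using u0_AE by (auto elim!: eventually_mono dest!: arg_cong[where f = Re])
  with assms show False by simp
qed

lemma global_limit_positive:
  assumes nz: "\<not> (AE x in lborel. u0 x = 0)"
    and g: "\<And>n. (Bn n, bn n) \<in> global_set s u0" and lim: "Bn \<longlonglongrightarrow> B" "bn \<longlonglongrightarrow> b"
  shows "0 < B" "0 < b"
proof -
  obtain x where x: "rift (dx c0) x < 0" using slope_negative_somewhere[OF nz] by blast
  define T where "T = 2 / - rift (dx c0) x"
  have T: "0 \<le> T" using x by (simp add: T_def)
  \<comment> \<open>The lower bound of \<open>no_initial_breaking\<close> is the same for all
    members of the sequence, while \<open>\<Phi>\<close> is continuous up to the boundary of the
    quadrant and vanishes there.\<close>
  define \<Phi> where "\<Phi> B b = 4 * B * b * (Hn s c0 + B * sqrt b * L2_norm c0 * T)" for B b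
  have "(rift (dx c0) x)\<^sup>2 / 2 \<le> \<Phi> (Bn n) (bn n)" for n
  proof -
    obtain a where a: "fw_spec s (Bn n) (bn n) T a" "a 0 = c0" using global_fw_spec[OF g T] by blast
    show ?thesis
      using fw_spec.no_initial_breaking[OF a(1), of "Hn s c0" x] rift_Hs_bounds[OF c0H] s x
      by (simp add: a(2) T_def \<Phi>_def)
  qed
  moreover have "(\<lambda>n. \<Phi> (Bn n) (bn n)) \<longlonglongrightarrow> \<Phi> B b"
    unfolding \<Phi>_def by (intro tendsto_intros lim)
  ultimately have "(rift (dx c0) x)\<^sup>2 / 2 \<le> \<Phi> B b"
    by (intro LIMSEQ_le_const) auto
  then have "0 < \<Phi> B b" by (rule less_le_trans[rotated]) (use x in simp)
  then have "B \<noteq> 0" "b \<noteq> 0" by (auto simp: \<Phi>_def)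
  moreover have "0 \<le> B" "0 \<le> b"
    using LIMSEQ_le_const[OF lim(1), of 0] LIMSEQ_le_const[OF lim(2), of 0] g
    by (auto simp: global_set_def less_imp_le)
  ultimately show "0 < B" "0 < b" by auto
qed

lemma global_subset: "global_set s u0 \<subseteq> {0<..} \<times> {0<..}"
  by (auto simp: global_set_def)

lemma global_sequence_limit:
  assumes "\<And>n. p n \<in> global_set s u0" "p \<longlonglongrightarrow> l" "l \<in> {0<..} \<times> {0<..}"
  shows "l \<in> global_set s u0"
  using global_limit[of "\<lambda>n. fst (p n)" "\<lambda>n. snd (p n)" "fst l" "snd l"] assms tendsto_fst[OF assms(2)] tendsto_snd[OF assms(2)]
  by auto

lemma closed_global:
  assumes nz: "\<not> (AE x in lborel. u0 x = 0)"
  shows "closed (global_set s u0)"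
  unfolding closed_sequential_limits
proof (intro allI impI, elim conjE)
  fix p l assume p: "\<forall>n. p n \<in> global_set s u0" "p \<longlonglongrightarrow> l"
  have "0 < fst l" "0 < snd l"
    using global_limit_positive[OF nz, of "\<lambda>n. fst (p n)" "\<lambda>n. snd (p n)" "fst l" "snd l"] p
      tendsto_fst[OF p(2)] tendsto_snd[OF p(2)] by auto
  then show "l \<in> global_set s u0"
    using global_sequence_limit[of p l] p by (auto simp: mem_Times_iff)
qed

lemma closedin_global: "closedin (top_of_set ({0<..} \<times> {0<..})) (global_set s u0)"
  unfolding closedin_closed
proof (intro exI conjI)
  show "closed (closure (global_set s u0))" by simp
  show "global_set s u0 = ({0<..} \<times> {0<..}) \<inter> closure (global_set s u0)"
  proof (intro equalityI subsetI)
    fix l assume "l \<in> ({0<..} \<times> {0<..}) \<inter> closure (global_set s u0)"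
    then obtain p where "\<forall>n. p n \<in> global_set s u0" "p \<longlonglongrightarrow> l" "l \<in> {0<..} \<times> {0<..}"
      by (auto simp: closure_sequential)
    then show "l \<in> global_set s u0" using global_sequence_limit[of p l] by blast
  qed (use global_subset closure_subset in blast)
qed

lemma open_blowup: "open (blowup_set s u0)"
proof -
  have "blowup_set s u0 = ({0<..} \<times> {0<..}) - global_set s u0"
    by (auto simp: blowup_set_def global_set_def)
  then have "openin (top_of_set ({0<..} \<times> {0<..})) (blowup_set s u0)"
    using closedin_global by (auto simp: closedin_def)
  moreover have "open ({0<..} \<times> {0<..} :: (real \<times> real) set)" by (intro open_Times open_greaterThan)
  ultimately show ?thesis by (simp add: openin_open_eq)
qed

end

text \<open>For the zero datum every pair of positive parameters is global, and the open quadrant is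
  not closed in the plane. Closedness in the plane is therefore claimed for nonzero data, and
  closedness relative to the quadrant for all data; the latter makes the blow-up set open in the
  plane, the quadrant being open.\<close>

theorem theorem1p3:
  fixes s :: real and u0 :: "real \<Rightarrow> real"
  assumes "3 \<le> s" and "u0 \<in> sobolev s"
  shows "(\<not> (AE x in lborel. u0 x = 0) \<longrightarrow> closed (global_set s u0)) \<and>
         closedin (top_of_set ({0<..} \<times> {0<..})) (global_set s u0) \<and>
         open (blowup_set s u0)"
proof -
  interpret fw_data s u0 by unfold_locales (use assms in auto)
  show ?thesis using closed_global closedin_global open_blowup by blast
qed

end
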